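(* Assume (H1), (H2) and $\ell>\frac{1}{(p_--1)^2}$. For every $R\in\mathbb R$ there exist initial data $(u_0,u_1)\in C_c^\infty(\Omega)\times C_c^\infty(\Omega)$ such that $E(0)=R$ and the corresponding maximal energy solution of (P) blows up in finite time, i.e. $T_{\max}<\infty$ and $\limsup_{t\uparrow T_{\max}}(\|u(t)\|_V+\|u_t(t)\|_2)=\infty$. Moreover, these data satisfy the criterion corresponding to the sign of $\mathcal E(0)=R+C_*/p_-$, and the associated upper lifespan bound applies, namely: (a) if $R+C_*/p_-<0$: with $\beta:=-\mathcal E(0)$ and $d_0:=(p_--2)(u_0,u_1)-2\|\nabla u_0\|_2^2$, one has $$T_{\max}\le\frac{2(\|u_0\|_2^2+\beta\sigma^2)}{(p_--2)[(u_0,u_1)+\beta\sigma]-2\|\nabla u_0\|_2^2}$$ for every $\sigma>0$ for which the denominator is positive, and in particular $$T_{\max}\le\frac{4\left[\sqrt{d_0^2+(p_--2)^2\beta\|u_0\|_2^2}-d_0\right]}{(p_--2)^2\beta};$$ (b) if $R+C_*/p_-=0$: $(u_0,u_1)>0$ and the bound $(\ast)$ below holds; (c) if $R+C_*/p_->0$: $0<\mathcal E(0)<\frac{C}{p_-}(u_0,u_1)$ and the bound $(\ast)$ below holds. In (b) and (c), with $L_0:=(u_0,u_1)-\frac{p_-}{C}\mathcal E(0)>0$, $\beta:=\frac{CL_0}{2p_-}$, $\tau$ the unique positive solution of $$CL_0\tau^2+\left[L_0-\frac{2(\mathcal E(0)+\beta)}{\lambda_1}\right]\tau-\|u_0\|_2^2=0,$$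 $U_\tau:=\left(\|u_0\|_2+\sqrt{\tau(\mathcal E(0)+\beta)/\lambda_1}\right)^2$, $G_\tau:=\left(\|\nabla u_0\|_2+\sqrt{\tau(\mathcal E(0)+\beta)}\right)^2$ and $d_\tau:=\frac{p_--2}{2}L_0-2G_\tau$, the bound is $$(\ast)\qquad T_{\max}\le\tau+\frac{4\left[\sqrt{d_\tau^2+(p_--2)^2\beta U_\tau}-d_\tau\right]}{(p_--2)^2\beta}.$$
   Context: Setting. $n\ge1$ and $\Omega\subset\mathbb R^n$ is a bounded domain with smooth boundary; $V=H_0^1(\Omega)$ with $\|z\|_V=\|\nabla z\|_2$; $H=L^2(\Omega)$; $\|\cdot\|_2$ and $(\cdot,\cdot)$ are the $L^2(\Omega)$ norm and inner product; $\langle\cdot,\cdot\rangle$ is the pairing of $V^*$ and $V$; $\lambda_1>0$ is the first Dirichlet eigenvalue of $-\Delta$ on $\Omega$. (H1): $p:\Omega\to\mathbb R$ is measurable and $2<p_-:=\operatorname{ess\,inf}_\Omega p\le p(x)\le p_+:=\operatorname{ess\,sup}_\Omega p<2^*$ for a.e. $x$, where $2^*=2n/(n-2)$ if $n\ge3$ and $2^*=\infty$ if $n\le2$. (H2): $g\in C^1([0,\infty))$, $g\ge0$, $g'\le0$, and $\ell:=1-\int_0^\infty g(s)\,ds>0$. Problem (P): $u_{tt}-\Delta u+\int_0^t g(t-s)\Delta u(s)\,ds-\Delta u_t=|u|^{p(x)-2}u\log|u|$ in $\Omega\times(0,\infty)$, $u=0$ on $\partial\Omega\times(0,\infty)$,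 $u(0)=u_0$, $u_t(0)=u_1$; the source is $0$ at $u=0$. For $(u_0,u_1)\in V\times H$, an energy solution on $[0,T]$ is $u\in C([0,T];V)$ with $u_t\in C([0,T];H)\cap L^2(0,T;V)$, $u_{tt}\in L^2(0,T;V^* )$, $u(0)=u_0$, $u_t(0)=u_1$, such that for every $z\in V$ and a.e. $t\in(0,T)$: $\langle u_{tt},z\rangle+(\nabla u,\nabla z)+(\nabla u_t,\nabla z)-\int_0^tg(t-s)(\nabla u(s),\nabla z)\,ds=\int_\Omega|u|^{p(x)-2}u\log|u|\,z\,dx$. Energies. $F(x,r)=\frac{|r|^{p(x)}}{p(x)}\log|r|-\frac{|r|^{p(x)}}{p(x)^2}$, $F(x,0)=0$; $(g\circ\nabla u)(t)=\int_0^tg(t-s)\|\nabla u(t)-\nabla u(s)\|_2^2\,ds$; $$E(t)=\tfrac12\|u_t(t)\|_2^2+\tfrac12\Big(1-\int_0^tg(s)\,ds\Big)\|\nabla u(t)\|_2^2+\tfrac12(g\circ\nabla u)(t)-\int_\Omega F(x,u(t))\,dx.$$ For $q\ge p_-$: $c_{p_-}(q)=\frac{q-p_-}{q^2}e^{-q/(q-p_-)}$ if $q>p_-$ and $c_{p_-}(p_-)=0$. $C_*=\int_\Omega c_{p_-}(p(x))\,dx$ (finite). The shifted energy is $\mathcal E(t)=E(t)+C_*/p_-$. Local theory (taken as known under (H1), (H2)). For every $(u_0,u_1)\in V\times H$, (P) has a unique maximal energy solution on $[0,T_{\max})$, $T_{\max}\in(0,\infty]$ (an energy solution on $[0,T]$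 for each $T<T_{\max}$); if $T_{\max}<\infty$ then $\limsup_{t\uparrow T_{\max}}(\|u(t)\|_V+\|u_t(t)\|_2)=\infty$; $E$ is locally absolutely continuous and, for a.e. $t<T_{\max}$, $E'(t)=-\|\nabla u_t(t)\|_2^2-\frac12g(t)\|\nabla u(t)\|_2^2+\frac12\int_0^tg'(t-s)\|\nabla u(t)-\nabla u(s)\|_2^2\,ds$. Constant. Since $\ell>1/(p_--1)^2$, set $C=\min\left\{p_-+2,\ \frac{2\lambda_1[(p_--1)^2\ell-1]}{2p_-+\lambda_1}\right\}>0$. *)

theory Defs
  imports "HOL-Analysis.Analysis" "HOL-Probability.Essential_Supremum"
begin

text \<open>Elements of \<open>L\<^sup>2(\<Omega>)\<close> and \<open>H\<^sub>0\<^sup>1(\<Omega>)\<close> are represented by functions on the whole space of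
  which only the values on \<open>\<Omega>\<close>, up to Lebesgue null sets, matter. The dimension of the space is
  \<open>n = DIM('a)\<close>, which is positive for every Euclidean space.\<close>

section \<open>Smooth functions and domains\<close>

primrec Ck_on :: "nat \<Rightarrow> 'a::euclidean_space set \<Rightarrow> ('a \<Rightarrow> real) \<Rightarrow> bool" where
  "Ck_on 0 S f \<longleftrightarrow> continuous_on S f"
| "Ck_on (Suc k) S f \<longleftrightarrow> (\<forall>x\<in>S. f differentiable (at x)) \<and>
     (\<forall>b\<in>Basis. Ck_on k S (\<lambda>x. frechet_derivative f (at x) b))"

definition smooth_on :: "'a::euclidean_space set \<Rightarrow> ('a \<Rightarrow> real) \<Rightarrow> bool" where
  "smooth_on S f \<longleftrightarrow> (\<forall>k. Ck_on k S f)"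

text \<open>Smoothness of the boundary: near each boundary point, \<open>\<Omega>\<close> is the negativity set of a smooth
  function without critical points. In particular \<open>\<Omega>\<close> lies locally on one side of its boundary.\<close>

definition smooth_boundary :: "'a::euclidean_space set \<Rightarrow> bool" where
  "smooth_boundary \<Omega> \<longleftrightarrow> (\<forall>x\<in>frontier \<Omega>. \<exists>U \<phi>. open U \<and> x \<in> U \<and> smooth_on U \<phi> \<and>
     (\<forall>y\<in>U. frechet_derivative \<phi> (at y) \<noteq> (\<lambda>_. 0)) \<and> \<Omega> \<inter> U = {y\<in>U. \<phi> y < 0})"

definition smooth_bounded_domain :: "'a::euclidean_space set \<Rightarrow> bool" where
  "smooth_bounded_domain \<Omega> \<longleftrightarrow>
     open \<Omega> \<and> connected \<Omega> \<and> \<Omega> \<noteq> {} \<and> bounded \<Omega> \<and> smooth_boundary \<Omega>"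

text \<open>\<open>C\<^sub>c\<^sup>\<infinity>(\<Omega>)\<close>, extended by zero.\<close>

definition test_functions :: "'a::euclidean_space set \<Rightarrow> ('a \<Rightarrow> real) set" where
  "test_functions \<Omega> =
     {\<phi>. smooth_on UNIV \<phi> \<and> (\<exists>K. compact K \<and> K \<subseteq> \<Omega> \<and> (\<forall>x. x \<notin> K \<longrightarrow> \<phi> x = 0))}"

section \<open>Lebesgue and Sobolev spaces\<close>

definition L2 :: "'a::euclidean_space set \<Rightarrow> ('a \<Rightarrow> 'b::euclidean_space) set" where
  "L2 \<Omega> = {f. f \<in> borel_measurable (lebesgue_on \<Omega>) \<and>
              integrable (lebesgue_on \<Omega>) (\<lambda>x. (norm (f x))\<^sup>2)}"

definition l2inner ::
    "'a::euclidean_space set \<Rightarrow> ('a \<Rightarrow> 'b::euclidean_space) \<Rightarrow> ('a \<Rightarrow> 'b) \<Rightarrow> real" where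
  "l2inner \<Omega> f h = (\<integral>x. f x \<bullet> h x \<partial>lebesgue_on \<Omega>)"

definition l2norm :: "'a::euclidean_space set \<Rightarrow> ('a \<Rightarrow> 'b::euclidean_space) \<Rightarrow> real" where
  "l2norm \<Omega> f = sqrt (l2inner \<Omega> f f)"

definition has_weak_gradient ::
    "'a::euclidean_space set \<Rightarrow> ('a \<Rightarrow> real) \<Rightarrow> ('a \<Rightarrow> 'a) \<Rightarrow> bool" where
  "has_weak_gradient \<Omega> f G \<longleftrightarrow> G \<in> L2 \<Omega> \<and>
     (\<forall>\<phi>\<in>test_functions \<Omega>. \<forall>b\<in>Basis.
        (\<integral>x. f x * frechet_derivative \<phi> (at x) b \<partial>lebesgue_on \<Omega>)
        = - (\<integral>x. (G x \<bullet> b) * \<phi> x \<partial>lebesgue_on \<Omega>))"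

text \<open>The weak gradient is determined almost everywhere on \<open>\<Omega>\<close>, so the choice is immaterial.\<close>

definition wgrad :: "'a::euclidean_space set \<Rightarrow> ('a \<Rightarrow> real) \<Rightarrow> ('a \<Rightarrow> 'a)" where
  "wgrad \<Omega> f = (SOME G. has_weak_gradient \<Omega> f G)"

definition sobolev_H1 :: "'a::euclidean_space set \<Rightarrow> ('a \<Rightarrow> real) set" where
  "sobolev_H1 \<Omega> = {f \<in> L2 \<Omega>. \<exists>G. has_weak_gradient \<Omega> f G}"

definition vnorm :: "'a::euclidean_space set \<Rightarrow> ('a \<Rightarrow> real) \<Rightarrow> real" where
  "vnorm \<Omega> z = l2norm \<Omega> (wgrad \<Omega> z)"

text \<open>\<open>V = H\<^sub>0\<^sup>1(\<Omega>)\<close>, the closure of the test functions in \<open>H\<^sup>1(\<Omega>)\<close>.\<close>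

definition H01 :: "'a::euclidean_space set \<Rightarrow> ('a \<Rightarrow> real) set" where
  "H01 \<Omega> = {f \<in> sobolev_H1 \<Omega>. \<exists>\<phi>::nat \<Rightarrow> 'a \<Rightarrow> real. (\<forall>k. \<phi> k \<in> test_functions \<Omega>) \<and>
     (\<lambda>k. l2norm \<Omega> (\<phi> k - f)) \<longlonglongrightarrow> 0 \<and>
     (\<lambda>k. l2norm \<Omega> (wgrad \<Omega> (\<phi> k) - wgrad \<Omega> f)) \<longlonglongrightarrow> 0}"

text \<open>\<open>V\<^sup>*\<close>: bounded linear functionals on \<open>H01 \<Omega>\<close>; the pairing is function application, and values
  outside \<open>H01 \<Omega>\<close> are irrelevant.\<close>

definition dual_V :: "'a::euclidean_space set \<Rightarrow> (('a \<Rightarrow> real) \<Rightarrow> real) set" where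
  "dual_V \<Omega> = {F.
     (\<forall>y\<in>H01 \<Omega>. \<forall>z\<in>H01 \<Omega>. \<forall>a b. F (\<lambda>x. a * y x + b * z x) = a * F y + b * F z) \<and>
     (\<exists>K. \<forall>z\<in>H01 \<Omega>. \<bar>F z\<bar> \<le> K * vnorm \<Omega> z)}"

definition dual_norm :: "'a::euclidean_space set \<Rightarrow> (('a \<Rightarrow> real) \<Rightarrow> real) \<Rightarrow> real" where
  "dual_norm \<Omega> F = (SUP z\<in>{z \<in> H01 \<Omega>. vnorm \<Omega> z \<le> 1}. \<bar>F z\<bar>)"

definition dirichlet_eigenvalue :: "'a::euclidean_space set \<Rightarrow> real \<Rightarrow> bool" where
  "dirichlet_eigenvalue \<Omega> \<mu> \<longleftrightarrow> (\<exists>w\<in>H01 \<Omega>. l2norm \<Omega> w \<noteq> 0 \<and>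
     (\<forall>z\<in>H01 \<Omega>. l2inner \<Omega> (wgrad \<Omega> w) (wgrad \<Omega> z) = \<mu> * l2inner \<Omega> w z))"

definition lambda1 :: "'a::euclidean_space set \<Rightarrow> real" where
  "lambda1 \<Omega> = Inf {\<mu>. dirichlet_eigenvalue \<Omega> \<mu>}"

section \<open>Functions of time with values in a normed space\<close>

text \<open>The space is given by a carrier \<open>X\<close> and a norm \<open>N\<close> on it; differences are pointwise
  differences of the representing functions.\<close>

definition continuous_into ::
    "'b::minus set \<Rightarrow> ('b \<Rightarrow> real) \<Rightarrow> real set \<Rightarrow> (real \<Rightarrow> 'b) \<Rightarrow> bool" where
  "continuous_into X N S u \<longleftrightarrow> (\<forall>t\<in>S. u t \<in> X \<and> ((\<lambda>s. N (u s - u t)) \<longlongrightarrow> 0) (at t within S))"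

text \<open>\<open>L\<^sup>2(0,T;X)\<close>, with Bochner measurability as almost everywhere approximation by simple
  functions.\<close>

definition bochner_L2 ::
    "'b::minus set \<Rightarrow> ('b \<Rightarrow> real) \<Rightarrow> real \<Rightarrow> (real \<Rightarrow> 'b) \<Rightarrow> bool" where
  "bochner_L2 X N T f \<longleftrightarrow>
     (\<exists>s::nat \<Rightarrow> real \<Rightarrow> 'b.
        (\<forall>k. simple_function (lebesgue_on {0<..<T}) (s k) \<and> (\<forall>t\<in>{0<..<T}. s k t \<in> X)) \<and>
        (AE t in lebesgue_on {0<..<T}. f t \<in> X \<and> (\<lambda>k. N (s k t - f t)) \<longlonglongrightarrow> 0)) \<and>
     integrable (lebesgue_on {0<..<T}) (\<lambda>t. (N (f t))\<^sup>2)"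

text \<open>\<open>v = u\<^sub>t\<close> on \<open>[0,T]\<close>, as a (one-sided at the end points) limit of difference quotients in
  \<open>L\<^sup>2(\<Omega>)\<close>.\<close>

definition has_time_derivative ::
    "'a::euclidean_space set \<Rightarrow> real \<Rightarrow> (real \<Rightarrow> 'a \<Rightarrow> real) \<Rightarrow> (real \<Rightarrow> 'a \<Rightarrow> real) \<Rightarrow> bool" where
  "has_time_derivative \<Omega> T u v \<longleftrightarrow> (\<forall>t\<in>{0..T}.
     ((\<lambda>s. l2norm \<Omega> (\<lambda>x. (u s x - u t x) / (s - t) - v t x)) \<longlongrightarrow> 0) (at t within {0..T}))"

text \<open>\<open>w = v\<^sub>t\<close> in the sense of \<open>V\<^sup>*\<close>-valued distributions on \<open>(0,T)\<close>, where \<open>v(t) \<in> L\<^sup>2(\<Omega>)\<close> is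
  regarded as the functional \<open>z \<mapsto> (v(t), z)\<close>.\<close>

definition has_weak_time_derivative ::
    "'a::euclidean_space set \<Rightarrow> real \<Rightarrow> (real \<Rightarrow> 'a \<Rightarrow> real) \<Rightarrow> (real \<Rightarrow> ('a \<Rightarrow> real) \<Rightarrow> real) \<Rightarrow> bool"
where
  "has_weak_time_derivative \<Omega> T v w \<longleftrightarrow>
     (\<forall>\<phi>\<in>test_functions {0<..<T}. \<forall>z\<in>H01 \<Omega>.
        (\<integral>t. deriv \<phi> t * l2inner \<Omega> (v t) z \<partial>lebesgue_on {0<..<T})
        = - (\<integral>t. \<phi> t * w t z \<partial>lebesgue_on {0<..<T}))"

definition absolutely_continuous_on_interval :: "real \<Rightarrow> real \<Rightarrow> (real \<Rightarrow> real) \<Rightarrow> bool" where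
  "absolutely_continuous_on_interval a b f \<longleftrightarrow> (\<forall>\<epsilon>>0. \<exists>\<delta>>0. \<forall>D::(real \<times> real) set.
     finite D \<and> (\<forall>(c, d)\<in>D. a \<le> c \<and> c \<le> d \<and> d \<le> b) \<and>
     pairwise (\<lambda>I J. {fst I<..<snd I} \<inter> {fst J<..<snd J} = {}) D \<and>
     (\<Sum>(c, d)\<in>D. d - c) < \<delta> \<longrightarrow> (\<Sum>(c, d)\<in>D. \<bar>f d - f c\<bar>) < \<epsilon>)"

section \<open>Hypotheses on the exponent and on the kernel\<close>

definition essinf :: "'a measure \<Rightarrow> ('a \<Rightarrow> ereal) \<Rightarrow> ereal" where
  "essinf M f = - esssup M (\<lambda>x. - f x)"

definition p_minus :: "'a::euclidean_space set \<Rightarrow> ('a \<Rightarrow> real) \<Rightarrow> real" where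
  "p_minus \<Omega> p = real_of_ereal (essinf (lebesgue_on \<Omega>) (\<lambda>x. ereal (p x)))"

definition critical_exponent :: "nat \<Rightarrow> ereal" where
  "critical_exponent n = (if n \<ge> 3 then ereal (2 * real n / (real n - 2)) else \<infinity>)"

definition hyp_H1 :: "'a::euclidean_space set \<Rightarrow> ('a \<Rightarrow> real) \<Rightarrow> bool" where
  "hyp_H1 \<Omega> p \<longleftrightarrow> p \<in> borel_measurable (lebesgue_on \<Omega>) \<and>
     2 < essinf (lebesgue_on \<Omega>) (\<lambda>x. ereal (p x)) \<and>
     esssup (lebesgue_on \<Omega>) (\<lambda>x. ereal (p x)) < critical_exponent DIM('a)"

definition ell :: "(real \<Rightarrow> real) \<Rightarrow> real" where
  "ell g = 1 - (\<integral>s. g s \<partial>lebesgue_on {0..})"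

abbreviation gprime :: "(real \<Rightarrow> real) \<Rightarrow> real \<Rightarrow> real" where
  "gprime g t \<equiv> vector_derivative g (at t within {0..})"

text \<open>Integrability has to be required separately, since the Bochner integral of a non-integrable
  function is \<open>0\<close>; in the source it is implicit in \<open>\<ell> > 0\<close>.\<close>

definition hyp_H2 :: "(real \<Rightarrow> real) \<Rightarrow> bool" where
  "hyp_H2 g \<longleftrightarrow> (\<forall>t\<ge>0. g differentiable (at t within {0..})) \<and>
     continuous_on {0..} (gprime g) \<and>
     (\<forall>t\<ge>0. g t \<ge> 0) \<and> (\<forall>t\<ge>0. gprime g t \<le> 0) \<and>
     integrable (lebesgue_on {0..}) g \<and> ell g > 0"

section \<open>Energy solutions and energies\<close>

definition source :: "('a \<Rightarrow> real) \<Rightarrow> 'a \<Rightarrow> real \<Rightarrow> real" where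
  "source p x r = (if r = 0 then 0 else \<bar>r\<bar> powr (p x - 2) * r * ln \<bar>r\<bar>)"

definition source_primitive :: "('a \<Rightarrow> real) \<Rightarrow> 'a \<Rightarrow> real \<Rightarrow> real" where
  "source_primitive p x r =
     (if r = 0 then 0 else \<bar>r\<bar> powr p x / p x * ln \<bar>r\<bar> - \<bar>r\<bar> powr p x / (p x)\<^sup>2)"

text \<open>A solution is a pair of \<open>u\<close> and its time derivative \<open>v = u\<^sub>t\<close>; the functional-valued \<open>w\<close> is
  \<open>u\<^sub>t\<^sub>t\<close>.\<close>

definition energy_solution ::
    "'a::euclidean_space set \<Rightarrow> ('a \<Rightarrow> real) \<Rightarrow> (real \<Rightarrow> real) \<Rightarrow> ('a \<Rightarrow> real) \<Rightarrow> ('a \<Rightarrow> real) \<Rightarrow>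
     real \<Rightarrow> (real \<Rightarrow> 'a \<Rightarrow> real) \<Rightarrow> (real \<Rightarrow> 'a \<Rightarrow> real) \<Rightarrow> bool" where
  "energy_solution \<Omega> p g u0 u1 T u v \<longleftrightarrow>
     continuous_into (H01 \<Omega>) (vnorm \<Omega>) {0..T} u \<and>
     has_time_derivative \<Omega> T u v \<and>
     continuous_into (L2 \<Omega>) (l2norm \<Omega>) {0..T} v \<and>
     bochner_L2 (H01 \<Omega>) (vnorm \<Omega>) T v \<and>
     (AE x in lebesgue_on \<Omega>. u 0 x = u0 x) \<and>
     (AE x in lebesgue_on \<Omega>. v 0 x = u1 x) \<and>
     (\<exists>w. bochner_L2 (dual_V \<Omega>) (dual_norm \<Omega>) T w \<and>
          has_weak_time_derivative \<Omega> T v w \<and>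
          (\<forall>z\<in>H01 \<Omega>. AE t in lebesgue_on {0<..<T}.
             w t z + l2inner \<Omega> (wgrad \<Omega> (u t)) (wgrad \<Omega> z)
             + l2inner \<Omega> (wgrad \<Omega> (v t)) (wgrad \<Omega> z)
             - (\<integral>s. g (t - s) * l2inner \<Omega> (wgrad \<Omega> (u s)) (wgrad \<Omega> z) \<partial>lebesgue_on {0..t})
             = (\<integral>x. source p x (u t x) * z x \<partial>lebesgue_on \<Omega>)))"

definition solution_upto ::
    "'a::euclidean_space set \<Rightarrow> ('a \<Rightarrow> real) \<Rightarrow> (real \<Rightarrow> real) \<Rightarrow> ('a \<Rightarrow> real) \<Rightarrow> ('a \<Rightarrow> real) \<Rightarrow>
     ereal \<Rightarrow> (real \<Rightarrow> 'a \<Rightarrow> real) \<Rightarrow> (real \<Rightarrow> 'a \<Rightarrow> real) \<Rightarrow> bool" where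
  "solution_upto \<Omega> p g u0 u1 Tm u v \<longleftrightarrow>
     0 < Tm \<and> (\<forall>T. 0 < T \<and> ereal T < Tm \<longrightarrow> energy_solution \<Omega> p g u0 u1 T u v)"

text \<open>Equality of two solutions on \<open>[0,Tm)\<close>.\<close>

definition agree_upto ::
    "'a::euclidean_space set \<Rightarrow> ereal \<Rightarrow> (real \<Rightarrow> 'a \<Rightarrow> real) \<Rightarrow> (real \<Rightarrow> 'a \<Rightarrow> real) \<Rightarrow>
     (real \<Rightarrow> 'a \<Rightarrow> real) \<Rightarrow> (real \<Rightarrow> 'a \<Rightarrow> real) \<Rightarrow> bool" where
  "agree_upto \<Omega> Tm u v u' v' \<longleftrightarrow> (\<forall>t. 0 \<le> t \<and> ereal t < Tm \<longrightarrow>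
     (AE x in lebesgue_on \<Omega>. u t x = u' t x) \<and> (AE x in lebesgue_on \<Omega>. v t x = v' t x))"

definition maximal_solution ::
    "'a::euclidean_space set \<Rightarrow> ('a \<Rightarrow> real) \<Rightarrow> (real \<Rightarrow> real) \<Rightarrow> ('a \<Rightarrow> real) \<Rightarrow> ('a \<Rightarrow> real) \<Rightarrow>
     ereal \<Rightarrow> (real \<Rightarrow> 'a \<Rightarrow> real) \<Rightarrow> (real \<Rightarrow> 'a \<Rightarrow> real) \<Rightarrow> bool" where
  "maximal_solution \<Omega> p g u0 u1 Tm u v \<longleftrightarrow> solution_upto \<Omega> p g u0 u1 Tm u v \<and>
     (\<nexists>Tm' u' v'. Tm < Tm' \<and> solution_upto \<Omega> p g u0 u1 Tm' u' v' \<and> agree_upto \<Omega> Tm u v u' v')"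

definition unique_maximal_solution ::
    "'a::euclidean_space set \<Rightarrow> ('a \<Rightarrow> real) \<Rightarrow> (real \<Rightarrow> real) \<Rightarrow> ('a \<Rightarrow> real) \<Rightarrow> ('a \<Rightarrow> real) \<Rightarrow>
     ereal \<Rightarrow> (real \<Rightarrow> 'a \<Rightarrow> real) \<Rightarrow> (real \<Rightarrow> 'a \<Rightarrow> real) \<Rightarrow> bool" where
  "unique_maximal_solution \<Omega> p g u0 u1 Tm u v \<longleftrightarrow> maximal_solution \<Omega> p g u0 u1 Tm u v \<and>
     (\<forall>Tm' u' v'. maximal_solution \<Omega> p g u0 u1 Tm' u' v' \<longrightarrow>
        Tm' = Tm \<and> agree_upto \<Omega> Tm u v u' v')"

definition blows_up_at ::
    "'a::euclidean_space set \<Rightarrow> real \<Rightarrow> (real \<Rightarrow> 'a \<Rightarrow> real) \<Rightarrow> (real \<Rightarrow> 'a \<Rightarrow> real) \<Rightarrow> bool" where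
  "blows_up_at \<Omega> T u v \<longleftrightarrow>
     Limsup (at_left T) (\<lambda>t. ereal (vnorm \<Omega> (u t) + l2norm \<Omega> (v t))) = \<infinity>"

definition energy ::
    "'a::euclidean_space set \<Rightarrow> ('a \<Rightarrow> real) \<Rightarrow> (real \<Rightarrow> real) \<Rightarrow>
     (real \<Rightarrow> 'a \<Rightarrow> real) \<Rightarrow> (real \<Rightarrow> 'a \<Rightarrow> real) \<Rightarrow> real \<Rightarrow> real" where
  "energy \<Omega> p g u v t =
     1/2 * (l2norm \<Omega> (v t))\<^sup>2
     + 1/2 * (1 - (\<integral>s. g s \<partial>lebesgue_on {0..t})) * (l2norm \<Omega> (wgrad \<Omega> (u t)))\<^sup>2
     + 1/2 * (\<integral>s. g (t - s) * (l2norm \<Omega> (wgrad \<Omega> (u t) - wgrad \<Omega> (u s)))\<^sup>2 \<partial>lebesgue_on {0..t})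
     - (\<integral>x. source_primitive p x (u t x) \<partial>lebesgue_on \<Omega>)"

definition c_shift :: "real \<Rightarrow> real \<Rightarrow> real" where
  "c_shift m q = (if q > m then (q - m) / q\<^sup>2 * exp (- q / (q - m)) else 0)"

definition C_star :: "'a::euclidean_space set \<Rightarrow> ('a \<Rightarrow> real) \<Rightarrow> real" where
  "C_star \<Omega> p = (\<integral>x. c_shift (p_minus \<Omega> p) (p x) \<partial>lebesgue_on \<Omega>)"

definition shifted_energy ::
    "'a::euclidean_space set \<Rightarrow> ('a \<Rightarrow> real) \<Rightarrow> (real \<Rightarrow> real) \<Rightarrow>
     (real \<Rightarrow> 'a \<Rightarrow> real) \<Rightarrow> (real \<Rightarrow> 'a \<Rightarrow> real) \<Rightarrow> real \<Rightarrow> real" where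
  "shifted_energy \<Omega> p g u v t = energy \<Omega> p g u v t + C_star \<Omega> p / p_minus \<Omega> p"

text \<open>The local theory of the problem, which the source takes as known: well-posedness, blow-up
  alternative and energy identity for all data in \<open>V \<times> H\<close>.\<close>

definition local_theory ::
    "'a::euclidean_space set \<Rightarrow> ('a \<Rightarrow> real) \<Rightarrow> (real \<Rightarrow> real) \<Rightarrow> bool" where
  "local_theory \<Omega> p g \<longleftrightarrow> (\<forall>u0\<in>H01 \<Omega>. \<forall>u1\<in>L2 \<Omega>. \<exists>Tm u v.
     unique_maximal_solution \<Omega> p g u0 u1 Tm u v \<and>
     (Tm < \<infinity> \<longrightarrow> blows_up_at \<Omega> (real_of_ereal Tm) u v) \<and>
     (\<forall>T. 0 < T \<and> ereal T < Tm \<longrightarrow> absolutely_continuous_on_interval 0 T (energy \<Omega> p g u v)) \<and>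
     (AE t in lebesgue_on {t. 0 < t \<and> ereal t < Tm}.
        (energy \<Omega> p g u v has_real_derivative
          - (l2norm \<Omega> (wgrad \<Omega> (v t)))\<^sup>2
          - 1/2 * g t * (l2norm \<Omega> (wgrad \<Omega> (u t)))\<^sup>2
          + 1/2 * (\<integral>s. gprime g (t - s) * (l2norm \<Omega> (wgrad \<Omega> (u t) - wgrad \<Omega> (u s)))\<^sup>2
                     \<partial>lebesgue_on {0..t})) (at t)))"

section \<open>Constants and the lifespan bound\<close>

definition growth_const ::
    "'a::euclidean_space set \<Rightarrow> ('a \<Rightarrow> real) \<Rightarrow> (real \<Rightarrow> real) \<Rightarrow> real" where
  "growth_const \<Omega> p g = (let m = p_minus \<Omega> p; l1 = lambda1 \<Omega> in
     min (m + 2) (2 * l1 * ((m - 1)\<^sup>2 * ell g - 1) / (2 * m + l1)))"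

text \<open>The bound \<open>(\<ast>)\<close> on the maximal time \<open>Tm\<close> for nonnegative shifted initial energy \<open>e = \<E>(0)\<close>,
  together with the positivity of \<open>L\<^sub>0\<close> and the unique existence of \<open>\<tau>\<close> on which it rests.\<close>

definition lifespan_bound ::
    "'a::euclidean_space set \<Rightarrow> ('a \<Rightarrow> real) \<Rightarrow> (real \<Rightarrow> real) \<Rightarrow> ('a \<Rightarrow> real) \<Rightarrow> ('a \<Rightarrow> real) \<Rightarrow>
     real \<Rightarrow> ereal \<Rightarrow> bool" where
  "lifespan_bound \<Omega> p g u0 u1 e Tm \<longleftrightarrow>
     (let m = p_minus \<Omega> p; C = growth_const \<Omega> p g; l1 = lambda1 \<Omega>;
          L0 = l2inner \<Omega> u0 u1 - m / C * e;
          \<beta> = C * L0 / (2 * m);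
          quad = (\<lambda>\<tau>. C * L0 * \<tau>\<^sup>2 + (L0 - 2 * (e + \<beta>) / l1) * \<tau> - (l2norm \<Omega> u0)\<^sup>2)
      in L0 > 0 \<and>
         (\<exists>\<tau>>0. quad \<tau> = 0 \<and> (\<forall>\<tau>'>0. quad \<tau>' = 0 \<longrightarrow> \<tau>' = \<tau>) \<and>
            (let U = (l2norm \<Omega> u0 + sqrt (\<tau> * (e + \<beta>) / l1))\<^sup>2;
                 G = (l2norm \<Omega> (wgrad \<Omega> u0) + sqrt (\<tau> * (e + \<beta>)))\<^sup>2;
                 d = (m - 2) / 2 * L0 - 2 * G
             in Tm \<le> ereal (\<tau> + 4 * (sqrt (d\<^sup>2 + (m - 2)\<^sup>2 * \<beta> * U) - d) / ((m - 2)\<^sup>2 * \<beta>)))))"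

end

theory Submission
 imports Defs "HOL-Library.Diagonal_Subsequence"
begin

text \<open>The data are multiples \<open>k \<phi>\<close> and \<open>s \<phi>\<close> of one bump function. Along these, the source energy
 \<open>\<integral> F(x, k \<phi>)\<close> grows faster than \<open>k\<^sup>2\<close> because \<open>p\<^sub>- > 2\<close>; so for large \<open>k\<close> the level \<open>E(0) = R\<close>
 forces a large \<open>s\<close>, and \<open>(u0, u1)\<close> exceeds every prescribed multiple of the shifted energy
 (\<open>data_with_energy\<close>). It remains to show that all such solutions blow up within the stated time.

 Pointwise, \<open>r f(x, r) \<ge> p\<^sub>- F(x, r) - c(p(x))\<close> for the source \<open>f\<close>, where \<open>c\<close> is the integrand of \<open>C\<^sub>*\<close>. Testing
 the equation with \<open>u\<close> itself, and absorbing the memory term by Young's inequality, bounds the time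
 derivative of \<open>(u, v) + \<parallel>\<nabla>u\<parallel>\<^sup>2 / 2\<close> from below by
 \<open>(p\<^sub>- + 2) / 2 \<parallel>v\<parallel>\<^sup>2 + \<kappa> \<parallel>\<nabla>u\<parallel>\<^sup>2 - p\<^sub>- \<E>\<close>, with \<open>\<kappa> > 0\<close> by the condition on \<open>\<ell>\<close> (\<open>energy_pointwise\<close>,
 \<open>energy_inequality\<close>); and \<open>\<E>\<close> decreases at least as fast as \<open>\<integral> \<parallel>\<nabla>v\<parallel>\<^sup>2\<close> grows. From here on only real
 functions of time occur; they are collected in the locale \<open>energy_growth\<close>.

 If \<open>\<E> \<le> -\<beta> < 0\<close> at some time, a functional \<open>\<Psi>\<close> built from \<open>\<parallel>u\<parallel>\<^sup>2\<close>, the time integral of \<open>\<parallel>\<nabla>u\<parallel>\<^sup>2\<close> and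
 \<open>\<beta> (t + \<sigma>)\<^sup>2\<close> satisfies \<open>\<Psi>'' \<Psi> \<ge> (1 + \<alpha>) \<Psi>'\<^sup>2\<close> with \<open>\<alpha> = (p\<^sub>- - 2) / 4\<close>. A negative power of it is concave, and
 the solution cannot outlive the zero of the tangent (\<open>concavity_lifespan\<close>, \<open>lifespan_from\<close>); the best \<open>\<sigma>\<close>
 gives \<open>lifespan_optimal\<close>. If \<open>\<E>(0) \<ge> 0\<close>, the functional \<open>L = (u, v) - p\<^sub>- \<E> / C\<close> satisfies \<open>L' \<ge> C L\<close>. As long as
 \<open>\<E> \<ge> -\<beta>\<close>, this makes \<open>\<parallel>u\<parallel>\<^sup>2\<close> grow quadratically, whereas the bounded dissipation allows linear growth only.
 Hence \<open>\<E>\<close> reaches \<open>-\<beta>\<close> by the time \<open>\<tau>\<close> at which the two estimates collide, and the first case applies from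
 there (\<open>delayed_lifespan\<close>).

 Most of the text supplies the function spaces: completeness of \<open>L\<^sup>2\<close>, test functions, the space \<open>H\<^sub>0\<^sup>1\<close>
 with Rellich's theorem (by averages over dyadic cells), which shows that \<open>lambda1\<close> is positive and is the
 Poincare constant, and a subcritical Sobolev inequality, which makes the source terms integrable. For the solution as a
 curve, product rules such as \<open>cross_increment\<close> hold because an additive function of intervals whose
 increments are \<open>o(1)\<close> times those of an increasing function vanishes (\<open>constant_if_small_increments\<close>).\<close>

section \<open>Square-integrable functions\<close>

lemma L2_measurable: "f \<in> L2 S ==> f \<in> borel_measurable (lebesgue_on S)"
 by (simp add: L2_def)

lemma L2_integrable: "f \<in> L2 S ==> integrable (lebesgue_on S) (\<lambda>x. (norm (f x))\<^sup>2)"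
 by (simp add: L2_def)

lemma L2_inner_integrable:
 assumes "f \<in> L2 S" "h \<in> L2 S"
 shows "integrable (lebesgue_on S) (\<lambda>x. f x \<bullet> h x)"
proof (rule Bochner_Integration.integrable_bound)
 show "integrable (lebesgue_on S) (\<lambda>x. (norm (f x))\<^sup>2 + (norm (h x))\<^sup>2)"
  using assms by (intro Bochner_Integration.integrable_add L2_integrable)
 show "(\<lambda>x. f x \<bullet> h x) \<in> borel_measurable (lebesgue_on S)"
  using L2_measurable[OF assms(1)] L2_measurable[OF assms(2)] by simp
 have "\<bar>f x \<bullet> h x\<bar> <= (norm (f x))\<^sup>2 + (norm (h x))\<^sup>2" for x
 proof -
  have "\<bar>f x \<bullet> h x\<bar> <= norm (f x) * norm (h x)" by (rule Cauchy_Schwarz_ineq2)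
  moreover have "2 * (norm (f x) * norm (h x)) <= (norm (f x))\<^sup>2 + (norm (h x))\<^sup>2"
   using sum_squares_bound[of "norm (f x)" "norm (h x)"] by (simp add: mult.assoc)
  moreover have "0 <= norm (f x) * norm (h x)" by simp
  ultimately show ?thesis by linarith
 qed
 then show "AE x in lebesgue_on S. norm (f x \<bullet> h x) <= norm ((norm (f x))\<^sup>2 + (norm (h x))\<^sup>2)"
  by (auto intro!: AE_I2)
qed

lemma L2_mult_integrable:
 fixes f h :: "'a::euclidean_space \<Rightarrow> real"
 shows "f \<in> L2 S ==> h \<in> L2 S ==> integrable (lebesgue_on S) (\<lambda>x. f x * h x)"
 using L2_inner_integrable[of f S h] by simp

lemma L2_scaleR: "f \<in> L2 S ==> (\<lambda>x. c *\<^sub>R f x) \<in> L2 S"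
 by (auto simp: L2_def power_mult_distrib)

lemma L2_add:
 assumes "f \<in> L2 S" "h \<in> L2 S"
 shows "(\<lambda>x. f x + h x) \<in> L2 S"
proof -
 have "integrable (lebesgue_on S) (\<lambda>x. (norm (f x))\<^sup>2 + 2 * (f x \<bullet> h x) + (norm (h x))\<^sup>2)"
  using assms by (intro Bochner_Integration.integrable_add L2_integrable
    integrable_mult_right L2_inner_integrable)
 then have "integrable (lebesgue_on S) (\<lambda>x. (norm (f x + h x))\<^sup>2)"
  by (simp add: power2_norm_eq_inner inner_add inner_commute algebra_simps)
 moreover have "(\<lambda>x. f x + h x) \<in> borel_measurable (lebesgue_on S)"
  by (intro borel_measurable_add L2_measurable assms)
 ultimately show ?thesis by (simp add: L2_def)
qed

lemma L2_diff:
 assumes "f \<in> L2 S" "h \<in> L2 S"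
 shows "(\<lambda>x. f x - h x) \<in> L2 S"
 using L2_add[OF assms(1) L2_scaleR[OF assms(2), of "-1"]] by simp

lemma L2_diff': "f \<in> L2 S ==> h \<in> L2 S ==> f - h \<in> L2 S"
 using L2_diff[of f S h] by (simp add: fun_diff_def)

lemma L2_zero: "(\<lambda>x. 0) \<in> L2 S"
 by (simp add: L2_def)

lemma L2_mult: "f \<in> L2 S ==> (\<lambda>x. c * f x) \<in> L2 S" for f :: "'a::euclidean_space \<Rightarrow> real"
 using L2_scaleR[of f S c] by simp

lemmas L2_intros = L2_add L2_diff L2_diff' L2_scaleR L2_mult L2_zero

lemma l2inner_commute: "l2inner S f h = l2inner S h f"
 by (simp add: l2inner_def inner_commute)

lemma l2inner_add_left:
 "f \<in> L2 S ==> h \<in> L2 S ==> k \<in> L2 S ==>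
  l2inner S (\<lambda>x. f x + h x) k = l2inner S f k + l2inner S h k"
 unfolding l2inner_def inner_add_left
 by (rule Bochner_Integration.integral_add) (auto intro: L2_inner_integrable)

lemma l2inner_diff_left:
 "f \<in> L2 S ==> h \<in> L2 S ==> k \<in> L2 S ==>
  l2inner S (\<lambda>x. f x - h x) k = l2inner S f k - l2inner S h k"
 unfolding l2inner_def inner_diff_left
 by (rule Bochner_Integration.integral_diff) (auto intro: L2_inner_integrable)

lemma l2inner_scaleR_left: "l2inner S (\<lambda>x. c *\<^sub>R f x) k = c * l2inner S f k"
 by (simp add: l2inner_def)

lemma l2inner_add_right:
 "f \<in> L2 S ==> h \<in> L2 S ==> k \<in> L2 S ==>
  l2inner S k (\<lambda>x. f x + h x) = l2inner S k f + l2inner S k h"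
 by (simp add: l2inner_commute[of S k] l2inner_add_left)

lemma l2inner_diff_right:
 "f \<in> L2 S ==> h \<in> L2 S ==> k \<in> L2 S ==>
  l2inner S k (\<lambda>x. f x - h x) = l2inner S k f - l2inner S k h"
 by (simp add: l2inner_commute[of S k] l2inner_diff_left)

lemma l2inner_scaleR_right: "l2inner S k (\<lambda>x. c *\<^sub>R f x) = c * l2inner S k f"
 by (simp add: l2inner_def)

lemma l2inner_self_nonneg: "0 <= l2inner S f f"
 by (simp add: l2inner_def)

lemma l2norm_nonneg: "0 <= l2norm S f"
 by (simp add: l2norm_def l2inner_self_nonneg)

lemma l2norm_power2: "(l2norm S f)\<^sup>2 = l2inner S f f"
 by (simp add: l2norm_def l2inner_self_nonneg)

lemma l2norm_power2_integral: "(l2norm S f)\<^sup>2 = (\<integral>x. (norm (f x))\<^sup>2 \<partial>lebesgue_on S)"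
 by (simp add: l2norm_power2 l2inner_def power2_norm_eq_inner)

lemma l2norm_scaleR: "l2norm S (\<lambda>x. c *\<^sub>R f x) = \<bar>c\<bar> * l2norm S f"
 by (simp add: l2norm_def l2inner_scaleR_left l2inner_scaleR_right real_sqrt_mult flip: mult.assoc)

lemma l2norm_mult: "l2norm S (\<lambda>x. c * f x) = \<bar>c\<bar> * l2norm S f" for f :: "'a::euclidean_space \<Rightarrow> real"
 using l2norm_scaleR[of S c f] by simp

lemma l2norm_minus: "l2norm S (\<lambda>x. - f x) = l2norm S f"
 using l2norm_scaleR[of S "-1" f] by simp

lemma l2norm_diff_commute: "l2norm S (\<lambda>x. f x - h x) = l2norm S (\<lambda>x. h x - f x)"
 using l2norm_minus[of S "\<lambda>x. f x - h x"] by simp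

lemma l2norm_add_power2:
 assumes "f \<in> L2 S" "h \<in> L2 S"
 shows "(l2norm S (\<lambda>x. f x + h x))\<^sup>2 = (l2norm S f)\<^sup>2 + 2 * l2inner S f h + (l2norm S h)\<^sup>2"
 using assms l2inner_commute[of S f h]
 by (simp add: l2norm_power2 l2inner_add_left l2inner_add_right L2_add)

lemma l2norm_diff_power2:
 assumes "f \<in> L2 S" "h \<in> L2 S"
 shows "(l2norm S (\<lambda>x. f x - h x))\<^sup>2 = (l2norm S f)\<^sup>2 - 2 * l2inner S f h + (l2norm S h)\<^sup>2"
 using assms l2inner_commute[of S f h]
 by (simp add: l2norm_power2 l2inner_diff_left l2inner_diff_right L2_diff)

lemma nonneg_quadratic_discriminant:
 fixes a b c :: real
 assumes nonneg: "!!s. 0 <= a + 2 * s * b + s\<^sup>2 * c" and "0 <= a" "0 <= c"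
 shows "\<bar>b\<bar> <= sqrt a * sqrt c"
proof -
 have "b\<^sup>2 <= a * c"
 proof (cases "c = 0")
  case True
  have "b = 0"
  proof (rule ccontr)
   assume "b \<noteq> 0"
   define s where "s = - (a + 1) / (2 * b)"
   have "2 * s * b = - (a + 1)" using \<open>b \<noteq> 0\<close> by (simp add: s_def)
   moreover have "0 <= a + 2 * s * b + s\<^sup>2 * c" by (rule nonneg)
   ultimately show False using True by simp
  qed
  with True show ?thesis by simp
 next
  case False
  define s where "s = b / c"
  have b: "b = s * c" using False by (simp add: s_def)
  have "0 <= (a - s\<^sup>2 * c) * c"
   using nonneg[of "- s"] \<open>0 <= c\<close>
   by (intro mult_nonneg_nonneg) (simp_all add: b power2_eq_square algebra_simps)
  then show ?thesis by (simp add: b power2_eq_square algebra_simps)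
 qed
 then have "sqrt (b\<^sup>2) <= sqrt (a * c)" by (rule real_sqrt_le_mono)
 then show ?thesis by (simp add: real_sqrt_mult)
qed

lemma l2inner_Cauchy_Schwarz:
 assumes "f \<in> L2 S" "h \<in> L2 S"
 shows "\<bar>l2inner S f h\<bar> <= l2norm S f * l2norm S h"
proof -
 have "0 <= l2inner S f f + 2 * s * l2inner S f h + s\<^sup>2 * l2inner S h h" for s
 proof -
  have "0 <= (l2norm S (\<lambda>x. f x + s *\<^sub>R h x))\<^sup>2" by simp
  also have "... = l2inner S f f + 2 * s * l2inner S f h + s\<^sup>2 * l2inner S h h"
   unfolding l2norm_add_power2[OF assms(1) L2_scaleR[OF assms(2)]]
   by (simp add: l2norm_power2 l2inner_scaleR_right l2inner_scaleR_left)
    (simp add: power2_eq_square)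
  finally show ?thesis .
 qed
 from nonneg_quadratic_discriminant[OF this] show ?thesis
  by (simp add: l2norm_def l2inner_self_nonneg)
qed

lemma l2norm_triangle:
 assumes "f \<in> L2 S" "h \<in> L2 S"
 shows "l2norm S (\<lambda>x. f x + h x) <= l2norm S f + l2norm S h"
proof (rule power2_le_imp_le)
 show "(l2norm S (\<lambda>x. f x + h x))\<^sup>2 <= (l2norm S f + l2norm S h)\<^sup>2"
  using l2inner_Cauchy_Schwarz[OF assms] by (simp add: l2norm_add_power2[OF assms] power2_sum)
 show "0 <= l2norm S f + l2norm S h" by (simp add: l2norm_nonneg)
qed

lemma l2norm_triangle_diff:
 assumes "f \<in> L2 S" "h \<in> L2 S" "k \<in> L2 S"
 shows "l2norm S (\<lambda>x. f x - k x) <= l2norm S (\<lambda>x. f x - h x) + l2norm S (\<lambda>x. h x - k x)"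
 using l2norm_triangle[of "\<lambda>x. f x - h x" S "\<lambda>x. h x - k x"] assms by (simp add: L2_diff)

lemma l2norm_reverse_triangle:
 assumes "f \<in> L2 S" "h \<in> L2 S"
 shows "\<bar>l2norm S f - l2norm S h\<bar> <= l2norm S (\<lambda>x. f x - h x)"
 using l2norm_triangle[of "\<lambda>x. f x - h x" S h] l2norm_triangle[of "\<lambda>x. h x - f x" S f]
  l2norm_diff_commute[of S f h] assms by (simp add: L2_diff)

lemma l2norm_tendsto:
 assumes "!!k. f k \<in> L2 S" "g \<in> L2 S" "((\<lambda>k. l2norm S (\<lambda>x. f k x - g x)) \<longlongrightarrow> 0) F"
 shows "((\<lambda>k. l2norm S (f k)) \<longlongrightarrow> l2norm S g) F"
proof -
 have "((\<lambda>k. l2norm S (f k) - l2norm S g) \<longlongrightarrow> 0) F"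
  using assms(3) by (rule Lim_null_comparison[rotated])
   (use l2norm_reverse_triangle[OF assms(1,2)] in auto)
 then show ?thesis by (simp add: LIM_zero_iff)
qed

lemma l2inner_tendsto_left:
 assumes "!!k. f k \<in> L2 S" "g \<in> L2 S" "h \<in> L2 S"
  "((\<lambda>k. l2norm S (\<lambda>x. f k x - g x)) \<longlongrightarrow> 0) F"
 shows "((\<lambda>k. l2inner S (f k) h) \<longlongrightarrow> l2inner S g h) F"
proof -
 have "((\<lambda>k. l2norm S (\<lambda>x. f k x - g x) * l2norm S h) \<longlongrightarrow> 0 * l2norm S h) F"
  by (intro tendsto_intros assms(4))
 then have "((\<lambda>k. l2norm S (\<lambda>x. f k x - g x) * l2norm S h) \<longlongrightarrow> 0) F" by simp
 then have "((\<lambda>k. l2inner S (f k) h - l2inner S g h) \<longlongrightarrow> 0) F"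
 proof (rule Lim_null_comparison[rotated], intro always_eventually allI)
  fix k
  have "\<bar>l2inner S (\<lambda>x. f k x - g x) h\<bar> <= l2norm S (\<lambda>x. f k x - g x) * l2norm S h"
   using assms by (intro l2inner_Cauchy_Schwarz L2_diff)
  then show "norm (l2inner S (f k) h - l2inner S g h) <= l2norm S (\<lambda>x. f k x - g x) * l2norm S h"
   using assms by (simp add: l2inner_diff_left)
 qed
 then show ?thesis by (simp add: LIM_zero_iff)
qed

lemma complete_measure_lebesgue_on:
 assumes "S \<in> sets lebesgue"
 shows "complete_measure (lebesgue_on S)"
proof
 fix A B assume *: "B \<subseteq> A" "A \<in> null_sets (lebesgue_on S)"
 then have "A \<in> null_sets lebesgue"
  using null_sets_restrict_space[of S lebesgue A] assms by simp
 then have "B \<in> null_sets lebesgue"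
  using *(1) by (rule completion.complete2[rotated])
 moreover have "B \<subseteq> S"
  using * sets.sets_into_space[of A "lebesgue_on S"] by (auto dest: null_setsD2)
 ultimately show "B \<in> sets (lebesgue_on S)"
  using assms by (simp add: sets_restrict_space_iff null_setsD2)
qed

lemma borel_measurable_AE_cong:
 fixes f h :: "'a::euclidean_space \<Rightarrow> 'b::topological_space"
 assumes S: "S \<in> sets lebesgue" and f: "f \<in> borel_measurable (lebesgue_on S)"
  and ae: "AE x in lebesgue_on S. f x = h x"
 shows "h \<in> borel_measurable (lebesgue_on S)"
proof (rule measurableI)
 interpret complete_measure "lebesgue_on S" by (rule complete_measure_lebesgue_on[OF S])
 fix A :: "'b set" assume "A \<in> sets borel"
 then have A: "f -` A \<inter> space (lebesgue_on S) \<in> sets (lebesgue_on S)"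
  using f by (rule measurable_sets[rotated])
 have "AE x in lebesgue_on S. x \<in> f -` A \<inter> space (lebesgue_on S)
   \<longleftrightarrow> x \<in> h -` A \<inter> space (lebesgue_on S)"
  using ae by eventually_elim auto
 from in_sets_AE[OF this A] show "h -` A \<inter> space (lebesgue_on S) \<in> sets (lebesgue_on S)"
  by simp
qed simp

lemma borel_measurable_AE_LIMSEQ:
 fixes f :: "nat \<Rightarrow> 'a::euclidean_space \<Rightarrow> 'b::euclidean_space"
 assumes S: "S \<in> sets lebesgue" and f: "!!k. f k \<in> borel_measurable (lebesgue_on S)"
  and ae: "AE x in lebesgue_on S. (\<lambda>k. f k x) \<longlonglongrightarrow> h x"
 shows "h \<in> borel_measurable (lebesgue_on S)"
proof -
 from ae obtain N where N: "{x \<in> space (lebesgue_on S). \<not> (\<lambda>k. f k x) \<longlonglongrightarrow> h x} \<subseteq> N"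
   "N \<in> sets (lebesgue_on S)" "emeasure (lebesgue_on S) N = 0"
  by (rule AE_E)
 have m: "(\<lambda>x. indicator (- N) x *\<^sub>R h x) \<in> borel_measurable (lebesgue_on S)"
 proof (rule borel_measurable_LIMSEQ_metric)
  show "(\<lambda>x. indicator (- N) x *\<^sub>R f k x) \<in> borel_measurable (lebesgue_on S)" for k
  proof -
   have "(indicator N :: 'a \<Rightarrow> real) \<in> borel_measurable (lebesgue_on S)"
    using N(2) by simp
   then have "(\<lambda>x. (1 - indicator N x) *\<^sub>R f k x) \<in> borel_measurable (lebesgue_on S)"
    using f[of k] by simp
   moreover have "(1 - indicator N x :: real) = indicator (- N) x" for x
    by (simp add: indicator_def)
   ultimately show ?thesis by simp
  qed
  show "(\<lambda>k. indicator (- N) x *\<^sub>R f k x) \<longlonglongrightarrow> indicator (- N) x *\<^sub>R h x"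
   if "x \<in> space (lebesgue_on S)" for x
   using N(1) that by (auto simp: indicator_def)
 qed
 have "AE x in lebesgue_on S. x \<notin> N"
  using N(2,3) by (intro AE_not_in) (auto simp: null_sets_def)
 then have "AE x in lebesgue_on S. indicator (- N) x *\<^sub>R h x = h x"
  by eventually_elim simp
 from borel_measurable_AE_cong[OF S m this] show ?thesis .
qed

lemma l2inner_AE_cong:
 assumes S: "S \<in> sets lebesgue" and L2: "f \<in> L2 S" "h \<in> L2 S"
  and ae: "AE x in lebesgue_on S. f x = f' x" "AE x in lebesgue_on S. h x = h' x"
 shows "l2inner S f h = l2inner S f' h'"
 unfolding l2inner_def
proof (rule integral_cong_AE)
 show "(\<lambda>x. f' x \<bullet> h' x) \<in> borel_measurable (lebesgue_on S)"
  by (intro borel_measurable_inner borel_measurable_AE_cong[OF S L2_measurable[OF L2(1)] ae(1)]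
    borel_measurable_AE_cong[OF S L2_measurable[OF L2(2)] ae(2)])
 show "(\<lambda>x. f x \<bullet> h x) \<in> borel_measurable (lebesgue_on S)"
  by (intro borel_measurable_inner L2_measurable L2)
 show "AE x in lebesgue_on S. f x \<bullet> h x = f' x \<bullet> h' x"
  using ae by eventually_elim simp
qed

lemma l2norm_AE_cong:
 assumes "S \<in> sets lebesgue" "f \<in> L2 S" "AE x in lebesgue_on S. f x = f' x"
 shows "l2norm S f = l2norm S f'"
 using l2inner_AE_cong[OF assms(1,2,2,3,3)] by (simp add: l2norm_def)

lemma L2_AE_cong:
 assumes S: "S \<in> sets lebesgue" "f \<in> L2 S" "AE x in lebesgue_on S. f x = f' x"
 shows "f' \<in> L2 S"
proof -
 have m: "f' \<in> borel_measurable (lebesgue_on S)"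
  using borel_measurable_AE_cong[OF S(1) _ S(3)] S(2) by (simp add: L2_measurable)
 have "AE x in lebesgue_on S. (norm (f x))\<^sup>2 = (norm (f' x))\<^sup>2"
  using S(3) by eventually_elim simp
 then have "integrable (lebesgue_on S) (\<lambda>x. (norm (f' x))\<^sup>2)"
  using integrable_cong_AE[of "\<lambda>x. (norm (f x))\<^sup>2" "lebesgue_on S" "\<lambda>x. (norm (f' x))\<^sup>2"]
   m L2_measurable[OF S(2)] L2_integrable[OF S(2)] by simp
 with m show ?thesis by (simp add: L2_def)
qed

lemma l2norm_zero_AE:
 assumes "f \<in> L2 S" "l2norm S f = 0"
 shows "AE x in lebesgue_on S. f x = 0"
proof -
 have "(\<integral>x. (norm (f x))\<^sup>2 \<partial>lebesgue_on S) = 0"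
  using assms(2) l2norm_power2_integral[of S f] by simp
 then have "AE x in lebesgue_on S. (norm (f x))\<^sup>2 = 0"
  using integral_nonneg_eq_0_iff_AE[OF L2_integrable[OF assms(1)]] by simp
 then show ?thesis by eventually_elim simp
qed

lemma L2_AE_bounded:
 fixes f :: "'a::euclidean_space \<Rightarrow> 'b::euclidean_space"
 assumes "S \<in> lmeasurable" "f \<in> borel_measurable (lebesgue_on S)"
  and "AE x in lebesgue_on S. norm (f x) <= B"
 shows "f \<in> L2 S"
proof -
 interpret finite_measure "lebesgue_on S" by (rule finite_measure_lebesgue_on[OF assms(1)])
 have "AE x in lebesgue_on S. norm ((norm (f x))\<^sup>2) <= B\<^sup>2"
  using assms(3) by eventually_elim (simp add: power_mono)
 then have "integrable (lebesgue_on S) (\<lambda>x. (norm (f x))\<^sup>2)"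
  using assms(2) by (intro integrable_const_bound) auto
 with assms(2) show ?thesis by (simp add: L2_def)
qed

text \<open>Fatou's lemma in the form in which limits of bounded sequences are taken below.\<close>

lemma L2_Fatou:
 fixes f :: "nat \<Rightarrow> 'a::euclidean_space \<Rightarrow> 'b::euclidean_space"
 assumes S: "S \<in> sets lebesgue" and f: "!!k. f k \<in> L2 S"
  and ae: "AE x in lebesgue_on S. (\<lambda>k. f k x) \<longlonglongrightarrow> h x"
  and bound: "eventually (\<lambda>k. l2norm S (f k) <= K) sequentially"
 shows "h \<in> L2 S" "l2norm S h <= K"
proof -
 have m: "h \<in> borel_measurable (lebesgue_on S)"
  using borel_measurable_AE_LIMSEQ[OF S _ ae] f by (simp add: L2_measurable)
 have K: "0 <= K"
  using bound l2norm_nonneg[of S] by (meson eventually_sequentially order_trans order_refl)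
 have nn: "(\<integral>\<^sup>+x. ennreal ((norm (f k x))\<^sup>2) \<partial>lebesgue_on S) = ennreal ((l2norm S (f k))\<^sup>2)" for k
  unfolding l2norm_power2_integral
  by (rule nn_integral_eq_integral) (auto intro: L2_integrable f)
 have "(\<integral>\<^sup>+x. ennreal ((norm (h x))\<^sup>2) \<partial>lebesgue_on S)
   = (\<integral>\<^sup>+x. liminf (\<lambda>k. ennreal ((norm (f k x))\<^sup>2)) \<partial>lebesgue_on S)"
 proof (rule nn_integral_cong_AE)
  show "AE x in lebesgue_on S. ennreal ((norm (h x))\<^sup>2) = liminf (\<lambda>k. ennreal ((norm (f k x))\<^sup>2))"
   using ae
  proof eventually_elim
   case (elim x)
   have "(\<lambda>k. ennreal ((norm (f k x))\<^sup>2)) \<longlonglongrightarrow> ennreal ((norm (h x))\<^sup>2)"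
    by (intro tendsto_intros tendsto_ennrealI elim)
   then show ?case by (intro lim_imp_Liminf[symmetric]) simp_all
  qed
 qed
 also have "... <= liminf (\<lambda>k. \<integral>\<^sup>+x. ennreal ((norm (f k x))\<^sup>2) \<partial>lebesgue_on S)"
  using borel_measurable_integrable[OF L2_integrable[OF f]] by (intro nn_integral_liminf) simp
 also have "... <= liminf (\<lambda>k. ennreal (K\<^sup>2))"
  unfolding nn using bound
  by (intro Liminf_mono) (auto elim!: eventually_mono intro!: ennreal_leI power_mono l2norm_nonneg)
 finally have *: "(\<integral>\<^sup>+x. ennreal ((norm (h x))\<^sup>2) \<partial>lebesgue_on S) <= ennreal (K\<^sup>2)"
  by (simp add: Liminf_const)
 then have int: "integrable (lebesgue_on S) (\<lambda>x. (norm (h x))\<^sup>2)"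
  using m by (intro integrableI_bounded) (auto intro: le_less_trans)
 with m show L2: "h \<in> L2 S" by (simp add: L2_def)
 have "(\<integral>\<^sup>+x. ennreal ((norm (h x))\<^sup>2) \<partial>lebesgue_on S) = ennreal ((l2norm S h)\<^sup>2)"
  unfolding l2norm_power2_integral by (rule nn_integral_eq_integral[OF int]) auto
 with * have "(l2norm S h)\<^sup>2 <= K\<^sup>2" by simp
 then show "l2norm S h <= K" using K by (rule power2_le_imp_le)
qed

lemma L2_AE_subsequence:
 fixes f :: "nat \<Rightarrow> 'a::euclidean_space \<Rightarrow> 'b::euclidean_space"
 assumes f: "!!k. f k \<in> L2 S" "h \<in> L2 S" and lim: "(\<lambda>k. l2norm S (\<lambda>x. f k x - h x)) \<longlonglongrightarrow> 0"
 obtains r where "strict_mono r" "AE x in lebesgue_on S. (\<lambda>k. f (r k) x) \<longlonglongrightarrow> h x"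
proof -
 have "(\<lambda>k. (l2norm S (\<lambda>x. f k x - h x))\<^sup>2) \<longlonglongrightarrow> 0\<^sup>2" by (intro tendsto_intros lim)
 then have "(\<lambda>k. \<integral>x. norm ((norm (f k x - h x))\<^sup>2) \<partial>lebesgue_on S) \<longlonglongrightarrow> 0"
  by (simp add: l2norm_power2_integral)
 moreover have "integrable (lebesgue_on S) (\<lambda>x. (norm (f k x - h x))\<^sup>2)" for k
  by (intro L2_integrable L2_diff f)
 ultimately obtain r where r: "strict_mono r"
   "AE x in lebesgue_on S. (\<lambda>k. (norm (f (r k) x - h x))\<^sup>2) \<longlonglongrightarrow> 0"
  using tendsto_L1_AE_subseq[of "lebesgue_on S" "\<lambda>k x. (norm (f k x - h x))\<^sup>2"] by blast
 have "AE x in lebesgue_on S. (\<lambda>k. f (r k) x) \<longlonglongrightarrow> h x"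
  using r(2)
 proof eventually_elim
  case (elim x)
  then have "(\<lambda>k. sqrt ((norm (f (r k) x - h x))\<^sup>2)) \<longlonglongrightarrow> sqrt 0" by (rule tendsto_real_sqrt)
  then have "(\<lambda>k. norm (f (r k) x - h x)) \<longlonglongrightarrow> 0" by simp
  then show ?case using LIM_zero_iff tendsto_norm_zero_iff by blast
 qed
 with r(1) show ?thesis by (rule that)
qed

text \<open>Along a subsequence the increments are at most \<open>2\<^sup>-\<^sup>k\<close> in norm, so
 \<open>\<Sum>k. 2\<^sup>k \<bar>f\<^sub>k\<^sub>+\<^sub>1(x) - f\<^sub>k(x)\<bar>\<^sup>2\<close> is integrable; hence the increments at almost every point decay
 geometrically, and the subsequence converges there.\<close>

theorem L2_complete:
 fixes f :: "nat \<Rightarrow> 'a::euclidean_space \<Rightarrow> 'b::euclidean_space"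
 assumes S: "S \<in> sets lebesgue" and f: "!!k. f k \<in> L2 S"
  and Cauchy: "!!e. 0 < e ==> \<exists>N. \<forall>i\<ge>N. \<forall>j\<ge>N. l2norm S (\<lambda>x. f i x - f j x) < e"
 obtains h where "h \<in> L2 S" "(\<lambda>k. l2norm S (\<lambda>x. f k x - h x)) \<longlonglongrightarrow> 0"
proof -
 have "\<exists>N. \<forall>k. N k < N (Suc k) \<and> (\<forall>i\<ge>N k. \<forall>j\<ge>N k. l2norm S (\<lambda>x. f i x - f j x) < (1/2) ^ k)"
 proof (rule dependent_nat_choice[where P = "\<lambda>k n. \<forall>i\<ge>n. \<forall>j\<ge>n. l2norm S (\<lambda>x. f i x - f j x) < (1/2) ^ k"
    and Q = "\<lambda>k n n'. n < n'", simplified conj_commute])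
  show "\<exists>x. \<forall>i\<ge>x. \<forall>j\<ge>x. l2norm S (\<lambda>x. f i x - f j x) < (1/2) ^ 0"
   using Cauchy[of 1] by simp
  fix n k
  obtain N where "\<forall>i\<ge>N. \<forall>j\<ge>N. l2norm S (\<lambda>x. f i x - f j x) < (1/2) ^ Suc k"
   using Cauchy[of "(1/2) ^ Suc k"] by auto
  then show "\<exists>y>n. \<forall>i\<ge>y. \<forall>j\<ge>y. l2norm S (\<lambda>x. f i x - f j x) < (1/2) ^ Suc k"
   by (intro exI[of _ "max N (Suc n)"]) auto
 qed
 then obtain r where mono: "!!k. r k < r (Suc k)"
  and r: "!!k i j. i \<ge> r k ==> j \<ge> r k ==> l2norm S (\<lambda>x. f i x - f j x) < (1/2) ^ k" by blast
 define d where "d k x = f (r (Suc k)) x - f (r k) x" for k x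
 have d: "d k \<in> L2 S" for k unfolding d_def by (intro L2_diff f)
 have dn: "(l2norm S (d k))\<^sup>2 <= (1/4) ^ k" for k
 proof -
  have "l2norm S (d k) <= (1/2) ^ k"
   using r[of k "r (Suc k)" "r k"] mono[of k] unfolding d_def by (simp add: less_imp_le)
  then have "(l2norm S (d k))\<^sup>2 <= ((1/2) ^ k)\<^sup>2" by (intro power_mono l2norm_nonneg)
  moreover have "((1/2) ^ k)\<^sup>2 = ((1/2)\<^sup>2 :: real) ^ k"
   by (simp only: power_mult [symmetric] mult.commute)
  ultimately show ?thesis by (simp add: power2_eq_square)
 qed
 have "(\<integral>\<^sup>+x. (\<Sum>k. ennreal (2 ^ k * (norm (d k x))\<^sup>2)) \<partial>lebesgue_on S)
   = (\<Sum>k. \<integral>\<^sup>+x. ennreal (2 ^ k * (norm (d k x))\<^sup>2) \<partial>lebesgue_on S)"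
  using borel_measurable_integrable[OF L2_integrable[OF d]] by (intro nn_integral_suminf) simp
 also have "... = (\<Sum>k. ennreal (2 ^ k * (l2norm S (d k))\<^sup>2))"
 proof (intro suminf_cong)
  fix k
  have "(\<integral>\<^sup>+x. ennreal (2 ^ k * (norm (d k x))\<^sup>2) \<partial>lebesgue_on S)
    = ennreal (\<integral>x. 2 ^ k * (norm (d k x))\<^sup>2 \<partial>lebesgue_on S)"
   by (rule nn_integral_eq_integral) (auto intro!: integrable_mult_right L2_integrable d)
  then show "(\<integral>\<^sup>+x. ennreal (2 ^ k * (norm (d k x))\<^sup>2) \<partial>lebesgue_on S)
    = ennreal (2 ^ k * (l2norm S (d k))\<^sup>2)"
   by (simp add: l2norm_power2_integral)
 qed
 also have "... <= (\<Sum>k. ennreal ((1/2) ^ k))"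
 proof (intro suminf_le ennreal_leI)
  fix k
  have "2 ^ k * (l2norm S (d k))\<^sup>2 <= 2 ^ k * (1/4) ^ k" by (intro mult_left_mono dn) simp
  also have "2 ^ k * (1/4 :: real) ^ k = (1/2) ^ k" by (simp flip: power_mult_distrib)
  finally show "2 ^ k * (l2norm S (d k))\<^sup>2 <= (1/2) ^ k" .
 qed auto
 also have "... = ennreal (\<Sum>k. (1/2) ^ k)"
  by (rule suminf_ennreal2) (auto intro: summable_geometric)
 finally have "(\<integral>\<^sup>+x. (\<Sum>k. ennreal (2 ^ k * (norm (d k x))\<^sup>2)) \<partial>lebesgue_on S) \<noteq> \<infinity>"
  by (auto simp: top_unique)
 then have "AE x in lebesgue_on S. (\<Sum>k. ennreal (2 ^ k * (norm (d k x))\<^sup>2)) \<noteq> \<infinity>"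
  using borel_measurable_integrable[OF L2_integrable[OF d]] by (intro nn_integral_PInf_AE) simp_all
 then have conv: "AE x in lebesgue_on S. convergent (\<lambda>k. f (r k) x)"
 proof eventually_elim
  case (elim x)
  then have "summable (\<lambda>k. 2 ^ k * (norm (d k x))\<^sup>2)"
   by (intro summable_suminf_not_top) auto
  then have "(\<lambda>k. 2 ^ k * (norm (d k x))\<^sup>2) \<longlonglongrightarrow> 0" by (rule summable_LIMSEQ_zero)
  then have "eventually (\<lambda>k. 2 ^ k * (norm (d k x))\<^sup>2 < 1) sequentially"
   by (rule order_tendstoD(2)) simp
  then have ev: "eventually (\<lambda>k. norm (norm (d k x)) <= (sqrt (1/2)) ^ k) sequentially"
  proof eventually_elim
   case (elim k)
   then have "(norm (d k x))\<^sup>2 <= (1/2) ^ k" by (simp add: field_simps power_one_over)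
   then have "sqrt ((norm (d k x))\<^sup>2) <= sqrt ((1/2) ^ k)" by (rule real_sqrt_le_mono)
   then show ?case by (simp add: real_sqrt_power)
  qed
  have "summable (\<lambda>k. (sqrt (1/2)) ^ k)" by (rule summable_geometric) (simp add: real_sqrt_divide)
  with ev have "summable (\<lambda>k. norm (d k x))" by (rule summable_comparison_test_ev)
  then have "summable (\<lambda>k. d k x)" by (rule summable_norm_cancel)
  then have "convergent (\<lambda>n. \<Sum>k<n. d k x)" by (simp add: summable_iff_convergent)
  then have "convergent (\<lambda>n. (\<Sum>k<n. d k x) + f (r 0) x)" by (intro convergent_add convergent_const)
  moreover have "(\<Sum>k<n. d k x) + f (r 0) x = f (r n) x" for n
   unfolding d_def using sum_lessThan_telescope[of "\<lambda>k. f (r k) x" n] by simp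
  ultimately show ?case by simp
 qed
 define h where "h x = lim (\<lambda>k. f (r k) x)" for x
 have lim: "AE x in lebesgue_on S. (\<lambda>k. f (r k) x) \<longlonglongrightarrow> h x"
  using conv by eventually_elim (simp add: h_def convergent_LIMSEQ_iff)
 have r_ge: "n <= r n" for n
  using mono by (intro seq_suble) (simp add: strict_mono_Suc_iff)
 have close: "h \<in> L2 S \<and> l2norm S (\<lambda>x. f i x - h x) <= (1/2) ^ n" if "i \<ge> r n" for i n
 proof -
  have ae: "AE x in lebesgue_on S. (\<lambda>k. f i x - f (r k) x) \<longlonglongrightarrow> f i x - h x"
   using lim by eventually_elim (intro tendsto_intros)
  have mono': "r n <= r k" if "n <= k" for k
   using that mono by (metis lift_Suc_mono_less order.order_iff_strict)
  have ev: "eventually (\<lambda>k. l2norm S (\<lambda>x. f i x - f (r k) x) <= (1/2) ^ n) sequentially"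
   using r[of n i "r _"] that mono' by (auto simp: eventually_sequentially intro!: exI[of _ n] less_imp_le)
  have F: "(\<lambda>x. f i x - h x) \<in> L2 S" "l2norm S (\<lambda>x. f i x - h x) <= (1/2) ^ n"
   using L2_Fatou[OF S _ ae ev] f by (auto intro: L2_diff)
  have "(\<lambda>x. f i x - (f i x - h x)) \<in> L2 S" by (intro L2_diff f F)
  with F show ?thesis by simp
 qed
 show ?thesis
 proof (rule that)
  show "h \<in> L2 S" using close by blast
  show "(\<lambda>k. l2norm S (\<lambda>x. f k x - h x)) \<longlonglongrightarrow> 0"
  proof (rule LIMSEQ_I)
   fix e :: real assume "0 < e"
   then obtain n where "(1/2::real) ^ n < e" using real_arch_pow_inv[of e "1/2"] by auto
   have "norm (l2norm S (\<lambda>x. f k x - h x) - 0) < e" if "r n <= k" for k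
    using close[OF that] l2norm_nonneg[of S "\<lambda>x. f k x - h x"] \<open>(1/2) ^ n < e\<close> by simp
   then show "\<exists>no. \<forall>k\<ge>no. norm (l2norm S (\<lambda>x. f k x - h x) - 0) < e" by blast
  qed
 qed
qed

section \<open>Smooth functions and bumps\<close>

lemma Ck_on_continuous: "Ck_on k UNIV f ==> continuous_on UNIV f"
 by (cases k) (auto intro!: differentiable_imp_continuous_on simp: differentiable_on_def differentiable_at_imp_differentiable_on)

lemma Ck_on_Suc_D: "Ck_on (Suc k) UNIV f ==> Ck_on k UNIV f"
proof (induction k arbitrary: f)
 case 0
 then show ?case using Ck_on_continuous by fastforce
next
 case (Suc k)
 then show ?case by (metis Ck_on.simps(2))
qed

lemma frechet_derivative_eqI: "(f has_derivative f') (at x) ==> frechet_derivative f (at x) = f'"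
 by (metis frechet_derivative_at)

lemma Ck_on_SucI:
 assumes "!!x. (f has_derivative f' x) (at x)" "!!b. b \<in> Basis ==> Ck_on k UNIV (\<lambda>x. f' x b)"
 shows "Ck_on (Suc k) UNIV f"
 using assms frechet_derivative_eqI[OF assms(1)] by (auto simp: differentiable_def)

lemma Ck_on_add: "Ck_on k UNIV f ==> Ck_on k UNIV h ==> Ck_on k UNIV (\<lambda>x. f x + h x)"
proof (induction k arbitrary: f h)
 case (Suc k)
 then have "(f has_derivative frechet_derivative f (at x)) (at x)"
  "(h has_derivative frechet_derivative h (at x)) (at x)" for x
  by (auto simp: frechet_derivative_works)
 from has_derivative_add[OF this] show ?case
  by (rule Ck_on_SucI) (use Suc in auto)
qed (auto intro: continuous_intros)

lemma Ck_on_mult: "Ck_on k UNIV f ==> Ck_on k UNIV h ==> Ck_on k UNIV (\<lambda>x. f x * h x)"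
proof (induction k arbitrary: f h)
 case (Suc k)
 then have "(f has_derivative frechet_derivative f (at x)) (at x)"
  "(h has_derivative frechet_derivative h (at x)) (at x)" for x
  by (auto simp: frechet_derivative_works)
 from has_derivative_mult[OF this] show ?case
 proof (rule Ck_on_SucI)
  fix b :: 'a assume b: "b \<in> Basis"
  have "Ck_on k UNIV f" "Ck_on k UNIV h" using Suc.prems by (blast dest: Ck_on_Suc_D)+
  then show "Ck_on k UNIV (\<lambda>x. f x * frechet_derivative h (at x) b + frechet_derivative f (at x) b * h x)"
   using Suc.prems b by (intro Ck_on_add Suc.IH) auto
 qed
qed (auto intro: continuous_intros)

lemma Ck_on_const: "Ck_on k UNIV (\<lambda>x. c)"
proof (induction k arbitrary: c)
 case (Suc k)
 show ?case by (rule Ck_on_SucI[where f' = "\<lambda>x y. 0"]) (use Suc in auto)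
qed simp

lemma Ck_on_prod:
 "finite I ==> (!!i. i \<in> I ==> Ck_on k UNIV (f i)) ==> Ck_on k UNIV (\<lambda>x. \<Prod>i\<in>I. f i x)"
 by (induction rule: finite_induct) (auto intro: Ck_on_mult Ck_on_const)

text \<open>A family of functions of one real variable closed under differentiation consists of smooth
 functions, and so do its compositions with affine functionals.\<close>

lemma Ck_on_affine:
 assumes closed: "!!h. h \<in> \<H> ==> \<exists>h'\<in>\<H>. \<forall>x. (h has_real_derivative h' x) (at x)"
 shows "h \<in> \<H> ==> Ck_on k UNIV (\<lambda>x. c * h (s * (x \<bullet> a) + t))"
proof (induction k arbitrary: h c)
 case 0
 obtain h' where "!!x. (h has_real_derivative h' x) (at x)" using closed[OF 0] by blast
 then have "continuous_on UNIV h"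
  by (meson DERIV_isCont continuous_at_imp_continuous_on)
 then have "continuous_on UNIV (\<lambda>x. h (s * (x \<bullet> a) + t))"
  by (rule continuous_on_compose2) (auto intro!: continuous_intros)
 then show ?case by (auto intro!: continuous_intros)
next
 case (Suc k)
 obtain h' where h': "h' \<in> \<H>" "!!x. (h has_real_derivative h' x) (at x)" using closed[OF Suc.prems] by blast
 have "((\<lambda>x. c * h (s * (x \<bullet> a) + t)) has_derivative
   (\<lambda>y. c * (h' (s * (x \<bullet> a) + t) * (s * (y \<bullet> a))))) (at x)" for x
  by (auto intro!: derivative_eq_intros
    has_derivative_compose[OF _ h'(2)[unfolded has_field_derivative_def], unfolded o_def])
 then show ?case
 proof (rule Ck_on_SucI)
  fix b
  have "(\<lambda>x. c * (h' (s * (x \<bullet> a) + t) * (s * (b \<bullet> a))))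
    = (\<lambda>x. (c * s * (b \<bullet> a)) * h' (s * (x \<bullet> a) + t))" by (simp add: mult_ac)
  with Suc.IH[OF h'(1)] show "Ck_on k UNIV (\<lambda>x. c * (h' (s * (x \<bullet> a) + t) * (s * (b \<bullet> a))))"
   by simp
 qed
qed

definition flat :: "real poly \<Rightarrow> real \<Rightarrow> real" where
 "flat P x = (if 0 < x then poly P (1 / x) * exp (- (1 / x)) else 0)"

lemma poly_times_exp_tendsto_0: "((\<lambda>z. poly P z * exp (- z)) \<longlongrightarrow> 0) at_top" for P :: "real poly"
proof -
 have "((\<lambda>z. \<Sum>i\<le>degree P. coeff P i * (z ^ i / exp z)) \<longlongrightarrow> (\<Sum>i\<le>degree P. coeff P i * 0)) at_top"
  by (intro tendsto_intros tendsto_power_div_exp_0)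
 then show ?thesis by (simp add: poly_altdef exp_minus sum_distrib_right divide_inverse mult.assoc)
qed

lemma flat_tendsto_0: "(flat P \<longlongrightarrow> 0) (at 0)"
proof (rule filterlim_split_at)
 have "((\<lambda>x. 0::real) \<longlongrightarrow> 0) (at_left 0)" by simp
 then show "(flat P \<longlongrightarrow> 0) (at_left 0)"
  by (rule Lim_transform_eventually) (auto simp: flat_def eventually_at_filter)
 have "((\<lambda>x. poly P (inverse x) * exp (- inverse x)) \<longlongrightarrow> 0) (at_right 0)"
  by (rule filterlim_compose[OF poly_times_exp_tendsto_0 filterlim_inverse_at_top_right])
 then show "(flat P \<longlongrightarrow> 0) (at_right 0)"
  by (rule Lim_transform_eventually) (auto simp: flat_def eventually_at_filter divide_inverse)
qed

lemma flat_has_derivative: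
 "(flat P has_real_derivative flat ([:0, 0, 1:] * (P - pderiv P)) x) (at x)"
proof (cases x "0 :: real" rule: linorder_cases)
 case less
 have "((\<lambda>x. 0) has_real_derivative 0) (at x)" by simp
 then have "(flat P has_real_derivative 0) (at x)"
  by (rule DERIV_cong_ev[OF refl _ refl, THEN iffD1, rotated])
   (use less in \<open>auto simp: flat_def eventually_nhds intro!: exI[of _ "{..<0}"]\<close>)
 with less show ?thesis by (simp add: flat_def)
next
 case equal
 have "flat P (0 + y) - flat P 0 = y * flat (pCons 0 P) y" for y by (simp add: flat_def)
 then have "(\<lambda>y. (flat P (0 + y) - flat P 0) / y) \<midarrow>0\<rightarrow> 0"
  using flat_tendsto_0[of "pCons 0 P"]
  by (auto intro!: Lim_transform_eventually[OF flat_tendsto_0[of "pCons 0 P"]] simp: eventually_at_filter)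
 then show ?thesis using equal by (simp add: DERIV_def flat_def)
next
 case greater
 have "((\<lambda>x. poly P (1 / x) * exp (- (1 / x))) has_real_derivative
   (poly (pderiv P) (1 / x) * (- 1 / x\<^sup>2) * exp (- (1 / x))
    + exp (- (1 / x)) * (1 / x\<^sup>2) * poly P (1 / x))) (at x)"
  using greater by (auto intro!: derivative_eq_intros simp: power2_eq_square divide_inverse)
 then have "(flat P has_real_derivative
   (poly (pderiv P) (1 / x) * (- 1 / x\<^sup>2) * exp (- (1 / x))
    + exp (- (1 / x)) * (1 / x\<^sup>2) * poly P (1 / x))) (at x)"
  by (rule DERIV_cong_ev[OF refl _ refl, THEN iffD1, rotated])
   (use greater in \<open>auto simp: flat_def eventually_nhds intro!: exI[of _ "{0<..}"]\<close>)
 then show ?thesis using greater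
  by (simp add: flat_def power2_eq_square algebra_simps)
qed

lemma flat_1_bounds: "0 <= flat 1 x" "flat 1 x <= 1" "x <= 0 ==> flat 1 x = 0" "0 < x ==> 0 < flat 1 x"
 by (auto simp: flat_def)

text \<open>The factors \<open>exp (-1 / (k (x - a) - 1))\<close> vanish for \<open>x - a <= 1/k\<close> and tend to \<open>1\<close> for \<open>x > a\<close>:
 their products are test functions supported in the open box, increasing to its indicator.\<close>

definition box_bump :: "nat \<Rightarrow> 'a \<Rightarrow> 'a \<Rightarrow> 'a::euclidean_space \<Rightarrow> real" where
 "box_bump k a b x = (\<Prod>i\<in>Basis. flat 1 (real k * (x \<bullet> i - a \<bullet> i) - 1) * flat 1 (real k * (b \<bullet> i - x \<bullet> i) - 1))"

lemma box_bump_smooth: "smooth_on UNIV (box_bump k a b)"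
proof -
 have flat: "Ck_on j UNIV (\<lambda>x. 1 * flat 1 (s * (x \<bullet> i) + t))" for j s t and i :: 'a
 proof (rule Ck_on_affine[where \<H> = "range flat"])
  fix h :: "real \<Rightarrow> real" assume "h \<in> range flat"
  then show "\<exists>h'\<in>range flat. \<forall>x. (h has_real_derivative h' x) (at x)"
   using flat_has_derivative by blast
 qed simp
 have "Ck_on j UNIV (\<lambda>x. \<Prod>i\<in>Basis. flat 1 (real k * (x \<bullet> i) + (- real k * (a \<bullet> i) - 1))
   * flat 1 (- real k * (x \<bullet> i) + (real k * (b \<bullet> i) - 1)))" for j
  by (intro Ck_on_prod Ck_on_mult finite_Basis flat[unfolded mult_1])
 moreover have "(\<lambda>x. \<Prod>i\<in>Basis. flat 1 (real k * (x \<bullet> i) + (- real k * (a \<bullet> i) - 1))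
   * flat 1 (- real k * (x \<bullet> i) + (real k * (b \<bullet> i) - 1))) = box_bump k a b"
  by (rule ext) (simp add: box_bump_def algebra_simps)
 ultimately show ?thesis by (simp add: smooth_on_def)
qed

lemma box_bump_bounds: "0 <= box_bump k a b x" "box_bump k a b x <= 1"
 unfolding box_bump_def
 by (auto intro!: prod_nonneg prod_le_1 mult_nonneg_nonneg mult_le_one flat_1_bounds)

lemma box_bump_nonzero:
 assumes "box_bump k a b x \<noteq> 0" "i \<in> Basis"
 shows "1 < real k * (x \<bullet> i - a \<bullet> i)" "1 < real k * (b \<bullet> i - x \<bullet> i)"
proof -
 have "flat 1 (real k * (x \<bullet> i - a \<bullet> i) - 1) \<noteq> 0" "flat 1 (real k * (b \<bullet> i - x \<bullet> i) - 1) \<noteq> 0"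
  using assms unfolding box_bump_def by auto
 then show "1 < real k * (x \<bullet> i - a \<bullet> i)" "1 < real k * (b \<bullet> i - x \<bullet> i)"
  using flat_1_bounds(3) by (smt (verit))+
qed

lemma box_bump_test:
 assumes "box a b \<subseteq> U"
 shows "box_bump k a b \<in> test_functions U"
proof -
 define K where "K = cbox (a + (1 / real k) *\<^sub>R One) (b - (1 / real k) *\<^sub>R One)"
 have zero: "box_bump k a b x = 0" if "x \<notin> K \<or> k = 0" for x
 proof (rule ccontr)
  assume *: "box_bump k a b x \<noteq> 0"
  note n = box_bump_nonzero[OF *]
  have k: "0 < k"
  proof (rule ccontr)
   assume "\<not> 0 < k"
   then show False using n(1)[OF SOME_Basis] by simp
  qed
  have "x \<in> K"
   unfolding K_def mem_box using n k
   by (auto simp: inner_add_left inner_diff_left field_simps intro!: less_imp_le)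
  with that k show False by simp
 qed
 show ?thesis
 proof (cases "k = 0")
  case True
  with zero show ?thesis
   unfolding test_functions_def using box_bump_smooth by (auto intro!: exI[of _ "{}"])
 next
  case False
  have "K \<subseteq> box a b"
  proof
   fix x assume "x \<in> K"
   then have "a \<bullet> i + 1 / real k <= x \<bullet> i" "x \<bullet> i <= b \<bullet> i - 1 / real k" if "i \<in> Basis" for i
    using that by (auto simp: K_def mem_box inner_add_left inner_diff_left)
   moreover have "0 < 1 / real k" using False by simp
   ultimately show "x \<in> box a b" unfolding mem_box by (smt (verit))
  qed
  moreover have "compact K" by (simp add: K_def)
  ultimately show ?thesis
   unfolding test_functions_def using box_bump_smooth zero assms by (auto intro!: exI[of _ K])
 qed
qed

lemma flat_1_tendsto_1:
 assumes "0 < c"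
 shows "(\<lambda>k. flat 1 (real k * c - 1)) \<longlonglongrightarrow> 1"
proof -
 have lim: "filterlim (\<lambda>k. real k * c - 1) at_top sequentially"
  using assms by (intro filterlim_tendsto_add_at_top[of "\<lambda>_. -1", simplified add.commute, simplified]
    filterlim_at_top_mult_tendsto_pos[OF tendsto_const] filterlim_real_sequentially) auto
 then have "(\<lambda>k. exp (- inverse (real k * c - 1))) \<longlonglongrightarrow> exp (- 0)"
  by (intro tendsto_intros tendsto_inverse_0_at_top)
 then have "(\<lambda>k. exp (- inverse (real k * c - 1))) \<longlonglongrightarrow> 1" by simp
 then show ?thesis
 proof (rule Lim_transform_eventually)
  have "eventually (\<lambda>k. 0 < real k * c - 1) sequentially"
   using lim unfolding filterlim_at_top_dense by blast
  then show "eventually (\<lambda>k. exp (- inverse (real k * c - 1)) = flat 1 (real k * c - 1)) sequentially"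
   by eventually_elim (simp add: flat_def divide_inverse)
 qed
qed

lemma box_bump_tendsto: "(\<lambda>k. box_bump k a b x) \<longlonglongrightarrow> indicator (box a b) x"
proof (cases "x \<in> box a b")
 case True
 then have "(\<lambda>k. box_bump k a b x) \<longlonglongrightarrow> (\<Prod>i\<in>(Basis :: 'a set). 1 * 1)"
  unfolding box_bump_def mem_box by (intro tendsto_intros flat_1_tendsto_1) auto
 with True show ?thesis by simp
next
 case False
 have "box_bump k a b x = 0" for k
 proof (rule ccontr)
  assume "box_bump k a b x \<noteq> 0"
  note n = box_bump_nonzero[OF this]
  have "a \<bullet> i < x \<bullet> i \<and> x \<bullet> i < b \<bullet> i" if "i \<in> Basis" for i
  proof -
   have "0 < real k * (x \<bullet> i - a \<bullet> i)" "0 < real k * (b \<bullet> i - x \<bullet> i)" using n[OF that] by auto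
   then show ?thesis by (auto simp: zero_less_mult_iff)
  qed
  with False show False by (simp add: mem_box)
 qed
 with False show ?thesis by simp
qed

section \<open>Test functions\<close>

lemma test_smooth: "\<phi> \<in> test_functions U ==> Ck_on k UNIV \<phi>"
 by (simp add: test_functions_def smooth_on_def)

lemma test_continuous: "\<phi> \<in> test_functions U ==> continuous_on UNIV \<phi>"
 using test_smooth[of \<phi> U 0] by simp

lemma test_has_derivative:
 "\<phi> \<in> test_functions U ==> (\<phi> has_derivative frechet_derivative \<phi> (at x)) (at x)"
 using test_smooth[of \<phi> U "Suc 0"] by (simp add: frechet_derivative_works)

lemma test_support:
 assumes "\<phi> \<in> test_functions U"
 obtains K where "compact K" "K \<subseteq> U" "!!x. x \<notin> K ==> \<phi> x = 0"
 using assms by (auto simp: test_functions_def)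

lemma test_partial:
 assumes "\<phi> \<in> test_functions U" "b \<in> Basis"
 shows "(\<lambda>x. frechet_derivative \<phi> (at x) b) \<in> test_functions U"
proof -
 obtain K where K: "compact K" "K \<subseteq> U" "!!x. x \<notin> K ==> \<phi> x = 0" using test_support[OF assms(1)] by metis
 have "frechet_derivative \<phi> (at x) b = 0" if "x \<notin> K" for x
 proof -
  have "open (- K)" using K(1) by (simp add: open_Compl compact_imp_closed)
  then have "(\<phi> has_derivative (\<lambda>x. 0)) (at x)"
   using that K(3) by (intro has_derivative_transform_within_open[OF has_derivative_const]) auto
  then show ?thesis by (simp add: frechet_derivative_eqI)
 qed
 moreover have "Ck_on k UNIV (\<lambda>x. frechet_derivative \<phi> (at x) b)" for k
  using test_smooth[OF assms(1), of "Suc k"] assms(2) by simp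
 ultimately show ?thesis using K by (auto simp: test_functions_def smooth_on_def)
qed

lemma test_add:
 assumes "\<phi> \<in> test_functions U" "\<psi> \<in> test_functions U"
 shows "(\<lambda>x. \<phi> x + \<psi> x) \<in> test_functions U"
proof -
 obtain K where K: "compact K" "K \<subseteq> U" "!!x. x \<notin> K ==> \<phi> x = 0" using test_support[OF assms(1)] by metis
 obtain L where L: "compact L" "L \<subseteq> U" "!!x. x \<notin> L ==> \<psi> x = 0" using test_support[OF assms(2)] by metis
 have "compact (K \<union> L)" "K \<union> L \<subseteq> U" "!!x. x \<notin> K \<union> L ==> \<phi> x + \<psi> x = 0"
  using K L by (auto intro: compact_Un)
 then show ?thesis
  using assms test_smooth by (auto simp: test_functions_def smooth_on_def intro!: Ck_on_add)
qed

lemma test_mult: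
 assumes "\<phi> \<in> test_functions U" "smooth_on UNIV \<psi>"
 shows "(\<lambda>x. \<psi> x * \<phi> x) \<in> test_functions U"
 using assms by (auto simp: test_functions_def smooth_on_def intro!: Ck_on_mult)

lemma test_scale: "\<phi> \<in> test_functions U ==> (\<lambda>x. c * \<phi> x) \<in> test_functions U"
 by (rule test_mult) (auto simp: smooth_on_def Ck_on_const)

lemma test_zero: "(\<lambda>x. 0) \<in> test_functions U"
 by (auto simp: test_functions_def smooth_on_def Ck_on_const intro!: exI[of _ "{}"])

lemma test_bounded:
 assumes "\<phi> \<in> test_functions U"
 obtains B where "0 <= B" "!!x. \<bar>\<phi> x\<bar> <= B"
proof -
 obtain K where K: "compact K" "!!x. x \<notin> K ==> \<phi> x = 0" using test_support[OF assms] by metis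
 have "bounded (\<phi> ` K)"
  using K(1) test_continuous[OF assms]
  by (intro compact_imp_bounded compact_continuous_image) (auto intro: continuous_on_subset)
 then obtain B where "!!x. x \<in> K ==> \<bar>\<phi> x\<bar> <= B" unfolding bounded_iff by auto
 then have "\<bar>\<phi> x\<bar> <= \<bar>B\<bar>" for x using K(2)[of x] by (cases "x \<in> K") force+
 then show ?thesis using that[of "\<bar>B\<bar>"] by simp
qed

lemma continuous_compact_support_integrable:
 fixes f :: "'a::euclidean_space \<Rightarrow> 'b::euclidean_space"
 assumes "continuous_on UNIV f" "compact K" "!!x. x \<notin> K ==> f x = 0" and S: "S \<in> sets lebesgue"
 shows "integrable (lebesgue_on S) f"
proof -
 have "integrable lborel (\<lambda>x. indicator K x *\<^sub>R f x)"
  using assms by (intro borel_integrable_compact) (auto intro: continuous_on_subset)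
 moreover have "(\<lambda>x. indicator K x *\<^sub>R f x) = f" using assms(3) by (auto simp: indicator_def)
 ultimately have "integrable lebesgue f"
  using assms(1) by (simp add: integrable_completion borel_measurable_continuous_onI)
 then show ?thesis
  using S integrable_mult_indicator[of S lebesgue f] by (simp add: integrable_restrict_space)
qed

definition gradient :: "('a::euclidean_space \<Rightarrow> real) \<Rightarrow> 'a \<Rightarrow> 'a" where
 "gradient \<phi> x = (\<Sum>b\<in>Basis. frechet_derivative \<phi> (at x) b *\<^sub>R b)"

lemma gradient_inner_Basis: "b \<in> Basis ==> gradient \<phi> x \<bullet> b = frechet_derivative \<phi> (at x) b"
 by (simp add: gradient_def inner_sum_left inner_Basis if_distrib sum.delta cong: if_cong)

lemma gradient_inner:
 assumes "\<phi> \<in> test_functions U"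
 shows "frechet_derivative \<phi> (at x) h = gradient \<phi> x \<bullet> h"
proof -
 interpret bounded_linear "frechet_derivative \<phi> (at x)"
  using test_has_derivative[OF assms] by (rule has_derivative_bounded_linear)
 have "frechet_derivative \<phi> (at x) h = frechet_derivative \<phi> (at x) (\<Sum>b\<in>Basis. (h \<bullet> b) *\<^sub>R b)"
  by (simp add: euclidean_representation)
 also have "... = gradient \<phi> x \<bullet> h"
  by (simp add: sum scaleR gradient_def inner_sum_left) (simp add: inner_commute mult.commute)
 finally show ?thesis .
qed

lemma gradient_continuous: "\<phi> \<in> test_functions U ==> continuous_on UNIV (gradient \<phi>)"
 unfolding gradient_def by (intro continuous_intros test_continuous test_partial)

lemma gradient_support:
 assumes "\<phi> \<in> test_functions U"
 obtains K where "compact K" "K \<subseteq> U" "!!x. x \<notin> K ==> \<phi> x = 0" "!!x. x \<notin> K ==> gradient \<phi> x = 0"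
proof -
 obtain K0 where K0: "compact K0" "K0 \<subseteq> U" "!!x. x \<notin> K0 ==> \<phi> x = 0" using test_support[OF assms] by metis
 have "\<exists>L. compact L \<and> L \<subseteq> U \<and> (\<forall>x. x \<notin> L --> frechet_derivative \<phi> (at x) b = 0)"
  if "b \<in> Basis" for b
  using test_support[OF test_partial[OF assms that]] by metis
 then obtain L where L: "!!b. b \<in> Basis ==> compact (L b) \<and> L b \<subseteq> U
   \<and> (\<forall>x. x \<notin> L b --> frechet_derivative \<phi> (at x) b = 0)" by metis
 have "compact (K0 \<union> (\<Union>b\<in>Basis. L b))" using K0 L by (intro compact_Un compact_UN) auto
 moreover have "K0 \<union> (\<Union>b\<in>Basis. L b) \<subseteq> U" using K0 L by blast
 moreover have "gradient \<phi> x = 0" if "x \<notin> K0 \<union> (\<Union>b\<in>Basis. L b)" for x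
  unfolding gradient_def using L that by (intro sum.neutral) auto
 ultimately show ?thesis using that K0 by blast
qed

lemma gradient_bounded:
 assumes "\<phi> \<in> test_functions U"
 obtains B where "0 <= B" "!!x. norm (gradient \<phi> x) <= B"
proof -
 obtain K where K: "compact K" "!!x. x \<notin> K ==> gradient \<phi> x = 0" using gradient_support[OF assms] by metis
 have "bounded (gradient \<phi> ` K)"
  using K(1) gradient_continuous[OF assms]
  by (intro compact_imp_bounded compact_continuous_image) (auto intro: continuous_on_subset)
 then obtain B where "!!x. x \<in> K ==> norm (gradient \<phi> x) <= B" unfolding bounded_iff by auto
 then have "norm (gradient \<phi> x) <= \<bar>B\<bar>" for x using K(2)[of x] by (cases "x \<in> K") force+
 then show ?thesis using that[of "\<bar>B\<bar>"] by simp
qed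

lemma test_L2: "\<phi> \<in> test_functions U ==> S \<in> sets lebesgue ==> \<phi> \<in> L2 S"
proof -
 assume *: "\<phi> \<in> test_functions U" "S \<in> sets lebesgue"
 obtain K where K: "compact K" "!!x. x \<notin> K ==> \<phi> x = 0" using test_support[OF *(1)] by metis
 have "integrable (lebesgue_on S) \<phi>" "integrable (lebesgue_on S) (\<lambda>x. (norm (\<phi> x))\<^sup>2)"
  using K * test_continuous[OF *(1)]
  by (auto intro!: continuous_compact_support_integrable[of _ K] continuous_intros)
 then show ?thesis by (simp add: L2_def borel_measurable_integrable)
qed

lemma gradient_L2: "\<phi> \<in> test_functions U ==> S \<in> sets lebesgue ==> gradient \<phi> \<in> L2 S"
proof -
 assume *: "\<phi> \<in> test_functions U" "S \<in> sets lebesgue"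
 obtain K where K: "compact K" "!!x. x \<notin> K ==> gradient \<phi> x = 0" using gradient_support[OF *(1)] by metis
 have "integrable (lebesgue_on S) (gradient \<phi>)" "integrable (lebesgue_on S) (\<lambda>x. (norm (gradient \<phi> x))\<^sup>2)"
  using K * gradient_continuous[OF *(1)]
  by (auto intro!: continuous_compact_support_integrable[of _ K] continuous_intros)
 then show ?thesis by (simp add: L2_def borel_measurable_integrable)
qed

lemma test_Lipschitz:
 assumes "\<phi> \<in> test_functions U" "!!x. norm (gradient \<phi> x) <= B"
 shows "\<bar>\<phi> x - \<phi> y\<bar> <= B * norm (x - y)"
proof -
 have "norm (\<phi> x - \<phi> y) <= B * norm (x - y)"
 proof (rule differentiable_bound[where S = UNIV and f' = "\<lambda>x. frechet_derivative \<phi> (at x)"])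
  show "(\<phi> has_derivative frechet_derivative \<phi> (at z)) (at z within UNIV)" for z
   using test_has_derivative[OF assms(1)] by simp
  show "onorm (frechet_derivative \<phi> (at z)) <= B" for z
  proof (rule onorm_le)
   fix h
   show "norm (frechet_derivative \<phi> (at z) h) <= B * norm h"
    using Cauchy_Schwarz_ineq2[of "gradient \<phi> z" h] mult_right_mono[OF assms(2)[of z], of "norm h"]
    by (simp add: gradient_inner[OF assms(1)])
  qed
 qed auto
 then show ?thesis by simp
qed

section \<open>Translations and integration by parts\<close>

lemma integral_lebesgue_eq_lborel:
 fixes f :: "'a::euclidean_space \<Rightarrow> real"
 assumes "f \<in> borel_measurable borel"
 shows "(\<integral>x. f x \<partial>lebesgue_on UNIV) = (\<integral>x. f x \<partial>lborel)"
 using assms by (simp add: lebesgue_on_UNIV_eq integral_completion)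

lemma integral_lborel_translate:
 fixes f :: "'a::euclidean_space \<Rightarrow> real"
 assumes "f \<in> borel_measurable borel"
 shows "(\<integral>x. f (x + h) \<partial>lborel) = (\<integral>x. f x \<partial>lborel)"
proof -
 have "(\<integral>x. f x \<partial>lborel) = (\<integral>x. f x \<partial>distr lborel borel ((+) h))"
  by (simp add: lborel_distr_plus)
 also have "... = (\<integral>x. f (h + x) \<partial>lborel)"
  using assms by (intro integral_distr) auto
 finally show ?thesis by (simp add: add.commute)
qed

lemma l2norm_translate:
 fixes f :: "'a::euclidean_space \<Rightarrow> real"
 assumes "continuous_on UNIV f"
 shows "l2norm UNIV (\<lambda>x. f (x + h)) = l2norm UNIV f"
proof -
 have f: "f \<in> borel_measurable borel" using assms by (rule borel_measurable_continuous_onI)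
 have c: "continuous_on UNIV (\<lambda>x. f (x + h))"
  by (rule continuous_on_compose2[OF assms]) (auto intro!: continuous_intros)
 then have fh: "(\<lambda>x. f (x + h)) \<in> borel_measurable borel" by (rule borel_measurable_continuous_onI)
 show ?thesis
  using integral_lborel_translate[of "\<lambda>x. f x * f x" h] f fh
  by (simp add: l2norm_def l2inner_def integral_lebesgue_eq_lborel)
qed

lemma integral_zero_extension:
 fixes f :: "'a::euclidean_space \<Rightarrow> real"
 assumes "S \<in> sets lebesgue" "!!x. x \<notin> S ==> f x = 0"
 shows "(\<integral>x. f x \<partial>lebesgue_on S) = (\<integral>x. f x \<partial>lebesgue_on UNIV)"
proof -
 have "(\<lambda>x. indicator S x *\<^sub>R f x) = f" using assms(2) by (auto simp: indicator_def fun_eq_iff)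
 then show ?thesis using assms(1) by (simp add: integral_restrict_space lebesgue_on_UNIV_eq)
qed

lemma l2norm_zero_extension:
 fixes f :: "'a::euclidean_space \<Rightarrow> 'b::euclidean_space"
 assumes "S \<in> sets lebesgue" "!!x. x \<notin> S ==> f x = 0"
 shows "l2norm S f = l2norm UNIV f"
 unfolding l2norm_def l2inner_def using assms by (subst integral_zero_extension) auto

lemma test_line_derivative:
 assumes "\<phi> \<in> test_functions U"
 shows "(\<lambda>n. real (Suc n) * (\<phi> (x + (1 / real (Suc n)) *\<^sub>R h) - \<phi> x)) \<longlonglongrightarrow> gradient \<phi> x \<bullet> h"
proof -
 have "((\<lambda>t. \<phi> (x + t *\<^sub>R h)) has_derivative (\<lambda>t. frechet_derivative \<phi> (at x) (t *\<^sub>R h))) (at 0)"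
  using test_has_derivative[OF assms, of x]
  by (intro has_derivative_compose[of "\<lambda>t. x + t *\<^sub>R h" "\<lambda>t. t *\<^sub>R h" 0 UNIV \<phi>]) (auto intro!: derivative_eq_intros)
 then have "((\<lambda>t. \<phi> (x + t *\<^sub>R h)) has_real_derivative (gradient \<phi> x \<bullet> h)) (at 0)"
  unfolding has_field_derivative_def
  by (simp add: gradient_inner[OF assms] mult.commute[of _ "gradient \<phi> x \<bullet> h"])
 then have lim: "(\<lambda>t. (\<phi> (x + t *\<^sub>R h) - \<phi> x) / t) \<midarrow>0\<rightarrow> gradient \<phi> x \<bullet> h"
  by (simp add: DERIV_def)
 have "filterlim (\<lambda>n. 1 / real (Suc n)) (at 0) sequentially"
  unfolding filterlim_at using LIMSEQ_inverse_real_of_nat by (auto simp: divide_inverse)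
 from filterlim_compose[OF lim this] show ?thesis by (simp add: mult.commute)
qed

text \<open>The difference quotients are dominated by a bounded function with compact support.\<close>

lemma test_difference_quotient_bound:
 assumes "\<phi> \<in> test_functions U"
 obtains B K where "0 <= B" "compact K"
  "!!n x. \<bar>real (Suc n) * (\<phi> (x + (1 / real (Suc n)) *\<^sub>R h) - \<phi> x)\<bar> <= indicator K x * B"
proof -
 obtain B where B: "0 <= B" "!!x. norm (gradient \<phi> x) <= B" using gradient_bounded[OF assms] by metis
 obtain K where K: "compact K" "!!x. x \<notin> K ==> \<phi> x = 0" using test_support[OF assms] by metis
 define L where "L = {x + y |x y. x \<in> K \<and> y \<in> cball 0 (norm h)}"
 have "\<bar>real (Suc n) * (\<phi> (x + (1 / real (Suc n)) *\<^sub>R h) - \<phi> x)\<bar> <= indicator L x * (B * norm h)" for n x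
 proof (cases "x \<in> L")
  case True
  have "\<bar>\<phi> (x + (1 / real (Suc n)) *\<^sub>R h) - \<phi> x\<bar> <= B * norm ((1 / real (Suc n)) *\<^sub>R h)"
   using test_Lipschitz[OF assms B(2), of "x + (1 / real (Suc n)) *\<^sub>R h" x] by simp
  then have "\<bar>\<phi> (x + (1 / real (Suc n)) *\<^sub>R h) - \<phi> x\<bar> <= B * norm h / real (Suc n)" by simp
  then have "real (Suc n) * \<bar>\<phi> (x + (1 / real (Suc n)) *\<^sub>R h) - \<phi> x\<bar> <= B * norm h"
   by (simp only: pos_le_divide_eq of_nat_0_less_iff zero_less_Suc mult.commute)
  with True show ?thesis by (simp add: abs_mult)
 next
  case False
  have "x \<notin> K"
  proof
   assume "x \<in> K"
   then have "\<exists>a b. x = a + b \<and> a \<in> K \<and> b \<in> cball 0 (norm h)" by (intro exI[of _ x] exI[of _ 0]) simp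
   then have "x \<in> L" unfolding L_def by blast
   with False show False ..
  qed
  moreover have "x + (1 / real (Suc n)) *\<^sub>R h \<notin> K"
  proof
   assume *: "x + (1 / real (Suc n)) *\<^sub>R h \<in> K"
   have "norm h / real (Suc n) <= norm h" by (simp add: divide_le_eq mult_le_cancel_left1)
   then have "- ((1 / real (Suc n)) *\<^sub>R h) \<in> cball 0 (norm h)" by simp
   with * have "\<exists>a b. x = a + b \<and> a \<in> K \<and> b \<in> cball 0 (norm h)"
    by (intro exI[of _ "x + (1 / real (Suc n)) *\<^sub>R h"] exI[of _ "- ((1 / real (Suc n)) *\<^sub>R h)"]) simp
   then have "x \<in> L" unfolding L_def by blast
   with False show False ..
  qed
  ultimately show ?thesis using K(2) False by simp
 qed
 moreover have "compact L" unfolding L_def by (intro compact_sums K compact_cball)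
 moreover have "0 <= B * norm h" using B(1) by simp
 ultimately show ?thesis using that by blast
qed

lemma continuous_translate: "continuous_on UNIV f ==> continuous_on UNIV (\<lambda>x. f (x + h))"
 for f :: "'a::euclidean_space \<Rightarrow> 'b::topological_space"
 by (rule continuous_on_compose2) (auto intro!: continuous_intros)

lemma test_translate_L2:
 assumes "\<phi> \<in> test_functions U"
 shows "(\<lambda>x. \<phi> (x + y)) \<in> L2 UNIV"
proof -
 obtain C where C: "compact C" "!!x. x \<notin> C ==> \<phi> x = 0" using test_support[OF assms] by metis
 have "\<phi> (x + y) = 0" if "x \<notin> (\<lambda>x. x - y) ` C" for x
  using C(2)[of "x + y"] that by (force simp: image_iff)
 moreover have "compact ((\<lambda>x. x - y) ` C)"
  using C(1) by (intro compact_continuous_image continuous_intros)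
 ultimately have "integrable (lebesgue_on UNIV) (\<lambda>x. \<phi> (x + y))"
  "integrable (lebesgue_on UNIV) (\<lambda>x. (norm (\<phi> (x + y)))\<^sup>2)"
  using continuous_translate[OF test_continuous[OF assms]]
  by (auto intro!: continuous_compact_support_integrable[of _ "(\<lambda>x. x - y) ` C"] continuous_intros)
 then show ?thesis unfolding L2_def using borel_measurable_integrable by blast
qed

text \<open>The difference quotients have integral \<open>0\<close>, by translation invariance.\<close>

lemma integral_directional_derivative_zero:
 assumes "\<phi> \<in> test_functions U"
 shows "(\<integral>x. gradient \<phi> x \<bullet> h \<partial>lborel) = 0"
proof -
 define q where "q n x = real (Suc n) * (\<phi> (x + (1 / real (Suc n)) *\<^sub>R h) - \<phi> x)" for n x
 obtain B K where BK: "0 <= B" "compact K" "!!n x. \<bar>q n x\<bar> <= indicator K x * B"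
  unfolding q_def using test_difference_quotient_bound[OF assms] by metis
 have c: "continuous_on UNIV \<phi>" by (rule test_continuous[OF assms])
 obtain C where C: "compact C" "!!x. x \<notin> C ==> \<phi> x = 0" using test_support[OF assms] by metis
 have "integrable lebesgue \<phi>"
  using continuous_compact_support_integrable[OF c C, of UNIV] by (simp add: lebesgue_on_UNIV_eq)
 then have i: "integrable lborel \<phi>"
  using c by (simp add: integrable_completion borel_measurable_continuous_onI)
 have ih: "integrable lborel (\<lambda>x. \<phi> (x + y))" for y
 proof -
  have "integrable (distr lborel borel ((+) y)) \<phi>" using i by (simp add: lborel_distr_plus)
  then have "integrable lborel (\<lambda>x. \<phi> (y + x))" by (rule integrable_distr[rotated]) simp
  then show ?thesis by (simp add: add.commute)
 qed
 have "(\<lambda>n. \<integral>x. q n x \<partial>lborel) \<longlonglongrightarrow> (\<integral>x. gradient \<phi> x \<bullet> h \<partial>lborel)"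
 proof (rule integral_dominated_convergence[where w = "\<lambda>x. indicator K x * B"])
  show "(\<lambda>x. gradient \<phi> x \<bullet> h) \<in> borel_measurable lborel"
   using gradient_continuous[OF assms] by (auto intro!: borel_measurable_continuous_onI continuous_intros)
  show "q n \<in> borel_measurable lborel" for n
   unfolding q_def using c continuous_translate[OF c]
   by (auto intro!: borel_measurable_continuous_onI continuous_intros)
  show "integrable lborel (\<lambda>x. indicator K x * B)"
   using BK(2) emeasure_compact_finite[of K] borel_compact[of K]
   by (intro integrable_mult_left integrable_real_indicator) auto
  show "AE x in lborel. (\<lambda>n. q n x) \<longlonglongrightarrow> gradient \<phi> x \<bullet> h"
   unfolding q_def using test_line_derivative[OF assms] by simp
  show "AE x in lborel. norm (q n x) <= indicator K x * B" for n using BK(3) by simp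
 qed
 moreover have "(\<integral>x. q n x \<partial>lborel) = 0" for n
  unfolding q_def using i ih integral_lborel_translate[of \<phi>] c
  by (simp add: borel_measurable_continuous_onI)
 ultimately show ?thesis by (simp add: LIMSEQ_const_iff)
qed

text \<open>A shift by \<open>h\<close> is composed of \<open>n\<close> shifts by \<open>h/n\<close>, each of which costs about \<open>1/n\<close> of the norm
 of the directional derivative.\<close>

theorem l2norm_shift_le:
 assumes "\<phi> \<in> test_functions U"
 shows "l2norm UNIV (\<lambda>x. \<phi> (x + h) - \<phi> x) <= norm h * l2norm UNIV (gradient \<phi>)"
proof -
 define q where "q n x = real (Suc n) * (\<phi> (x + (1 / real (Suc n)) *\<^sub>R h) - \<phi> x)" for n x
 obtain B K where BK: "0 <= B" "compact K" "!!n x. \<bar>q n x\<bar> <= indicator K x * B"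
  unfolding q_def using test_difference_quotient_bound[OF assms] by metis
 have c: "continuous_on UNIV \<phi>" by (rule test_continuous[OF assms])
 have sets: "UNIV \<in> sets lebesgue" by simp
 note L2 = test_translate_L2[OF assms]
 have shifts: "l2norm UNIV (\<lambda>x. \<phi> (x + real j *\<^sub>R y) - \<phi> x) <= real j * l2norm UNIV (\<lambda>x. \<phi> (x + y) - \<phi> x)" for j y
 proof (induction j)
  case 0
  show ?case by (simp add: l2norm_def l2inner_def)
 next
  case (Suc j)
  have "l2norm UNIV (\<lambda>x. \<phi> (x + real (Suc j) *\<^sub>R y) - \<phi> x)
    <= l2norm UNIV (\<lambda>x. \<phi> (x + real (Suc j) *\<^sub>R y) - \<phi> (x + real j *\<^sub>R y))
     + l2norm UNIV (\<lambda>x. \<phi> (x + real j *\<^sub>R y) - \<phi> x)"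
   using L2[of 0] by (intro l2norm_triangle_diff L2) simp
  also have "l2norm UNIV (\<lambda>x. \<phi> (x + real (Suc j) *\<^sub>R y) - \<phi> (x + real j *\<^sub>R y))
    = l2norm UNIV (\<lambda>x. \<phi> (x + y) - \<phi> x)"
   using l2norm_translate[of "\<lambda>x. \<phi> (x + y) - \<phi> x" "real j *\<^sub>R y"] c continuous_translate[OF c, of y]
   by (simp add: continuous_on_diff scaleR_left_distrib add_ac)
  finally show ?case using Suc.IH by (simp add: algebra_simps)
 qed
 have bound: "l2norm UNIV (\<lambda>x. \<phi> (x + h) - \<phi> x) <= l2norm UNIV (q n)" for n
 proof -
  have "l2norm UNIV (q n) = real (Suc n) * l2norm UNIV (\<lambda>x. \<phi> (x + (1 / real (Suc n)) *\<^sub>R h) - \<phi> x)"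
   unfolding q_def by (subst l2norm_mult) simp
  with shifts[of "Suc n" "(1 / real (Suc n)) *\<^sub>R h"] show ?thesis by simp
 qed
 have "(\<lambda>n. \<integral>x. q n x * q n x \<partial>lborel) \<longlonglongrightarrow> (\<integral>x. (gradient \<phi> x \<bullet> h) * (gradient \<phi> x \<bullet> h) \<partial>lborel)"
 proof (rule integral_dominated_convergence[where w = "\<lambda>x. indicator K x * B\<^sup>2"])
  show "(\<lambda>x. (gradient \<phi> x \<bullet> h) * (gradient \<phi> x \<bullet> h)) \<in> borel_measurable lborel"
   using gradient_continuous[OF assms] by (auto intro!: borel_measurable_continuous_onI continuous_intros)
  show "(\<lambda>x. q n x * q n x) \<in> borel_measurable lborel" for n
   unfolding q_def using c continuous_translate[OF c]
   by (auto intro!: borel_measurable_continuous_onI continuous_intros)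
  show "integrable lborel (\<lambda>x. indicator K x * B\<^sup>2)"
   using BK(2) emeasure_compact_finite[of K] borel_compact[of K]
   by (intro integrable_mult_left integrable_real_indicator) auto
  show "AE x in lborel. (\<lambda>n. q n x * q n x) \<longlonglongrightarrow> (gradient \<phi> x \<bullet> h) * (gradient \<phi> x \<bullet> h)"
   unfolding q_def by (intro AE_I2 tendsto_mult test_line_derivative[OF assms])
  show "AE x in lborel. norm (q n x * q n x) <= indicator K x * B\<^sup>2" for n
  proof (rule AE_I2)
   fix x
   have "\<bar>q n x\<bar> * \<bar>q n x\<bar> <= (indicator K x * B) * (indicator K x * B)"
    using BK by (intro mult_mono) auto
   then show "norm (q n x * q n x) <= indicator K x * B\<^sup>2"
    by (cases "x \<in> K") (auto simp: abs_mult power2_eq_square)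
  qed
 qed
 moreover have "(l2norm UNIV (q n))\<^sup>2 = (\<integral>x. q n x * q n x \<partial>lborel)" for n
  unfolding l2norm_power2 l2inner_def inner_real_def
  by (rule integral_lebesgue_eq_lborel)
   (use c continuous_translate[OF c] in \<open>auto simp: q_def intro!: borel_measurable_continuous_onI continuous_intros\<close>)
 moreover have "(l2norm UNIV (\<lambda>x. gradient \<phi> x \<bullet> h))\<^sup>2
   = (\<integral>x. (gradient \<phi> x \<bullet> h) * (gradient \<phi> x \<bullet> h) \<partial>lborel)"
  unfolding l2norm_power2 l2inner_def inner_real_def
  by (rule integral_lebesgue_eq_lborel)
   (use gradient_continuous[OF assms] in \<open>auto intro!: borel_measurable_continuous_onI continuous_intros\<close>)
 ultimately have "(\<lambda>n. (l2norm UNIV (q n))\<^sup>2) \<longlonglongrightarrow> (l2norm UNIV (\<lambda>x. gradient \<phi> x \<bullet> h))\<^sup>2" by simp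
 moreover have "(l2norm UNIV (\<lambda>x. \<phi> (x + h) - \<phi> x))\<^sup>2 <= (l2norm UNIV (q n))\<^sup>2" for n
  using bound by (intro power_mono l2norm_nonneg)
 ultimately have "(l2norm UNIV (\<lambda>x. \<phi> (x + h) - \<phi> x))\<^sup>2 <= (l2norm UNIV (\<lambda>x. gradient \<phi> x \<bullet> h))\<^sup>2"
  by (intro LIMSEQ_le_const) auto
 also have "... = (\<integral>x. (norm (gradient \<phi> x \<bullet> h))\<^sup>2 \<partial>lebesgue_on UNIV)"
  by (rule l2norm_power2_integral)
 also have "... <= (\<integral>x. (norm h)\<^sup>2 * (norm (gradient \<phi> x))\<^sup>2 \<partial>lebesgue_on UNIV)"
 proof (rule integral_mono)
  have *: "(norm (gradient \<phi> x \<bullet> h))\<^sup>2 <= (norm h)\<^sup>2 * (norm (gradient \<phi> x))\<^sup>2" for x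
   using power_mono[OF Cauchy_Schwarz_ineq2[of "gradient \<phi> x" h] abs_ge_zero, of 2]
   by (simp add: power_mult_distrib mult.commute)
  show "(norm (gradient \<phi> x \<bullet> h))\<^sup>2 <= (norm h)\<^sup>2 * (norm (gradient \<phi> x))\<^sup>2" for x by (rule *)
  show int: "integrable (lebesgue_on UNIV) (\<lambda>x. (norm h)\<^sup>2 * (norm (gradient \<phi> x))\<^sup>2)"
   by (intro integrable_mult_right L2_integrable gradient_L2[OF assms sets])
  show "integrable (lebesgue_on UNIV) (\<lambda>x. (norm (gradient \<phi> x \<bullet> h))\<^sup>2)"
   using L2_measurable[OF gradient_L2[OF assms sets]] *
   by (intro Bochner_Integration.integrable_bound[OF int]) auto
 qed
 also have "... = (norm h * l2norm UNIV (gradient \<phi>))\<^sup>2"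
  by (simp add: power_mult_distrib l2norm_power2_integral)
 finally show ?thesis by (rule power2_le_imp_le) (simp add: l2norm_nonneg)
qed

lemma test_has_weak_gradient:
 assumes \<phi>: "\<phi> \<in> test_functions U" and U: "U \<in> sets lebesgue"
 shows "has_weak_gradient U \<phi> (gradient \<phi>)"
 unfolding has_weak_gradient_def
proof (intro conjI ballI gradient_L2[OF \<phi> U])
 fix \<psi> and b :: 'a assume \<psi>: "\<psi> \<in> test_functions U" and b: "b \<in> Basis"
 define \<eta> where "\<eta> x = \<phi> x * \<psi> x" for x
 have \<eta>: "\<eta> \<in> test_functions U"
  unfolding \<eta>_def using \<psi> test_smooth[OF \<phi>] by (intro test_mult) (auto simp: smooth_on_def)
 have prod: "gradient \<eta> x \<bullet> b = \<phi> x * frechet_derivative \<psi> (at x) b + (gradient \<phi> x \<bullet> b) * \<psi> x" for x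
 proof -
  have "(\<eta> has_derivative (\<lambda>h. \<phi> x * frechet_derivative \<psi> (at x) h + frechet_derivative \<phi> (at x) h * \<psi> x)) (at x)"
   unfolding \<eta>_def by (intro has_derivative_mult test_has_derivative[OF \<phi>] test_has_derivative[OF \<psi>])
  from frechet_derivative_eqI[OF this] show ?thesis
   by (simp add: gradient_inner_Basis b gradient_inner[OF \<eta>, symmetric])
 qed
 have "(\<integral>x. \<phi> x * frechet_derivative \<psi> (at x) b \<partial>lebesgue_on U) + (\<integral>x. (gradient \<phi> x \<bullet> b) * \<psi> x \<partial>lebesgue_on U)
   = (\<integral>x. gradient \<eta> x \<bullet> b \<partial>lebesgue_on U)"
  unfolding prod
 proof (rule Bochner_Integration.integral_add[symmetric])
  show "integrable (lebesgue_on U) (\<lambda>x. \<phi> x * frechet_derivative \<psi> (at x) b)"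
   by (intro L2_mult_integrable test_L2[OF \<phi> U] test_L2[OF test_partial[OF \<psi> b] U])
  show "integrable (lebesgue_on U) (\<lambda>x. (gradient \<phi> x \<bullet> b) * \<psi> x)"
   unfolding gradient_inner_Basis[OF b]
   by (intro L2_mult_integrable test_L2[OF \<psi> U] test_L2[OF test_partial[OF \<phi> b] U])
 qed
 also have "... = (\<integral>x. gradient \<eta> x \<bullet> b \<partial>lebesgue_on UNIV)"
  by (rule integral_zero_extension[OF U]) (metis gradient_support[OF \<eta>] inner_zero_left subsetD)
 also have "... = (\<integral>x. gradient \<eta> x \<bullet> b \<partial>lborel)"
  using gradient_continuous[OF \<eta>]
  by (intro integral_lebesgue_eq_lborel borel_measurable_continuous_onI continuous_intros)
 also have "... = 0" by (rule integral_directional_derivative_zero[OF \<eta>])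
 finally show "(\<integral>x. \<phi> x * frechet_derivative \<psi> (at x) b \<partial>lebesgue_on U)
   = - (\<integral>x. (gradient \<phi> x \<bullet> b) * \<psi> x \<partial>lebesgue_on U)" by simp
qed

section \<open>The fundamental lemma of the calculus of variations\<close>

lemma AE_zero_if_box_integrals_zero:
 fixes F :: "'a::euclidean_space \<Rightarrow> real"
 assumes F: "integrable lborel F" and zero: "!!a b. (\<integral>x. indicator (box a b) x * F x \<partial>lborel) = 0"
 shows "AE x in lborel. F x = 0"
proof -
 have [measurable]: "F \<in> borel_measurable borel" using F by auto
 have fin: "(\<integral>\<^sup>+x. ennreal (F x) \<partial>lborel) < \<infinity>" "(\<integral>\<^sup>+x. ennreal (- F x) \<partial>lborel) < \<infinity>"
  using F by (auto simp: real_integrable_def less_top)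
 have eq: "emeasure (density lborel (\<lambda>x. ennreal (F x))) (box a b)
   = emeasure (density lborel (\<lambda>x. ennreal (- F x))) (box a b)" for a b
 proof -
  have i: "integrable lborel (\<lambda>x. indicator (box a b) x * F x)"
   using integrable_mult_indicator[OF _ F, of "box a b"] by simp
  have "enn2real (\<integral>\<^sup>+x. ennreal (indicator (box a b) x * F x) \<partial>lborel)
    = enn2real (\<integral>\<^sup>+x. ennreal (- (indicator (box a b) x * F x)) \<partial>lborel)"
   using zero[of a b] i by (simp add: real_lebesgue_integral_def)
  moreover have "(\<integral>\<^sup>+x. ennreal (indicator (box a b) x * F x) \<partial>lborel) < \<infinity>"
    "(\<integral>\<^sup>+x. ennreal (- (indicator (box a b) x * F x)) \<partial>lborel) < \<infinity>"
   using i by (auto simp: real_integrable_def less_top)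
  ultimately have "(\<integral>\<^sup>+x. ennreal (indicator (box a b) x * F x) \<partial>lborel)
    = (\<integral>\<^sup>+x. ennreal (- (indicator (box a b) x * F x)) \<partial>lborel)"
   by (metis ennreal_enn2real infinity_ennreal_def)
  moreover have "ennreal (indicator (box a b) x * F x) = ennreal (F x) * indicator (box a b) x"
    "ennreal (- (indicator (box a b) x * F x)) = ennreal (- F x) * indicator (box a b) x" for x
   by (auto simp: indicator_def)
  ultimately show ?thesis by (simp add: emeasure_density)
 qed
 have "density lborel (\<lambda>x. ennreal (F x)) = density lborel (\<lambda>x. ennreal (- F x))"
 proof (rule measure_eqI_generator_eq)
  let ?E = "range (\<lambda>(a, b). box a b :: 'a set)"
  let ?A = "\<lambda>n::nat. box (- (real n *\<^sub>R One)) (real n *\<^sub>R One) :: 'a set"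
  show "Int_stable ?E" by (auto simp: Int_stable_def box_Int_box)
  show "?E \<subseteq> Pow UNIV" "sets (density lborel (\<lambda>x. ennreal (F x))) = sigma_sets UNIV ?E"
   "sets (density lborel (\<lambda>x. ennreal (- F x))) = sigma_sets UNIV ?E"
   by (simp_all add: borel_eq_box)
  show "range ?A \<subseteq> ?E" "(\<Union>i. ?A i) = UNIV" unfolding UN_box_eq_UNIV by auto
  show "emeasure (density lborel (\<lambda>x. ennreal (F x))) (?A i) \<noteq> \<infinity>" for i
  proof -
   have "emeasure (density lborel (\<lambda>x. ennreal (F x))) (?A i) <= (\<integral>\<^sup>+x. ennreal (F x) \<partial>lborel)"
    by (subst emeasure_density) (auto intro!: nn_integral_mono simp: indicator_def)
   with fin(1) show ?thesis by (auto simp: top_unique)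
  qed
  show "emeasure (density lborel (\<lambda>x. ennreal (F x))) X = emeasure (density lborel (\<lambda>x. ennreal (- F x))) X"
   if "X \<in> ?E" for X using that eq by auto
 qed
 then have "AE x in lborel. ennreal (F x) = ennreal (- F x)"
  by (subst (asm) finite_density_unique) (use fin in auto)
 then show ?thesis
 proof eventually_elim
  case (elim x)
  then show ?case by (cases "0 <= F x") (auto simp: ennreal_neg ennreal_eq_0_iff dest: sym)
 qed
qed

theorem fundamental_lemma:
 fixes f :: "'a::euclidean_space \<Rightarrow> real"
 assumes U: "open U" and f: "integrable (lebesgue_on U) f"
  and zero: "!!\<phi>. \<phi> \<in> test_functions U ==> (\<integral>x. f x * \<phi> x \<partial>lebesgue_on U) = 0"
 shows "AE x in lebesgue_on U. f x = 0"
proof -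
 have sets: "U \<in> sets lebesgue" using U by (simp add: lborelD)
 have f0: "integrable lebesgue (\<lambda>x. indicator U x *\<^sub>R f x)"
  using f sets by (simp add: integrable_restrict_space)
 then obtain F where F: "F \<in> borel_measurable lborel" "AE x in lborel. indicator U x *\<^sub>R f x = F x"
  using completion_ex_borel_measurable_real borel_measurable_integrable by blast
 have F': "AE x in lebesgue. indicator U x *\<^sub>R f x = F x" by (rule AE_completion[OF F(2)])
 have iF: "integrable lborel F"
  using f0 F F' integrable_cong_AE[OF borel_measurable_integrable[OF f0] measurable_completion[OF F(1)] F']
  by (simp add: integrable_completion)
 have test: "(\<integral>x. F x * \<phi> x \<partial>lborel) = 0" if \<phi>: "\<phi> \<in> test_functions U" for \<phi>
 proof -
  have m: "\<phi> \<in> borel_measurable borel" using test_continuous[OF \<phi>] by (rule borel_measurable_continuous_onI)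
  have "(\<integral>x. F x * \<phi> x \<partial>lborel) = (\<integral>x. F x * \<phi> x \<partial>lebesgue)"
   using F(1) m by (subst integral_completion) auto
  also have "... = (\<integral>x. indicator U x *\<^sub>R (f x * \<phi> x) \<partial>lebesgue)"
  proof (rule integral_cong_AE)
   show "AE x in lebesgue. F x * \<phi> x = indicator U x *\<^sub>R (f x * \<phi> x)"
    using F' by eventually_elim (auto simp: indicator_def)
   show 1: "(\<lambda>x. F x * \<phi> x) \<in> borel_measurable lebesgue"
    using F(1) m by (intro measurable_completion) auto
   have "(\<lambda>x. (indicator U x *\<^sub>R f x) * \<phi> x) \<in> borel_measurable lebesgue"
    using borel_measurable_integrable[OF f0] measurable_completion[of \<phi> lborel borel] m
    by (intro borel_measurable_times) auto
   then show "(\<lambda>x. indicator U x *\<^sub>R (f x * \<phi> x)) \<in> borel_measurable lebesgue"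
    by (simp add: mult.assoc)
  qed
  also have "... = 0" using zero[OF \<phi>] sets by (simp add: integral_restrict_space)
  finally show ?thesis .
 qed
 have box: "(\<integral>x. indicator (box a b) x * F x \<partial>lborel) = 0" if "box a b \<subseteq> U" for a b
 proof -
  have "(\<lambda>k. \<integral>x. F x * box_bump k a b x \<partial>lborel) \<longlonglongrightarrow> (\<integral>x. indicator (box a b) x * F x \<partial>lborel)"
  proof (rule integral_dominated_convergence[where w = "\<lambda>x. \<bar>F x\<bar>"])
   show "(\<lambda>x. indicator (box a b) x * F x) \<in> borel_measurable lborel" using F(1) by simp
   show "(\<lambda>x. F x * box_bump k a b x) \<in> borel_measurable lborel" for k
    using F(1) test_continuous[OF box_bump_test[OF that, of k]]
    by (intro borel_measurable_times) (auto intro: borel_measurable_continuous_onI)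
   show "integrable lborel (\<lambda>x. \<bar>F x\<bar>)" using iF by simp
   show "AE x in lborel. (\<lambda>k. F x * box_bump k a b x) \<longlonglongrightarrow> indicator (box a b) x * F x"
    by (intro AE_I2) (subst mult.commute[of _ "F _"], intro tendsto_intros box_bump_tendsto)
   show "AE x in lborel. norm (F x * box_bump k a b x) <= \<bar>F x\<bar>" for k
    using box_bump_bounds[of k a b] by (intro AE_I2) (simp add: abs_mult mult_left_le)
  qed
  moreover have "(\<integral>x. F x * box_bump k a b x \<partial>lborel) = 0" for k
   by (intro test box_bump_test that)
  ultimately show ?thesis by (simp add: LIMSEQ_const_iff)
 qed
 have boxAE: "AE x in lborel. x \<in> box a b --> F x = 0" if "box a b \<subseteq> U" for a b
 proof -
  have "AE x in lborel. indicator (box a b) x * F x = 0"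
  proof (rule AE_zero_if_box_integrals_zero)
   show "integrable lborel (\<lambda>x. indicator (box a b) x * F x)"
    using integrable_mult_indicator[OF _ iF, of "box a b"] by simp
   fix c d :: 'a
   obtain a' b' where ab: "box c d \<inter> box a b = box a' b'" using box_Int_box by blast
   then have "box a' b' \<subseteq> U" using that by blast
   then have "(\<integral>x. indicator (box a' b') x * F x \<partial>lborel) = 0" by (rule box)
   moreover have "(\<lambda>x. indicator (box c d) x * (indicator (box a b) x * F x)) = (\<lambda>x. indicator (box a' b') x * F x)"
    unfolding ab[symmetric] by (auto simp: indicator_def fun_eq_iff)
   ultimately show "(\<integral>x. indicator (box c d) x * (indicator (box a b) x * F x) \<partial>lborel) = 0"
    by (simp only:)
  qed
  then show ?thesis by eventually_elim (auto simp: indicator_def)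
 qed
 obtain \<D> where \<D>: "countable \<D>" "\<D> \<subseteq> Pow U" "!!X. X \<in> \<D> ==> \<exists>a b. X = box a b" "\<Union>\<D> = U"
  using open_countable_Union_open_box[OF U] by metis
 have "AE x in lborel. \<forall>X\<in>\<D>. x \<in> X --> F x = 0"
 proof (subst AE_ball_countable[OF \<D>(1)], rule ballI)
  fix X assume "X \<in> \<D>"
  with \<D> obtain a b where "X = box a b" "box a b \<subseteq> U" by blast
  then show "AE x in lborel. x \<in> X --> F x = 0" using boxAE by simp
 qed
 then have "AE x in lebesgue. \<forall>X\<in>\<D>. x \<in> X --> F x = 0" by (rule AE_completion)
 with F' have "AE x in lebesgue. x \<in> U --> f x = 0"
  by eventually_elim (use \<D>(4) in \<open>auto simp: indicator_def\<close>)
 then show ?thesis using sets by (simp add: AE_restrict_space_iff)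
qed

section \<open>The space of functions vanishing on the boundary\<close>

lemma L2_scaleR_vector:
 fixes e :: "'b::euclidean_space"
 assumes "\<phi> \<in> L2 S"
 shows "(\<lambda>x. \<phi> x *\<^sub>R e) \<in> L2 S"
proof -
 have "(\<lambda>x. \<phi> x *\<^sub>R e) \<in> borel_measurable (lebesgue_on S)"
  using L2_measurable[OF assms] by (intro borel_measurable_scaleR) auto
 with assms show ?thesis by (simp add: L2_def power_mult_distrib)
qed

lemma test_zero_outside: "\<phi> \<in> test_functions U ==> x \<notin> U ==> \<phi> x = 0"
 by (auto simp: test_functions_def)

lemma tendsto_0_if_less_inverse_Suc:
 fixes a :: "nat \<Rightarrow> real"
 assumes "!!k. 0 <= a k" "!!k. a k < inverse (real (Suc k))"
 shows "a \<longlonglongrightarrow> 0"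
 by (rule real_tendsto_sandwich[OF _ _ tendsto_const LIMSEQ_inverse_real_of_nat])
  (use assms in \<open>auto intro!: always_eventually less_imp_le\<close>)

locale bounded_open =
 fixes U :: "'a::euclidean_space set"
 assumes open_U: "open U" and bounded_U: "bounded U" and nonempty_U: "U \<noteq> {}"
begin

lemma sets_U: "U \<in> sets lebesgue"
 using open_U by (simp add: lborelD)

lemma lmeasurable_U: "U \<in> lmeasurable"
 using open_U bounded_U by (rule lmeasurable_open[rotated])

lemma finite_measure_U: "finite_measure (lebesgue_on U)"
 by (rule finite_measure_lebesgue_on[OF lmeasurable_U])

lemma L2_U_integrable:
 fixes f :: "'a \<Rightarrow> real"
 assumes "f \<in> L2 U"
 shows "integrable (lebesgue_on U) f"
proof -
 have "(\<lambda>x. 1::real) \<in> L2 U"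
  by (rule L2_AE_bounded[OF lmeasurable_U, of _ 1]) auto
 from L2_mult_integrable[OF assms this] show ?thesis by simp
qed

lemma weak_gradient_unique:
 assumes "has_weak_gradient U f G" "has_weak_gradient U f G'"
 shows "AE x in lebesgue_on U. G x = G' x"
proof -
 have G: "G \<in> L2 U" "G' \<in> L2 U" using assms by (auto simp: has_weak_gradient_def)
 have comp: "(\<lambda>x. G x \<bullet> b) \<in> L2 U" if "b \<in> Basis" "G \<in> L2 U" for b and G :: "'a \<Rightarrow> 'a"
 proof -
  have "integrable (lebesgue_on U) (\<lambda>x. (norm (G x \<bullet> b))\<^sup>2)"
  proof (rule Bochner_Integration.integrable_bound[OF L2_integrable[OF that(2)]])
   show "(\<lambda>x. (norm (G x \<bullet> b))\<^sup>2) \<in> borel_measurable (lebesgue_on U)"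
    using L2_measurable[OF that(2)] by simp
   show "AE x in lebesgue_on U. norm ((norm (G x \<bullet> b))\<^sup>2) <= norm ((norm (G x))\<^sup>2)"
    using Basis_le_norm[OF that(1)] by (intro AE_I2) (simp flip: abs_le_square_iff)
  qed
  with L2_measurable[OF that(2)] show ?thesis by (simp add: L2_def)
 qed
 have "AE x in lebesgue_on U. G x \<bullet> b - G' x \<bullet> b = 0" if b: "b \<in> Basis" for b
 proof (rule fundamental_lemma[OF open_U])
  show "integrable (lebesgue_on U) (\<lambda>x. G x \<bullet> b - G' x \<bullet> b)"
   by (intro L2_U_integrable L2_diff comp G b)
  fix \<phi> assume \<phi>: "\<phi> \<in> test_functions U"
  have "(\<integral>x. (G x \<bullet> b - G' x \<bullet> b) * \<phi> x \<partial>lebesgue_on U)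
    = (\<integral>x. (G x \<bullet> b) * \<phi> x \<partial>lebesgue_on U) - (\<integral>x. (G' x \<bullet> b) * \<phi> x \<partial>lebesgue_on U)"
   unfolding left_diff_distrib
   by (intro Bochner_Integration.integral_diff L2_mult_integrable comp G b test_L2[OF \<phi> sets_U])
  also have "... = 0"
  proof -
   let ?I = "\<integral>x. f x * frechet_derivative \<phi> (at x) b \<partial>lebesgue_on U"
   have "?I = - (\<integral>x. (G x \<bullet> b) * \<phi> x \<partial>lebesgue_on U)" "?I = - (\<integral>x. (G' x \<bullet> b) * \<phi> x \<partial>lebesgue_on U)"
    using assms \<phi> b by (simp_all add: has_weak_gradient_def)
   then show ?thesis by linarith
  qed
  finally show "(\<integral>x. (G x \<bullet> b - G' x \<bullet> b) * \<phi> x \<partial>lebesgue_on U) = 0" .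
 qed
 then have "AE x in lebesgue_on U. \<forall>b\<in>Basis. G x \<bullet> b - G' x \<bullet> b = 0"
  by (subst AE_ball_countable) (auto simp: countable_finite)
 then show ?thesis by eventually_elim (auto intro: euclidean_eqI)
qed

lemma has_weak_gradient_wgrad: "f \<in> sobolev_H1 U ==> has_weak_gradient U f (wgrad U f)"
 using someI_ex[of "has_weak_gradient U f"] by (auto simp: sobolev_H1_def wgrad_def)

lemma wgrad_AE:
 assumes "has_weak_gradient U f G"
 shows "AE x in lebesgue_on U. wgrad U f x = G x"
proof (rule weak_gradient_unique[OF _ assms])
 show "has_weak_gradient U f (wgrad U f)"
  using someI[of "has_weak_gradient U f", OF assms] by (simp add: wgrad_def)
qed

lemma has_weak_gradient_combination:
 assumes y: "y \<in> L2 U" "has_weak_gradient U y G" and z: "z \<in> L2 U" "has_weak_gradient U z H"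
 shows "has_weak_gradient U (\<lambda>x. a * y x + b * z x) (\<lambda>x. a *\<^sub>R G x + b *\<^sub>R H x)"
 unfolding has_weak_gradient_def
proof (intro conjI ballI)
 have G: "G \<in> L2 U" "H \<in> L2 U" using y z by (auto simp: has_weak_gradient_def)
 then show "(\<lambda>x. a *\<^sub>R G x + b *\<^sub>R H x) \<in> L2 U" by (intro L2_add L2_scaleR)
 fix \<phi> and e :: 'a assume \<phi>: "\<phi> \<in> test_functions U" and e: "e \<in> Basis"
 let ?d = "\<lambda>x. frechet_derivative \<phi> (at x) e"
 have e\<phi>: "(\<lambda>x. \<phi> x *\<^sub>R e) \<in> L2 U"
  by (rule L2_scaleR_vector[OF test_L2[OF \<phi> sets_U]])
 have int: "integrable (lebesgue_on U) (\<lambda>x. (G x \<bullet> e) * \<phi> x)" if "G \<in> L2 U" for G :: "'a \<Rightarrow> 'a"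
  using L2_inner_integrable[OF that e\<phi>] by (simp add: mult.commute)
 have d: "?d \<in> L2 U" by (intro test_L2[OF test_partial[OF \<phi> e] sets_U])
 have "(\<integral>x. (a * y x + b * z x) * ?d x \<partial>lebesgue_on U)
   = (\<integral>x. a * (y x * ?d x) + b * (z x * ?d x) \<partial>lebesgue_on U)" by (simp add: algebra_simps)
 also have "... = a * (\<integral>x. y x * ?d x \<partial>lebesgue_on U) + b * (\<integral>x. z x * ?d x \<partial>lebesgue_on U)"
  using y z d by (simp add: L2_mult_integrable)
 also have "... = a * (- (\<integral>x. (G x \<bullet> e) * \<phi> x \<partial>lebesgue_on U)) + b * (- (\<integral>x. (H x \<bullet> e) * \<phi> x \<partial>lebesgue_on U))"
  using y(2) z(2) \<phi> e by (simp add: has_weak_gradient_def)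
 also have "... = - (\<integral>x. a * ((G x \<bullet> e) * \<phi> x) + b * ((H x \<bullet> e) * \<phi> x) \<partial>lebesgue_on U)"
  using int G by simp
 also have "... = - (\<integral>x. ((a *\<^sub>R G x + b *\<^sub>R H x) \<bullet> e) * \<phi> x \<partial>lebesgue_on U)"
  by (simp add: inner_add_left algebra_simps)
 finally show "(\<integral>x. (a * y x + b * z x) * ?d x \<partial>lebesgue_on U)
   = - (\<integral>x. ((a *\<^sub>R G x + b *\<^sub>R H x) \<bullet> e) * \<phi> x \<partial>lebesgue_on U)" .
qed

lemma H01_D:
 assumes "z \<in> H01 U"
 shows H01_L2: "z \<in> L2 U" and H01_has_weak_gradient: "has_weak_gradient U z (wgrad U z)"
  and wgrad_L2: "wgrad U z \<in> L2 U"
proof -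
 have "z \<in> sobolev_H1 U" using assms by (simp add: H01_def)
 then show "z \<in> L2 U" "has_weak_gradient U z (wgrad U z)"
  using has_weak_gradient_wgrad by (auto simp: sobolev_H1_def)
 then show "wgrad U z \<in> L2 U" by (simp add: has_weak_gradient_def)
qed

lemma test_H1: "\<phi> \<in> test_functions U ==> \<phi> \<in> sobolev_H1 U"
 unfolding sobolev_H1_def using test_L2[of \<phi> U] test_has_weak_gradient[of \<phi> U] sets_U by blast

lemma test_H01: "\<phi> \<in> test_functions U ==> \<phi> \<in> H01 U"
 unfolding H01_def using test_H1
 by (auto intro!: exI[of _ "\<lambda>_. \<phi>"] simp: l2norm_def l2inner_def)

lemma wgrad_test:
 assumes "\<phi> \<in> test_functions U"
 shows "AE x in lebesgue_on U. wgrad U \<phi> x = gradient \<phi> x"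
 by (rule wgrad_AE[OF test_has_weak_gradient[OF assms sets_U]])

lemma H01_characterization:
 "z \<in> H01 U \<longleftrightarrow> z \<in> L2 U \<and> (\<exists>G. has_weak_gradient U z G \<and>
   (\<forall>e>0. \<exists>\<phi>\<in>test_functions U. l2norm U (\<lambda>x. \<phi> x - z x) < e \<and> l2norm U (\<lambda>x. gradient \<phi> x - G x) < e))"
 (is "?L \<longleftrightarrow> ?R")
proof
 assume z: ?L
 then obtain \<phi> where \<phi>: "!!k. \<phi> k \<in> test_functions U" "(\<lambda>k. l2norm U (\<phi> k - z)) \<longlonglongrightarrow> 0"
   "(\<lambda>k. l2norm U (wgrad U (\<phi> k) - wgrad U z)) \<longlonglongrightarrow> 0"
  by (auto simp: H01_def)
 have "\<exists>\<phi>\<in>test_functions U. l2norm U (\<lambda>x. \<phi> x - z x) < e \<and> l2norm U (\<lambda>x. gradient \<phi> x - wgrad U z x) < e"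
  if "0 < e" for e
 proof -
  have "eventually (\<lambda>k. l2norm U (\<phi> k - z) < e \<and> l2norm U (wgrad U (\<phi> k) - wgrad U z) < e) sequentially"
   using \<phi>(2,3) that by (intro eventually_conj order_tendstoD(2))
  then obtain k where k: "l2norm U (\<phi> k - z) < e" "l2norm U (wgrad U (\<phi> k) - wgrad U z) < e"
   by (auto simp: eventually_sequentially)
  have "l2norm U (\<lambda>x. wgrad U (\<phi> k) x - wgrad U z x) = l2norm U (\<lambda>x. gradient (\<phi> k) x - wgrad U z x)"
  proof (rule l2norm_AE_cong[OF sets_U])
   show "(\<lambda>x. wgrad U (\<phi> k) x - wgrad U z x) \<in> L2 U"
    by (intro L2_diff wgrad_L2 test_H01 \<phi> z)
   show "AE x in lebesgue_on U. wgrad U (\<phi> k) x - wgrad U z x = gradient (\<phi> k) x - wgrad U z x"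
    using wgrad_test[OF \<phi>(1)] by eventually_elim simp
  qed
  with k show ?thesis using \<phi>(1) by (auto simp: fun_diff_def intro!: bexI[of _ "\<phi> k"])
 qed
 then show ?R using H01_L2[OF z] H01_has_weak_gradient[OF z] by blast
next
 assume ?R
 then obtain G where z: "z \<in> L2 U" and G: "has_weak_gradient U z G"
  and ap: "!!e. 0 < e ==> \<exists>\<phi>\<in>test_functions U. l2norm U (\<lambda>x. \<phi> x - z x) < e \<and> l2norm U (\<lambda>x. gradient \<phi> x - G x) < e"
  by blast
 have "\<forall>k. \<exists>\<phi>\<in>test_functions U. l2norm U (\<lambda>x. \<phi> x - z x) < inverse (real (Suc k))
   \<and> l2norm U (\<lambda>x. gradient \<phi> x - G x) < inverse (real (Suc k))"
  using ap by simp
 then obtain \<phi> where \<phi>: "!!k. \<phi> k \<in> test_functions U"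
   "!!k. l2norm U (\<lambda>x. \<phi> k x - z x) < inverse (real (Suc k))"
   "!!k. l2norm U (\<lambda>x. gradient (\<phi> k) x - G x) < inverse (real (Suc k))"
  by metis
 have GL2: "G \<in> L2 U" using G by (simp add: has_weak_gradient_def)
 have eq: "l2norm U (\<lambda>x. gradient (\<phi> k) x - G x) = l2norm U (\<lambda>x. wgrad U (\<phi> k) x - wgrad U z x)" for k
 proof (rule l2norm_AE_cong[OF sets_U])
  show "(\<lambda>x. gradient (\<phi> k) x - G x) \<in> L2 U"
   by (intro L2_diff gradient_L2[OF \<phi>(1) sets_U] GL2)
  show "AE x in lebesgue_on U. gradient (\<phi> k) x - G x = wgrad U (\<phi> k) x - wgrad U z x"
   using wgrad_test[OF \<phi>(1)[of k]] wgrad_AE[OF G] by eventually_elim simp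
 qed
 have "(\<lambda>k. l2norm U (\<phi> k - z)) \<longlonglongrightarrow> 0"
  unfolding fun_diff_def by (intro tendsto_0_if_less_inverse_Suc l2norm_nonneg \<phi>(2))
 moreover have "(\<lambda>k. l2norm U (wgrad U (\<phi> k) - wgrad U z)) \<longlonglongrightarrow> 0"
  unfolding fun_diff_def
  by (intro tendsto_0_if_less_inverse_Suc l2norm_nonneg) (rule \<phi>(3)[unfolded eq])
 moreover have "z \<in> sobolev_H1 U" using z G by (auto simp: sobolev_H1_def)
 ultimately show ?L unfolding H01_def using \<phi>(1) by blast
qed

lemma gradient_combination:
 assumes "\<phi> \<in> test_functions U" "\<psi> \<in> test_functions U"
 shows "gradient (\<lambda>x. a * \<phi> x + b * \<psi> x) x = a *\<^sub>R gradient \<phi> x + b *\<^sub>R gradient \<psi> x"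
proof -
 have "((\<lambda>x. a * \<phi> x + b * \<psi> x) has_derivative
   (\<lambda>h. a * frechet_derivative \<phi> (at x) h + b * frechet_derivative \<psi> (at x) h)) (at x)"
  by (intro derivative_intros test_has_derivative[OF assms(1)] test_has_derivative[OF assms(2)])
 from frechet_derivative_eqI[OF this] show ?thesis
  by (simp add: gradient_def scaleR_left_distrib sum.distrib scaleR_sum_right)
qed

lemma
 assumes y: "y \<in> H01 U" and z: "z \<in> H01 U"
 shows H01_combination: "(\<lambda>x. a * y x + b * z x) \<in> H01 U"
  and wgrad_combination: "AE x in lebesgue_on U.
   wgrad U (\<lambda>x. a * y x + b * z x) x = a *\<^sub>R wgrad U y x + b *\<^sub>R wgrad U z x"
proof -
 let ?c = "\<lambda>x. a * y x + b * z x" and ?G = "\<lambda>x. a *\<^sub>R wgrad U y x + b *\<^sub>R wgrad U z x"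
 have G: "has_weak_gradient U ?c ?G"
  by (intro has_weak_gradient_combination H01_D y z)
 then show "AE x in lebesgue_on U. wgrad U ?c x = ?G x" by (rule wgrad_AE)
 have "\<exists>\<phi>\<in>test_functions U. l2norm U (\<lambda>x. \<phi> x - ?c x) < e \<and> l2norm U (\<lambda>x. gradient \<phi> x - ?G x) < e"
  if "0 < e" for e
 proof -
  define d where "d = e / (1 + \<bar>a\<bar> + \<bar>b\<bar>)"
  have d: "0 < d" using that by (simp add: d_def add_pos_nonneg)
  have approx: "\<exists>\<phi>\<in>test_functions U. l2norm U (\<lambda>x. \<phi> x - y x) < d \<and> l2norm U (\<lambda>x. gradient \<phi> x - wgrad U y x) < d"
   if y: "y \<in> H01 U" for y
  proof -
   from y obtain G where G: "has_weak_gradient U y G"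
    "\<exists>\<phi>\<in>test_functions U. l2norm U (\<lambda>x. \<phi> x - y x) < d \<and> l2norm U (\<lambda>x. gradient \<phi> x - G x) < d"
    using d by (auto simp: H01_characterization)
   have "l2norm U (\<lambda>x. gradient \<phi> x - G x) = l2norm U (\<lambda>x. gradient \<phi> x - wgrad U y x)"
    if "\<phi> \<in> test_functions U" for \<phi>
   proof (rule l2norm_AE_cong[OF sets_U])
    show "(\<lambda>x. gradient \<phi> x - G x) \<in> L2 U"
     using G(1) by (intro L2_diff gradient_L2[OF that sets_U]) (simp add: has_weak_gradient_def)
    show "AE x in lebesgue_on U. gradient \<phi> x - G x = gradient \<phi> x - wgrad U y x"
     using wgrad_AE[OF G(1)] by eventually_elim simp
   qed
   with G(2) show ?thesis by auto
  qed
  obtain \<phi> where \<phi>: "\<phi> \<in> test_functions U" "l2norm U (\<lambda>x. \<phi> x - y x) < d"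
   "l2norm U (\<lambda>x. gradient \<phi> x - wgrad U y x) < d" using approx[OF y] by blast
  obtain \<psi> where \<psi>: "\<psi> \<in> test_functions U" "l2norm U (\<lambda>x. \<psi> x - z x) < d"
   "l2norm U (\<lambda>x. gradient \<psi> x - wgrad U z x) < d" using approx[OF z] by blast
  have small: "\<bar>a\<bar> * s + \<bar>b\<bar> * t < e" if "s < d" "t < d" "0 <= s" "0 <= t" for s t
  proof -
   have "\<bar>a\<bar> * s + \<bar>b\<bar> * t <= \<bar>a\<bar> * d + \<bar>b\<bar> * d"
    using that by (intro add_mono mult_left_mono) auto
   also have "... < (1 + \<bar>a\<bar> + \<bar>b\<bar>) * d" using d by (simp add: algebra_simps)
   also have "... = e" by (simp add: d_def add_pos_nonneg)
   finally show ?thesis .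
  qed
  have comb: "l2norm U (\<lambda>x. (a *\<^sub>R f x + b *\<^sub>R h x) - (a *\<^sub>R F x + b *\<^sub>R H x)) < e"
   if "f \<in> L2 U" "h \<in> L2 U" "F \<in> L2 U" "H \<in> L2 U" "l2norm U (\<lambda>x. f x - F x) < d" "l2norm U (\<lambda>x. h x - H x) < d"
   for f h F H :: "'a \<Rightarrow> 'b::euclidean_space"
  proof -
   have "l2norm U (\<lambda>x. (a *\<^sub>R f x + b *\<^sub>R h x) - (a *\<^sub>R F x + b *\<^sub>R H x))
     = l2norm U (\<lambda>x. a *\<^sub>R (f x - F x) + b *\<^sub>R (h x - H x))" by (simp add: algebra_simps)
   also have "... <= l2norm U (\<lambda>x. a *\<^sub>R (f x - F x)) + l2norm U (\<lambda>x. b *\<^sub>R (h x - H x))"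
    by (intro l2norm_triangle L2_scaleR L2_diff that)
   also have "... < e"
    unfolding l2norm_scaleR using that(5,6) by (intro small l2norm_nonneg)
   finally show ?thesis .
  qed
  show ?thesis
  proof (intro bexI conjI)
   show "(\<lambda>x. a * \<phi> x + b * \<psi> x) \<in> test_functions U" by (intro test_add test_scale \<phi> \<psi>)
   show "l2norm U (\<lambda>x. (a * \<phi> x + b * \<psi> x) - ?c x) < e"
    using comb[of \<phi> \<psi> y z, OF test_L2[OF \<phi>(1) sets_U] test_L2[OF \<psi>(1) sets_U] H01_L2[OF y] H01_L2[OF z] \<phi>(2) \<psi>(2)]
    by simp
   show "l2norm U (\<lambda>x. gradient (\<lambda>x. a * \<phi> x + b * \<psi> x) x - ?G x) < e"
    unfolding gradient_combination[OF \<phi>(1) \<psi>(1)]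
    by (rule comb[OF gradient_L2[OF \<phi>(1) sets_U] gradient_L2[OF \<psi>(1) sets_U]
      wgrad_L2[OF y] wgrad_L2[OF z] \<phi>(3) \<psi>(3)])
  qed
 qed
 moreover have "?c \<in> L2 U" by (intro L2_add L2_mult H01_L2 y z)
 ultimately show "?c \<in> H01 U" using G by (auto simp: H01_characterization)
qed

definition vinner :: "('a \<Rightarrow> real) \<Rightarrow> ('a \<Rightarrow> real) \<Rightarrow> real" where
 "vinner y z = l2inner U (wgrad U y) (wgrad U z)"

lemma H01_diff: "y \<in> H01 U ==> z \<in> H01 U ==> (\<lambda>x. y x - z x) \<in> H01 U"
 using H01_combination[of y z 1 "-1"] by simp

lemma H01_add: "y \<in> H01 U ==> z \<in> H01 U ==> (\<lambda>x. y x + z x) \<in> H01 U"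
 using H01_combination[of y z 1 1] by simp

lemma H01_scale: "y \<in> H01 U ==> (\<lambda>x. c * y x) \<in> H01 U"
 using H01_combination[of y y c 0] by simp

lemma vinner_combination:
 assumes "y \<in> H01 U" "z \<in> H01 U" "w \<in> H01 U"
 shows "vinner (\<lambda>x. a * y x + b * z x) w = a * vinner y w + b * vinner z w"
proof -
 have "vinner (\<lambda>x. a * y x + b * z x) w = l2inner U (\<lambda>x. a *\<^sub>R wgrad U y x + b *\<^sub>R wgrad U z x) (wgrad U w)"
  unfolding vinner_def
  by (intro l2inner_AE_cong[OF sets_U] wgrad_L2 H01_combination assms wgrad_combination) simp
 also have "... = a * vinner y w + b * vinner z w"
  using assms by (simp add: vinner_def l2inner_add_left L2_scaleR wgrad_L2 l2inner_scaleR_left)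
 finally show ?thesis .
qed

lemma vinner_commute: "vinner y z = vinner z y"
 by (simp add: vinner_def l2inner_commute)

lemma vinner_diff_left:
 "y \<in> H01 U ==> z \<in> H01 U ==> w \<in> H01 U ==> vinner (\<lambda>x. y x - z x) w = vinner y w - vinner z w"
 using vinner_combination[of y z w 1 "-1"] by simp

lemma vinner_diff_right:
 "y \<in> H01 U ==> z \<in> H01 U ==> w \<in> H01 U ==> vinner w (\<lambda>x. y x - z x) = vinner w y - vinner w z"
 using vinner_diff_left[of y z w] by (simp add: vinner_commute)

lemma vnorm_nonneg: "0 <= vnorm U z"
 by (simp add: vnorm_def l2norm_nonneg)

lemma vnorm_power2: "(vnorm U z)\<^sup>2 = vinner z z"
 by (simp add: vnorm_def vinner_def l2norm_power2)

lemma vinner_Cauchy_Schwarz: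
 "y \<in> H01 U ==> z \<in> H01 U ==> \<bar>vinner y z\<bar> <= vnorm U y * vnorm U z"
 unfolding vinner_def vnorm_def by (intro l2inner_Cauchy_Schwarz wgrad_L2)

lemma vnorm_diff:
 assumes "y \<in> H01 U" "z \<in> H01 U"
 shows "vnorm U (\<lambda>x. y x - z x) = l2norm U (\<lambda>x. wgrad U y x - wgrad U z x)"
 unfolding vnorm_def
proof (rule l2norm_AE_cong[OF sets_U])
 show "wgrad U (\<lambda>x. y x - z x) \<in> L2 U" by (intro wgrad_L2 H01_diff assms)
 show "AE x in lebesgue_on U. wgrad U (\<lambda>x. y x - z x) x = wgrad U y x - wgrad U z x"
  using wgrad_combination[OF assms, of 1 "-1"] by simp
qed

lemma vnorm_scale: "z \<in> H01 U ==> vnorm U (\<lambda>x. c * z x) = \<bar>c\<bar> * vnorm U z"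
proof -
 assume z: "z \<in> H01 U"
 have "vnorm U (\<lambda>x. c * z x) = l2norm U (\<lambda>x. c *\<^sub>R wgrad U z x)"
  unfolding vnorm_def
  by (rule l2norm_AE_cong[OF sets_U wgrad_L2[OF H01_scale[OF z]]])
   (use wgrad_combination[OF z z, of c 0] in simp)
 then show ?thesis by (simp add: l2norm_scaleR vnorm_def)
qed

lemma vnorm_reverse_triangle:
 "y \<in> H01 U ==> z \<in> H01 U ==> \<bar>vnorm U y - vnorm U z\<bar> <= vnorm U (\<lambda>x. y x - z x)"
 unfolding vnorm_diff by (simp add: vnorm_def l2norm_reverse_triangle wgrad_L2)

lemma H01_approximation:
 assumes "z \<in> H01 U"
 obtains \<phi> where "!!k. \<phi> k \<in> test_functions U" "(\<lambda>k. l2norm U (\<lambda>x. \<phi> k x - z x)) \<longlonglongrightarrow> 0"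
  "(\<lambda>k. vnorm U (\<lambda>x. \<phi> k x - z x)) \<longlonglongrightarrow> 0"
proof -
 obtain \<phi> where \<phi>: "!!k. \<phi> k \<in> test_functions U" "(\<lambda>k. l2norm U (\<phi> k - z)) \<longlonglongrightarrow> 0"
   "(\<lambda>k. l2norm U (wgrad U (\<phi> k) - wgrad U z)) \<longlonglongrightarrow> 0"
  using assms by (auto simp: H01_def)
 show ?thesis
  using that[OF \<phi>(1)] \<phi>(2,3) by (simp add: fun_diff_def vnorm_diff test_H01 \<phi>(1) assms)
qed

lemma H01_closed:
 assumes z: "!!k. z k \<in> H01 U" and y: "y \<in> L2 U" "(\<lambda>k. l2norm U (\<lambda>x. z k x - y x)) \<longlonglongrightarrow> 0"
  and G: "G \<in> L2 U" "(\<lambda>k. l2norm U (\<lambda>x. wgrad U (z k) x - G x)) \<longlonglongrightarrow> 0"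
 shows "y \<in> H01 U" "has_weak_gradient U y G"
proof -
 show wG: "has_weak_gradient U y G"
  unfolding has_weak_gradient_def
 proof (intro conjI ballI G(1))
  fix \<phi> and b :: 'a assume \<phi>: "\<phi> \<in> test_functions U" and b: "b \<in> Basis"
  let ?d = "\<lambda>x. frechet_derivative \<phi> (at x) b"
  have \<phi>b: "(\<lambda>x. \<phi> x *\<^sub>R b) \<in> L2 U"
   by (rule L2_scaleR_vector[OF test_L2[OF \<phi> sets_U]])
  have 1: "(\<lambda>k. l2inner U (z k) ?d) \<longlonglongrightarrow> l2inner U y ?d"
   by (intro l2inner_tendsto_left H01_L2 z y test_L2[OF test_partial[OF \<phi> b] sets_U])
  have 2: "(\<lambda>k. l2inner U (wgrad U (z k)) (\<lambda>x. \<phi> x *\<^sub>R b)) \<longlonglongrightarrow> l2inner U G (\<lambda>x. \<phi> x *\<^sub>R b)"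
   by (intro l2inner_tendsto_left wgrad_L2 z G \<phi>b)
  have 3: "l2inner U (z k) ?d = - l2inner U (wgrad U (z k)) (\<lambda>x. \<phi> x *\<^sub>R b)" for k
   using H01_has_weak_gradient[OF z] \<phi> b by (simp add: has_weak_gradient_def l2inner_def mult.commute)
  have "l2inner U y ?d = - l2inner U G (\<lambda>x. \<phi> x *\<^sub>R b)"
   by (rule LIMSEQ_unique[OF 1[unfolded 3] tendsto_minus[OF 2]])
  then show "(\<integral>x. y x * ?d x \<partial>lebesgue_on U) = - (\<integral>x. (G x \<bullet> b) * \<phi> x \<partial>lebesgue_on U)"
   by (simp add: l2inner_def mult.commute)
 qed
 have "\<exists>\<phi>\<in>test_functions U. l2norm U (\<lambda>x. \<phi> x - y x) < e \<and> l2norm U (\<lambda>x. gradient \<phi> x - G x) < e"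
  if "0 < e" for e
 proof -
  have "eventually (\<lambda>k. l2norm U (\<lambda>x. z k x - y x) < e / 2
    \<and> l2norm U (\<lambda>x. wgrad U (z k) x - G x) < e / 2) sequentially"
   using y(2) G(2) that by (intro eventually_conj order_tendstoD(2)) auto
  then obtain k where k: "l2norm U (\<lambda>x. z k x - y x) < e / 2" "l2norm U (\<lambda>x. wgrad U (z k) x - G x) < e / 2"
   by (auto simp: eventually_sequentially)
  obtain \<phi> where \<phi>: "!!j. \<phi> j \<in> test_functions U" "(\<lambda>j. l2norm U (\<lambda>x. \<phi> j x - z k x)) \<longlonglongrightarrow> 0"
   "(\<lambda>j. vnorm U (\<lambda>x. \<phi> j x - z k x)) \<longlonglongrightarrow> 0" using H01_approximation[OF z[of k]] by blast
  have "eventually (\<lambda>j. l2norm U (\<lambda>x. \<phi> j x - z k x) < e / 2 \<and> vnorm U (\<lambda>x. \<phi> j x - z k x) < e / 2) sequentially"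
   using \<phi>(2,3) that by (intro eventually_conj order_tendstoD(2)) auto
  then obtain j where j: "l2norm U (\<lambda>x. \<phi> j x - z k x) < e / 2" "vnorm U (\<lambda>x. \<phi> j x - z k x) < e / 2"
   by (auto simp: eventually_sequentially)
  have "l2norm U (\<lambda>x. \<phi> j x - y x) < e"
   using l2norm_triangle_diff[OF test_L2[OF \<phi>(1)[of j] sets_U] H01_L2[OF z[of k]] y(1)] j(1) k(1) by linarith
  moreover have "l2norm U (\<lambda>x. wgrad U (\<phi> j) x - G x) < e"
   using l2norm_triangle_diff[OF wgrad_L2[OF test_H01[OF \<phi>(1)[of j]]] wgrad_L2[OF z[of k]] G(1)]
    j(2) k(2) vnorm_diff[OF test_H01[OF \<phi>(1)[of j]] z[of k]] by linarith
  moreover have "l2norm U (\<lambda>x. wgrad U (\<phi> j) x - G x) = l2norm U (\<lambda>x. gradient (\<phi> j) x - G x)"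
  proof (rule l2norm_AE_cong[OF sets_U])
   show "(\<lambda>x. wgrad U (\<phi> j) x - G x) \<in> L2 U" by (intro L2_diff wgrad_L2 test_H01 \<phi> G)
   show "AE x in lebesgue_on U. wgrad U (\<phi> j) x - G x = gradient (\<phi> j) x - G x"
    using wgrad_test[OF \<phi>(1)[of j]] by eventually_elim simp
  qed
  ultimately show ?thesis using \<phi>(1) by auto
 qed
 then show "y \<in> H01 U" using y(1) wG by (auto simp: H01_characterization)
qed

lemma vnorm_test: "\<phi> \<in> test_functions U ==> vnorm U \<phi> = l2norm UNIV (gradient \<phi>)"
proof -
 assume \<phi>: "\<phi> \<in> test_functions U"
 have "vnorm U \<phi> = l2norm U (gradient \<phi>)"
  unfolding vnorm_def by (rule l2norm_AE_cong[OF sets_U wgrad_L2[OF test_H01[OF \<phi>]] wgrad_test[OF \<phi>]])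
 also have "... = l2norm UNIV (gradient \<phi>)"
  by (rule l2norm_zero_extension[OF sets_U]) (metis gradient_support[OF \<phi>] subsetD)
 finally show ?thesis .
qed

text \<open>Shifting a test function by more than the diameter of \<open>U\<close> separates the supports, so the
 shift estimate bounds the function itself.\<close>

lemma Poincare:
 obtains D where "0 < D" "!!z. z \<in> H01 U ==> l2norm U z <= D * vnorm U z"
proof -
 obtain B where B: "0 < B" "!!x. x \<in> U ==> norm x <= B"
  using bounded_U by (auto simp: bounded_pos)
 obtain e :: 'a where e: "e \<in> Basis" by (meson SOME_Basis)
 define h where "h = (3 * B) *\<^sub>R e"
 have nh: "norm h = 3 * B" using B(1) e by (simp add: h_def)
 have test: "l2norm U \<phi> <= (3 * B) * vnorm U \<phi>" if \<phi>: "\<phi> \<in> test_functions U" for \<phi>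
 proof -
  note supp = test_zero_outside[OF \<phi>]
  have disj: "\<phi> (x + h) * \<phi> x = 0" for x
  proof (cases "x \<in> U \<and> x + h \<in> U")
   case True
   then have "norm h <= B + B"
    using norm_triangle_ineq4[of "x + h" x] B(2)[of x] B(2)[of "x + h"] by simp
   with nh B(1) show ?thesis by simp
  qed (use supp in auto)
  have U: "UNIV \<in> sets lebesgue" by simp
  have a: "\<phi> \<in> L2 UNIV" by (rule test_L2[OF \<phi> U])
  have b: "(\<lambda>x. \<phi> (x + h)) \<in> L2 UNIV" by (rule test_translate_L2[OF \<phi>])
  have "(l2norm UNIV \<phi>)\<^sup>2 <= (l2norm UNIV (\<lambda>x. \<phi> (x + h) - \<phi> x))\<^sup>2"
  proof -
   have "l2inner UNIV (\<lambda>x. \<phi> (x + h)) \<phi> = 0" unfolding l2inner_def inner_real_def disj by simp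
   then show ?thesis unfolding l2norm_diff_power2[OF b a] by simp
  qed
  then have "l2norm UNIV \<phi> <= l2norm UNIV (\<lambda>x. \<phi> (x + h) - \<phi> x)"
   by (rule power2_le_imp_le) (rule l2norm_nonneg)
  also have "... <= norm h * l2norm UNIV (gradient \<phi>)" by (rule l2norm_shift_le[OF \<phi>])
  finally show ?thesis
   using supp by (simp add: nh vnorm_test[OF \<phi>] l2norm_zero_extension[OF sets_U])
 qed
 have "l2norm U z <= (3 * B) * vnorm U z" if z: "z \<in> H01 U" for z
 proof -
  obtain \<phi> where \<phi>: "!!k. \<phi> k \<in> test_functions U" "(\<lambda>k. l2norm U (\<lambda>x. \<phi> k x - z x)) \<longlonglongrightarrow> 0"
   "(\<lambda>k. vnorm U (\<lambda>x. \<phi> k x - z x)) \<longlonglongrightarrow> 0" using H01_approximation[OF z] by blast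
  have "(\<lambda>k. l2norm U (\<phi> k)) \<longlonglongrightarrow> l2norm U z"
   by (intro l2norm_tendsto test_L2[OF \<phi>(1) sets_U] H01_L2 z \<phi>)
  moreover have "(\<lambda>k. vnorm U (\<phi> k)) \<longlonglongrightarrow> vnorm U z"
   using \<phi>(3) unfolding vnorm_diff[OF test_H01[OF \<phi>(1)] z] unfolding vnorm_def
   by (intro l2norm_tendsto wgrad_L2 test_H01 \<phi> z)
  ultimately show ?thesis using test[OF \<phi>(1)]
   by (intro LIMSEQ_le[of "\<lambda>k. l2norm U (\<phi> k)" _ "\<lambda>k. (3 * B) * vnorm U (\<phi> k)"]) (auto intro!: tendsto_intros)
 qed
 with B(1) show ?thesis using that[of "3 * B"] by simp
qed

end

section \<open>Averages over dyadic cubes\<close>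

lemma l2inner_mult_right: "l2inner S k (\<lambda>x. c * f x) = c * l2inner S k f"
 for f :: "'a::euclidean_space \<Rightarrow> real"
 using l2inner_scaleR_right[of S k c f] by simp

definition cell :: "nat \<Rightarrow> 'a::euclidean_space \<Rightarrow> 'a set" where
 "cell k x = {y. \<forall>b\<in>Basis. \<lfloor>2 ^ k * (y \<bullet> b)\<rfloor> = \<lfloor>2 ^ k * (x \<bullet> b)\<rfloor>}"

lemma cell_eq: "y \<in> cell k x ==> cell k y = cell k x"
 by (auto simp: cell_def)

lemma cell_self: "x \<in> cell k x"
 by (simp add: cell_def)

lemma cell_sets [measurable]: "cell k x \<in> sets borel"
 unfolding cell_def by measurable

lemma cell_Suc: "cell (Suc k) x \<subseteq> cell k x"
proof
 fix y assume y: "y \<in> cell (Suc k) x"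
 have half: "\<lfloor>2 ^ k * t\<rfloor> = \<lfloor>2 ^ Suc k * t\<rfloor> div 2" for t :: real
  using floor_divide_real_eq_div[of 2 "2 ^ Suc k * t"] by simp
 show "y \<in> cell k x"
  unfolding cell_def mem_Collect_eq half using y by (simp add: cell_def)
qed

lemma cell_between_boxes:
 fixes x :: "'a::euclidean_space" and k :: nat
 defines "l \<equiv> \<Sum>b\<in>Basis. (\<lfloor>2 ^ k * (x \<bullet> b)\<rfloor> / 2 ^ k) *\<^sub>R b"
 shows "box l (l + (1 / 2 ^ k) *\<^sub>R One) \<subseteq> cell k x" "cell k x \<subseteq> cbox l (l + (1 / 2 ^ k) *\<^sub>R One)"
proof -
 have l: "l \<bullet> b = \<lfloor>2 ^ k * (x \<bullet> b)\<rfloor> / 2 ^ k" if "b \<in> Basis" for b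
  using that by (simp add: l_def inner_sum_left inner_Basis if_distrib sum.delta cong: if_cong)
 show "box l (l + (1 / 2 ^ k) *\<^sub>R One) \<subseteq> cell k x"
 proof
  fix y assume y: "y \<in> box l (l + (1 / 2 ^ k) *\<^sub>R One)"
  have "\<lfloor>2 ^ k * (y \<bullet> b)\<rfloor> = \<lfloor>2 ^ k * (x \<bullet> b)\<rfloor>" if b: "b \<in> Basis" for b
  proof (rule floor_unique)
   have "l \<bullet> b < y \<bullet> b" "y \<bullet> b < l \<bullet> b + 1 / 2 ^ k"
    using y b by (auto simp: mem_box inner_add_left)
   then have "of_int \<lfloor>2 ^ k * (x \<bullet> b)\<rfloor> / 2 ^ k < y \<bullet> b" "y \<bullet> b < (of_int \<lfloor>2 ^ k * (x \<bullet> b)\<rfloor> + 1) / 2 ^ k"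
    unfolding l[OF b] add_divide_distrib by simp_all
   then have "of_int \<lfloor>2 ^ k * (x \<bullet> b)\<rfloor> < y \<bullet> b * 2 ^ k" "y \<bullet> b * 2 ^ k < of_int \<lfloor>2 ^ k * (x \<bullet> b)\<rfloor> + 1"
    by (simp_all only: pos_divide_less_eq pos_less_divide_eq zero_less_power zero_less_numeral)
   then show "of_int \<lfloor>2 ^ k * (x \<bullet> b)\<rfloor> <= 2 ^ k * (y \<bullet> b)" "2 ^ k * (y \<bullet> b) < of_int \<lfloor>2 ^ k * (x \<bullet> b)\<rfloor> + 1"
    by (simp_all only: mult.commute less_imp_le)
  qed
  then show "y \<in> cell k x" by (simp add: cell_def)
 qed
 show "cell k x \<subseteq> cbox l (l + (1 / 2 ^ k) *\<^sub>R One)"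
 proof
  fix y assume y: "y \<in> cell k x"
  have "l \<bullet> b <= y \<bullet> b \<and> y \<bullet> b <= l \<bullet> b + 1 / 2 ^ k" if b: "b \<in> Basis" for b
  proof -
   have "\<lfloor>2 ^ k * (y \<bullet> b)\<rfloor> = \<lfloor>2 ^ k * (x \<bullet> b)\<rfloor>" using y b by (simp add: cell_def)
   then have "of_int \<lfloor>2 ^ k * (x \<bullet> b)\<rfloor> <= 2 ^ k * (y \<bullet> b)" "2 ^ k * (y \<bullet> b) < of_int \<lfloor>2 ^ k * (x \<bullet> b)\<rfloor> + 1"
    by linarith+
   then have "of_int \<lfloor>2 ^ k * (x \<bullet> b)\<rfloor> / 2 ^ k <= y \<bullet> b" "y \<bullet> b < (of_int \<lfloor>2 ^ k * (x \<bullet> b)\<rfloor> + 1) / 2 ^ k"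
    by (simp_all only: pos_divide_le_eq pos_less_divide_eq zero_less_power zero_less_numeral mult.commute)
   then show ?thesis unfolding l[OF b] add_divide_distrib by simp
  qed
  then show "y \<in> cbox l (l + (1 / 2 ^ k) *\<^sub>R One)" by (auto simp: mem_box inner_add_left)
 qed
qed

lemma emeasure_cell: "emeasure lborel (cell k x) = ennreal ((1 / 2 ^ k) ^ DIM('a))"
 for x :: "'a::euclidean_space"
proof -
 define l where "l = (\<Sum>b\<in>(Basis::'a set). (\<lfloor>2 ^ k * (x \<bullet> b)\<rfloor> / 2 ^ k) *\<^sub>R b)"
 note sub = cell_between_boxes[of k x, folded l_def]
 have "emeasure lborel (box l (l + (1 / 2 ^ k) *\<^sub>R One)) = ennreal ((1 / 2 ^ k) ^ DIM('a))"
  by (subst emeasure_lborel_box) (auto simp: inner_add_left)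
 moreover have "emeasure lborel (cbox l (l + (1 / 2 ^ k) *\<^sub>R One)) = ennreal ((1 / 2 ^ k) ^ DIM('a))"
  by (subst emeasure_lborel_cbox) (auto simp: inner_add_left)
 ultimately show ?thesis
  using emeasure_mono[OF sub(1), of lborel] emeasure_mono[OF sub(2), of lborel] cell_sets[of k x]
  by (intro antisym) simp_all
qed

lemma cell_diff:
 assumes "y \<in> cell k x" "b \<in> Basis"
 shows "\<bar>(y - x) \<bullet> b\<bar> <= 1 / 2 ^ k"
proof -
 have "\<lfloor>2 ^ k * (y \<bullet> b)\<rfloor> = \<lfloor>2 ^ k * (x \<bullet> b)\<rfloor>" using assms by (simp add: cell_def)
 then have "\<bar>2 ^ k * (y \<bullet> b) - 2 ^ k * (x \<bullet> b)\<bar> <= 1" by linarith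
 then have "\<bar>2 ^ k * ((y - x) \<bullet> b)\<bar> <= 1" by (simp add: inner_diff_left right_diff_distrib)
 then show ?thesis by (simp add: abs_mult field_simps)
qed

definition cell_average :: "nat \<Rightarrow> ('a::euclidean_space \<Rightarrow> real) \<Rightarrow> 'a \<Rightarrow> real" where
 "cell_average k f x = (2 ^ k) ^ DIM('a) * l2inner UNIV (indicator (cell k x)) f"

lemma cell_indicator_L2: "(indicator (cell k x) :: 'a \<Rightarrow> real) \<in> L2 UNIV"
 and cell_indicator_norm: "(l2norm UNIV (indicator (cell k x) :: 'a \<Rightarrow> real))\<^sup>2 = (1 / 2 ^ k) ^ DIM('a)"
 for x :: "'a::euclidean_space"
proof -
 have sq: "(norm (indicator (cell k x) y :: real))\<^sup>2 = indicator (cell k x) y" for y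
  by (simp add: indicator_def)
 have i: "integrable lborel (indicator (cell k x) :: 'a \<Rightarrow> real)"
  using emeasure_cell[of k x] by (intro integrable_real_indicator) auto
 then have i': "integrable (lebesgue_on UNIV) (indicator (cell k x) :: 'a \<Rightarrow> real)"
  by (simp add: lebesgue_on_UNIV_eq integrable_completion)
 then show "(indicator (cell k x) :: 'a \<Rightarrow> real) \<in> L2 UNIV"
  using borel_measurable_integrable[OF i'] by (simp only: L2_def mem_Collect_eq sq simp_thms)
 show "(l2norm UNIV (indicator (cell k x) :: 'a \<Rightarrow> real))\<^sup>2 = (1 / 2 ^ k) ^ DIM('a)"
  unfolding l2norm_power2_integral sq
  by (subst integral_lebesgue_eq_lborel) (simp_all add: measure_def emeasure_cell)
qed

lemma cell_average_bound:
 fixes f :: "'a::euclidean_space \<Rightarrow> real"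
 assumes "f \<in> L2 UNIV"
 shows "\<bar>cell_average k f x\<bar> <= sqrt ((2 ^ k) ^ DIM('a)) * l2norm UNIV f"
proof -
 let ?i = "indicator (cell k x) :: 'a \<Rightarrow> real"
 let ?N = "(2 ^ k :: real) ^ DIM('a)"
 have N: "0 < ?N" by simp
 have n: "l2norm UNIV ?i = 1 / sqrt ?N"
  using real_sqrt_unique[OF cell_indicator_norm[of k x] l2norm_nonneg]
  by (simp add: power_one_over real_sqrt_divide)
 have "\<bar>cell_average k f x\<bar> = ?N * \<bar>l2inner UNIV ?i f\<bar>" by (simp add: cell_average_def abs_mult)
 also have "... <= ?N * (1 / sqrt ?N * l2norm UNIV f)"
  using l2inner_Cauchy_Schwarz[OF cell_indicator_L2 assms, of k x] n N by (intro mult_left_mono) auto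
 also have "... = (?N / sqrt ?N) * l2norm UNIV f" by simp
 also have "?N / sqrt ?N = sqrt ?N" using N by (intro real_div_sqrt) simp
 finally show ?thesis .
qed

lemma cell_average_cell: "y \<in> cell k x ==> cell_average k f y = cell_average k f x"
 by (simp add: cell_average_def cell_eq)

lemma cell_average_diff:
 "f \<in> L2 UNIV ==> h \<in> L2 UNIV ==> cell_average k (\<lambda>x. f x - h x) x = cell_average k f x - cell_average k h x"
 by (simp add: cell_average_def l2inner_diff_right cell_indicator_L2 right_diff_distrib)

text \<open>Every cell meets a fixed countable dense set, so averages are described by countably many
 numbers.\<close>

lemma cell_representatives:
 obtains S :: "'a::euclidean_space set" where "countable S" "!!k x. \<exists>y\<in>S. y \<in> cell k x"
proof -
 obtain S :: "'a set" where S: "countable S" "!!X. open X ==> X \<noteq> {} ==> \<exists>y\<in>S. y \<in> X"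
  using countable_dense_setE by metis
 have "\<exists>y\<in>S. y \<in> cell k x" for k and x :: 'a
 proof -
  define l where "l = (\<Sum>b\<in>(Basis::'a set). (\<lfloor>2 ^ k * (x \<bullet> b)\<rfloor> / 2 ^ k) *\<^sub>R b)"
  have "box l (l + (1 / 2 ^ k) *\<^sub>R One) \<noteq> {}" by (simp add: box_ne_empty inner_add_left)
  then show ?thesis using S(2)[OF open_box] cell_between_boxes(1)[of k x] unfolding l_def by blast
 qed
 with S(1) show ?thesis by (rule that)
qed

lemma cell_average_measurable: "cell_average k f \<in> borel_measurable borel"
 for f :: "'a::euclidean_space \<Rightarrow> real"
proof (rule borel_measurableI)
 fix W :: "real set" assume "open W"
 obtain S :: "'a set" where S: "countable S" "!!k x. \<exists>y\<in>S. y \<in> cell k x" using cell_representatives by blast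
 let ?Z = "{y \<in> S. cell_average k f y \<in> W}"
 have "cell_average k f -` W = (\<Union>y\<in>?Z. cell k y)"
 proof (intro equalityI subsetI)
  fix x assume x: "x \<in> cell_average k f -` W"
  obtain y where y: "y \<in> S" "y \<in> cell k x" using S(2) by blast
  then show "x \<in> (\<Union>y\<in>?Z. cell k y)"
   using x cell_average_cell[OF y(2), of f] cell_eq[OF y(2)] cell_self[of x k] by auto
 next
  fix x assume "x \<in> (\<Union>y\<in>?Z. cell k y)"
  then obtain y where "y \<in> ?Z" "x \<in> cell k y" by blast
  then show "x \<in> cell_average k f -` W" using cell_average_cell[of x k y f] by simp
 qed
 moreover have "(\<Union>y\<in>?Z. cell k y) \<in> sets borel"
  by (rule sets.countable_UN') (auto intro: countable_subset[OF _ S(1)])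
 ultimately show "cell_average k f -` W \<inter> space borel \<in> sets borel" by simp
qed

text \<open>On a cell of the finer grid, the coarser average is constant.\<close>

lemma cell_average_Suc_diff:
 fixes f :: "'a::euclidean_space \<Rightarrow> real"
 assumes "f \<in> L2 UNIV" "(\<lambda>x. f x - cell_average k f x) \<in> L2 UNIV"
 shows "cell_average (Suc k) f x - cell_average k f x = cell_average (Suc k) (\<lambda>x. f x - cell_average k f x) x"
proof -
 let ?i = "indicator (cell (Suc k) x) :: 'a \<Rightarrow> real"
 let ?N = "(2 ^ Suc k :: real) ^ DIM('a)"
 have A: "cell_average k f \<in> L2 UNIV"
  using L2_diff[OF assms] by simp
 have "l2inner UNIV ?i (cell_average k f) = l2inner UNIV ?i (\<lambda>y. cell_average k f x * ?i y)"
  unfolding l2inner_def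
 proof (intro Bochner_Integration.integral_cong refl)
  fix y
  show "?i y \<bullet> cell_average k f y = ?i y \<bullet> (cell_average k f x * ?i y)"
   using cell_average_cell[of y k x f] cell_Suc[of k x] by (auto simp: indicator_def)
 qed
 also have "... = cell_average k f x * (1 / 2 ^ Suc k) ^ DIM('a)"
  using l2inner_scaleR_right[of UNIV ?i "cell_average k f x" ?i] cell_indicator_norm[of "Suc k" x]
  by (simp add: l2norm_power2)
 finally have "?N * l2inner UNIV ?i (cell_average k f) = cell_average k f x"
  by (simp add: power_one_over)
 then show ?thesis
  using cell_average_diff[OF assms(1) A, of "Suc k" x] by (simp add: cell_average_def)
qed

text \<open>The deviation from the average at \<open>x\<close> is bounded by the deviations from the values at the
 points of the cell, that is, by differences of shifts of length at most that of the diagonal.\<close>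

lemma cell_average_test_nn:
 fixes \<phi> :: "'a::euclidean_space \<Rightarrow> real"
 assumes \<phi>: "\<phi> \<in> test_functions U"
 shows "ennreal ((\<phi> x - cell_average k \<phi> x)\<^sup>2)
  <= ennreal ((2 ^ k) ^ DIM('a)) * (\<integral>\<^sup>+h. indicator (cbox (- ((1 / 2 ^ k) *\<^sub>R One)) ((1 / 2 ^ k) *\<^sub>R One)) h
    * ennreal ((\<phi> (x + h) - \<phi> x)\<^sup>2) \<partial>lborel)"
proof -
 let ?i = "indicator (cell k x) :: 'a \<Rightarrow> real"
 let ?N = "(2 ^ k :: real) ^ DIM('a)"
 let ?Q = "cbox (- ((1 / 2 ^ k) *\<^sub>R One)) ((1 / 2 ^ k) *\<^sub>R One) :: 'a set"
 have U: "UNIV \<in> sets lebesgue" by simp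
 note cont = test_continuous[OF \<phi>]
 have [measurable]: "\<phi> \<in> borel_measurable borel" by (rule borel_measurable_continuous_onI[OF cont])
 define h where "h y = ?i y * (\<phi> x - \<phi> y)" for y
 have hL2: "h \<in> L2 UNIV"
 proof -
  obtain B where B: "!!x. \<bar>\<phi> x\<bar> <= B" using test_bounded[OF \<phi>] by metis
  have [measurable]: "h \<in> borel_measurable borel" unfolding h_def by measurable
  have "integrable lborel (\<lambda>y. (norm (h y))\<^sup>2)"
  proof (rule Bochner_Integration.integrable_bound)
   show "integrable lborel (\<lambda>y. (2 * B)\<^sup>2 * ?i y)"
    using emeasure_cell[of k x] by (intro integrable_mult_right integrable_real_indicator) auto
   have "(h y)\<^sup>2 <= (2 * B)\<^sup>2 * ?i y" for y
   proof (cases "y \<in> cell k x")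
    case True
    have "\<bar>\<phi> x - \<phi> y\<bar> <= 2 * B" using B[of x] B[of y] by linarith
    then have "(\<phi> x - \<phi> y)\<^sup>2 <= (2 * B)\<^sup>2" using power_mono[of "\<bar>\<phi> x - \<phi> y\<bar>" "2 * B" 2] by simp
    with True show ?thesis by (simp add: h_def)
   qed (simp add: h_def)
   then show "AE y in lborel. norm ((norm (h y))\<^sup>2) <= norm ((2 * B)\<^sup>2 * ?i y)" by simp
  qed simp
  then show ?thesis
   by (auto simp: L2_def lebesgue_on_UNIV_eq integrable_completion measurable_completion)
 qed
 have "\<phi> x - cell_average k \<phi> x = ?N * l2inner UNIV ?i h"
 proof -
  have "l2inner UNIV ?i h = l2inner UNIV ?i (\<lambda>y. \<phi> x * ?i y - \<phi> y)"
   unfolding l2inner_def h_def by (intro Bochner_Integration.integral_cong) (auto simp: indicator_def)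
  also have "... = \<phi> x * (1 / 2 ^ k) ^ DIM('a) - l2inner UNIV ?i \<phi>"
   using cell_indicator_norm[of k x]
   by (simp add: l2inner_diff_right[OF L2_mult[OF cell_indicator_L2] test_L2[OF \<phi> U] cell_indicator_L2]
     l2inner_mult_right l2norm_power2)
  finally show ?thesis by (simp add: cell_average_def right_diff_distrib power_one_over)
 qed
 then have "(\<phi> x - cell_average k \<phi> x)\<^sup>2 = ?N\<^sup>2 * (l2inner UNIV ?i h)\<^sup>2" by (simp add: power_mult_distrib)
 also have "... <= ?N\<^sup>2 * ((l2norm UNIV ?i)\<^sup>2 * (l2norm UNIV h)\<^sup>2)"
  using power_mono[OF l2inner_Cauchy_Schwarz[OF cell_indicator_L2 hL2, of k x] abs_ge_zero, of 2]
  by (intro mult_left_mono) (simp_all add: power_mult_distrib)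
 also have "... = ?N * (l2norm UNIV h)\<^sup>2"
  unfolding cell_indicator_norm by (simp add: power_one_over power2_eq_square)
 finally have "ennreal ((\<phi> x - cell_average k \<phi> x)\<^sup>2) <= ennreal ?N * ennreal ((l2norm UNIV h)\<^sup>2)"
  by (simp add: ennreal_mult[symmetric] ennreal_leI)
 also have "ennreal ((l2norm UNIV h)\<^sup>2) = (\<integral>\<^sup>+y. ennreal ((h y)\<^sup>2) \<partial>lborel)"
  unfolding l2norm_power2_integral lebesgue_on_UNIV_eq
  using nn_integral_eq_integral[OF L2_integrable[OF hL2]]
  by (simp add: lebesgue_on_UNIV_eq nn_integral_completion)
 also have "... <= (\<integral>\<^sup>+y. indicator ?Q (y - x) * ennreal ((\<phi> (x + (y - x)) - \<phi> x)\<^sup>2) \<partial>lborel)"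
 proof (rule nn_integral_mono)
  fix y
  show "ennreal ((h y)\<^sup>2) <= indicator ?Q (y - x) * ennreal ((\<phi> (x + (y - x)) - \<phi> x)\<^sup>2)"
  proof (cases "y \<in> cell k x")
   case True
   have "y - x \<in> ?Q"
    unfolding mem_box
   proof
    fix b :: 'a assume b: "b \<in> Basis"
    from cell_diff[OF True b] b
    show "- ((1 / 2 ^ k) *\<^sub>R One) \<bullet> b <= (y - x) \<bullet> b \<and> (y - x) \<bullet> b <= ((1 / 2 ^ k) *\<^sub>R One) \<bullet> b"
     by (simp add: abs_le_iff)
   qed
   with True show ?thesis by (simp add: h_def power2_commute)
  qed (simp add: h_def)
 qed
 also have "... = (\<integral>\<^sup>+y. (\<lambda>h. indicator ?Q h * ennreal ((\<phi> (x + h) - \<phi> x)\<^sup>2)) (- x + y) \<partial>lborel)"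
  by simp
 also have "... = (\<integral>\<^sup>+h. indicator ?Q h * ennreal ((\<phi> (x + h) - \<phi> x)\<^sup>2) \<partial>distr lborel borel ((+) (- x)))"
  by (subst nn_integral_distr) auto
 finally show ?thesis by (simp add: lborel_distr_plus mult_left_mono)
qed

definition grid_const :: "'a::euclidean_space itself \<Rightarrow> real" where
 "grid_const _ = sqrt (2 ^ DIM('a)) * DIM('a)"

lemma cell_average_test:
 fixes \<phi> :: "'a::euclidean_space \<Rightarrow> real"
 assumes \<phi>: "\<phi> \<in> test_functions U"
 shows "(\<lambda>x. \<phi> x - cell_average k \<phi> x) \<in> L2 UNIV"
  and "l2norm UNIV (\<lambda>x. \<phi> x - cell_average k \<phi> x) <= grid_const TYPE('a) / 2 ^ k * l2norm UNIV (gradient \<phi>)"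
proof -
 let ?N = "(2 ^ k :: real) ^ DIM('a)"
 let ?Q = "cbox (- ((1 / 2 ^ k) *\<^sub>R One)) ((1 / 2 ^ k) *\<^sub>R One) :: 'a set"
 define g where "g = l2norm UNIV (gradient \<phi>)"
 define e where "e x = \<phi> x - cell_average k \<phi> x" for x
 note cont = test_continuous[OF \<phi>]
 have [measurable]: "\<phi> \<in> borel_measurable borel" by (rule borel_measurable_continuous_onI[OF cont])
 have [measurable]: "e \<in> borel_measurable borel"
  unfolding e_def using cell_average_measurable[of k \<phi>] by measurable
 have inner: "(\<integral>\<^sup>+x. indicator ?Q h * ennreal ((\<phi> (x + h) - \<phi> x)\<^sup>2) \<partial>lborel)
   <= indicator ?Q h * ennreal ((DIM('a) / 2 ^ k * g)\<^sup>2)" for h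
 proof (cases "h \<in> ?Q")
  case True
  have "norm h <= (\<Sum>b\<in>Basis. \<bar>h \<bullet> b\<bar>)" by (rule norm_le_l1)
  also have "... <= (\<Sum>b\<in>(Basis::'a set). 1 / 2 ^ k)"
  proof (rule sum_mono)
   fix b :: 'a assume b: "b \<in> Basis"
   with True have "- (1 / 2 ^ k) <= h \<bullet> b" "h \<bullet> b <= 1 / 2 ^ k" by (auto simp: mem_box)
   then show "\<bar>h \<bullet> b\<bar> <= 1 / 2 ^ k" by linarith
  qed
  finally have nh: "norm h <= DIM('a) / 2 ^ k" by simp
  have L2: "(\<lambda>x. \<phi> (x + h) - \<phi> x) \<in> L2 UNIV"
   using test_translate_L2[OF \<phi>, of h] test_translate_L2[OF \<phi>, of 0] by (intro L2_diff) auto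
  have "(\<integral>\<^sup>+x. ennreal ((\<phi> (x + h) - \<phi> x)\<^sup>2) \<partial>lborel) = ennreal ((l2norm UNIV (\<lambda>x. \<phi> (x + h) - \<phi> x))\<^sup>2)"
   unfolding l2norm_power2_integral
   using nn_integral_eq_integral[OF L2_integrable[OF L2]]
   by (simp add: lebesgue_on_UNIV_eq nn_integral_completion)
  also have "... <= ennreal ((DIM('a) / 2 ^ k * g)\<^sup>2)"
  proof (intro ennreal_leI power_mono l2norm_nonneg)
   have "l2norm UNIV (\<lambda>x. \<phi> (x + h) - \<phi> x) <= norm h * g" unfolding g_def by (rule l2norm_shift_le[OF \<phi>])
   also have "... <= DIM('a) / 2 ^ k * g" by (intro mult_right_mono nh) (simp add: g_def l2norm_nonneg)
   finally show "l2norm UNIV (\<lambda>x. \<phi> (x + h) - \<phi> x) <= DIM('a) / 2 ^ k * g" .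
  qed
  finally show ?thesis using True by simp
 qed simp
 have Qm: "emeasure lborel ?Q = ennreal ((2 / 2 ^ k) ^ DIM('a))"
 proof -
  have "emeasure lborel ?Q = ennreal (\<Prod>b\<in>(Basis::'a set). ((1 / 2 ^ k) *\<^sub>R One - (- ((1 / 2 ^ k) *\<^sub>R One))) \<bullet> b)"
   by (rule emeasure_lborel_cbox) simp
  also have "(\<Prod>b\<in>(Basis::'a set). ((1 / 2 ^ k) *\<^sub>R One - (- ((1 / 2 ^ k) *\<^sub>R One))) \<bullet> b) = (\<Prod>b\<in>(Basis::'a set). 2 / 2 ^ k)"
   by (intro prod.cong refl) (simp add: inner_add_left)
  finally show ?thesis by simp
 qed
 have "(\<integral>\<^sup>+x. ennreal ((e x)\<^sup>2) \<partial>lborel)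
   <= (\<integral>\<^sup>+x. ennreal ?N * (\<integral>\<^sup>+h. indicator ?Q h * ennreal ((\<phi> (x + h) - \<phi> x)\<^sup>2) \<partial>lborel) \<partial>lborel)"
  unfolding e_def by (intro nn_integral_mono cell_average_test_nn[OF \<phi>])
 also have "... = ennreal ?N * (\<integral>\<^sup>+x. (\<integral>\<^sup>+h. indicator ?Q h * ennreal ((\<phi> (x + h) - \<phi> x)\<^sup>2) \<partial>lborel) \<partial>lborel)"
  by (rule nn_integral_cmult) simp
 also have "(\<integral>\<^sup>+x. (\<integral>\<^sup>+h. indicator ?Q h * ennreal ((\<phi> (x + h) - \<phi> x)\<^sup>2) \<partial>lborel) \<partial>lborel)
   = (\<integral>\<^sup>+h. (\<integral>\<^sup>+x. indicator ?Q h * ennreal ((\<phi> (x + h) - \<phi> x)\<^sup>2) \<partial>lborel) \<partial>lborel)"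
  by (rule lborel_pair.Fubini') simp
 also have "... <= (\<integral>\<^sup>+h. ennreal ((DIM('a) / 2 ^ k * g)\<^sup>2) * indicator ?Q h \<partial>lborel)"
  using inner by (intro nn_integral_mono) (simp add: mult.commute)
 also have "... = ennreal ((DIM('a) / 2 ^ k * g)\<^sup>2) * ennreal ((2 / 2 ^ k) ^ DIM('a))"
  by (subst nn_integral_cmult_indicator) (simp_all add: Qm)
 also have "ennreal ?N * (ennreal ((DIM('a) / 2 ^ k * g)\<^sup>2) * ennreal ((2 / 2 ^ k) ^ DIM('a)))
   = ennreal ((grid_const TYPE('a) / 2 ^ k * g)\<^sup>2)"
  by (simp add: grid_const_def power_mult_distrib power_divide ennreal_mult[symmetric])
 finally have le: "(\<integral>\<^sup>+x. ennreal ((e x)\<^sup>2) \<partial>lborel) <= ennreal ((grid_const TYPE('a) / 2 ^ k * g)\<^sup>2)"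
  by (simp add: mult_left_mono)
 then have int: "integrable lborel (\<lambda>x. (e x)\<^sup>2)"
  by (intro integrableI_bounded) (auto intro: le_less_trans)
 then have e: "e \<in> L2 UNIV"
  by (auto simp: L2_def lebesgue_on_UNIV_eq integrable_completion measurable_completion)
 then show "(\<lambda>x. \<phi> x - cell_average k \<phi> x) \<in> L2 UNIV" by (simp add: e_def[abs_def])
 have "ennreal ((l2norm UNIV e)\<^sup>2) = (\<integral>\<^sup>+x. ennreal ((e x)\<^sup>2) \<partial>lborel)"
  unfolding l2norm_power2_integral
  using nn_integral_eq_integral[OF L2_integrable[OF e]]
  by (simp add: lebesgue_on_UNIV_eq nn_integral_completion)
 with le have "ennreal ((l2norm UNIV e)\<^sup>2) <= ennreal ((grid_const TYPE('a) / 2 ^ k * g)\<^sup>2)" by (simp only:)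
 then have "(l2norm UNIV e)\<^sup>2 <= (grid_const TYPE('a) / 2 ^ k * g)\<^sup>2"
  by (subst (asm) ennreal_le_iff) simp_all
 moreover have "0 <= grid_const TYPE('a) / 2 ^ k * g" by (simp add: grid_const_def g_def l2norm_nonneg)
 ultimately have "l2norm UNIV e <= grid_const TYPE('a) / 2 ^ k * g" by (rule power2_le_imp_le)
 then show "l2norm UNIV (\<lambda>x. \<phi> x - cell_average k \<phi> x) <= grid_const TYPE('a) / 2 ^ k * l2norm UNIV (gradient \<phi>)"
  by (simp add: e_def[abs_def] g_def)
qed

context bounded_open
begin

definition zero_ext :: "('a \<Rightarrow> real) \<Rightarrow> 'a \<Rightarrow> real" where
 "zero_ext f x = indicator U x * f x"

lemma zero_ext_L2: "f \<in> L2 U ==> zero_ext f \<in> L2 UNIV"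
proof -
 assume f: "f \<in> L2 U"
 have "zero_ext f \<in> borel_measurable lebesgue"
  using L2_measurable[OF f] sets_U unfolding zero_ext_def
  by (simp add: borel_measurable_restrict_space_iff)
 moreover have "integrable lebesgue (\<lambda>x. indicator U x *\<^sub>R (norm (f x))\<^sup>2)"
  using L2_integrable[OF f] sets_U by (simp add: integrable_restrict_space)
 moreover have "(\<lambda>x. indicator U x *\<^sub>R (norm (f x))\<^sup>2) = (\<lambda>x. (norm (zero_ext f x))\<^sup>2)"
  by (auto simp: zero_ext_def indicator_def)
 ultimately show ?thesis by (simp add: L2_def lebesgue_on_UNIV_eq)
qed

lemma l2norm_zero_ext: "l2norm UNIV (zero_ext f) = l2norm U f"
proof -
 have "l2norm UNIV (zero_ext f) = l2norm U (zero_ext f)"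
  by (rule l2norm_zero_extension[OF sets_U, symmetric]) (simp add: zero_ext_def)
 also have "... = l2norm U f"
  unfolding l2norm_def l2inner_def
  by (rule arg_cong[where f = sqrt], rule Bochner_Integration.integral_cong) (auto simp: zero_ext_def)
 finally show ?thesis .
qed

lemma cell_average_tendsto:
 assumes "!!i. f i \<in> L2 UNIV" "h \<in> L2 UNIV" "(\<lambda>i. l2norm UNIV (\<lambda>x. f i x - h x)) \<longlonglongrightarrow> 0"
 shows "(\<lambda>i. cell_average k (f i) x) \<longlonglongrightarrow> cell_average k h (x::'a)"
 unfolding cell_average_def
 by (subst (1 2) l2inner_commute)
  (intro tendsto_intros l2inner_tendsto_left assms cell_indicator_L2)

lemma
 assumes z: "z \<in> H01 U"
 shows cell_average_error_L2: "(\<lambda>x. zero_ext z x - cell_average k (zero_ext z) x) \<in> L2 UNIV"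
  and cell_average_error: "l2norm UNIV (\<lambda>x. zero_ext z x - cell_average k (zero_ext z) x)
   <= grid_const TYPE('a) / 2 ^ k * vnorm U z"
proof -
 obtain \<phi> where \<phi>: "!!i. \<phi> i \<in> test_functions U" "(\<lambda>i. l2norm U (\<lambda>x. \<phi> i x - z x)) \<longlonglongrightarrow> 0"
  "(\<lambda>i. vnorm U (\<lambda>x. \<phi> i x - z x)) \<longlonglongrightarrow> 0" using H01_approximation[OF z] by blast
 have U: "UNIV \<in> sets lebesgue" by simp
 have \<phi>L2: "\<phi> i \<in> L2 UNIV" for i by (rule test_L2[OF \<phi>(1) U])
 have zL2: "zero_ext z \<in> L2 UNIV" by (rule zero_ext_L2[OF H01_L2[OF z]])
 have lim: "(\<lambda>i. l2norm UNIV (\<lambda>x. \<phi> i x - zero_ext z x)) \<longlonglongrightarrow> 0"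
 proof -
  have "(\<lambda>x. \<phi> i x - zero_ext z x) = zero_ext (\<lambda>x. \<phi> i x - z x)" for i
   using test_zero_outside[OF \<phi>(1)[of i]] by (auto simp: zero_ext_def indicator_def)
  then show ?thesis using \<phi>(2) by (simp add: l2norm_zero_ext)
 qed
 obtain r where r: "strict_mono r" "AE x in lebesgue_on UNIV. (\<lambda>i. \<phi> (r i) x) \<longlonglongrightarrow> zero_ext z x"
  using L2_AE_subsequence[OF \<phi>L2 zL2 lim] by blast
 have ae: "AE x in lebesgue_on UNIV. (\<lambda>i. \<phi> (r i) x - cell_average k (\<phi> (r i)) x)
   \<longlonglongrightarrow> zero_ext z x - cell_average k (zero_ext z) x"
  using r(2)
 proof eventually_elim
  case (elim x)
  have "(\<lambda>i. cell_average k (\<phi> (r i)) x) \<longlonglongrightarrow> cell_average k (zero_ext z) x"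
   using LIMSEQ_subseq_LIMSEQ[OF cell_average_tendsto[OF \<phi>L2 zL2 lim, of k x] r(1)] by (simp add: o_def)
  with elim show ?case by (rule tendsto_diff)
 qed
 have "(\<lambda>i. vnorm U (\<phi> i)) \<longlonglongrightarrow> vnorm U z"
  using \<phi>(3) unfolding vnorm_diff[OF test_H01[OF \<phi>(1)] z] unfolding vnorm_def
  by (intro l2norm_tendsto wgrad_L2 test_H01 \<phi> z)
 then have vlim: "(\<lambda>i. grid_const TYPE('a) / 2 ^ k * vnorm U (\<phi> (r i))) \<longlonglongrightarrow> grid_const TYPE('a) / 2 ^ k * vnorm U z"
  using LIMSEQ_subseq_LIMSEQ[OF _ r(1)] by (intro tendsto_intros) (simp add: o_def)
 have err: "(\<lambda>x. zero_ext z x - cell_average k (zero_ext z) x) \<in> L2 UNIV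
   \<and> l2norm UNIV (\<lambda>x. zero_ext z x - cell_average k (zero_ext z) x) <= K"
  if "grid_const TYPE('a) / 2 ^ k * vnorm U z < K" for K
 proof -
  have "eventually (\<lambda>i. l2norm UNIV (\<lambda>x. \<phi> (r i) x - cell_average k (\<phi> (r i)) x) <= K) sequentially"
   using order_tendstoD(2)[OF vlim that]
  proof eventually_elim
   case (elim i)
   then show ?case using cell_average_test(2)[OF \<phi>(1)[of "r i"], of k] by (simp add: vnorm_test[OF \<phi>(1)])
  qed
  from L2_Fatou[OF U cell_average_test(1)[OF \<phi>(1)] ae this] show ?thesis by blast
 qed
 then show "(\<lambda>x. zero_ext z x - cell_average k (zero_ext z) x) \<in> L2 UNIV"
  using err[of "grid_const TYPE('a) / 2 ^ k * vnorm U z + 1"] by simp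
 show "l2norm UNIV (\<lambda>x. zero_ext z x - cell_average k (zero_ext z) x) <= grid_const TYPE('a) / 2 ^ k * vnorm U z"
  by (rule dense_ge, drule err) simp
qed

end

section \<open>Compactness and the first eigenvalue\<close>

lemma diagonal_convergent_subsequence:
 fixes a :: "nat \<Rightarrow> nat \<Rightarrow> real"
 assumes "!!n. bounded (range (a n))"
 obtains r where "strict_mono r" "!!n. convergent (\<lambda>i. a n (r i))"
proof -
 interpret subseqs "\<lambda>n s. convergent (\<lambda>i. a n (s i))"
 proof
  fix n and s :: "nat \<Rightarrow> nat" assume "strict_mono s"
  have "bounded (range (\<lambda>i. a n (s i)))"
   using assms[of n] by (rule bounded_subset) auto
  then obtain l r where "strict_mono r" "((\<lambda>i. a n (s i)) \<circ> r) \<longlonglongrightarrow> l"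
   using bounded_imp_convergent_subsequence by blast
  then show "\<exists>r'. strict_mono r' \<and> convergent (\<lambda>i. a n ((s \<circ> r') i))"
   by (auto simp: convergent_def o_def)
 qed
 have "convergent (\<lambda>i. a n (diagseq i))" for n
 proof -
  have "convergent (\<lambda>i. a n ((diagseq \<circ> ((+) (Suc n))) i))"
  proof (rule diagseq_holds)
   fix r s :: "nat \<Rightarrow> nat" and m assume "strict_mono r" "convergent (\<lambda>i. a m (s i))"
   then show "convergent (\<lambda>i. a m ((s \<circ> r) i))"
    using convergent_subseq_convergent[of "\<lambda>i. a m (s i)" r] by (simp add: o_def)
  qed
  then have "convergent (\<lambda>i. a n (diagseq (i + Suc n)))" by (simp add: o_def add.commute)
  then show ?thesis by (rule convergent_ignore_initial_segment[THEN iffD1])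
 qed
 with subseq_diagseq show ?thesis using that by blast
qed

context bounded_open
begin

lemma L2_restrict: "f \<in> L2 UNIV ==> f \<in> L2 U" for f :: "'a \<Rightarrow> real"
proof -
 assume f: "f \<in> L2 UNIV"
 have "f \<in> borel_measurable (lebesgue_on U)"
  using L2_measurable[OF f] by (simp add: lebesgue_on_UNIV_eq measurable_restrict_space1)
 moreover have "integrable (lebesgue_on U) (\<lambda>x. (norm (f x))\<^sup>2)"
  using integrable_mult_indicator[OF _ L2_integrable[OF f], of U] sets_U
  by (simp add: integrable_restrict_space lebesgue_on_UNIV_eq)
 ultimately show ?thesis by (simp add: L2_def)
qed

lemma l2norm_restrict_le:
 fixes f :: "'a \<Rightarrow> real"
 assumes "f \<in> L2 UNIV"
 shows "l2norm U f <= l2norm UNIV f"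
proof (rule power2_le_imp_le)
 have "(l2norm U f)\<^sup>2 = (\<integral>x. indicator U x *\<^sub>R (norm (f x))\<^sup>2 \<partial>lebesgue)"
  using sets_U by (simp add: l2norm_power2_integral integral_restrict_space)
 also have "... <= (\<integral>x. (norm (f x))\<^sup>2 \<partial>lebesgue)"
  using integrable_mult_indicator[OF _ L2_integrable[OF assms], of U] L2_integrable[OF assms] sets_U
  by (intro integral_mono) (auto simp: lebesgue_on_UNIV_eq indicator_def)
 finally show "(l2norm U f)\<^sup>2 <= (l2norm UNIV f)\<^sup>2"
  by (simp add: l2norm_power2_integral lebesgue_on_UNIV_eq)
qed (rule l2norm_nonneg)

lemma cell_average_L2:
 assumes "z \<in> H01 U"
 shows "cell_average k (zero_ext z) \<in> L2 UNIV"
 using L2_diff[OF zero_ext_L2[OF H01_L2[OF assms]] cell_average_error_L2[OF assms, of k]] by simp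

text \<open>A subsequence along which all averages over dyadic cubes converge is a Cauchy sequence, because
 the averages approximate the functions uniformly on bounded sets of \<open>H\<^sub>0\<^sup>1\<close>.\<close>

theorem Rellich:
 fixes z :: "nat \<Rightarrow> 'a \<Rightarrow> real"
 assumes z: "!!i. z i \<in> H01 U" and bound: "!!i. vnorm U (z i) <= M"
 obtains r :: "nat \<Rightarrow> nat" where "strict_mono r"
  "!!e. 0 < e ==> \<exists>N. \<forall>i\<ge>N. \<forall>j\<ge>N. l2norm U (\<lambda>x. z (r i) x - z (r j) x) < e"
proof -
 obtain D where D: "0 < D" "!!z. z \<in> H01 U ==> l2norm U z <= D * vnorm U z" using Poincare by blast
 have M: "0 <= M" using bound[of 0] vnorm_nonneg[of "z 0"] by linarith
 obtain S :: "'a set" where S: "countable S" "!!k x. \<exists>y\<in>S. y \<in> cell k x" using cell_representatives by blast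
 define B where "B k = sqrt ((2 ^ k) ^ DIM('a)) * (D * M)" for k :: nat
 have avg_bound: "\<bar>cell_average k (zero_ext (z i)) x\<bar> <= B k" for k i x
 proof -
  have "\<bar>cell_average k (zero_ext (z i)) x\<bar> <= sqrt ((2 ^ k) ^ DIM('a)) * l2norm U (z i)"
   using cell_average_bound[OF zero_ext_L2[OF H01_L2[OF z]], of k i x] by (simp add: l2norm_zero_ext)
  also have "l2norm U (z i) <= D * M"
   using D(2)[OF z[of i]] mult_left_mono[OF bound[of i], of D] D(1) by linarith
  finally show ?thesis by (simp add: B_def mult_left_mono)
 qed
 define P where "P = (UNIV :: nat set) \<times> S"
 have P: "countable P" "P \<noteq> {}" using S by (auto simp: P_def intro: countable_SIGMA)
 define a where "a n i = cell_average (fst (from_nat_into P n)) (zero_ext (z i)) (snd (from_nat_into P n))" for n i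
 have "bounded (range (a n))" for n
  unfolding bounded_iff a_def using avg_bound by auto
 then obtain r where r: "strict_mono r" "!!n. convergent (\<lambda>i. a n (r i))"
  using diagonal_convergent_subsequence by blast
 have conv: "convergent (\<lambda>i. cell_average k (zero_ext (z (r i))) x)" for k x
 proof -
  obtain y where y: "y \<in> S" "y \<in> cell k x" using S(2) by blast
  then obtain n where "from_nat_into P n = (k, y)"
   using from_nat_into_surj[OF P(1), of "(k, y)"] by (auto simp: P_def)
  then have "convergent (\<lambda>i. cell_average k (zero_ext (z (r i))) y)" using r(2)[of n] by (simp add: a_def)
  then show ?thesis by (simp add: cell_average_cell[OF y(2)])
 qed
 define l where "l k x = lim (\<lambda>i. cell_average k (zero_ext (z (r i))) x)" for k x
 have l: "(\<lambda>i. cell_average k (zero_ext (z (r i))) x) \<longlonglongrightarrow> l k x" for k x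
  using conv by (simp add: l_def convergent_LIMSEQ_iff)
 have l_bound: "\<bar>l k x\<bar> <= B k" for k x
  by (rule LIMSEQ_le_const2[OF tendsto_rabs[OF l]]) (use avg_bound in auto)
 have l_meas: "l k \<in> borel_measurable (lebesgue_on U)" for k
 proof (rule borel_measurable_LIMSEQ_real[OF l])
  show "cell_average k (zero_ext (z (r i))) \<in> borel_measurable (lebesgue_on U)" for i
   by (rule L2_measurable[OF L2_restrict[OF cell_average_L2[OF z]]])
 qed
 have l_L2: "l k \<in> L2 U" for k
  by (rule L2_AE_bounded[OF lmeasurable_U l_meas, of _ "B k"]) (use l_bound in auto)
 interpret finite_measure "lebesgue_on U" by (rule finite_measure_U)
 have "(\<lambda>i. \<integral>x. (norm (cell_average k (zero_ext (z (r i))) x - l k x))\<^sup>2 \<partial>lebesgue_on U) \<longlonglongrightarrow> (\<integral>x. 0 \<partial>lebesgue_on U)" for k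
 proof (rule integral_dominated_convergence[where w = "\<lambda>x. (2 * B k)\<^sup>2"])
  show "(\<lambda>x. (norm (cell_average k (zero_ext (z (r i))) x - l k x))\<^sup>2) \<in> borel_measurable (lebesgue_on U)" for i
   by (rule borel_measurable_integrable[OF L2_integrable[OF
      L2_diff[OF L2_restrict[OF cell_average_L2[OF z]] l_L2]]])
  show "AE x in lebesgue_on U. (\<lambda>i. (norm (cell_average k (zero_ext (z (r i))) x - l k x))\<^sup>2) \<longlonglongrightarrow> 0"
  proof (rule AE_I2)
   fix x
   have "(\<lambda>i. (norm (cell_average k (zero_ext (z (r i))) x - l k x))\<^sup>2) \<longlonglongrightarrow> (norm (l k x - l k x))\<^sup>2"
    by (intro tendsto_intros l)
   then show "(\<lambda>i. (norm (cell_average k (zero_ext (z (r i))) x - l k x))\<^sup>2) \<longlonglongrightarrow> 0" by simp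
  qed
  show "AE x in lebesgue_on U. norm ((norm (cell_average k (zero_ext (z (r i))) x - l k x))\<^sup>2) <= (2 * B k)\<^sup>2" for i
  proof (rule AE_I2)
   fix x
   have "\<bar>cell_average k (zero_ext (z (r i))) x - l k x\<bar> <= 2 * B k"
    using avg_bound[of k "r i" x] l_bound[of k x] by linarith
   then have "\<bar>cell_average k (zero_ext (z (r i))) x - l k x\<bar>\<^sup>2 <= (2 * B k)\<^sup>2" by (rule power_mono) simp
   then show "norm ((norm (cell_average k (zero_ext (z (r i))) x - l k x))\<^sup>2) <= (2 * B k)\<^sup>2" by simp
  qed
 qed auto
 then have "(\<lambda>i. (l2norm U (\<lambda>x. cell_average k (zero_ext (z (r i))) x - l k x))\<^sup>2) \<longlonglongrightarrow> 0" for k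
  by (simp add: l2norm_power2_integral)
 then have "(\<lambda>i. sqrt ((l2norm U (\<lambda>x. cell_average k (zero_ext (z (r i))) x - l k x))\<^sup>2)) \<longlonglongrightarrow> sqrt 0" for k
  by (rule tendsto_real_sqrt)
 then have l_lim: "(\<lambda>i. l2norm U (\<lambda>x. cell_average k (zero_ext (z (r i))) x - l k x)) \<longlonglongrightarrow> 0" for k
  by (simp add: l2norm_nonneg)
 have z_l: "l2norm U (\<lambda>x. z (r i) x - l k x)
   <= grid_const TYPE('a) / 2 ^ k * M + l2norm U (\<lambda>x. cell_average k (zero_ext (z (r i))) x - l k x)" for i k
 proof -
  have A: "cell_average k (zero_ext (z (r i))) \<in> L2 U" by (rule L2_restrict[OF cell_average_L2[OF z]])
  have "l2norm U (\<lambda>x. z (r i) x - cell_average k (zero_ext (z (r i))) x)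
    = l2norm U (\<lambda>x. zero_ext (z (r i)) x - cell_average k (zero_ext (z (r i))) x)"
   unfolding l2norm_def l2inner_def
   by (rule arg_cong[where f = sqrt], rule Bochner_Integration.integral_cong) (auto simp: zero_ext_def)
  also have "... <= l2norm UNIV (\<lambda>x. zero_ext (z (r i)) x - cell_average k (zero_ext (z (r i))) x)"
   by (rule l2norm_restrict_le[OF cell_average_error_L2[OF z]])
  also have "... <= grid_const TYPE('a) / 2 ^ k * vnorm U (z (r i))" by (rule cell_average_error[OF z])
  also have "... <= grid_const TYPE('a) / 2 ^ k * M"
   by (intro mult_left_mono bound) (simp add: grid_const_def)
  finally show ?thesis
   using l2norm_triangle_diff[OF H01_L2[OF z[of "r i"]] A l_L2[of k]] by linarith
 qed
 have "\<exists>N. \<forall>i\<ge>N. \<forall>j\<ge>N. l2norm U (\<lambda>x. z (r i) x - z (r j) x) < e" if e: "0 < e" for e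
 proof -
  have "(\<lambda>k. grid_const TYPE('a) * M * (1 / 2) ^ k) \<longlonglongrightarrow> grid_const TYPE('a) * M * 0"
   by (intro tendsto_intros LIMSEQ_realpow_zero) auto
  then have "eventually (\<lambda>k. grid_const TYPE('a) * M * (1 / 2) ^ k < e / 4) sequentially"
   using e by (intro order_tendstoD(2)) auto
  then obtain k where "grid_const TYPE('a) * M * (1 / 2) ^ k < e / 4" by (auto simp: eventually_sequentially)
  then have k: "grid_const TYPE('a) / 2 ^ k * M < e / 4" by (simp add: power_one_over)
  have "eventually (\<lambda>i. l2norm U (\<lambda>x. cell_average k (zero_ext (z (r i))) x - l k x) < e / 4) sequentially"
   using l_lim[of k] e by (intro order_tendstoD(2)) auto
  then obtain N where N: "!!i. N <= i ==> l2norm U (\<lambda>x. cell_average k (zero_ext (z (r i))) x - l k x) < e / 4"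
   by (auto simp: eventually_sequentially)
  have close: "l2norm U (\<lambda>x. z (r i) x - l k x) < e / 2" if "N <= i" for i
   using z_l[of i k] N[OF that] k by linarith
  have "l2norm U (\<lambda>x. z (r i) x - z (r j) x) < e" if "N <= i" "N <= j" for i j
   using l2norm_triangle_diff[OF H01_L2[OF z[of "r i"]] l_L2[of k] H01_L2[OF z[of "r j"]]]
    close[OF that(1)] close[OF that(2)] l2norm_diff_commute[of U "l k" "z (r j)"] by linarith
  then show ?thesis by blast
 qed
 with r(1) show ?thesis using that by blast
qed

lemma nonzero_test_function:
 obtains \<phi> where "\<phi> \<in> test_functions U" "!!x. 0 <= \<phi> x" "!!x. \<phi> x <= 1" "0 < l2norm U \<phi>"
proof -
 obtain x where x: "x \<in> U" using nonempty_U by blast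
 obtain a b where ab: "x \<in> box a b" "box a b \<subseteq> U"
  using open_contains_box[of U] open_U x by (metis)
 have "(\<lambda>k. box_bump k a b x) \<longlonglongrightarrow> 1" using box_bump_tendsto[of a b x] ab by simp
 then have "eventually (\<lambda>k. 0 < box_bump k a b x) sequentially" by (rule order_tendstoD(1)) simp
 then obtain k where k: "0 < box_bump k a b x" by (auto simp: eventually_sequentially)
 define \<phi> where "\<phi> = box_bump k a b"
 have \<phi>: "\<phi> \<in> test_functions U" unfolding \<phi>_def by (rule box_bump_test[OF ab(2)])
 have "l2norm U \<phi> \<noteq> 0"
 proof
  assume "l2norm U \<phi> = 0"
  then have "AE x in lebesgue_on U. \<phi> x = 0" by (rule l2norm_zero_AE[OF test_L2[OF \<phi> sets_U]])
  then have ae: "AE y in lborel. y \<in> U --> \<phi> y = 0"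
   using sets_U by (simp add: AE_restrict_space_iff AE_completion_iff)
  let ?U = "U \<inter> {y. 0 < \<phi> y}"
  have U: "open ?U"
   using open_U by (intro open_Int open_Collect_less continuous_on_const test_continuous[OF \<phi>])
  have "AE y in lborel. y \<notin> ?U" using ae by eventually_elim auto
  then have "emeasure lborel ?U = 0"
   using U by (subst (asm) AE_iff_measurable[of ?U]) auto
  moreover have "x \<in> ?U" using k x by (simp add: \<phi>_def)
  ultimately show False
   using U open_not_negligible[of ?U] by (auto simp: negligible_iff_emeasure0 emeasure_completion borel_open)
 qed
 then have "0 < l2norm U \<phi>" using l2norm_nonneg[of U \<phi>] by linarith
 then show ?thesis by (rule that[OF \<phi>, rotated 2]) (simp_all add: \<phi>_def box_bump_bounds)
qed

lemma vnorm_add_power2: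
 assumes "y \<in> H01 U" "z \<in> H01 U"
 shows "(vnorm U (\<lambda>x. y x + z x))\<^sup>2 = (vnorm U y)\<^sup>2 + 2 * vinner y z + (vnorm U z)\<^sup>2"
proof -
 have "vnorm U (\<lambda>x. y x + z x) = l2norm U (\<lambda>x. wgrad U y x + wgrad U z x)"
  unfolding vnorm_def
  by (rule l2norm_AE_cong[OF sets_U wgrad_L2[OF H01_add[OF assms]]])
   (use wgrad_combination[OF assms, of 1 1] in simp)
 then show ?thesis using assms by (simp add: l2norm_add_power2 wgrad_L2 vnorm_def vinner_def)
qed

lemma vnorm_diff_power2:
 assumes "y \<in> H01 U" "z \<in> H01 U"
 shows "(vnorm U (\<lambda>x. y x - z x))\<^sup>2 = (vnorm U y)\<^sup>2 - 2 * vinner y z + (vnorm U z)\<^sup>2"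
 using assms by (simp add: vnorm_diff l2norm_diff_power2 wgrad_L2) (simp add: vnorm_def vinner_def)

lemma vinner_add_scale_left:
 "y \<in> H01 U ==> z \<in> H01 U ==> u \<in> H01 U ==>
  vinner (\<lambda>x. y x + s * z x) u = vinner y u + s * vinner z u"
 using vinner_combination[of y z u 1 s] by simp

lemma vinner_add_scale_right:
 "y \<in> H01 U ==> z \<in> H01 U ==> u \<in> H01 U ==>
  vinner u (\<lambda>x. y x + s * z x) = vinner u y + s * vinner u z"
 by (subst (1 2 3) vinner_commute) (rule vinner_add_scale_left)

text \<open>A minimizing sequence of the Rayleigh quotient has a subsequence converging in \<open>L\<^sup>2\<close>, and the
 parallelogram identity upgrades this to convergence in \<open>H\<^sub>0\<^sup>1\<close>.\<close>

lemma Rayleigh_minimizer: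
 obtains w \<mu> where "0 < \<mu>" "w \<in> H01 U" "l2norm U w = 1" "vinner w w = \<mu>"
  "!!z. z \<in> H01 U ==> \<mu> * (l2norm U z)\<^sup>2 <= vinner z z"
proof -
 define V where "V = {z \<in> H01 U. l2norm U z = 1}"
 define \<mu> where "\<mu> = Inf ((\<lambda>z. vinner z z) ` V)"
 have nonneg: "0 <= vinner z z" for z by (simp flip: vnorm_power2)
 have bdd: "bdd_below ((\<lambda>z. vinner z z) ` V)" by (rule bdd_belowI[of _ 0]) (auto simp: nonneg)
 have normalize: "(\<lambda>x. (1 / l2norm U z) * z x) \<in> V" if "z \<in> H01 U" "l2norm U z \<noteq> 0" for z
 proof -
  define c where "c = 1 / l2norm U z"
  have "\<bar>c\<bar> * l2norm U z = 1" using that(2) l2norm_nonneg[of U z] by (simp add: c_def)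
  then show ?thesis unfolding V_def c_def[symmetric] using H01_scale[OF that(1), of c] l2norm_mult[of U c z] by simp
 qed
 obtain \<phi> where \<phi>: "\<phi> \<in> test_functions U" "0 < l2norm U \<phi>" using nonzero_test_function by metis
 have ne: "V \<noteq> {}" using normalize[OF test_H01[OF \<phi>(1)]] \<phi>(2) by auto
 have min: "\<mu> * (l2norm U z)\<^sup>2 <= vinner z z" if z: "z \<in> H01 U" for z
 proof (cases "l2norm U z = 0")
  case True
  then show ?thesis by (simp add: nonneg)
 next
  case False
  define c where "c = 1 / l2norm U z"
  have "\<mu> <= vinner (\<lambda>x. c * z x) (\<lambda>x. c * z x)"
   unfolding \<mu>_def c_def by (rule cInf_lower[OF imageI bdd]) (rule normalize[OF z False])
  also have "... = c\<^sup>2 * vinner z z"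
   by (simp flip: vnorm_power2 add: vnorm_scale[OF z] power_mult_distrib)
  finally have "\<mu> * (l2norm U z)\<^sup>2 <= (c\<^sup>2 * vinner z z) * (l2norm U z)\<^sup>2" by (rule mult_right_mono) simp
  also have "... = (c * l2norm U z)\<^sup>2 * vinner z z" by (simp add: power_mult_distrib)
  also have "c * l2norm U z = 1" using False by (simp add: c_def)
  finally show ?thesis by simp
 qed
 have "\<exists>z\<in>V. vinner z z < \<mu> + inverse (real (Suc i))" for i
 proof -
  have "Inf ((\<lambda>z. vinner z z) ` V) < \<mu> + inverse (real (Suc i))" by (simp add: \<mu>_def)
  then show ?thesis using ne bdd by (auto simp: cInf_less_iff)
 qed
 then obtain z where z: "!!i. z i \<in> V" "!!i. vinner (z i) (z i) < \<mu> + inverse (real (Suc i))" by metis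
 have zH: "z i \<in> H01 U" and zn: "l2norm U (z i) = 1" for i using z(1)[of i] by (auto simp: V_def)
 have bound: "vnorm U (z i) <= sqrt (\<mu> + 1)" for i
 proof (rule real_le_rsqrt)
  have "inverse (real (Suc i)) <= 1" by (simp add: inverse_le_1_iff)
  then show "(vnorm U (z i))\<^sup>2 <= \<mu> + 1" using z(2)[of i] by (simp add: vnorm_power2)
 qed
 obtain r :: "nat \<Rightarrow> nat" where r: "strict_mono r"
  and C: "!!e. 0 < e ==> \<exists>N. \<forall>i\<ge>N. \<forall>j\<ge>N. l2norm U (\<lambda>x. z (r i) x - z (r j) x) < e"
  using Rellich[of z, OF zH bound] by blast
 obtain w where w: "w \<in> L2 U" "(\<lambda>k. l2norm U (\<lambda>x. z (r k) x - w x)) \<longlonglongrightarrow> 0"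
  using L2_complete[of U "\<lambda>k. z (r k)", OF sets_U H01_L2[OF zH] C] by blast
 have parallelogram: "(vnorm U (\<lambda>x. z i x - z j x))\<^sup>2
   <= 2 * inverse (real (Suc i)) + 2 * inverse (real (Suc j)) + \<mu> * (l2norm U (\<lambda>x. z i x - z j x))\<^sup>2" for i j
 proof -
  have "(l2norm U (\<lambda>x. z i x + z j x))\<^sup>2 = 4 - (l2norm U (\<lambda>x. z i x - z j x))\<^sup>2"
   using H01_L2[OF zH] by (simp add: l2norm_add_power2 l2norm_diff_power2 zn)
  then have a: "\<mu> * (4 - (l2norm U (\<lambda>x. z i x - z j x))\<^sup>2) <= vinner (\<lambda>x. z i x + z j x) (\<lambda>x. z i x + z j x)"
   using min[OF H01_add[OF zH zH], of i j] by simp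
  have "vinner (\<lambda>x. z i x + z j x) (\<lambda>x. z i x + z j x) + (vnorm U (\<lambda>x. z i x - z j x))\<^sup>2
    = 2 * vinner (z i) (z i) + 2 * vinner (z j) (z j)"
   using vnorm_add_power2[OF zH[of i] zH[of j]] vnorm_diff_power2[OF zH[of i] zH[of j]]
   by (simp only: vnorm_power2)
  with a z(2)[of i] z(2)[of j] show ?thesis unfolding right_diff_distrib by linarith
 qed
 have VC: "\<exists>N. \<forall>i\<ge>N. \<forall>j\<ge>N. l2norm U (\<lambda>x. wgrad U (z (r i)) x - wgrad U (z (r j)) x) < e" if e: "0 < e" for e
 proof -
  have \<mu>0: "0 <= \<mu>" unfolding \<mu>_def by (rule cInf_greatest) (use ne nonneg in auto)
  define d where "d = e / sqrt (2 * (\<mu> + 1))"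
  have d: "0 < d" using e \<mu>0 by (simp add: d_def)
  obtain N1 where N1: "!!i j. N1 <= i ==> N1 <= j ==> l2norm U (\<lambda>x. z (r i) x - z (r j) x) < d" using C[OF d] by blast
  obtain N2 where N2: "inverse (real (Suc N2)) < e\<^sup>2 / 8" using reals_Archimedean[of "e\<^sup>2 / 8"] e by auto
  have "l2norm U (\<lambda>x. wgrad U (z (r i)) x - wgrad U (z (r j)) x) < e" if "max N1 N2 <= i" "max N1 N2 <= j" for i j
  proof -
   have small: "inverse (real (Suc (r i))) < e\<^sup>2 / 8" if "N2 <= i" for i
   proof -
    have "N2 <= r i" using that seq_suble[OF r, of i] by linarith
    then have "inverse (real (Suc (r i))) <= inverse (real (Suc N2))" by (intro le_imp_inverse_le) auto
    with N2 show ?thesis by linarith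
   qed
   have "(l2norm U (\<lambda>x. z (r i) x - z (r j) x))\<^sup>2 <= d\<^sup>2"
    using N1[of i j] that by (intro power_mono l2norm_nonneg) auto
   then have "\<mu> * (l2norm U (\<lambda>x. z (r i) x - z (r j) x))\<^sup>2 <= \<mu> * d\<^sup>2" using \<mu>0 by (rule mult_left_mono)
   also have "\<mu> * d\<^sup>2 <= e\<^sup>2 / 2"
   proof -
    have "d\<^sup>2 = e\<^sup>2 / (2 * (\<mu> + 1))" using \<mu>0 by (simp add: d_def power_divide)
    then have "\<mu> * d\<^sup>2 = (\<mu> / (\<mu> + 1)) * (e\<^sup>2 / 2)" by simp
    also have "... <= 1 * (e\<^sup>2 / 2)" using \<mu>0 by (intro mult_right_mono) auto
    finally show ?thesis by simp
   qed
   finally have "(vnorm U (\<lambda>x. z (r i) x - z (r j) x))\<^sup>2 < e\<^sup>2"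
    using parallelogram[of "r i" "r j"] small[of i] small[of j] that by simp
   from power2_less_imp_less[OF this] have "vnorm U (\<lambda>x. z (r i) x - z (r j) x) < e" using e by simp
   then show ?thesis by (simp add: vnorm_diff zH)
  qed
  then show ?thesis by blast
 qed
 obtain G where G: "G \<in> L2 U" "(\<lambda>k. l2norm U (\<lambda>x. wgrad U (z (r k)) x - G x)) \<longlonglongrightarrow> 0"
  using L2_complete[of U "\<lambda>k. wgrad U (z (r k))", OF sets_U wgrad_L2[OF zH] VC] by blast
 note closed = H01_closed[of "\<lambda>k. z (r k)", OF zH w G]
 have wn: "l2norm U w = 1"
 proof -
  have "(\<lambda>k. l2norm U (z (r k))) \<longlonglongrightarrow> l2norm U w" by (rule l2norm_tendsto[of "\<lambda>k. z (r k)", OF H01_L2[OF zH] w])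
  then show ?thesis by (simp add: zn LIMSEQ_const_iff)
 qed
 have vw: "vinner w w = \<mu>"
 proof (rule antisym)
  have "(\<lambda>k. l2norm U (wgrad U (z (r k)))) \<longlonglongrightarrow> l2norm U G" by (rule l2norm_tendsto[of "\<lambda>k. wgrad U (z (r k))", OF wgrad_L2[OF zH] G])
  moreover have "l2norm U G = l2norm U (wgrad U w)"
   by (rule l2norm_AE_cong[OF sets_U wgrad_L2[OF closed(1)] wgrad_AE[OF closed(2)], symmetric])
  ultimately have "(\<lambda>k. (vnorm U (z (r k)))\<^sup>2) \<longlonglongrightarrow> (vnorm U w)\<^sup>2" by (intro tendsto_intros) (simp add: vnorm_def)
  then have lim: "(\<lambda>k. vinner (z (r k)) (z (r k))) \<longlonglongrightarrow> vinner w w" by (simp add: vnorm_power2)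
  have "(\<lambda>k. \<mu> + inverse (real (Suc (r k)))) \<longlonglongrightarrow> \<mu> + 0"
   using LIMSEQ_subseq_LIMSEQ[OF LIMSEQ_inverse_real_of_nat r] by (intro tendsto_intros) (simp add: o_def)
  then have "vinner w w <= \<mu> + 0"
   by (rule LIMSEQ_le[OF lim]) (use z(2) less_imp_le in blast)
  then show "vinner w w <= \<mu>" by simp
  show "\<mu> <= vinner w w" using min[OF closed(1)] by (simp add: wn)
 qed
 have "0 < \<mu>"
 proof -
  obtain D where D: "0 < D" "!!z. z \<in> H01 U ==> l2norm U z <= D * vnorm U z" using Poincare by blast
  have "vnorm U w \<noteq> 0" using D(2)[OF closed(1)] wn by auto
  then show ?thesis by (simp add: vw[symmetric] vnorm_power2[symmetric])
 qed
 with closed(1) wn vw min show ?thesis by (intro that)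
qed

lemma
 shows lambda1_pos: "0 < lambda1 U"
  and lambda1_le: "z \<in> H01 U ==> lambda1 U * (l2norm U z)\<^sup>2 <= (vnorm U z)\<^sup>2"
proof -
 obtain w \<mu> where w: "0 < \<mu>" "w \<in> H01 U" "l2norm U w = 1" "vinner w w = \<mu>"
  and min: "!!z. z \<in> H01 U ==> \<mu> * (l2norm U z)\<^sup>2 <= vinner z z" using Rayleigh_minimizer by blast
 have "vinner w z = \<mu> * l2inner U w z" if z: "z \<in> H01 U" for z
 proof -
  have "0 <= 0 + 2 * s * (vinner w z - \<mu> * l2inner U w z) + s\<^sup>2 * (vinner z z - \<mu> * (l2norm U z)\<^sup>2)" for s
  proof -
   let ?y = "\<lambda>x. w x + s * z x"
   have y: "?y \<in> H01 U" using H01_combination[OF w(2) z, of 1 s] by simp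
   have n: "(l2norm U ?y)\<^sup>2 = 1 + 2 * s * l2inner U w z + s\<^sup>2 * (l2norm U z)\<^sup>2"
    using l2norm_add_power2[OF H01_L2[OF w(2)] L2_mult[OF H01_L2[OF z], of s]] w(3)
    by (simp add: l2inner_mult_right l2norm_mult power_mult_distrib)
   have v: "vinner ?y ?y = \<mu> + 2 * s * vinner w z + s\<^sup>2 * vinner z z"
    unfolding vinner_add_scale_left[OF w(2) z y] vinner_add_scale_right[OF w(2) z w(2)]
     vinner_add_scale_right[OF w(2) z z] w(4) vinner_commute[of z w]
    by (simp add: power2_eq_square algebra_simps)
   show ?thesis using min[OF y] unfolding n v by (simp add: algebra_simps)
  qed
  from nonneg_quadratic_discriminant[OF this] min[OF z] show ?thesis by simp
 qed
 then have ev: "dirichlet_eigenvalue U \<mu>"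
  unfolding dirichlet_eigenvalue_def using w by (auto simp: vinner_def intro!: bexI[of _ w])
 have "\<mu> <= \<nu>" if \<nu>: "dirichlet_eigenvalue U \<nu>" for \<nu>
 proof -
  obtain y where y: "y \<in> H01 U" "l2norm U y \<noteq> 0" "vinner y y = \<nu> * l2inner U y y"
   using \<nu> by (auto simp: dirichlet_eigenvalue_def vinner_def)
  then have "\<mu> * (l2norm U y)\<^sup>2 <= \<nu> * (l2norm U y)\<^sup>2" using min[OF y(1)] by (simp add: l2norm_power2)
  then show ?thesis using y(2) by (simp add: mult_le_cancel_right)
 qed
 with ev have "lambda1 U = \<mu>" unfolding lambda1_def by (intro cInf_eq_minimum) auto
 then show "0 < lambda1 U" "z \<in> H01 U ==> lambda1 U * (l2norm U z)\<^sup>2 <= (vnorm U z)\<^sup>2"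
  using w(1) min[of z] by (simp_all add: vnorm_power2)
qed

end

section \<open>The Sobolev inequality below the critical exponent\<close>

context bounded_open
begin

text \<open>The averages at level \<open>k\<close> grow at most like \<open>\<rho>\<^sup>k\<close>; where \<open>\<bar>z\<bar>\<close> is of size \<open>2A\<rho>\<^sup>k\<close>, it therefore
 differs from its average at level \<open>k\<close> by at least \<open>A\<rho>\<^sup>k\<close>, and this happens rarely because the
 difference is of order \<open>2\<^sup>-\<^sup>k\<close> in mean square. The choice of \<open>\<rho>\<close> is possible exactly for subcritical
 \<open>q\<close>.\<close>

theorem Sobolev:
 assumes q: "2 < q" and subcritical: "DIM('a) <= 2 \<or> q < 2 * real DIM('a) / (real DIM('a) - 2)"
 obtains K where "0 <= K"
  "!!z. z \<in> H01 U ==> vnorm U z <= 1 ==> integrable (lebesgue_on U) (\<lambda>x. \<bar>z x\<bar> powr q) \<and>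
   (\<integral>x. \<bar>z x\<bar> powr q \<partial>lebesgue_on U) <= K"
proof -
 define n where "n = real DIM('a)"
 obtain \<theta> where \<theta>: "0 < \<theta>" "n / 2 - 1 <= \<theta>" "\<theta> * (q - 2) < 2"
 proof (cases "DIM('a) <= 2")
  case True
  have "1 / (q - 1) * (q - 2) < 2" using q by (simp add: field_simps)
  moreover have "n / 2 - 1 <= 0" using True by (simp add: n_def)
  moreover have "0 < 1 / (q - 1)" using q by simp
  ultimately show ?thesis using that[of "1 / (q - 1)"] by linarith
 next
  case False
  then have n: "2 < n" by (simp add: n_def)
  with subcritical False have "q < 2 * n / (n - 2)" by (simp add: n_def)
  then have "q * (n - 2) < 2 * n" using n by (simp add: pos_less_divide_eq)
  then have "(n / 2 - 1) * (q - 2) < 2" by (simp add: field_simps)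
  with n show ?thesis using that[of "n / 2 - 1"] by simp
 qed
 define \<rho> where "\<rho> = 2 powr \<theta>"
 have \<rho>: "1 < \<rho>" using \<theta>(1) by (simp add: \<rho>_def)
 define C where "C = grid_const TYPE('a)"
 have C: "0 <= C" by (simp add: C_def grid_const_def)
 obtain D where D: "0 < D" "!!z. z \<in> H01 U ==> l2norm U z <= D * vnorm U z" using Poincare by blast
 define c where "c = sqrt (2 ^ DIM('a)) * C"
 have c: "0 <= c" using C by (simp add: c_def)
 define A where "A = D + c / (\<rho> - 1)"
 have A: "0 < A" using D(1) c \<rho> by (simp add: A_def add_pos_nonneg)
 have scale: "sqrt ((2 ^ Suc k) ^ DIM('a)) * (C / 2 ^ k) <= c * \<rho> ^ k" for k
 proof -
  have "sqrt ((2 ^ k) ^ DIM('a)) = 2 powr (real k * n / 2)"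
   by (simp add: n_def powr_half_sqrt[symmetric] powr_realpow[symmetric] powr_powr mult.commute)
  also have "... <= 2 powr (real k * (\<theta> + 1))"
   using \<theta>(2) mult_left_mono[of "n / 2" "\<theta> + 1" "real k"] by (intro powr_mono) auto
  also have "... = \<rho> ^ k * 2 ^ k"
   by (simp add: \<rho>_def powr_add[symmetric] powr_realpow[symmetric] powr_powr algebra_simps)
  finally have 1: "sqrt ((2 ^ k) ^ DIM('a)) <= \<rho> ^ k * 2 ^ k" .
  have "sqrt ((2 ^ Suc k) ^ DIM('a)) * (C / 2 ^ k) = c * (sqrt ((2 ^ k) ^ DIM('a)) / 2 ^ k)"
   by (simp add: c_def power_mult_distrib real_sqrt_mult)
  also have "... <= c * \<rho> ^ k"
   using 1 by (intro mult_left_mono c) (simp add: divide_le_eq)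
  finally show ?thesis .
 qed
 define s where "s = \<rho> powr (q - 2) / 4"
 have s: "0 <= s" "s < 1"
 proof -
  have "\<rho> powr (q - 2) = 2 powr (\<theta> * (q - 2))" by (simp add: \<rho>_def powr_powr)
  also have "... < 2 powr 2" using \<theta>(3) by (intro powr_less_mono) auto
  finally show "s < 1" by (simp add: s_def)
 qed (simp add: s_def)
 define b where "b k = (2 * A * \<rho>) powr q / A\<^sup>2 * (\<rho> powr (q - 2)) ^ k" for k
 have b: "0 <= b k" for k by (simp add: b_def)
 define K where "K = (2 * A) powr q * measure (lebesgue_on U) U + (2 * A * \<rho>) powr q / A\<^sup>2 * C\<^sup>2 * (1 / (1 - s))"
 interpret finite_measure "lebesgue_on U" by (rule finite_measure_U)
 have K: "0 <= K" using s by (simp add: K_def)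
 have main: "integrable (lebesgue_on U) (\<lambda>x. \<bar>z x\<bar> powr q) \<and> (\<integral>x. \<bar>z x\<bar> powr q \<partial>lebesgue_on U) <= K"
  if z: "z \<in> H01 U" and v: "vnorm U z <= 1" for z
 proof -
  define a where "a k = cell_average k (zero_ext z)" for k
  define e where "e k x = zero_ext z x - a k x" for k x
  have e_L2: "e k \<in> L2 UNIV" for k
   using cell_average_error_L2[OF z, of k] by (simp add: e_def[abs_def] a_def)
  have e_norm: "l2norm UNIV (e k) <= C / 2 ^ k" for k
  proof -
   have "l2norm UNIV (e k) <= C / 2 ^ k * vnorm U z"
    using cell_average_error[OF z, of k] by (simp add: e_def[abs_def] a_def C_def)
   also have "... <= C / 2 ^ k * 1" using C by (intro mult_left_mono v) auto
   finally show ?thesis by simp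
  qed
  have a_step: "\<bar>a (Suc k) x - a k x\<bar> <= c * \<rho> ^ k" for k x
  proof -
   have "\<bar>a (Suc k) x - a k x\<bar> = \<bar>cell_average (Suc k) (e k) x\<bar>"
    using cell_average_Suc_diff[OF zero_ext_L2[OF H01_L2[OF z]] cell_average_error_L2[OF z, of k], of x]
    by (simp add: a_def e_def[abs_def])
   also have "... <= sqrt ((2 ^ Suc k) ^ DIM('a)) * l2norm UNIV (e k)" by (rule cell_average_bound[OF e_L2])
   also have "... <= sqrt ((2 ^ Suc k) ^ DIM('a)) * (C / 2 ^ k)" by (intro mult_left_mono e_norm) simp
   finally show ?thesis using scale[of k] by linarith
  qed
  have a_sum: "\<bar>a k x\<bar> <= D + c * (\<rho> ^ k - 1) / (\<rho> - 1)" for k x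
  proof (induction k)
   case 0
   have "\<bar>a 0 x\<bar> <= l2norm U z"
    using cell_average_bound[OF zero_ext_L2[OF H01_L2[OF z]], of 0 x] by (simp add: a_def l2norm_zero_ext)
   also have "... <= D * 1" using D(2)[OF z] mult_left_mono[OF v, of D] D(1) by linarith
   finally show ?case by simp
  next
   case (Suc k)
   have "D + c * (\<rho> ^ k - 1) / (\<rho> - 1) + c * \<rho> ^ k = D + c * (\<rho> ^ Suc k - 1) / (\<rho> - 1)"
    using \<rho> by (simp add: field_simps)
   then show ?case using Suc.IH a_step[of k x] by linarith
  qed
  have a_bound: "\<bar>a k x\<bar> <= A * \<rho> ^ k" for k x
  proof -
   have "D + c * (\<rho> ^ k - 1) / (\<rho> - 1) <= D * \<rho> ^ k + c / (\<rho> - 1) * \<rho> ^ k"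
   proof (rule add_mono)
    show "D <= D * \<rho> ^ k" using D(1) \<rho> one_le_power[of \<rho> k] by simp
    have "c * (\<rho> ^ k - 1) / (\<rho> - 1) <= c * \<rho> ^ k / (\<rho> - 1)"
     using c \<rho> by (intro divide_right_mono mult_left_mono) auto
    then show "c * (\<rho> ^ k - 1) / (\<rho> - 1) <= c / (\<rho> - 1) * \<rho> ^ k" by simp
   qed
   then show ?thesis using a_sum[of k x] by (simp add: A_def distrib_right)
  qed
  have pointwise: "ennreal (\<bar>z x\<bar> powr q) <= ennreal ((2 * A) powr q) + (\<Sum>k. ennreal (b k * (e k x)\<^sup>2))"
   if x: "x \<in> U" for x
  proof (cases "\<bar>z x\<bar> <= 2 * A")
   case True
   then have "ennreal (\<bar>z x\<bar> powr q) <= ennreal ((2 * A) powr q)" using q by (intro ennreal_leI powr_mono2) auto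
   then show ?thesis by (rule order_trans) simp
  next
   case False
   obtain N where "\<bar>z x\<bar> / (2 * A) < \<rho> ^ N" using real_arch_pow[OF \<rho>] by blast
   then have N: "\<bar>z x\<bar> <= 2 * A * \<rho> ^ N" using A by (simp add: divide_less_eq mult.commute)
   define M where "M = (LEAST j. \<bar>z x\<bar> <= 2 * A * \<rho> ^ j)"
   have M: "\<bar>z x\<bar> <= 2 * A * \<rho> ^ M" unfolding M_def by (rule LeastI[of _ N]) (rule N)
   have "M \<noteq> 0" using M False by (intro notI) simp
   then obtain k where k: "M = Suc k" by (cases M) auto
   have lt: "2 * A * \<rho> ^ k < \<bar>z x\<bar>"
    using not_less_Least[of k "\<lambda>j. \<bar>z x\<bar> <= 2 * A * \<rho> ^ j"] k by (simp add: M_def)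
   have "A * \<rho> ^ k <= \<bar>e k x\<bar>"
    using lt a_bound[of k x] x by (simp add: e_def zero_ext_def)
   then have "(A * \<rho> ^ k)\<^sup>2 <= (e k x)\<^sup>2" using A \<rho> by (simp flip: abs_le_square_iff)
   then have one: "1 <= (e k x)\<^sup>2 / (A * \<rho> ^ k)\<^sup>2" using A \<rho> by simp
   have "\<bar>z x\<bar> powr q <= (2 * A * \<rho> * \<rho> ^ k) powr q"
    using M q unfolding k by (intro powr_mono2) (simp_all add: mult_ac)
   also have "... = (2 * A * \<rho>) powr q * (\<rho> powr q) ^ k"
    using A \<rho> by (simp add: powr_mult powr_powr powr_realpow[symmetric] mult.commute)
   also have "... <= (2 * A * \<rho>) powr q * (\<rho> powr q) ^ k * ((e k x)\<^sup>2 / (A * \<rho> ^ k)\<^sup>2)"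
    by (rule order_trans[OF _ mult_left_mono[OF one]]) simp_all
   also have "... = b k * (e k x)\<^sup>2"
   proof -
    have "\<rho> powr q = \<rho> powr (q - 2) * \<rho>\<^sup>2" using \<rho> by (simp add: powr_diff powr_numeral)
    then have "(\<rho> powr q) ^ k = (\<rho> powr (q - 2)) ^ k * (\<rho> ^ k)\<^sup>2"
     by (simp add: power_mult_distrib power_mult[symmetric] mult.commute)
    then show ?thesis using \<rho> A by (simp add: b_def power_mult_distrib)
   qed
   finally have "ennreal (\<bar>z x\<bar> powr q) <= ennreal (b k * (e k x)\<^sup>2)" by (rule ennreal_leI)
   also have "... <= (\<Sum>k. ennreal (b k * (e k x)\<^sup>2))"
    using sum_le_suminf[of "\<lambda>k. ennreal (b k * (e k x)\<^sup>2)" "{k}"] by simp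
   finally show ?thesis by (rule order_trans) simp
  qed
  have e_int: "integrable (lebesgue_on U) (\<lambda>x. (norm (e k x))\<^sup>2)" for k
   by (rule L2_integrable[OF L2_restrict[OF e_L2]])
  have level: "(\<integral>\<^sup>+x. ennreal (b k * (e k x)\<^sup>2) \<partial>lebesgue_on U)
    <= ennreal ((2 * A * \<rho>) powr q / A\<^sup>2 * C\<^sup>2 * s ^ k)" for k
  proof -
   have "(\<integral>\<^sup>+x. ennreal (b k * (e k x)\<^sup>2) \<partial>lebesgue_on U) = ennreal (\<integral>x. b k * (e k x)\<^sup>2 \<partial>lebesgue_on U)"
    using e_int[of k] b[of k] by (intro nn_integral_eq_integral) auto
   also have "(\<integral>x. b k * (e k x)\<^sup>2 \<partial>lebesgue_on U) = b k * (l2norm U (e k))\<^sup>2"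
    by (simp add: l2norm_power2_integral)
   also have "... <= b k * (C / 2 ^ k)\<^sup>2"
    using l2norm_restrict_le[OF e_L2[of k]] e_norm[of k]
    by (intro mult_left_mono b power_mono l2norm_nonneg) linarith
   also have "... = (2 * A * \<rho>) powr q / A\<^sup>2 * C\<^sup>2 * s ^ k"
   proof -
    have "(2 ^ k)\<^sup>2 = ((2::real)\<^sup>2) ^ k" by (simp only: power_mult [symmetric] mult.commute)
    then have "(2 ^ k)\<^sup>2 = (4::real) ^ k" by simp
    then show ?thesis by (simp add: b_def s_def power_divide)
   qed
   finally show ?thesis by (simp add: ennreal_leI)
  qed
  have zm: "z \<in> borel_measurable (lebesgue_on U)" by (rule L2_measurable[OF H01_L2[OF z]])
  have "(\<integral>\<^sup>+x. ennreal (\<bar>z x\<bar> powr q) \<partial>lebesgue_on U)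
    <= (\<integral>\<^sup>+x. ennreal ((2 * A) powr q) + (\<Sum>k. ennreal (b k * (e k x)\<^sup>2)) \<partial>lebesgue_on U)"
   using pointwise by (intro nn_integral_mono) auto
  also have "... = (\<integral>\<^sup>+x. ennreal ((2 * A) powr q) \<partial>lebesgue_on U) + (\<Sum>k. \<integral>\<^sup>+x. ennreal (b k * (e k x)\<^sup>2) \<partial>lebesgue_on U)"
  proof -
   have m: "(\<lambda>x. ennreal (b k * (e k x)\<^sup>2)) \<in> borel_measurable (lebesgue_on U)" for k
    using borel_measurable_integrable[OF e_int[of k]] by simp
   show ?thesis by (subst nn_integral_add) (use m in \<open>simp_all add: nn_integral_suminf\<close>)
  qed
  also have "... <= ennreal ((2 * A) powr q) * emeasure (lebesgue_on U) U
    + (\<Sum>k. ennreal ((2 * A * \<rho>) powr q / A\<^sup>2 * C\<^sup>2 * s ^ k))"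
   using level by (intro add_mono suminf_le) auto
  also have "(\<Sum>k. ennreal ((2 * A * \<rho>) powr q / A\<^sup>2 * C\<^sup>2 * s ^ k))
    = ennreal (\<Sum>k. (2 * A * \<rho>) powr q / A\<^sup>2 * C\<^sup>2 * s ^ k)"
   using s by (intro suminf_ennreal2) (auto intro!: summable_mult summable_geometric)
  also have "(\<Sum>k. (2 * A * \<rho>) powr q / A\<^sup>2 * C\<^sup>2 * s ^ k) = (2 * A * \<rho>) powr q / A\<^sup>2 * C\<^sup>2 * (1 / (1 - s))"
   using s by (subst suminf_mult) (auto simp: suminf_geometric intro: summable_geometric)
  also have "ennreal ((2 * A) powr q) * emeasure (lebesgue_on U) U + ennreal ((2 * A * \<rho>) powr q / A\<^sup>2 * C\<^sup>2 * (1 / (1 - s))) = ennreal K"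
   unfolding emeasure_eq_measure K_def using s
   by (subst ennreal_plus) (auto simp: ennreal_mult)
  finally have le: "(\<integral>\<^sup>+x. ennreal (\<bar>z x\<bar> powr q) \<partial>lebesgue_on U) <= ennreal K" .
  have int: "integrable (lebesgue_on U) (\<lambda>x. \<bar>z x\<bar> powr q)"
   using zm le by (intro integrableI_bounded) (auto intro: le_less_trans)
  have "ennreal (\<integral>x. \<bar>z x\<bar> powr q \<partial>lebesgue_on U) <= ennreal K"
   using le nn_integral_eq_integral[OF int] by simp
  then have "(\<integral>x. \<bar>z x\<bar> powr q \<partial>lebesgue_on U) <= K" using K by (simp add: ennreal_le_iff)
  with int show ?thesis by blast
 qed
 show ?thesis using that[OF K] main by blast
qed

lemma AE_obtain_point:
 assumes "AE x in lebesgue_on U. Q x"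
 shows "\<exists>x. Q x"
proof (rule ccontr)
 assume "\<not> ?thesis"
 with assms have *: "AE x in lebesgue_on U. False" by simp
 obtain \<phi> where \<phi>: "\<phi> \<in> test_functions U" "0 < l2norm U \<phi>" using nonzero_test_function by metis
 have "l2norm U \<phi> = l2norm U (\<lambda>x. 0 :: real)"
  by (rule l2norm_AE_cong[OF sets_U test_L2[OF \<phi>(1) sets_U]]) (use * in auto)
 with \<phi>(2) show False by (simp add: l2norm_def l2inner_def)
qed

end

section \<open>The source term\<close>

text \<open>With \<open>y = ln (\<bar>r\<bar>\<^sup>q) + q / (q - m)\<close>, the claim reduces to \<open>e\<^sup>y (1 - y) <= 1\<close>.\<close>

lemma source_energy_pointwise:
 assumes m: "0 < m" "m <= p x"
 shows "m * source_primitive p x r - c_shift m (p x) <= source p x r * r"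
proof (cases "r = 0")
 case True
 then show ?thesis using m by (simp add: source_primitive_def c_shift_def)
next
 case False
 define a where "a = \<bar>r\<bar> powr p x"
 define q where "q = p x"
 have q: "0 < q" "m <= q" using m by (simp_all add: q_def)
 have a: "0 < a" "ln a = q * ln \<bar>r\<bar>" using False by (simp_all add: a_def q_def ln_powr)
 have lnr: "ln \<bar>r\<bar> = ln a / q" using a(2) q by simp
 have "\<bar>r\<bar> powr (q - 2) * \<bar>r\<bar>\<^sup>2 = a"
  using False by (simp add: a_def q_def powr_diff powr_numeral)
 then have "source p x r * r = a * ln \<bar>r\<bar>"
  using False by (simp add: source_def q_def[symmetric] power2_eq_square mult_ac abs_mult_self_eq)
 then have 1: "source p x r * r = a * ln a / q" by (simp add: lnr)
 have "\<bar>r\<bar> powr q = a" by (simp add: a_def q_def)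
 then have 2: "m * source_primitive p x r = m * (a * ln a / q\<^sup>2 - a / q\<^sup>2)"
  using False by (simp add: source_primitive_def q_def[symmetric] lnr power2_eq_square)
 have diff: "source p x r * r - m * source_primitive p x r = a * ((q - m) * ln a + m) / q\<^sup>2"
  unfolding 1 2 using q by (simp add: field_simps power2_eq_square)
 have "- c_shift m q <= a * ((q - m) * ln a + m) / q\<^sup>2"
 proof (cases "q = m")
  case True
  then show ?thesis using a(1) m by (simp add: c_shift_def)
 next
  case False
  define d where "d = q - m"
  have d: "0 < d" using False q by (simp add: d_def)
  define y where "y = ln a + q / d"
  have "a = exp (y - q / d)" using a(1) by (simp add: y_def)
  then have ay: "a = exp y * exp (- q / d)" by (simp flip: exp_add)
  have "d * ln a + m = d * (y - 1)" using d by (simp add: y_def d_def field_simps)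
  then have eq: "a * ((q - m) * ln a + m) / q\<^sup>2 = d / q\<^sup>2 * exp (- q / d) * (exp y * (y - 1))"
   by (simp add: ay d_def[symmetric])
  have "(1 - y) <= exp (- y)" using exp_ge_add_one_self[of "- y"] by simp
  then have "exp y * (1 - y) <= exp y * exp (- y)" by (intro mult_left_mono) auto
  then have "- 1 <= exp y * (y - 1)" by (simp add: exp_minus algebra_simps)
  then have "d / q\<^sup>2 * exp (- q / d) * (- 1) <= d / q\<^sup>2 * exp (- q / d) * (exp y * (y - 1))"
   using d by (intro mult_left_mono) auto
  then show ?thesis unfolding eq using d by (simp add: c_shift_def d_def)
 qed
 with diff show ?thesis by (simp add: q_def)
qed

lemma source_growth:
 assumes p: "2 <= p x" "p x <= P" and q: "P < q"
 shows "\<bar>source p x r\<bar> <= (1 + 1 / (q - P)) * (1 + \<bar>r\<bar> powr (q - 1))"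
proof (cases "r = 0")
 case False
 have rp: "0 < \<bar>r\<bar>" using False by simp
 have abs_eq: "\<bar>source p x r\<bar> = \<bar>r\<bar> powr (p x - 1) * \<bar>ln \<bar>r\<bar>\<bar>"
 proof -
  have "\<bar>r\<bar> powr (p x - 2) * \<bar>r\<bar> = \<bar>r\<bar> powr (p x - 1)"
   using rp powr_add[of "\<bar>r\<bar>" "p x - 2" 1] by simp
  then show ?thesis using False by (simp add: source_def abs_mult)
 qed
 have nn: "0 <= 1 / (q - P)" using q by simp
 show ?thesis
 proof (cases "\<bar>r\<bar> <= 1")
  case True
  have "ln (1 / \<bar>r\<bar>) <= 1 / \<bar>r\<bar> - 1" using rp by (intro ln_le_minus_one) simp
  then have "\<bar>ln \<bar>r\<bar>\<bar> <= 1 / \<bar>r\<bar>" using rp True by (simp add: ln_div)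
  moreover have "\<bar>r\<bar> powr (p x - 1) <= \<bar>r\<bar> powr 1" using p True by (intro powr_mono') auto
  ultimately have "\<bar>r\<bar> powr (p x - 1) * \<bar>ln \<bar>r\<bar>\<bar> <= \<bar>r\<bar> powr 1 * (1 / \<bar>r\<bar>)" by (intro mult_mono) auto
  also have "... = 1 * 1" using rp by simp
  also have "... <= (1 + 1 / (q - P)) * (1 + \<bar>r\<bar> powr (q - 1))" using nn by (intro mult_mono) auto
  finally show ?thesis by (simp add: abs_eq)
 next
  case False
  then have r1: "1 <= \<bar>r\<bar>" by simp
  have "\<bar>ln \<bar>r\<bar>\<bar> <= \<bar>r\<bar> powr (q - P) / (q - P)" using ln_powr_bound[OF r1, of "q - P"] q r1 by simp
  moreover have "\<bar>r\<bar> powr (p x - 1) <= \<bar>r\<bar> powr (P - 1)" using p r1 by (intro powr_mono) auto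
  ultimately have "\<bar>r\<bar> powr (p x - 1) * \<bar>ln \<bar>r\<bar>\<bar> <= \<bar>r\<bar> powr (P - 1) * (\<bar>r\<bar> powr (q - P) / (q - P))"
   by (intro mult_mono) auto
  also have "... = 1 / (q - P) * \<bar>r\<bar> powr (q - 1)" using powr_add[of "\<bar>r\<bar>" "P - 1" "q - P"] by simp
  also have "... <= (1 + 1 / (q - P)) * (1 + \<bar>r\<bar> powr (q - 1))" using nn by (intro mult_mono) auto
  finally show ?thesis by (simp add: abs_eq)
 qed
qed (use q in \<open>simp add: source_def\<close>)

lemma powr_diff_1_mult_le: "a powr (q - 1) * b <= a powr q + b powr q" if "0 <= a" "0 <= b" "1 < q" for a b q :: real
proof (cases "a <= b")
 case True
 have "a powr (q - 1) * b <= b powr (q - 1) * b" using True that by (intro mult_right_mono powr_mono2) auto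
 also have "... = b powr q" using powr_mult_base[of b "q - 1"] that by (simp add: mult.commute)
 finally show ?thesis using powr_ge_zero[of a q] by linarith
next
 case False
 have "a powr (q - 1) * b <= a powr (q - 1) * a" using False that by (intro mult_left_mono) auto
 also have "... = a powr q" using powr_mult_base[of a "q - 1"] that by (simp add: mult.commute)
 finally show ?thesis using powr_ge_zero[of b q] by linarith
qed

lemma le_1_plus_powr: "a powr t <= 1 + a powr q" if "0 <= a" "0 <= t" "t <= q" for a q t :: real
proof (cases "a <= 1")
 case True
 then have "a powr t <= 1" using that by (intro powr_le1) auto
 then show ?thesis using powr_ge_zero[of a q] by linarith
next
 case False
 then have "a powr t <= a powr q" using that by (intro powr_mono) auto
 then show ?thesis by linarith
qed

locale variable_exponent = bounded_open U for U :: "'a::euclidean_space set" +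
 fixes p :: "'a \<Rightarrow> real"
 assumes H1: "hyp_H1 U p"
begin

definition m where "m = p_minus U p"

lemma p_measurable: "p \<in> borel_measurable (lebesgue_on U)"
 using H1 by (simp add: hyp_H1_def)

lemma
 shows m_gt_2: "2 < m"
  and m_le_p: "AE x in lebesgue_on U. m <= p x"
  and subcritical_growth: "\<exists>P q. P < q \<and> (DIM('a) <= 2 \<or> q < 2 * real DIM('a) / (real DIM('a) - 2)) \<and>
   (AE x in lebesgue_on U. p x <= P)"
proof -
 let ?i = "essinf (lebesgue_on U) (\<lambda>x. ereal (p x))" and ?s = "esssup (lebesgue_on U) (\<lambda>x. ereal (p x))"
 have lo: "AE x in lebesgue_on U. ?i <= ereal (p x)"
  using esssup_AE[of "\<lambda>x. - ereal (p x)" "lebesgue_on U"]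
  unfolding essinf_def by eventually_elim (simp add: ereal_uminus_le_reorder)
 have hi: "AE x in lebesgue_on U. ereal (p x) <= ?s" by (rule esssup_AE)
 obtain x0 where x0: "?i <= ereal (p x0)" "ereal (p x0) <= ?s"
  using AE_obtain_point[OF eventually_conj[OF lo hi]] by blast
 have H: "2 < ?i" "?s < critical_exponent DIM('a)" using H1 by (auto simp: hyp_H1_def)
 have i: "?i = ereal m"
  using H(1) x0(1) unfolding m_def p_minus_def by (cases ?i) auto
 show "2 < m" using H(1) unfolding i by (metis ereal_less(2) ereal_less_eq(3) less_ereal.simps(1) numeral_eq_ereal)
 show "AE x in lebesgue_on U. m <= p x" using lo unfolding i by simp
 obtain P where P: "?s = ereal P" using H(2) x0(2) by (cases ?s) auto
 have "\<exists>q. P < q \<and> (DIM('a) <= 2 \<or> q < 2 * real DIM('a) / (real DIM('a) - 2))"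
 proof (cases "DIM('a) <= 2")
  case True
  then show ?thesis by (intro exI[of _ "P + 1"]) simp
 next
  case False
  then have "P < 2 * real DIM('a) / (real DIM('a) - 2)" using H(2) by (simp add: critical_exponent_def P)
  then show ?thesis using dense by blast
 qed
 moreover have "AE x in lebesgue_on U. p x <= P" using hi unfolding P by simp
 ultimately show "\<exists>P q. P < q \<and> (DIM('a) <= 2 \<or> q < 2 * real DIM('a) / (real DIM('a) - 2)) \<and>
   (AE x in lebesgue_on U. p x <= P)" by blast
qed

lemma source_measurable:
 assumes [measurable]: "u \<in> borel_measurable (lebesgue_on U)"
 shows "(\<lambda>x. source p x (u x)) \<in> borel_measurable (lebesgue_on U)"
  and "(\<lambda>x. source_primitive p x (u x)) \<in> borel_measurable (lebesgue_on U)"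
proof -
 note p_measurable[measurable]
 show "(\<lambda>x. source p x (u x)) \<in> borel_measurable (lebesgue_on U)"
  "(\<lambda>x. source_primitive p x (u x)) \<in> borel_measurable (lebesgue_on U)"
  unfolding source_def source_primitive_def by measurable
qed

text \<open>A linear functional that is bounded on the unit ball is bounded; there, Young's inequality and
 the Sobolev inequality bound the integrand by an integrable function.\<close>

lemma
 assumes u: "u \<in> H01 U"
 shows source_integrable: "z \<in> H01 U ==> integrable (lebesgue_on U) (\<lambda>x. source p x (u x) * z x)"
  and source_bounded: "\<exists>K. \<forall>z\<in>H01 U. \<bar>\<integral>x. source p x (u x) * z x \<partial>lebesgue_on U\<bar> <= K * vnorm U z"
  and source_primitive_integrable: "integrable (lebesgue_on U) (\<lambda>x. source_primitive p x (u x))"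
proof -
 obtain P q where Pq: "P < q" "DIM('a) <= 2 \<or> q < 2 * real DIM('a) / (real DIM('a) - 2)"
  and pP: "AE x in lebesgue_on U. p x <= P" using subcritical_growth by blast
 have "2 < P" using AE_obtain_point[OF eventually_conj[OF pP m_le_p]] m_gt_2 by force
 then have q: "2 < q" using Pq(1) by linarith
 obtain K where K: "0 <= K" "!!z. z \<in> H01 U ==> vnorm U z <= 1 ==>
   integrable (lebesgue_on U) (\<lambda>x. \<bar>z x\<bar> powr q) \<and> (\<integral>x. \<bar>z x\<bar> powr q \<partial>lebesgue_on U) <= K"
  using Sobolev[OF q Pq(2)] by metis
 have int: "integrable (lebesgue_on U) (\<lambda>x. \<bar>z x\<bar> powr q)" if z: "z \<in> H01 U" for z
 proof -
  define c where "c = 1 / (1 + vnorm U z)"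
  have c: "0 < c" using vnorm_nonneg[of z] by (simp add: c_def add_pos_nonneg)
  have "c * vnorm U z <= 1" using vnorm_nonneg[of z] by (simp add: c_def divide_le_eq)
  then have "vnorm U (\<lambda>x. c * z x) <= 1" using vnorm_scale[OF z, of c] c by simp
  then have "integrable (lebesgue_on U) (\<lambda>x. \<bar>c * z x\<bar> powr q)" using K(2)[OF H01_scale[OF z]] by blast
  then have "integrable (lebesgue_on U) (\<lambda>x. c powr q * \<bar>z x\<bar> powr q)"
   using c by (simp add: abs_mult powr_mult)
  then show ?thesis using c by simp
 qed
 define B where "B = 1 + 1 / (q - P)"
 have B: "1 <= B" using Pq(1) by (simp add: B_def)
 interpret finite_measure "lebesgue_on U" by (rule finite_measure_U)
 have growth: "AE x in lebesgue_on U. \<forall>r. \<bar>source p x r\<bar> <= B * (1 + \<bar>r\<bar> powr (q - 1)) \<and> 2 <= p x \<and> p x <= P"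
  using pP m_le_p
 proof eventually_elim
  case (elim x)
  then show ?case using source_growth[of p x P q] Pq(1) m_gt_2 by (auto simp: B_def)
 qed
 have bound: "AE x in lebesgue_on U. \<bar>source p x (u x) * z x\<bar> <= B * (1 + \<bar>u x\<bar> powr q + 2 * \<bar>z x\<bar> powr q)" for z
  using growth
 proof eventually_elim
  case (elim x)
  have "\<bar>source p x (u x) * z x\<bar> <= B * (1 + \<bar>u x\<bar> powr (q - 1)) * \<bar>z x\<bar>"
   unfolding abs_mult using elim by (intro mult_right_mono) auto
  also have "... = B * (\<bar>z x\<bar> powr 1 + \<bar>u x\<bar> powr (q - 1) * \<bar>z x\<bar>)" by (simp add: algebra_simps)
  also have "... <= B * (1 + \<bar>u x\<bar> powr q + 2 * \<bar>z x\<bar> powr q)"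
   using powr_diff_1_mult_le[of "\<bar>u x\<bar>" "\<bar>z x\<bar>" q] le_1_plus_powr[of "\<bar>z x\<bar>" 1 q] q B
   by (intro mult_left_mono) auto
  finally show ?case .
 qed
 have dom: "integrable (lebesgue_on U) (\<lambda>x. B * (1 + \<bar>u x\<bar> powr q + 2 * \<bar>z x\<bar> powr q))" if "z \<in> H01 U" for z
  using int[OF u] int[OF that] by simp
 show int_s: "integrable (lebesgue_on U) (\<lambda>x. source p x (u x) * z x)" if z: "z \<in> H01 U" for z
 proof (rule Bochner_Integration.integrable_bound[OF dom[OF z]])
  show "(\<lambda>x. source p x (u x) * z x) \<in> borel_measurable (lebesgue_on U)"
   using source_measurable(1)[OF L2_measurable[OF H01_L2[OF u]]] L2_measurable[OF H01_L2[OF z]] by simp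
  show "AE x in lebesgue_on U. norm (source p x (u x) * z x) <= norm (B * (1 + \<bar>u x\<bar> powr q + 2 * \<bar>z x\<bar> powr q))"
   using bound[of z] by eventually_elim (unfold real_norm_def, erule order_trans, rule abs_ge_self)
 qed
 define K' where "K' = B * (measure (lebesgue_on U) U + (\<integral>x. \<bar>u x\<bar> powr q \<partial>lebesgue_on U) + 2 * K)"
 have ball: "\<bar>\<integral>x. source p x (u x) * z x \<partial>lebesgue_on U\<bar> <= K'" if z: "z \<in> H01 U" "vnorm U z <= 1" for z
 proof -
  have "\<bar>\<integral>x. source p x (u x) * z x \<partial>lebesgue_on U\<bar> <= (\<integral>x. \<bar>source p x (u x) * z x\<bar> \<partial>lebesgue_on U)"
   by (rule integral_abs_bound)
  also have "... <= (\<integral>x. B * (1 + \<bar>u x\<bar> powr q + 2 * \<bar>z x\<bar> powr q) \<partial>lebesgue_on U)"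
   using int_s[OF z(1)] dom[OF z(1)] bound[of z] by (intro integral_mono_AE) auto
  also have "... = B * (measure (lebesgue_on U) U + (\<integral>x. \<bar>u x\<bar> powr q \<partial>lebesgue_on U) + 2 * (\<integral>x. \<bar>z x\<bar> powr q \<partial>lebesgue_on U))"
   using int[OF u] int[OF z(1)] by simp
  also have "... <= K'" unfolding K'_def using K(2)[OF z] B by (intro mult_left_mono) auto
  finally show ?thesis .
 qed
 have "\<bar>\<integral>x. source p x (u x) * z x \<partial>lebesgue_on U\<bar> <= K' * vnorm U z" if z: "z \<in> H01 U" for z
 proof (rule field_le_epsilon)
  fix e :: real assume e: "0 < e"
  define d where "d = vnorm U z + e / (K' + 1)"
  have K'0: "0 <= K'" using ball[OF test_H01[OF test_zero]] vnorm_scale[OF test_H01[OF test_zero], of 0] by simp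
  then have d: "0 < d" "vnorm U z <= d" using e vnorm_nonneg[of z] by (auto simp: d_def add_nonneg_pos)
  have "\<bar>\<integral>x. source p x (u x) * (1 / d * z x) \<partial>lebesgue_on U\<bar> <= K'"
   by (rule ball[OF H01_scale[OF z]]) (use d in \<open>simp only: vnorm_scale[OF z], simp\<close>)
  moreover have "(\<integral>x. source p x (u x) * (1 / d * z x) \<partial>lebesgue_on U) = 1 / d * (\<integral>x. source p x (u x) * z x \<partial>lebesgue_on U)"
   by (subst integral_mult_right_zero[symmetric]) (simp add: mult_ac)
  ultimately have "1 / d * \<bar>\<integral>x. source p x (u x) * z x \<partial>lebesgue_on U\<bar> <= K'" using d by (simp add: abs_mult)
  then have "\<bar>\<integral>x. source p x (u x) * z x \<partial>lebesgue_on U\<bar> <= K' * d" using d by (simp add: divide_le_eq)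
  also have "... <= K' * vnorm U z + e"
  proof -
   have "K' * (e / (K' + 1)) <= e" using K'0 e by (simp add: field_simps)
   then show ?thesis by (simp add: d_def distrib_left)
  qed
  finally show "\<bar>\<integral>x. source p x (u x) * z x \<partial>lebesgue_on U\<bar> <= K' * vnorm U z + e" .
 qed
 then show "\<exists>K. \<forall>z\<in>H01 U. \<bar>\<integral>x. source p x (u x) * z x \<partial>lebesgue_on U\<bar> <= K * vnorm U z" by blast
 show "integrable (lebesgue_on U) (\<lambda>x. source_primitive p x (u x))"
 proof (rule Bochner_Integration.integrable_bound)
  show "integrable (lebesgue_on U) (\<lambda>x. \<bar>source p x (u x) * u x\<bar> + (1 + \<bar>u x\<bar> powr q))"
   using int_s[OF u] int[OF u] by simp
  show "(\<lambda>x. source_primitive p x (u x)) \<in> borel_measurable (lebesgue_on U)"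
   by (rule source_measurable(2)[OF L2_measurable[OF H01_L2[OF u]]])
  show "AE x in lebesgue_on U. norm (source_primitive p x (u x)) <= norm (\<bar>source p x (u x) * u x\<bar> + (1 + \<bar>u x\<bar> powr q))"
   using growth
  proof eventually_elim
   case (elim x)
   then have px: "2 <= p x" "p x <= P" by blast+
   show ?case
   proof (cases "u x = 0")
    case False
    define a where "a = \<bar>u x\<bar> powr p x"
    have "\<bar>u x\<bar> powr (p x - 2) * \<bar>u x\<bar>\<^sup>2 = a"
     using False by (simp add: a_def powr_diff powr_numeral)
    then have "source p x (u x) * u x = a * ln \<bar>u x\<bar>"
     using False by (simp add: source_def power2_eq_square mult_ac abs_mult_self_eq)
    then have eq: "source_primitive p x (u x) = source p x (u x) * u x / p x - a / (p x)\<^sup>2"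
     using False by (simp add: source_primitive_def a_def)
    have a: "0 <= a" "a <= 1 + \<bar>u x\<bar> powr q"
     using le_1_plus_powr[of "\<bar>u x\<bar>" "p x" q] px Pq(1) by (auto simp: a_def)
    have "\<bar>source p x (u x) * u x / p x\<bar> <= \<bar>source p x (u x) * u x\<bar>"
     using px mult_left_mono[of 1 "p x" "\<bar>source p x (u x) * u x\<bar>"] by (simp add: divide_le_eq)
    moreover have "a / (p x)\<^sup>2 <= a"
     using px a(1) one_le_power[of "p x" 2] mult_left_mono[of 1 "(p x)\<^sup>2" a] by (simp add: divide_le_eq)
    moreover have "0 <= a / (p x)\<^sup>2" using a by simp
    ultimately show ?thesis unfolding eq real_norm_def using a(2) by linarith
   qed (simp add: source_primitive_def)
  qed
 qed
qed

lemma C_star_integrable: "integrable (lebesgue_on U) (\<lambda>x. c_shift m (p x))"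
proof -
 interpret finite_measure "lebesgue_on U" by (rule finite_measure_U)
 note p_measurable[measurable]
 have "(\<lambda>x. c_shift m (p x)) \<in> borel_measurable (lebesgue_on U)"
  unfolding c_shift_def by measurable
 moreover have "\<bar>c_shift m r\<bar> <= 1" for r
 proof (cases "m < r")
  case True
  have "(r - m) / r\<^sup>2 <= 1"
   using True m_gt_2 mult_mono[of 1 r "r - m" r] by (simp add: divide_le_eq power2_eq_square)
  moreover have "exp (- r / (r - m)) <= 1" using True m_gt_2 by simp
  ultimately have "(r - m) / r\<^sup>2 * exp (- r / (r - m)) <= 1 * 1"
   using True by (intro mult_mono) auto
  with True show ?thesis by (simp add: c_shift_def abs_mult)
 qed (simp add: c_shift_def)
 ultimately show ?thesis by (intro integrable_const_bound[of _ 1]) auto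
qed

lemma source_energy:
 assumes u: "u \<in> H01 U"
 shows "m * (\<integral>x. source_primitive p x (u x) \<partial>lebesgue_on U) - C_star U p
  <= (\<integral>x. source p x (u x) * u x \<partial>lebesgue_on U)"
proof -
 have "m * (\<integral>x. source_primitive p x (u x) \<partial>lebesgue_on U) - C_star U p
   = (\<integral>x. m * source_primitive p x (u x) - c_shift m (p x) \<partial>lebesgue_on U)"
  using source_primitive_integrable[OF u] C_star_integrable by (simp add: C_star_def m_def)
 also have "... <= (\<integral>x. source p x (u x) * u x \<partial>lebesgue_on U)"
 proof (rule integral_mono_AE)
  show "AE x in lebesgue_on U. m * source_primitive p x (u x) - c_shift m (p x) <= source p x (u x) * u x"
   using m_le_p by eventually_elim (use m_gt_2 in \<open>auto intro: source_energy_pointwise\<close>)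
 qed (use source_primitive_integrable[OF u] C_star_integrable source_integrable[OF u u] in auto)
 finally show ?thesis .
qed

end

section \<open>Functions on a time interval\<close>

abbreviation tint :: "(real \<Rightarrow> real) \<Rightarrow> real \<Rightarrow> real \<Rightarrow> real" where
 "tint f s t \<equiv> integral\<^sup>L (lebesgue_on {s..t}) f"

lemma tint_combine:
 assumes "integrable (lebesgue_on {a..c}) f" "a <= b" "b <= c"
 shows "tint f a c = tint f a b + tint f b c"
 by (rule Equivalence_Measurable_On_Borel.integral_combine[OF assms])

lemma tint_FTC:
 assumes "!!r. r \<in> {a..b} ==> (F has_real_derivative f r) (at r within {a..b})" "continuous_on {a..b} f" "a <= b"
 shows "tint f a b = F b - F a"
proof -
 have "tint f a b = integral {a..b} f"
  by (intro lebesgue_integral_eq_integral continuous_imp_integrable_real assms) simp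
 also have "(f has_integral (F b - F a)) {a..b}"
  using assms by (intro fundamental_theorem_of_calculus)
   (auto simp: has_real_derivative_iff_has_vector_derivative)
 then have "integral {a..b} f = F b - F a" by (rule integral_unique)
 finally show ?thesis .
qed

lemma tint_has_derivative:
 assumes "continuous_on {a..b} f" "t \<in> {a..b}"
 shows "((\<lambda>t. tint f a t) has_real_derivative f t) (at t within {a..b})"
proof (rule has_field_derivative_transform_within[OF integral_has_real_derivative[OF assms], of 1])
 fix x assume "x \<in> {a..b}"
 then have "continuous_on {a..x} f" using assms(1) by (auto intro: continuous_on_subset)
 then show "integral {a..x} f = tint f a x"
  by (intro lebesgue_integral_eq_integral[symmetric] continuous_imp_integrable_real) auto
qed (use assms in auto)

lemma tint_mono_AE:
 assumes "integrable (lebesgue_on {a..b}) f" "integrable (lebesgue_on {a..b}) h"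
  "AE x in lebesgue_on {a..b}. f x <= h x"
 shows "tint f a b <= tint h a b"
 using assms by (rule integral_mono_AE)

lemma AE_subinterval:
 assumes "AE x in lebesgue_on {a..b}. Q x" "{c..d} \<subseteq> {a..b}"
 shows "AE x in lebesgue_on {c..d}. Q (x::real)"
proof -
 have "AE x in lebesgue. x \<in> {a..b} --> Q x" using assms(1) by (simp add: AE_restrict_space_iff)
 then have "AE x in lebesgue. x \<in> {c..d} --> Q x" by eventually_elim (use assms(2) in blast)
 then show ?thesis by (simp add: AE_restrict_space_iff)
qed

lemma AE_closed_interval:
 assumes "AE x in lebesgue_on {a<..<b}. Q x"
 shows "AE x in lebesgue_on {a..b}. Q (x::real)"
proof -
 have 1: "AE x in lebesgue. x \<in> {a<..<b} --> Q x" using assms by (simp add: AE_restrict_space_iff)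
 have "AE x in lebesgue. x \<noteq> a" "AE x in lebesgue. x \<noteq> b"
  by (auto intro!: AE_completion AE_lborel_singleton)
 with 1 have "AE x in lebesgue. x \<in> {a..b} --> Q x" by eventually_elim auto
 then show ?thesis by (simp add: AE_restrict_space_iff)
qed

lemma AE_indicator_open_closed:
 "AE x in lebesgue_on UNIV. indicator {a<..<b} x *\<^sub>R f x = (indicator {a..b} x *\<^sub>R f x :: real)" for a b :: real
proof -
 have "AE x in lebesgue. x \<noteq> a" "AE x in lebesgue. x \<noteq> b"
  by (auto intro!: AE_completion AE_lborel_singleton)
 then have "AE x in lebesgue. indicator {a<..<b} x *\<^sub>R f x = (indicator {a..b} x *\<^sub>R f x :: real)"
  by eventually_elim (auto simp: indicator_def)
 then show ?thesis by (simp only: lebesgue_on_UNIV_eq)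
qed

lemma borel_measurable_closed_interval:
 fixes f :: "real \<Rightarrow> real"
 assumes "f \<in> borel_measurable (lebesgue_on {a<..<b})"
 shows "f \<in> borel_measurable (lebesgue_on {a..b})"
proof -
 have "(\<lambda>x. indicator {a<..<b} x *\<^sub>R f x) \<in> borel_measurable (lebesgue_on UNIV)"
  using assms by (simp add: borel_measurable_restrict_space_iff lebesgue_on_UNIV_eq)
 from borel_measurable_AE_cong[OF _ this AE_indicator_open_closed]
 show ?thesis by (simp add: borel_measurable_restrict_space_iff lebesgue_on_UNIV_eq)
qed

lemma integral_open_interval:
 fixes f :: "real \<Rightarrow> real"
 assumes "f \<in> borel_measurable (lebesgue_on {a..b})"
 shows "(\<integral>x. f x \<partial>lebesgue_on {a<..<b}) = tint f a b"
proof -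
 have m: "(\<lambda>x. indicator {a..b} x *\<^sub>R f x) \<in> borel_measurable (lebesgue_on UNIV)"
  using assms by (simp add: borel_measurable_restrict_space_iff lebesgue_on_UNIV_eq)
 have m': "(\<lambda>x. indicator {a<..<b} x *\<^sub>R f x) \<in> borel_measurable (lebesgue_on UNIV)"
  by (rule borel_measurable_AE_cong[OF _ m]) (use AE_indicator_open_closed[of a b f] in auto)
 have "(\<integral>x. indicator {a<..<b} x *\<^sub>R f x \<partial>lebesgue_on UNIV) = (\<integral>x. indicator {a..b} x *\<^sub>R f x \<partial>lebesgue_on UNIV)"
  by (rule integral_cong_AE[OF m' m AE_indicator_open_closed])
 then show ?thesis by (simp add: integral_restrict_space lebesgue_on_UNIV_eq)
qed

lemma integrable_closed_interval:
 fixes f :: "real \<Rightarrow> real"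
 assumes "integrable (lebesgue_on {a<..<b}) f"
 shows "integrable (lebesgue_on {a..b}) f"
proof -
 have m: "(\<lambda>x. indicator {a..b} x *\<^sub>R f x) \<in> borel_measurable (lebesgue_on UNIV)"
  using borel_measurable_closed_interval[OF borel_measurable_integrable[OF assms]]
  by (simp add: borel_measurable_restrict_space_iff lebesgue_on_UNIV_eq)
 have i: "integrable (lebesgue_on UNIV) (\<lambda>x. indicator {a<..<b} x *\<^sub>R f x)"
  using assms by (simp add: integrable_restrict_space lebesgue_on_UNIV_eq)
 have "integrable (lebesgue_on UNIV) (\<lambda>x. indicator {a..b} x *\<^sub>R f x)"
  by (rule integrable_cong_AE_imp[OF i m])
   (use AE_indicator_open_closed[of a b f] in \<open>eventually_elim, simp\<close>)
 then show ?thesis by (simp add: integrable_restrict_space lebesgue_on_UNIV_eq)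
qed

text \<open>Summed over a fine partition of \<open>{s..t}\<close>, the increments of \<open>R\<close> amount to at most \<open>e\<close> times the total
 increment of \<open>H\<close>.\<close>

lemma constant_if_small_increments:
 fixes R H :: "real \<Rightarrow> real"
 assumes small: "!!e. 0 < e ==> \<exists>d>0. \<forall>s t. 0 <= s \<and> s <= t \<and> t <= T \<and> t - s < d --> \<bar>R t - R s\<bar> <= e * (H t - H s)"
  and st: "0 <= s" "s <= t" "t <= T"
 shows "R t = R s"
proof -
 have le: "\<bar>R t - R s\<bar> <= e * (H t - H s)" if e: "0 < e" for e
 proof -
  obtain d where d: "0 < d" "!!s t. 0 <= s ==> s <= t ==> t <= T ==> t - s < d ==> \<bar>R t - R s\<bar> <= e * (H t - H s)"
   using small[OF e] by blast
  obtain n where n: "(t - s) / d < real n" using reals_Archimedean2 by blast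
  have n0: "0 < real n" using n st d(1) by (meson divide_nonneg_pos diff_ge_0_iff_ge le_less_trans)
  define h where "h = (t - s) / real n"
  have h: "0 <= h" "h < d" using n n0 st d(1) by (auto simp: h_def field_simps)
  have nh: "real n * h = t - s" using n0 by (simp add: h_def)
  have "\<bar>R (s + real i * h) - R s\<bar> <= e * (H (s + real i * h) - H s)" if "i <= n" for i
   using that
  proof (induction i)
   case (Suc i)
   have "real (Suc i) * h <= real n * h" using Suc.prems h by (intro mult_right_mono) auto
   then have "\<bar>R (s + real (Suc i) * h) - R (s + real i * h)\<bar> <= e * (H (s + real (Suc i) * h) - H (s + real i * h))"
    using nh st h by (intro d(2)) (auto simp: algebra_simps)
   moreover have "\<bar>R (s + real i * h) - R s\<bar> <= e * (H (s + real i * h) - H s)" using Suc by simp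
   ultimately show ?case unfolding right_diff_distrib by linarith
  qed simp
  from this[of n] nh show ?thesis by simp
 qed
 have "\<bar>R t - R s\<bar> <= 0"
 proof (rule field_le_epsilon)
  fix e :: real assume e: "0 < e"
  have "\<bar>R t - R s\<bar> <= (e / (\<bar>H t - H s\<bar> + 1)) * (H t - H s)" using e by (intro le) (simp add: add_nonneg_pos)
  also have "... <= (e / (\<bar>H t - H s\<bar> + 1)) * (\<bar>H t - H s\<bar> + 1)" using e by (intro mult_left_mono) auto
  also have "... = e" by simp
  finally show "\<bar>R t - R s\<bar> <= 0 + e" by simp
 qed
 then show ?thesis by simp
qed

lemma uniform_modulus:
 fixes d :: "real \<Rightarrow> real \<Rightarrow> real"
 assumes tri: "!!r s t. r \<in> {0..T} ==> s \<in> {0..T} ==> t \<in> {0..T} ==> d s t <= d s r + d t r"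
  and zero: "!!t. d t t = 0"
  and cont: "!!t. t \<in> {0..T} ==> ((\<lambda>s. d s t) \<longlongrightarrow> 0) (at t within {0..T})"
  and e: "0 < e"
 shows "\<exists>\<delta>>0. \<forall>s\<in>{0..T}. \<forall>t\<in>{0..T}. \<bar>s - t\<bar> < \<delta> --> d s t < e"
proof -
 have "\<exists>\<delta>>0. \<forall>s\<in>{0..T}. \<bar>s - t\<bar> < \<delta> --> d s t < e / 2" if "t \<in> {0..T}" for t
 proof -
  have "eventually (\<lambda>s. d s t < e / 2) (at t within {0..T})"
   using cont[OF that] e by (intro order_tendstoD(2)) auto
  then obtain \<delta> where "\<delta> > 0" "!!s. s \<in> {0..T} ==> s \<noteq> t ==> dist s t < \<delta> ==> d s t < e / 2"
   by (auto simp: eventually_at)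
  then show ?thesis using zero[of t] e by (intro exI[of _ \<delta>]) (metis dist_real_def half_gt_zero)
 qed
 then obtain \<delta> where \<delta>: "!!t. t \<in> {0..T} ==> 0 < \<delta> t"
   "!!s t. t \<in> {0..T} ==> s \<in> {0..T} ==> \<bar>s - t\<bar> < \<delta> t ==> d s t < e / 2" by metis
 obtain \<epsilon> where \<epsilon>: "0 < \<epsilon>" "!!t. t \<in> {0..T} ==> \<exists>G\<in>(\<lambda>t. ball t (\<delta> t)) ` {0..T}. ball t \<epsilon> \<subseteq> G"
 proof (rule Heine_Borel_lemma)
  show "compact {0..T}" by simp
  show "{0..T} \<subseteq> \<Union> ((\<lambda>t. ball t (\<delta> t)) ` {0..T})" using \<delta>(1) by force
  show "open G" if "G \<in> (\<lambda>t. ball t (\<delta> t)) ` {0..T}" for G using that by auto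
 qed (metis)
 have "d s t < e" if st: "s \<in> {0..T}" "t \<in> {0..T}" "\<bar>s - t\<bar> < \<epsilon>" for s t
 proof -
  obtain r where r: "r \<in> {0..T}" "ball t \<epsilon> \<subseteq> ball r (\<delta> r)" using \<epsilon>(2)[OF st(2)] by blast
  have "s \<in> ball t \<epsilon>" "t \<in> ball t \<epsilon>" using st(3) \<epsilon>(1) by (auto simp: dist_real_def abs_minus_commute)
  with r(2) have "s \<in> ball r (\<delta> r)" "t \<in> ball r (\<delta> r)" by blast+
  then have "\<bar>s - r\<bar> < \<delta> r" "\<bar>t - r\<bar> < \<delta> r" by (auto simp: dist_real_def abs_minus_commute)
  then show ?thesis using tri[OF r(1) st(1,2)] \<delta>(2)[OF r(1) st(1)] \<delta>(2)[OF r(1) st(2)] by linarith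
 qed
 with \<epsilon>(1) show ?thesis by blast
qed

lemma simple_function_apply_measurable:
 assumes s: "simple_function M s" and B: "!!z. z \<in> s ` space M ==> (\<lambda>t. B t z) \<in> borel_measurable M"
 shows "(\<lambda>t. B t (s t)) \<in> borel_measurable M"
proof (rule measurable_compose_countable'[where f = "\<lambda>z t. B t z" and I = "s ` space M"])
 show "s \<in> M \<rightarrow>\<^sub>M count_space (s ` space M)"
  using s by (subst measurable_count_space_eq2) (auto simp: simple_functionD)
 show "countable (s ` space M)" using simple_functionD(1)[OF s] by (rule countable_finite)
qed (rule B)

subsection \<open>Weak derivatives in time\<close>

text \<open>Differences of two rescaled steps are the test functions that single out a time interval.\<close>

definition smooth_step :: "(real \<Rightarrow> real) \<Rightarrow> (real \<Rightarrow> real) \<Rightarrow> bool" where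
 "smooth_step \<Theta> \<Theta>' \<longleftrightarrow> smooth_on UNIV \<Theta> \<and> continuous_on UNIV \<Theta>' \<and>
   (\<forall>x. (\<Theta> has_real_derivative \<Theta>' x) (at x)) \<and> (\<forall>x. 0 <= \<Theta>' x) \<and>
   (\<forall>x\<le>-1. \<Theta> x = 0) \<and> (\<forall>x\<ge>1. \<Theta> x = 1) \<and> (\<forall>x. 1 <= \<bar>x\<bar> --> \<Theta>' x = 0)"

lemma smooth_step_exists: "\<exists>\<Theta> \<Theta>'. smooth_step \<Theta> \<Theta>'"
proof -
 define \<beta> :: "real \<Rightarrow> real" where "\<beta> = box_bump 2 (-1) 1"
 have sm: "Ck_on k UNIV \<beta>" for k using box_bump_smooth[of 2 "-1::real" 1] by (simp add: \<beta>_def smooth_on_def)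
 have c: "continuous_on S \<beta>" for S using sm[of 0] by (auto intro: continuous_on_subset)
 have nonneg: "0 <= \<beta> x" for x by (simp add: \<beta>_def box_bump_bounds)
 have zero: "\<beta> x = 0" if "1 <= \<bar>x\<bar>" for x
 proof (rule ccontr)
  assume "\<beta> x \<noteq> 0"
  from box_bump_nonzero[OF this[unfolded \<beta>_def], of 1] that show False by auto
 qed
 have pos: "0 < \<beta> 0" by (simp add: \<beta>_def box_bump_def flat_1_bounds)
 define F where "F x = integral {-2..x} \<beta>" for x
 have F_left: "F x = 0" if "x <= -1" for x
 proof -
  have "integral {-2..x} \<beta> = integral {-2..x} (\<lambda>_. 0)"
   by (rule integral_cong) (use zero that in auto)
  then show ?thesis by (simp add: F_def)
 qed
 have F': "(F has_real_derivative \<beta> x) (at x)" for x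
 proof (cases "x < -1")
  case True
  have "((\<lambda>_. 0) has_real_derivative 0) (at x)" by simp
  then have "(F has_real_derivative 0) (at x)"
   by (rule has_field_derivative_transform_within_open[where S = "{..<-1}"]) (use True F_left in auto)
  then show ?thesis using True zero[of x] by simp
 next
  case False
  have "((\<lambda>x. integral {-2..x} \<beta>) has_real_derivative \<beta> x) (at x within {-2..x + 1})"
   by (rule integral_has_real_derivative) (use False c in auto)
  moreover have "at x within {-2..x + 1} = at x" using False by (intro at_within_interior) auto
  ultimately show ?thesis by (simp add: F_def[abs_def])
 qed
 have F_right: "F x = F 1" if "1 <= x" for x
 proof -
  have "integral {-2..1} \<beta> + integral {1..x} \<beta> = integral {-2..x} \<beta>"
   by (rule Henstock_Kurzweil_Integration.integral_combine) (use that in \<open>auto intro: integrable_continuous_real c\<close>)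
  moreover have "integral {1..x} \<beta> = integral {1..x} (\<lambda>_. 0)" by (rule integral_cong) (use zero in auto)
  ultimately show ?thesis by (simp add: F_def)
 qed
 have "F 1 \<noteq> 0"
 proof
  assume "F 1 = 0"
  then have "(\<beta> has_integral 0) (cbox (-2) 1)"
   using integrable_integral[OF integrable_continuous_real[OF c[of "{-2..1}"]]] by (simp add: F_def)
  from has_integral_0_cbox_imp_0[OF c nonneg this, of 0] have "\<beta> 0 = 0" by simp
  with pos show False by simp
 qed
 moreover have "0 <= F 1" unfolding F_def by (intro integral_nonneg integrable_continuous_real c nonneg)
 ultimately have F1: "0 < F 1" by simp
 define \<Theta> where "\<Theta> x = (1 / F 1) * F x" for x
 define \<Theta>' where "\<Theta>' x = (1 / F 1) * \<beta> x" for x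
 have D: "(\<Theta> has_real_derivative \<Theta>' x) (at x)" for x
  unfolding \<Theta>_def[abs_def] \<Theta>'_def by (intro DERIV_cmult F')
 have "Ck_on k UNIV \<Theta>" for k
 proof -
  have "Ck_on (Suc k) UNIV \<Theta>"
  proof (rule Ck_on_SucI)
   show "(\<Theta> has_derivative (*) (\<Theta>' x)) (at x)" for x using D[of x] by (simp add: has_field_derivative_def)
   fix b :: real assume "b \<in> Basis"
   then show "Ck_on k UNIV (\<lambda>x. \<Theta>' x * b)"
    unfolding \<Theta>'_def by (intro Ck_on_mult Ck_on_const sm)
  qed
  then show ?thesis by (rule Ck_on_Suc_D)
 qed
 then have "smooth_on UNIV \<Theta>" by (simp add: smooth_on_def)
 moreover have "continuous_on UNIV \<Theta>'"
  unfolding \<Theta>'_def[abs_def] by (intro continuous_intros c[of UNIV])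
 moreover have "0 <= \<Theta>' x" for x unfolding \<Theta>'_def using F1 nonneg[of x] by simp
 moreover have "\<Theta> x = 0" if "x <= -1" for x unfolding \<Theta>_def using F_left[of x] that by simp
 moreover have "\<Theta> x = 1" if "1 <= x" for x unfolding \<Theta>_def using F_right[of x] that F1 by simp
 moreover have "\<Theta>' x = 0" if "1 <= \<bar>x\<bar>" for x unfolding \<Theta>'_def using zero[of x] that by simp
 ultimately have "smooth_step \<Theta> \<Theta>'"
  unfolding smooth_step_def using D by blast
 then show ?thesis by blast
qed

lemma smooth_affine:
 fixes h :: "real \<Rightarrow> real"
 assumes "smooth_on UNIV h"
 shows "Ck_on k UNIV (\<lambda>x. h (a * x + b))"
proof -
 have "Ck_on k UNIV (\<lambda>x::real. 1 * h (a * (x \<bullet> 1) + b))"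
 proof (rule Ck_on_affine[where \<H> = "{h. smooth_on UNIV h}"])
  fix h :: "real \<Rightarrow> real" assume "h \<in> {h. smooth_on UNIV h}"
  then have sm: "!!k. Ck_on k UNIV h" by (simp add: smooth_on_def)
  have "h differentiable (at x)" for x using sm[of 1] by simp
  then have hd: "(h has_derivative frechet_derivative h (at x)) (at x)" for x by (simp add: frechet_derivative_works)
  have lin: "frechet_derivative h (at x) y = frechet_derivative h (at x) 1 * y" for x y
  proof -
   interpret bounded_linear "frechet_derivative h (at x)"
    by (rule has_derivative_bounded_linear[OF hd])
   have "frechet_derivative h (at x) y = frechet_derivative h (at x) (y *\<^sub>R 1)" by simp
   also have "... = y *\<^sub>R frechet_derivative h (at x) 1" by (rule scaleR)
   also have "... = frechet_derivative h (at x) 1 * y" by (simp add: mult.commute)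
   finally show ?thesis .
  qed
  have "(h has_real_derivative frechet_derivative h (at x) 1) (at x)" for x
   by (rule has_derivative_imp_has_field_derivative[OF hd]) (rule trans[OF mult.commute lin[symmetric]])
  moreover have "smooth_on UNIV (\<lambda>x. frechet_derivative h (at x) 1)"
   unfolding smooth_on_def
  proof
   fix k
   have "Ck_on (Suc k) UNIV h" by (rule sm)
   then show "Ck_on k UNIV (\<lambda>x. frechet_derivative h (at x) 1)" by simp
  qed
  ultimately show "\<exists>h'\<in>{h. smooth_on UNIV h}. \<forall>x. (h has_real_derivative h' x) (at x)"
   by (intro bexI[of _ "\<lambda>x. frechet_derivative h (at x) 1"]) auto
 qed (use assms in simp)
 then show ?thesis by simp
qed

text \<open>Testing with a function rising from \<open>0\<close> to \<open>1\<close> at \<open>s\<close> and falling back at \<open>t\<close>.\<close>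

lemma weak_derivative_increment:
 fixes f h :: "real \<Rightarrow> real"
 assumes f: "continuous_on {0..T} f" and h: "integrable (lebesgue_on {0..T}) h"
  and weak: "!!\<phi>. \<phi> \<in> test_functions {0<..<T} ==>
   (\<integral>x. deriv \<phi> x * f x \<partial>lebesgue_on {0<..<T}) = - (\<integral>x. \<phi> x * h x \<partial>lebesgue_on {0<..<T})"
  and st: "0 < s" "s < t" "t < T"
 shows "f t - f s = tint h s t"
proof -
 obtain \<Theta> \<Theta>' where step: "smooth_step \<Theta> \<Theta>'" using smooth_step_exists by blast
 then have \<Theta>: "smooth_on UNIV \<Theta>"
  "!!x. (\<Theta> has_real_derivative \<Theta>' x) (at x)" "continuous_on UNIV \<Theta>'" "!!x. 0 <= \<Theta>' x"
  "!!x. x <= -1 ==> \<Theta> x = 0" "!!x. 1 <= x ==> \<Theta> x = 1" "!!x. 1 <= \<bar>x\<bar> ==> \<Theta>' x = 0"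
  by (simp_all add: smooth_step_def)
 have \<Theta>_mono: "\<Theta> x <= \<Theta> y" if "x <= y" for x y
  using DERIV_nonneg_imp_nondecreasing[OF that] \<Theta>(2,4) by blast
 have \<Theta>_range: "0 <= \<Theta> x" "\<Theta> x <= 1" for x
  using \<Theta>_mono[of "min x (-1)" x] \<Theta>_mono[of x "max x 1"] \<Theta>(5,6) by auto
 define S where "S a k x = \<Theta> (real k * (x - a))" for a k x
 define S' where "S' a k x = real k * \<Theta>' (real k * (x - a))" for a k x
 have S': "(S a k has_real_derivative S' a k x) (at x)" for a k x
  unfolding S_def[abs_def] S'_def
  by (rule DERIV_cong[OF DERIV_chain2[OF \<Theta>(2)]]) (auto intro!: derivative_eq_intros)
 have S'_cont: "continuous_on X (S' a k)" for X a k
  unfolding S'_def[abs_def] by (intro continuous_intros continuous_on_compose2[OF \<Theta>(3)]) auto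
 have S'_nonneg: "0 <= S' a k x" for a k x by (simp add: S'_def \<Theta>(4))
 define d where "d = Min {s, t - s, T - t}"
 have d: "0 < d" "d <= s" "d <= t - s" "d <= T - t" using st by (auto simp: d_def)
 have Smooth: "Ck_on j UNIV (S a k)" for a k j
  using smooth_affine[OF \<Theta>(1), of j "real k" "- real k * a"] by (simp add: S_def[abs_def] algebra_simps)
 have S_left: "S a k x = 0" if "x <= a - 1 / real k" "0 < k" for a k x
  using that by (auto simp: S_def field_simps intro!: \<Theta>(5))
 have S_right: "S a k x = 1" if "a + 1 / real k <= x" "0 < k" for a k x
  using that by (auto simp: S_def field_simps intro!: \<Theta>(6))
 have S'_zero: "S' a k x = 0" if "1 / real k <= \<bar>x - a\<bar>" "0 < k" for a k x
 proof -
  have "1 <= \<bar>real k * (x - a)\<bar>" using that by (simp add: abs_mult divide_le_eq mult.commute)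
  then show ?thesis by (simp add: S'_def \<Theta>(7))
 qed
 have ev: "eventually (\<lambda>k. 0 < k \<and> 1 / real k < d / 2) sequentially"
 proof -
  have "(\<lambda>k. 1 / real k) \<longlonglongrightarrow> 0" by (rule lim_1_over_n)
  then have "eventually (\<lambda>k. 1 / real k < d / 2) sequentially" using d(1) by (intro order_tendstoD(2)) auto
  with eventually_gt_at_top[of "0::nat"] show ?thesis by eventually_elim simp
 qed
 have approx: "(\<lambda>k. tint (\<lambda>x. S' a k x * f x) 0 T) \<longlonglongrightarrow> f a" if a: "a = s \<or> a = t" for a
 proof (rule LIMSEQ_I)
  fix e :: real assume e: "0 < e"
  have aT: "d <= a" "a <= T - d" using a d st by auto
  obtain \<delta> where \<delta>: "0 < \<delta>" "!!x. x \<in> {0..T} ==> \<bar>x - a\<bar> < \<delta> ==> \<bar>f x - f a\<bar> < e / 2"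
   using f[unfolded continuous_on_iff, rule_format, of a "e / 2"] aT d(1) e by (auto simp: dist_real_def)
  have "(\<lambda>k. 1 / real k) \<longlonglongrightarrow> 0" by (rule lim_1_over_n)
  then have "eventually (\<lambda>k. 1 / real k < \<delta>) sequentially" using \<delta>(1) by (intro order_tendstoD(2)) auto
  with ev have "eventually (\<lambda>k. norm (tint (\<lambda>x. S' a k x * f x) 0 T - f a) < e) sequentially"
  proof eventually_elim
   case (elim k)
   have k: "0 < k" "1 / real k < d / 2" using elim by auto
   have mass: "tint (S' a k) 0 T = 1"
   proof -
    have "tint (S' a k) 0 T = S a k T - S a k 0"
     by (rule tint_FTC[OF _ S'_cont]) (use S' st in \<open>auto intro: has_field_derivative_at_within\<close>)
    moreover have "S a k T = 1" using k d(1) aT by (intro S_right) linarith+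
    moreover have "S a k 0 = 0" using k d(1) aT by (intro S_left) linarith+
    ultimately show ?thesis by simp
   qed
   have i1: "integrable (lebesgue_on {0..T}) (\<lambda>x. S' a k x * f x)"
    by (intro continuous_imp_integrable_real continuous_intros S'_cont f)
   have i2: "integrable (lebesgue_on {0..T}) (S' a k)"
    by (intro continuous_imp_integrable_real S'_cont)
   have "tint (\<lambda>x. S' a k x * f x) 0 T - f a = tint (\<lambda>x. S' a k x * f x) 0 T - tint (\<lambda>x. S' a k x * f a) 0 T"
    using mass by simp
   also have "... = tint (\<lambda>x. S' a k x * f x - S' a k x * f a) 0 T"
    by (rule Bochner_Integration.integral_diff[symmetric]) (use i1 i2 in auto)
   also have "\<bar>...\<bar> <= tint (\<lambda>x. \<bar>S' a k x * f x - S' a k x * f a\<bar>) 0 T" by (rule integral_abs_bound)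
   also have "... <= tint (\<lambda>x. S' a k x * (e / 2)) 0 T"
   proof (rule integral_mono)
    show "integrable (lebesgue_on {0..T}) (\<lambda>x. \<bar>S' a k x * f x - S' a k x * f a\<bar>)" using i1 i2 by simp
    show "integrable (lebesgue_on {0..T}) (\<lambda>x. S' a k x * (e / 2))" using i2 by simp
    fix x assume "x \<in> space (lebesgue_on {0..T})"
    then have x: "x \<in> {0..T}" by simp
    show "\<bar>S' a k x * f x - S' a k x * f a\<bar> <= S' a k x * (e / 2)"
    proof (cases "1 / real k <= \<bar>x - a\<bar>")
     case True
     then show ?thesis using S'_zero[OF True k(1)] by simp
    next
     case False
     then have "\<bar>f x - f a\<bar> <= e / 2" using \<delta>(2)[OF x] elim by (simp add: less_imp_le)
     then have "S' a k x * \<bar>f x - f a\<bar> <= S' a k x * (e / 2)" by (intro mult_left_mono S'_nonneg)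
     moreover have "\<bar>S' a k x * f x - S' a k x * f a\<bar> = S' a k x * \<bar>f x - f a\<bar>"
      using S'_nonneg[of a k x] by (simp add: abs_mult flip: right_diff_distrib)
     ultimately show ?thesis by simp
    qed
   qed
   also have "... = e / 2" using mass by simp
   finally show ?case using e by simp
  qed
  then show "\<exists>no. \<forall>k\<ge>no. norm (tint (\<lambda>x. S' a k x * f x) 0 T - f a) < e" by (simp add: eventually_sequentially)
 qed
 define \<phi> where "\<phi> k x = S s k x - S t k x" for k x
 have \<phi>': "deriv (\<phi> k) x = S' s k x - S' t k x" for k x
  unfolding \<phi>_def[abs_def] by (intro DERIV_imp_deriv DERIV_diff S')
 have test: "\<phi> k \<in> test_functions {0<..<T}" if k: "0 < k" "1 / real k < d / 2" for k
 proof -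
  have "Ck_on j UNIV (\<lambda>x. S s k x + (-1) * S t k x)" for j by (intro Ck_on_add Ck_on_mult Ck_on_const Smooth)
  then have "smooth_on UNIV (\<phi> k)" by (simp add: smooth_on_def \<phi>_def[abs_def])
  moreover have "\<phi> k x = 0" if "x \<notin> {d / 2..T - d / 2}" for x
  proof (cases "x < d / 2")
   case True
   then have "S s k x = 0" "S t k x = 0" using k d st by (intro S_left; linarith)+
   then show ?thesis by (simp add: \<phi>_def)
  next
   case False
   with that have "T - d / 2 < x" by simp
   then have "S s k x = 1" "S t k x = 1" using k d st by (intro S_right; linarith)+
   then show ?thesis by (simp add: \<phi>_def)
  qed
  moreover have "compact {d / 2..T - d / 2}" "{d / 2..T - d / 2} \<subseteq> {0<..<T}" using d by auto
  ultimately show ?thesis unfolding test_functions_def by blast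
 qed
 have \<phi>_cont: "continuous_on X (\<phi> k)" for X k
  unfolding \<phi>_def[abs_def] using Smooth[of 0 s k] Smooth[of 0 t k]
  by (auto intro!: continuous_intros intro: continuous_on_subset)
 have m\<phi>: "\<phi> k \<in> borel_measurable (lebesgue_on {0..T})" for k
  by (rule borel_measurable_integrable[OF continuous_imp_integrable_real[OF \<phi>_cont]])
 have id: "tint (\<lambda>x. S' s k x * f x) 0 T - tint (\<lambda>x. S' t k x * f x) 0 T = - tint (\<lambda>x. \<phi> k x * h x) 0 T"
  if k: "0 < k" "1 / real k < d / 2" for k
 proof -
  have ii: "integrable (lebesgue_on {0..T}) (\<lambda>x. S' a k x * f x)" for a
   by (intro continuous_imp_integrable_real continuous_intros S'_cont f)
  have "tint (\<lambda>x. S' s k x * f x) 0 T - tint (\<lambda>x. S' t k x * f x) 0 T = tint (\<lambda>x. deriv (\<phi> k) x * f x) 0 T"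
   unfolding \<phi>' left_diff_distrib by (rule Bochner_Integration.integral_diff[symmetric]) (rule ii)+
  also have "... = (\<integral>x. deriv (\<phi> k) x * f x \<partial>lebesgue_on {0<..<T})"
   unfolding \<phi>' by (intro integral_open_interval[symmetric] borel_measurable_integrable
     continuous_imp_integrable_real continuous_intros S'_cont f)
  also have "... = - (\<integral>x. \<phi> k x * h x \<partial>lebesgue_on {0<..<T})" by (rule weak[OF test[OF k]])
  also have "(\<integral>x. \<phi> k x * h x \<partial>lebesgue_on {0<..<T}) = tint (\<lambda>x. \<phi> k x * h x) 0 T"
   by (intro integral_open_interval borel_measurable_times m\<phi> borel_measurable_integrable[OF h])
  finally show ?thesis .
 qed
 have lim1: "(\<lambda>k. tint (\<lambda>x. S' s k x * f x) 0 T - tint (\<lambda>x. S' t k x * f x) 0 T) \<longlonglongrightarrow> f s - f t"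
  by (intro tendsto_diff approx) auto
 have "(\<lambda>k. tint (\<lambda>x. \<phi> k x * h x) 0 T) \<longlonglongrightarrow> tint (\<lambda>x. indicator {s..t} x * h x) 0 T"
 proof (rule integral_dominated_convergence[where w = "\<lambda>x. \<bar>h x\<bar>"])
  have "integrable (lebesgue_on {0..T}) (\<lambda>x. indicator {s..t} x *\<^sub>R h x)"
   by (rule integrable_mult_indicator[OF _ h]) (use st in \<open>auto simp: sets_restrict_space_iff\<close>)
  then show "(\<lambda>x. indicator {s..t} x * h x) \<in> borel_measurable (lebesgue_on {0..T})" by auto
  show "(\<lambda>x. \<phi> k x * h x) \<in> borel_measurable (lebesgue_on {0..T})" for k
   by (intro borel_measurable_times m\<phi> borel_measurable_integrable[OF h])
  show "integrable (lebesgue_on {0..T}) (\<lambda>x. \<bar>h x\<bar>)" using h by simp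
  have "AE x in lebesgue. x \<noteq> s" "AE x in lebesgue. x \<noteq> t"
   by (auto intro!: AE_completion AE_lborel_singleton)
  then have "AE x in lebesgue. x \<in> {0..T} --> (\<lambda>k. \<phi> k x * h x) \<longlonglongrightarrow> indicator {s..t} x * h x"
  proof eventually_elim
   case (elim x)
   have step: "(\<lambda>k. S a k x) \<longlonglongrightarrow> (if a < x then 1 else 0)" if "x \<noteq> a" for a
   proof -
    have "(\<lambda>k. 1 / real k) \<longlonglongrightarrow> 0" by (rule lim_1_over_n)
    then have "eventually (\<lambda>k. 1 / real k < \<bar>x - a\<bar>) sequentially" using that by (intro order_tendstoD(2)) auto
    with eventually_gt_at_top[of "0::nat"] have "eventually (\<lambda>k. (if a < x then 1 else 0) = S a k x) sequentially"
    proof eventually_elim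
     case (elim k)
     then show ?case using that S_left[of x a k] S_right[of a k x] by (auto simp: abs_if split: if_splits)
    qed
    then show ?thesis by (rule Lim_transform_eventually[OF tendsto_const])
   qed
   have "(\<lambda>k. \<phi> k x * h x) \<longlonglongrightarrow> ((if s < x then 1 else 0) - (if t < x then 1 else 0)) * h x"
    unfolding \<phi>_def using elim by (intro tendsto_intros step) auto
   moreover have "((if s < x then 1 else 0) - (if t < x then 1 else 0)) * h x = indicator {s..t} x * h x"
    using elim st by (auto simp: indicator_def)
   ultimately show ?case by simp
  qed
  then show "AE x in lebesgue_on {0..T}. (\<lambda>k. \<phi> k x * h x) \<longlonglongrightarrow> indicator {s..t} x * h x"
   by (simp add: AE_restrict_space_iff)
  have "\<bar>\<phi> k x\<bar> <= 1" for k x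
   unfolding \<phi>_def S_def using \<Theta>_range[of "real k * (x - s)"] \<Theta>_range[of "real k * (x - t)"] by linarith
  then show "AE x in lebesgue_on {0..T}. norm (\<phi> k x * h x) <= \<bar>h x\<bar>" for k
   by (intro AE_I2) (simp add: abs_mult mult_left_le_one_le)
 qed
 moreover have "tint (\<lambda>x. indicator {s..t} x * h x) 0 T = tint h s t"
 proof -
  have eq: "(\<lambda>x. indicator {0..T} x *\<^sub>R (indicator {s..t} x * h x)) = (\<lambda>x. indicator {s..t} x *\<^sub>R h x)"
   using st by (auto simp: indicator_def fun_eq_iff)
  have "tint (\<lambda>x. indicator {s..t} x * h x) 0 T = (\<integral>x. indicator {0..T} x *\<^sub>R (indicator {s..t} x * h x) \<partial>lebesgue)"
   by (rule integral_restrict_space) simp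
  also have "... = tint h s t" unfolding eq by (rule integral_restrict_space[symmetric]) simp
  finally show ?thesis .
 qed
 ultimately have lim2: "(\<lambda>k. - tint (\<lambda>x. \<phi> k x * h x) 0 T) \<longlonglongrightarrow> - tint h s t"
  by (simp add: tendsto_minus)
 have "eventually (\<lambda>k. - tint (\<lambda>x. \<phi> k x * h x) 0 T
   = tint (\<lambda>x. S' s k x * f x) 0 T - tint (\<lambda>x. S' t k x * f x) 0 T) sequentially"
  using ev by eventually_elim (use id in simp)
 then have lim3: "(\<lambda>k. tint (\<lambda>x. S' s k x * f x) 0 T - tint (\<lambda>x. S' t k x * f x) 0 T) \<longlonglongrightarrow> - tint h s t"
  by (rule Lim_transform_eventually[OF lim2])
 show ?thesis using LIMSEQ_unique[OF lim1 lim3] by linarith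
qed

subsection \<open>Absolutely continuous functions\<close>

definition variation_modulus :: "real \<Rightarrow> real \<Rightarrow> (real \<Rightarrow> real) \<Rightarrow> real \<Rightarrow> real \<Rightarrow> bool" where
 "variation_modulus a b f e \<delta> \<longleftrightarrow> (\<forall>D::(real \<times> real) set.
   finite D \<and> (\<forall>(c, d)\<in>D. a <= c \<and> c <= d \<and> d <= b) \<and>
   pairwise (\<lambda>I J. {fst I<..<snd I} \<inter> {fst J<..<snd J} = {}) D \<and>
   (\<Sum>(c, d)\<in>D. d - c) < \<delta> --> (\<Sum>(c, d)\<in>D. \<bar>f d - f c\<bar>) < e)"

lemma absolutely_continuous_iff_modulus:
 "absolutely_continuous_on_interval a b f \<longleftrightarrow> (\<forall>e>0. \<exists>\<delta>>0. variation_modulus a b f e \<delta>)"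
 unfolding absolutely_continuous_on_interval_def variation_modulus_def ..

lemma variation_modulusD:
 assumes "variation_modulus a b f e \<delta>" "finite D" "\<forall>(c, d)\<in>D. a <= c \<and> c <= d \<and> d <= b"
  "pairwise (\<lambda>I J. {fst I<..<snd I} \<inter> {fst J<..<snd J} = {}) D" "(\<Sum>(c, d)\<in>D. d - c) < \<delta>"
 shows "(\<Sum>(c, d)\<in>D. \<bar>f d - f c\<bar>) < e"
 by (rule mp[OF spec[OF assms(1)[unfolded variation_modulus_def], of D]]) (intro conjI assms)

lemma absolutely_continuous_on_interval_continuous:
 assumes ac: "absolutely_continuous_on_interval a b f"
 shows "continuous_on {a..b} f"
 unfolding continuous_on_iff
proof (intro ballI allI impI)
 fix x e :: real assume x: "x \<in> {a..b}" and e: "0 < e"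
 obtain d where d: "0 < d" and modulus: "variation_modulus a b f e d"
  using ac e unfolding absolutely_continuous_iff_modulus by blast
 note D = variation_modulusD[OF modulus]
 have "dist (f y) (f x) < e" if y: "y \<in> {a..b}" "dist y x < d" for y
  using D[of "{(min x y, max x y)}"] x y e
  by (cases "x <= y") (auto simp: dist_real_def min_def max_def abs_minus_commute)
 with d show "\<exists>d>0. \<forall>y\<in>{a..b}. dist y x < d --> dist (f y) (f x) < e" by blast
qed

text \<open>In a sufficiently fine tagged division, the intervals with tags at which the derivative is
 controlled contribute at most a Riemann sum, and the others have small total length.\<close>

theorem absolutely_continuous_increment_le:
 assumes ac: "absolutely_continuous_on_interval a b f" and h: "integrable (lebesgue_on {a..b}) h"
  and deriv: "AE x in lebesgue_on {a..b}. \<exists>D. (f has_real_derivative D) (at x) \<and> D <= h x"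
  and ab: "a <= b"
 shows "f b - f a <= tint h a b"
proof (rule field_le_epsilon)
 fix e0 :: real assume e0: "0 < e0"
 define e where "e = e0 / (b - a + 2)"
 have e: "0 < e" using e0 ab by (simp add: e_def)
 from deriv have "AE x in lebesgue. x \<in> {a..b} --> (\<exists>D. (f has_real_derivative D) (at x) \<and> D <= h x)"
  by (simp add: AE_restrict_space_iff)
 then obtain N where N: "N \<in> null_sets lebesgue"
  and sub: "{x \<in> space lebesgue. \<not> (x \<in> {a..b} --> (\<exists>D. (f has_real_derivative D) (at x) \<and> D <= h x))} \<subseteq> N"
  unfolding eventually_ae_filter by blast
 have good: "\<exists>D. (f has_real_derivative D) (at x) \<and> D <= h x" if "x \<in> {a..b}" "x \<notin> N" for x
  using sub that by auto
 have negl: "negligible N" using N by (simp add: negligible_iff_null_sets)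
 define h0 where "h0 x = (if x \<in> N then 0 else h x)" for x
 have "(h has_integral (tint h a b)) {a..b}" by (rule has_integral_integral_lebesgue_on[OF h]) simp
 then have "(h0 has_integral (tint h a b)) {a..b}"
  by (rule has_integral_spike[OF negl, rotated]) (simp add: h0_def)
 then have "\<exists>\<gamma>. gauge \<gamma> \<and> (\<forall>\<D>. \<D> tagged_division_of {a..b} \<and> \<gamma> fine \<D> -->
   norm ((\<Sum>(x, K)\<in>\<D>. measure lborel K *\<^sub>R h0 x) - tint h a b) < e)"
  using e unfolding has_integral_real by simp
 then obtain \<gamma>1 where \<gamma>1: "gauge \<gamma>1" "!!\<D>. \<D> tagged_division_of {a..b} ==> \<gamma>1 fine \<D> ==>
   norm ((\<Sum>(x, K)\<in>\<D>. measure lborel K *\<^sub>R h0 x) - tint h a b) < e"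
  by (elim exE conjE) simp
 obtain d where d: "0 < d" and modulus: "variation_modulus a b f e d"
  using ac[unfolded absolutely_continuous_iff_modulus, rule_format, OF e] by (elim exE conjE)
 note ac_d = variation_modulusD[OF modulus]
 obtain G where G: "open G" "N \<subseteq> G" "G - N \<in> lmeasurable" "emeasure lebesgue (G - N) < ennreal d"
  by (rule sets_lebesgue_outer_open[OF null_setsD2[OF N] d])
 have G_meas: "G \<in> lmeasurable" "measure lebesgue G < d"
 proof -
  have eq: "G = (G - N) \<union> N" using G(2) by blast
  have em: "emeasure lebesgue G = emeasure lebesgue (G - N)"
   using emeasure_Un_null_set[of "G - N" lebesgue N] N G(3) eq by (simp add: fmeasurableD)
  have Gs: "G \<in> sets lebesgue" using G(1) by (simp add: lborelD)
  have "emeasure lebesgue G < \<infinity>" using em G(4) by (auto intro: less_trans)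
  with Gs show "G \<in> lmeasurable" by (simp add: fmeasurable_def)
  then show "measure lebesgue G < d"
   using em G(4) by (metis emeasure_eq_measure2 ennreal_less_iff measure_nonneg)
 qed
 have "\<exists>r>0. \<forall>y. \<bar>y - x\<bar> < r --> \<bar>f y - f x - D * (y - x)\<bar> <= e * \<bar>y - x\<bar>"
  if "(f has_real_derivative D) (at x)" for x D
 proof -
  have "(f has_derivative (*) D) (at x)" using that by (simp add: has_field_derivative_def)
  then obtain r where "0 < r" "!!y. norm (y - x) < r ==> norm (f y - f x - D * (y - x)) <= e * norm (y - x)"
   using e unfolding has_derivative_at_alt by blast
  then show ?thesis by (intro exI[of _ r]) simp
 qed
 note local = this
 define near where "near x r D \<longleftrightarrow> 0 < r \<and> D <= h x \<and>
   (\<forall>y. \<bar>y - x\<bar> < r --> \<bar>f y - f x - D * (y - x)\<bar> <= e * \<bar>y - x\<bar>)" for x r D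
 have "\<exists>r D. near x r D" if "x \<in> {a..b}" "x \<notin> N" for x
 proof -
  from good[OF that] obtain D where D: "(f has_real_derivative D) (at x)" "D <= h x" by blast
  show ?thesis using local[OF D(1)] D(2) unfolding near_def by blast
 qed
 then obtain r D where near: "!!x. x \<in> {a..b} ==> x \<notin> N ==> near x (r x) (D x)" by metis
 have rD: "0 < r x \<and> D x <= h x" if "x \<in> {a..b}" "x \<notin> N" for x using near[OF that] by (simp add: near_def)
 have rD2: "\<bar>f y - f x - D x * (y - x)\<bar> <= e * \<bar>y - x\<bar>"
  if "x \<in> {a..b}" "x \<notin> N" "\<bar>y - x\<bar> < r x" for x y using near[OF that(1,2)] that(3) by (simp add: near_def)
 define \<gamma>2 where "\<gamma>2 x = (if x \<in> N then G else if x \<in> {a..b} then ball x (r x) else UNIV)" for x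
 have "gauge \<gamma>2"
  unfolding gauge_def \<gamma>2_def using G(1,2) rD by auto
 then have "gauge (\<lambda>x. \<gamma>1 x \<inter> \<gamma>2 x)" using \<gamma>1(1) by (intro gauge_Int)
 then obtain \<D> where \<D>: "\<D> tagged_division_of {a..b}" "(\<lambda>x. \<gamma>1 x \<inter> \<gamma>2 x) fine \<D>"
  by (rule fine_division_exists_real)
 have fine: "\<gamma>1 fine \<D>" "\<gamma>2 fine \<D>" using \<D>(2) by (auto simp: fine_Int)
 have fin: "finite \<D>" using \<D>(1) by blast
 have tag: "x \<in> {a..b} \<and> (\<exists>c d. K = {c..d} \<and> a <= c \<and> c <= x \<and> x <= d \<and> d <= b)" if "(x, K) \<in> \<D>" for x K
 proof -
  from tagged_division_ofD(4)[OF \<D>(1) that] obtain c d where "K = cbox c d" by blast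
  moreover have "x \<in> K" "K \<subseteq> {a..b}" using tagged_division_ofD(2,3)[OF \<D>(1) that] by auto
  ultimately show ?thesis by auto
 qed
 define \<D>N where "\<D>N = {(x, K) \<in> \<D>. x \<in> N}"
 have DN: "\<D>N \<subseteq> \<D>" "finite \<D>N" using fin by (auto simp: \<D>N_def intro: finite_subset)
 have good_part: "f (Sup K) - f (Inf K) <= measure lborel K *\<^sub>R h0 x + e * measure lborel K" if "(x, K) \<in> \<D> - \<D>N" for x K
 proof -
  have xN: "x \<notin> N" and xK: "(x, K) \<in> \<D>" using that by (auto simp: \<D>N_def)
  obtain c d where K: "K = {c..d}" "a <= c" "c <= x" "x <= d" "d <= b" and x: "x \<in> {a..b}" using tag[OF xK] by blast
  have "K \<subseteq> ball x (r x)" using fineD[OF fine(2) xK] xN x by (simp add: \<gamma>2_def)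
  moreover have "c \<in> K" "d \<in> K" using K by auto
  ultimately have "dist x c < r x" "dist x d < r x" by auto
  then have "\<bar>c - x\<bar> < r x" "\<bar>d - x\<bar> < r x" by (simp_all only: dist_real_def abs_minus_commute)
  then have "\<bar>f c - f x - D x * (c - x)\<bar> <= e * \<bar>c - x\<bar>" "\<bar>f d - f x - D x * (d - x)\<bar> <= e * \<bar>d - x\<bar>"
   using rD2[OF x xN] by blast+
  moreover have "\<bar>c - x\<bar> = x - c" "\<bar>d - x\<bar> = d - x" using K by auto
  ultimately have "f d - f c <= D x * (d - c) + e * (d - c)" by (simp add: abs_le_iff algebra_simps)
  also have "D x * (d - c) <= h x * (d - c)" using rD[OF x xN] K by (intro mult_right_mono) auto
  finally show ?thesis using K xN by (simp add: h0_def algebra_simps)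
 qed
 have bad_part: "(\<Sum>(x, K)\<in>\<D>N. \<bar>f (Sup K) - f (Inf K)\<bar>) < e"
 proof -
  let ?P = "(\<lambda>(x, K). (Inf K, Sup K)) ` \<D>N"
  have inj0: "\<bar>f (Sup K) - f (Inf K)\<bar> = 0 \<and> Sup K - Inf K = 0"
   if 1: "(x, K) \<in> \<D>N" "(y, L) \<in> \<D>N" "(x, K) \<noteq> (y, L)" "(Inf K, Sup K) = (Inf L, Sup L)" for x K y L
  proof -
   obtain c d where K: "K = {c..d}" "c <= d" using tag[of x K] 1(1) DN(1) by force
   obtain c' d' where L: "L = {c'..d'}" "c' <= d'" using tag[of y L] 1(2) DN(1) by force
   have "K = L" using 1(4) K L by simp
   moreover have "interior K \<inter> interior L = {}"
    using tagged_division_ofD(5)[OF \<D>(1), of x K y L] 1 DN(1) by blast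
   ultimately have "interior {c..d} = {}" unfolding K(1) by simp
   then have "c = d" using K(2) by (simp add: interior_atLeastAtMost_real)
   then show ?thesis using K by simp
  qed
  have reindex: "(\<Sum>(c, d)\<in>?P. F c d) = (\<Sum>(x, K)\<in>\<D>N. F (Inf K) (Sup K))"
   if F0: "!!c. F c c = 0" for F :: "real \<Rightarrow> real \<Rightarrow> real"
  proof -
   have "(\<lambda>(c, d). F c d) ((\<lambda>(x, K). (Inf K, Sup K)) i) = 0"
    if 1: "i \<in> \<D>N" "j \<in> \<D>N" "i \<noteq> j" "(\<lambda>(x, K). (Inf K, Sup K)) i = (\<lambda>(x, K). (Inf K, Sup K)) j" for i j
   proof -
    obtain x K where i: "i = (x, K)" by (cases i)
    obtain y L where j: "j = (y, L)" by (cases j)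
    have "Sup K = Inf K" using inj0[of x K y L] 1 unfolding i j by simp
    then show ?thesis using F0 by (simp add: i)
   qed
   then have "(\<Sum>(c, d)\<in>?P. F c d) = sum ((\<lambda>(c, d). F c d) \<circ> (\<lambda>(x, K). (Inf K, Sup K))) \<D>N"
    by (rule sum.reindex_nontrivial[OF DN(2)])
   then show ?thesis by (simp add: case_prod_beta o_def)
  qed
  have "(\<Sum>(c, d)\<in>?P. \<bar>f d - f c\<bar>) < e"
  proof (rule ac_d)
   show "finite ?P" using DN(2) by simp
   show "\<forall>(c, d)\<in>?P. a <= c \<and> c <= d \<and> d <= b"
   proof clarsimp
    fix x K assume "(x, K) \<in> \<D>N"
    then show "a <= Inf K \<and> Inf K <= Sup K \<and> Sup K <= b" using tag[of x K] DN(1) by force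
   qed
   show "pairwise (\<lambda>I J. {fst I<..<snd I} \<inter> {fst J<..<snd J} = {}) ?P"
   proof (rule pairwiseI)
    fix I J assume IJ: "I \<in> ?P" "J \<in> ?P" "I \<noteq> J"
    from IJ(1) obtain x K where I: "I = (Inf K, Sup K)" "(x, K) \<in> \<D>N" by (auto simp: image_iff)
    from IJ(2) obtain y L where J: "J = (Inf L, Sup L)" "(y, L) \<in> \<D>N" by (auto simp: image_iff)
    have 1: "(x, K) \<in> \<D>N" "(y, L) \<in> \<D>N" "K \<noteq> L" using I J IJ(3) by auto
    obtain c d where K: "K = {c..d}" "c <= d" using tag[of x K] 1(1) DN(1) by force
    obtain c' d' where L: "L = {c'..d'}" "c' <= d'" using tag[of y L] 1(2) DN(1) by force
    have "interior K \<inter> interior L = {}"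
     using tagged_division_ofD(5)[OF \<D>(1), of x K y L] 1 DN(1) by blast
    then show "{fst I<..<snd I} \<inter> {fst J<..<snd J} = {}"
     unfolding I(1) J(1) fst_conv snd_conv K(1) L(1) using K(2) L(2) by (simp only: interior_atLeastAtMost_real cInf_atLeastAtMost cSup_atLeastAtMost)
   qed
   have "(\<Sum>(c, d)\<in>?P. d - c) = (\<Sum>(x, K)\<in>\<D>N. Sup K - Inf K)"
    by (rule reindex) simp
   also have "... = (\<Sum>(x, K)\<in>\<D>N. measure lborel K)"
   proof (rule sum.cong[OF refl], clarify)
    fix x K assume "(x, K) \<in> \<D>N"
    then obtain c d where "K = {c..d}" "c <= d" using tag[of x K] DN(1) by force
    then show "Sup K - Inf K = measure lborel K" by simp
   qed
   also have "... = (\<Sum>K\<in>snd ` \<D>N. measure lborel K)"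
   proof -
    have "measure lborel K = 0" if 1: "(x, K) \<in> \<D>N" "(y, L) \<in> \<D>N" "(x, K) \<noteq> (y, L)" "K = L" for x K y L
    proof -
     obtain c d where K: "K = {c..d}" "c <= d" using tag[of x K] 1(1) DN(1) by force
     then show ?thesis using inj0[OF 1(1,2,3)] 1(4) by simp
    qed
    then have z: "measure lborel (snd i) = 0" if "i \<in> \<D>N" "j \<in> \<D>N" "i \<noteq> j" "snd i = snd j" for i j
     using that by (cases i, cases j) auto
    have "sum (measure lborel) (snd ` \<D>N) = sum (measure lborel \<circ> snd) \<D>N"
     by (rule sum.reindex_nontrivial[OF DN(2)]) (rule z)
    then show ?thesis by (simp add: case_prod_beta o_def)
   qed
   also have "... = (\<Sum>K\<in>snd ` \<D>N. measure lebesgue K)"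
   proof (rule sum.cong[OF refl])
    fix K assume "K \<in> snd ` \<D>N"
    then obtain x where "(x, K) \<in> \<D>" using DN(1) by force
    then obtain c d where "K = {c..d}" using tag by blast
    then show "measure lborel K = measure lebesgue K" by simp
   qed
   also have "... = measure lebesgue (\<Union>(snd ` \<D>N))"
   proof (rule content_division)
    have "\<D>N tagged_partial_division_of {a..b}"
     using tagged_partial_division_subset[OF _ DN(1)] \<D>(1) by (auto simp: tagged_division_of_def)
    from tagged_partial_division_of_Union_self[OF this]
    show "snd ` \<D>N division_of \<Union>(snd ` \<D>N)" by (rule division_of_tagged_division)
   qed
   also have "... <= measure lebesgue G"
   proof (rule measure_mono_fmeasurable[OF _ _ G_meas(1)])
    show "\<Union>(snd ` \<D>N) \<subseteq> G"
    proof (clarsimp simp: \<D>N_def)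
     fix x K y assume 1: "(x, K) \<in> \<D>" "x \<in> N" "y \<in> K"
     show "y \<in> G" using fineD[OF fine(2) 1(1)] 1(2,3) by (auto simp: \<gamma>2_def)
    qed
    have "K \<in> sets lebesgue" if "K \<in> snd ` \<D>N" for K
    proof -
     from that DN(1) obtain x where "(x, K) \<in> \<D>" by force
     then show ?thesis using tag by fastforce
    qed
    then show "\<Union>(snd ` \<D>N) \<in> sets lebesgue" using DN(2) by (intro sets.finite_Union) auto
   qed
   also have "... < d" by (rule G_meas)
   finally show "(\<Sum>(c, d)\<in>?P. d - c) < d" .
  qed
  also have "(\<Sum>(c, d)\<in>?P. \<bar>f d - f c\<bar>) = (\<Sum>(x, K)\<in>\<D>N. \<bar>f (Sup K) - f (Inf K)\<bar>)"
   by (rule reindex) simp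
  finally show ?thesis .
 qed
 have "f b - f a = (\<Sum>(x, K)\<in>\<D>. f (Sup K) - f (Inf K))"
  using additive_tagged_division_1[OF ab \<D>(1), of f] by simp
 also have "... = (\<Sum>(x, K)\<in>\<D> - \<D>N. f (Sup K) - f (Inf K)) + (\<Sum>(x, K)\<in>\<D>N. f (Sup K) - f (Inf K))"
  by (rule sum.subset_diff[OF DN(1) fin])
 finally have split: "f b - f a = ..." .
 have "(\<Sum>(x, K)\<in>\<D>N. f (Sup K) - f (Inf K)) <= (\<Sum>(x, K)\<in>\<D>N. \<bar>f (Sup K) - f (Inf K)\<bar>)"
  by (rule sum_mono) auto
 with bad_part have bad: "(\<Sum>(x, K)\<in>\<D>N. f (Sup K) - f (Inf K)) <= e" by linarith
 have "(\<Sum>(x, K)\<in>\<D> - \<D>N. f (Sup K) - f (Inf K)) <= (\<Sum>(x, K)\<in>\<D> - \<D>N. measure lborel K *\<^sub>R h0 x + e * measure lborel K)"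
  by (rule sum_mono) (use good_part in auto)
 also have "... <= (\<Sum>(x, K)\<in>\<D>. measure lborel K *\<^sub>R h0 x + e * measure lborel K)"
 proof (rule sum_mono2[OF fin])
  fix y assume "y \<in> \<D> - (\<D> - \<D>N)"
  then obtain x K where "y = (x, K)" "x \<in> N" by (auto simp: \<D>N_def)
  then show "0 <= (case y of (x, K) \<Rightarrow> measure lborel K *\<^sub>R h0 x + e * measure lborel K)" using e by (simp add: h0_def)
 qed auto
 also have "... = (\<Sum>(x, K)\<in>\<D>. measure lborel K *\<^sub>R h0 x) + e * (\<Sum>(x, K)\<in>\<D>. measure lborel K)"
  by (simp add: case_prod_beta sum.distrib sum_distrib_left)
 also have "(\<Sum>(x, K)\<in>\<D>. measure lborel K) = b - a"
  using additive_content_tagged_division[of \<D> a b] \<D>(1) ab by simp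
 finally have good': "(\<Sum>(x, K)\<in>\<D> - \<D>N. f (Sup K) - f (Inf K))
   <= (\<Sum>(x, K)\<in>\<D>. measure lborel K *\<^sub>R h0 x) + e * (b - a)" .
 have "(\<Sum>(x, K)\<in>\<D>. measure lborel K *\<^sub>R h0 x) <= tint h a b + e"
  using \<gamma>1(2)[OF \<D>(1) fine(1)] by simp
 with good' bad split have "f b - f a <= tint h a b + (e * (b - a) + e + e)" by linarith
 also have "e * (b - a) + e + e = e * (b - a + 2)" by (simp add: algebra_simps)
 also have "e * (b - a + 2) = e0" using ab by (simp add: e_def)
 finally show "f b - f a <= tint h a b + e0" .
qed

section \<open>Curves in function spaces\<close>

subsection \<open>Integrals over subintervals\<close>

lemma tint_integrable:
 "integrable (lebesgue_on {0..T}) f ==> 0 <= s ==> t <= T ==> integrable (lebesgue_on {s..t}) f"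
 for f :: "real \<Rightarrow> real"
 by (rule integrable_subinterval) auto

lemma tint_increment:
 fixes f :: "real \<Rightarrow> real"
 assumes "integrable (lebesgue_on {0..T}) f" "0 <= s" "s <= t" "t <= T"
 shows "tint f 0 t - tint f 0 s = tint f s t"
 using tint_combine[OF tint_integrable[OF assms(1) order_refl assms(4)] assms(2,3)] by simp

lemma tint_abs_le:
 assumes "integrable (lebesgue_on {a..b}) f" "integrable (lebesgue_on {a..b}) h"
  "AE x in lebesgue_on {a..b}. \<bar>f x\<bar> <= h x"
 shows "\<bar>tint f a b\<bar> <= tint h a b"
proof -
 have "tint f a b <= tint h a b"
  by (rule tint_mono_AE[OF assms(1,2)]) (use assms(3) in \<open>eventually_elim, auto\<close>)
 moreover have "tint (\<lambda>x. - f x) a b <= tint h a b"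
  by (rule tint_mono_AE[OF _ assms(2)]) (use assms(1) in simp, use assms(3) in \<open>eventually_elim, auto\<close>)
 ultimately show ?thesis by simp
qed

lemma continuous_tint_integrable: "continuous_on {0..T} f ==> integrable (lebesgue_on {0..T}) f" for f :: "real \<Rightarrow> real"
 by (rule continuous_imp_integrable_real)

subsection \<open>Uniformly continuous curves\<close>

text \<open>Continuity on a compact interval, in uniform form: the product rules below need one modulus for all
 short intervals.\<close>

definition curve :: "('a \<Rightarrow> real) set \<Rightarrow> (('a \<Rightarrow> real) \<Rightarrow> real) \<Rightarrow> real \<Rightarrow> (real \<Rightarrow> 'a \<Rightarrow> real) \<Rightarrow> bool" where
 "curve X N T y \<longleftrightarrow> (\<forall>t\<in>{0..T}. y t \<in> X) \<and>
   (\<forall>e>0. \<exists>\<delta>>0. \<forall>s\<in>{0..T}. \<forall>t\<in>{0..T}. \<bar>s - t\<bar> < \<delta> --> N (\<lambda>x. y s x - y t x) < e)"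

lemma curve_of_continuous_into:
 assumes y: "continuous_into X N {0..T} y"
  and tri: "!!a b c. a \<in> X ==> b \<in> X ==> c \<in> X ==> N (\<lambda>x. a x - b x) <= N (\<lambda>x. a x - c x) + N (\<lambda>x. b x - c x)"
  and zero: "N (\<lambda>x. 0) = 0"
 shows "curve X N T y"
proof -
 have yX: "y t \<in> X" and lim: "((\<lambda>s. N (\<lambda>x. y s x - y t x)) \<longlongrightarrow> 0) (at t within {0..T})" if "t \<in> {0..T}" for t
  using y that by (auto simp: continuous_into_def fun_diff_def)
 have "\<exists>\<delta>>0. \<forall>s\<in>{0..T}. \<forall>t\<in>{0..T}. \<bar>s - t\<bar> < \<delta> --> N (\<lambda>x. y s x - y t x) < e" if e: "0 < e" for e
 proof (rule uniform_modulus[where d = "\<lambda>s t. N (\<lambda>x. y s x - y t x)"])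
  show "N (\<lambda>x. y s x - y t x) <= N (\<lambda>x. y s x - y r x) + N (\<lambda>x. y t x - y r x)"
   if "r \<in> {0..T}" "s \<in> {0..T}" "t \<in> {0..T}" for r s t
   using that by (intro tri yX)
 qed (use zero lim e in simp_all)
 then show ?thesis using yX by (simp add: curve_def)
qed

lemma curve_const: "a \<in> X ==> N (\<lambda>x. 0) = 0 ==> curve X N T (\<lambda>_. a)"
 by (auto simp: curve_def intro: exI[of _ 1])

lemma curve_mem: "curve X N T y ==> t \<in> {0..T} ==> y t \<in> X"
 by (simp add: curve_def)

lemma curve_modulus:
 "curve X N T y ==> 0 < e ==>
  \<exists>\<delta>>0. \<forall>s\<in>{0..T}. \<forall>t\<in>{0..T}. \<bar>s - t\<bar> < \<delta> --> N (\<lambda>x. y s x - y t x) < e"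
 by (simp add: curve_def)

lemma curve_tendsto:
 assumes y: "curve X N T y" and N: "!!z. 0 <= N z" and t: "t \<in> {0..T}"
 shows "((\<lambda>s. N (\<lambda>x. y s x - y t x)) \<longlongrightarrow> 0) (at t within {0..T})"
proof (rule tendstoI)
 fix e :: real assume "0 < e"
 from curve_modulus[OF y this]
 obtain \<delta> where \<delta>: "0 < \<delta>" "\<forall>s\<in>{0..T}. \<forall>t\<in>{0..T}. \<bar>s - t\<bar> < \<delta> --> N (\<lambda>x. y s x - y t x) < e"
  by blast
 show "\<forall>\<^sub>F s in at t within {0..T}. dist (N (\<lambda>x. y s x - y t x)) 0 < e"
  unfolding eventually_at
 proof (intro exI[of _ \<delta>] conjI ballI impI)
  fix s assume "s \<in> {0..T}" "s \<noteq> t \<and> dist s t < \<delta>"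
  then have "N (\<lambda>x. y s x - y t x) < e" using \<delta>(2) t by (simp add: dist_real_def)
  then show "dist (N (\<lambda>x. y s x - y t x)) 0 < e" using N by (simp add: dist_real_def)
 qed (rule \<delta>(1))
qed

lemma product_curve_continuous:
 assumes y: "curve X N T y" and z: "curve X N T z" and N: "!!a. 0 <= N a"
  and rev: "!!a c. a \<in> X ==> c \<in> X ==> \<bar>N a - N c\<bar> <= N (\<lambda>x. a x - c x)"
  and b: "!!a a' c c'. a \<in> X ==> a' \<in> X ==> c \<in> X ==> c' \<in> X ==>
   \<bar>b a c - b a' c'\<bar> <= N (\<lambda>x. a x - a' x) * N c + N a' * N (\<lambda>x. c x - c' x)"
 shows "continuous_on {0..T} (\<lambda>t. b (y t) (z t))"
 unfolding continuous_on_def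
proof
 fix t assume t: "t \<in> {0..T}"
 let ?F = "at t within {0..T}"
 let ?Y = "\<lambda>s. N (\<lambda>x. y s x - y t x)" and ?Z = "\<lambda>s. N (\<lambda>x. z s x - z t x)"
 have lim: "((\<lambda>s. ?Y s * (N (z t) + ?Z s) + N (y t) * ?Z s) \<longlongrightarrow> 0) ?F"
  using curve_tendsto[OF y N t] curve_tendsto[OF z N t] by (auto intro!: tendsto_eq_intros)
 have "eventually (\<lambda>s. s \<in> {0..T}) ?F" by (simp add: eventually_at_filter)
 then have "eventually (\<lambda>s. norm (b (y s) (z s) - b (y t) (z t)) <= ?Y s * (N (z t) + ?Z s) + N (y t) * ?Z s) ?F"
 proof eventually_elim
  case (elim s)
  note mem = curve_mem[OF y elim] curve_mem[OF z elim] curve_mem[OF y t] curve_mem[OF z t]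
  have "N (z s) <= N (z t) + ?Z s" using rev[OF mem(2,4)] by linarith
  then have "?Y s * N (z s) <= ?Y s * (N (z t) + ?Z s)" by (intro mult_left_mono N)
  with b[OF mem(1,3,2,4)] show ?case by simp
 qed
 from Lim_null_comparison[OF this lim]
 show "((\<lambda>t. b (y t) (z t)) \<longlongrightarrow> b (y t) (z t)) ?F" by (rule LIM_zero_cancel)
qed

subsection \<open>Square integrable curves\<close>

lemma bochner_L2_norm_integrable:
 assumes "bochner_L2 X N T f"
 shows "integrable (lebesgue_on {0..T}) (\<lambda>t. (N (f t))\<^sup>2)" "integrable (lebesgue_on {0..T}) (\<lambda>t. \<bar>N (f t)\<bar>)"
proof -
 show 1: "integrable (lebesgue_on {0..T}) (\<lambda>t. (N (f t))\<^sup>2)"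
  using assms by (auto simp: bochner_L2_def intro: integrable_closed_interval)
 have i: "integrable (lebesgue_on {0..T}) (\<lambda>t. 1 + (N (f t))\<^sup>2)"
  by (intro Bochner_Integration.integrable_add 1 continuous_tint_integrable continuous_on_const)
 have "(\<lambda>t. sqrt ((N (f t))\<^sup>2)) \<in> borel_measurable (lebesgue_on {0..T})"
  using borel_measurable_integrable[OF 1] by measurable
 then have m: "(\<lambda>t. \<bar>N (f t)\<bar>) \<in> borel_measurable (lebesgue_on {0..T})" by simp
 show "integrable (lebesgue_on {0..T}) (\<lambda>t. \<bar>N (f t)\<bar>)"
 proof (rule Bochner_Integration.integrable_bound[OF i m], rule AE_I2)
  fix t
  have "0 <= (\<bar>N (f t)\<bar> - 1)\<^sup>2" by simp
  then have "2 * \<bar>N (f t)\<bar> <= 1 + (N (f t))\<^sup>2" by (simp add: power2_diff)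
  then show "norm \<bar>N (f t)\<bar> <= norm (1 + (N (f t))\<^sup>2)" by simp
 qed
qed

lemma bochner_L2_AE_mem:
 assumes "bochner_L2 X N T f"
 shows "AE t in lebesgue_on {0..T}. f t \<in> X"
proof (rule AE_closed_interval)
 obtain s :: "nat \<Rightarrow> real \<Rightarrow> _" where "AE t in lebesgue_on {0<..<T}. f t \<in> X \<and> (\<lambda>k. N (s k t - f t)) \<longlonglongrightarrow> 0"
  using assms unfolding bochner_L2_def by blast
 then show "AE t in lebesgue_on {0<..<T}. f t \<in> X" by eventually_elim simp
qed

text \<open>Measurability passes from the simple approximations to the limit along functionals that are
 Lipschitz in the norm.\<close>

lemma bochner_L2_functional_integrable:
 fixes L :: "real \<Rightarrow> 'b::minus \<Rightarrow> real"
 assumes f: "bochner_L2 X N T f"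
  and cont: "!!a. a \<in> X ==> continuous_on {0..T} (\<lambda>t. L t a)"
  and diff: "!!t a b. t \<in> {0..T} ==> a \<in> X ==> b \<in> X ==> \<bar>L t a - L t b\<bar> <= K * N (a - b)"
  and bound: "!!t a. t \<in> {0..T} ==> a \<in> X ==> \<bar>L t a\<bar> <= K * N a"
 shows "integrable (lebesgue_on {0..T}) (\<lambda>t. L t (f t))"
proof -
 let ?M = "lebesgue_on {0<..<T}"
 obtain s :: "nat \<Rightarrow> real \<Rightarrow> 'b" where s: "!!k. simple_function ?M (s k)" "!!k t. t \<in> {0<..<T} ==> s k t \<in> X"
  and ae: "AE t in ?M. f t \<in> X \<and> (\<lambda>k. N (s k t - f t)) \<longlonglongrightarrow> 0"
  using f unfolding bochner_L2_def by blast
 have "(\<lambda>t. L t (f t)) \<in> borel_measurable ?M"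
 proof (rule borel_measurable_AE_LIMSEQ)
  show "{0<..<T} \<in> sets lebesgue" by simp
  show "(\<lambda>t. L t (s k t)) \<in> borel_measurable ?M" for k
  proof (rule simple_function_apply_measurable[OF s(1)])
   fix z assume "z \<in> s k ` space ?M"
   then have "z \<in> X" using s(2)[of _ k] by auto
   from cont[OF this] have "continuous_on {0<..<T} (\<lambda>t. L t z)" by (rule continuous_on_subset) auto
   then show "(\<lambda>t. L t z) \<in> borel_measurable ?M"
    by (rule continuous_imp_measurable_on_sets_lebesgue) simp
  qed
  have "AE t in lebesgue. t \<in> {0<..<T} --> (\<lambda>k. L t (s k t)) \<longlonglongrightarrow> L t (f t)"
  proof -
   from ae have "AE t in lebesgue. t \<in> {0<..<T} --> f t \<in> X \<and> (\<lambda>k. N (s k t - f t)) \<longlonglongrightarrow> 0"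
    by (subst (asm) AE_restrict_space_iff) simp_all
   then show ?thesis
   proof eventually_elim
    case (elim t)
    show ?case
    proof
     assume t: "t \<in> {0<..<T}"
     then have 1: "f t \<in> X" "(\<lambda>k. N (s k t - f t)) \<longlonglongrightarrow> 0" using elim by auto
     have lim: "(\<lambda>k. K * N (s k t - f t)) \<longlonglongrightarrow> 0" using tendsto_mult_right_zero[OF 1(2)] by simp
     have "norm (L t (s k t) - L t (f t)) <= K * N (s k t - f t)" for k
      using diff[of t "s k t" "f t"] s(2)[OF t] 1(1) t by simp
     then have "(\<lambda>k. L t (s k t) - L t (f t)) \<longlonglongrightarrow> 0"
      by (intro Lim_null_comparison[OF _ lim] always_eventually allI)
     then show "(\<lambda>k. L t (s k t)) \<longlonglongrightarrow> L t (f t)" by (rule LIM_zero_cancel)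
    qed
   qed
  qed
  then show "AE t in ?M. (\<lambda>k. L t (s k t)) \<longlonglongrightarrow> L t (f t)" by (simp add: AE_restrict_space_iff)
 qed
 then have m: "(\<lambda>t. L t (f t)) \<in> borel_measurable (lebesgue_on {0..T})"
  by (rule borel_measurable_closed_interval)
 have i: "integrable (lebesgue_on {0..T}) (\<lambda>t. \<bar>K\<bar> * \<bar>N (f t)\<bar>)"
  using bochner_L2_norm_integrable(2)[OF f] by simp
 have "AE t in lebesgue_on {0..T}. t \<in> {0..T} \<and> f t \<in> X"
  using bochner_L2_AE_mem[OF f] by (auto simp: AE_restrict_space_iff)
 then have "AE t in lebesgue_on {0..T}. norm (L t (f t)) <= norm (\<bar>K\<bar> * \<bar>N (f t)\<bar>)"
 proof eventually_elim
  case (elim t)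
  have "\<bar>L t (f t)\<bar> <= K * N (f t)" using bound elim by blast
  also have "... <= \<bar>K * N (f t)\<bar>" by simp
  finally show ?case by (simp add: abs_mult)
 qed
 from Bochner_Integration.integrable_bound[OF i m this] show ?thesis .
qed

subsection \<open>The dual norm\<close>

context bounded_open
begin

lemma vnorm_zero: "vnorm U (\<lambda>x. 0) = 0"
 using vnorm_scale[OF test_H01[OF test_zero], of 0] by simp

lemma vnorm_triangle_diff:
 assumes "a \<in> H01 U" "b \<in> H01 U" "c \<in> H01 U"
 shows "vnorm U (\<lambda>x. a x - b x) <= vnorm U (\<lambda>x. a x - c x) + vnorm U (\<lambda>x. b x - c x)"
 using l2norm_triangle_diff[OF wgrad_L2[OF assms(1)] wgrad_L2[OF assms(3)] wgrad_L2[OF assms(2)]]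
  l2norm_diff_commute[of U "wgrad U c" "wgrad U b"]
 by (simp add: vnorm_diff assms)

lemma dual_linear:
 assumes F: "F \<in> dual_V U" and y: "y \<in> H01 U" and z: "z \<in> H01 U"
 shows "F (\<lambda>x. a * y x + b * z x) = a * F y + b * F z"
 using assms unfolding dual_V_def by blast

lemma dual_diff:
 assumes "F \<in> dual_V U" "y \<in> H01 U" "z \<in> H01 U"
 shows "F (\<lambda>x. y x - z x) = F y - F z"
 using dual_linear[OF assms, of 1 "-1"] by simp

lemma dual_norm_bound:
 assumes F: "F \<in> dual_V U" and z: "z \<in> H01 U"
 shows "\<bar>F z\<bar> <= dual_norm U F * vnorm U z"
proof -
 obtain K where K: "!!z. z \<in> H01 U ==> \<bar>F z\<bar> <= K * vnorm U z" using F unfolding dual_V_def by blast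
 show ?thesis
 proof (cases "vnorm U z = 0")
  case True
  then show ?thesis using K[OF z] by simp
 next
  case False
  then have pos: "0 < vnorm U z" using vnorm_nonneg[of z] by linarith
  let ?y = "\<lambda>x. (1 / vnorm U z) * z x"
  have "bdd_above ((\<lambda>z. \<bar>F z\<bar>) ` {z \<in> H01 U. vnorm U z <= 1})"
  proof (rule bdd_aboveI2)
   fix y assume "y \<in> {z \<in> H01 U. vnorm U z <= 1}"
   then have y: "y \<in> H01 U" "vnorm U y <= 1" by auto
   have "\<bar>F y\<bar> <= \<bar>K\<bar> * vnorm U y" using K[OF y(1)] mult_right_mono[OF abs_ge_self[of K] vnorm_nonneg[of y]] by linarith
   also have "... <= \<bar>K\<bar>" using mult_left_mono[OF y(2), of "\<bar>K\<bar>"] by simp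
   finally show "\<bar>F y\<bar> <= \<bar>K\<bar>" .
  qed
  moreover have "?y \<in> {z \<in> H01 U. vnorm U z <= 1}"
   using H01_scale[OF z, of "1 / vnorm U z"] vnorm_scale[OF z, of "1 / vnorm U z"] pos by simp
  ultimately have "\<bar>F ?y\<bar> <= dual_norm U F" unfolding dual_norm_def by (rule cSUP_upper[rotated])
  moreover have "F ?y = (1 / vnorm U z) * F z" using dual_linear[OF F z z, of "1 / vnorm U z" 0] by simp
  ultimately have "\<bar>(1 / vnorm U z) * F z\<bar> <= dual_norm U F" by simp
  then have "\<bar>F z\<bar> / vnorm U z <= dual_norm U F" using pos by (simp add: abs_mult)
  then show ?thesis using pos by (simp add: pos_divide_le_eq)
 qed
qed

lemma dual_norm_nonneg:
 assumes "F \<in> dual_V U"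
 shows "0 <= dual_norm U F"
proof -
 obtain \<phi> where \<phi>: "\<phi> \<in> test_functions U" "0 < l2norm U \<phi>" by (metis nonzero_test_function)
 have "0 < lambda1 U * (l2norm U \<phi>)\<^sup>2" using \<phi>(2) lambda1_pos by simp
 also have "... <= (vnorm U \<phi>)\<^sup>2" by (rule lambda1_le[OF test_H01[OF \<phi>(1)]])
 finally have pos: "0 < vnorm U \<phi>" using vnorm_nonneg[of \<phi>] by (simp add: less_eq_real_def)
 have "0 <= dual_norm U F * vnorm U \<phi>" using dual_norm_bound[OF assms test_H01[OF \<phi>(1)]] by linarith
 then show ?thesis using pos by (simp add: zero_le_mult_iff)
qed

lemma dual_V_diff:
 assumes "F \<in> dual_V U" "F' \<in> dual_V U"
 shows "F - F' \<in> dual_V U"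
proof -
 have "\<bar>(F - F') z\<bar> <= (dual_norm U F + dual_norm U F') * vnorm U z" if "z \<in> H01 U" for z
  using dual_norm_bound[OF assms(1) that] dual_norm_bound[OF assms(2) that] by (simp add: algebra_simps)
 moreover have "(F - F') (\<lambda>x. a * y x + b * z x) = a * (F - F') y + b * (F - F') z"
  if "y \<in> H01 U" "z \<in> H01 U" for a b y z
  by (simp add: dual_linear[OF assms(1) that] dual_linear[OF assms(2) that] algebra_simps)
 ultimately show ?thesis unfolding dual_V_def by blast
qed

text \<open>On test functions the inner product of \<open>V\<close> is an \<open>L\<^sup>2\<close> pairing with the Laplacian.\<close>

lemma vinner_test:
 assumes \<phi>: "\<phi> \<in> test_functions U"
 shows "\<exists>\<psi>\<in>L2 U. \<forall>y\<in>H01 U. vinner y \<phi> = l2inner U y \<psi>"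
proof -
 let ?d = "\<lambda>b x. frechet_derivative \<phi> (at x) b"
 let ?dd = "\<lambda>b x. frechet_derivative (?d b) (at x) b"
 have d: "?d b \<in> test_functions U" if "b \<in> Basis" for b by (rule test_partial[OF \<phi> that])
 have dd: "?dd b \<in> L2 U" if "b \<in> Basis" for b by (rule test_L2[OF test_partial[OF d[OF that] that] sets_U])
 have sum: "(\<lambda>x. \<Sum>b\<in>B. ?dd b x) \<in> L2 U" if "finite B" "B \<subseteq> Basis" for B
  using that
 proof (induction B rule: finite_induct)
  case empty
  show ?case using L2_zero[of U] by simp
 next
  case (insert b B)
  then show ?case using L2_add[OF dd[of b] insert.IH] by simp
 qed
 define \<psi> where "\<psi> x = (-1) * (\<Sum>b\<in>Basis. ?dd b x)" for x
 have "\<psi> \<in> L2 U" unfolding \<psi>_def[abs_def] by (rule L2_mult[OF sum[OF finite_Basis subset_refl]])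
 moreover have "vinner y \<phi> = l2inner U y \<psi>" if y: "y \<in> H01 U" for y
 proof -
  have i1: "integrable (lebesgue_on U) (\<lambda>x. (wgrad U y x \<bullet> b) * ?d b x)" if "b \<in> Basis" for b
   using L2_inner_integrable[OF wgrad_L2[OF y] L2_scaleR_vector[OF test_L2[OF d[OF that] sets_U], of b]]
   by (simp add: mult.commute)
  have i2: "integrable (lebesgue_on U) (\<lambda>x. y x * ?dd b x)" if "b \<in> Basis" for b
   by (rule L2_mult_integrable[OF H01_L2[OF y] dd[OF that]])
  have "vinner y \<phi> = l2inner U (wgrad U y) (gradient \<phi>)"
   unfolding vinner_def
   by (rule l2inner_AE_cong[OF sets_U wgrad_L2[OF y] wgrad_L2[OF test_H01[OF \<phi>]]]) (auto intro: wgrad_test[OF \<phi>])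
  also have "... = (\<integral>x. (\<Sum>b\<in>Basis. (wgrad U y x \<bullet> b) * ?d b x) \<partial>lebesgue_on U)"
   unfolding l2inner_def by (subst euclidean_inner) (simp add: gradient_inner_Basis)
  also have "... = (\<Sum>b\<in>Basis. \<integral>x. (wgrad U y x \<bullet> b) * ?d b x \<partial>lebesgue_on U)"
   by (rule Bochner_Integration.integral_sum) (rule i1)
  also have "... = (\<Sum>b\<in>Basis. (-1) * (\<integral>x. y x * ?dd b x \<partial>lebesgue_on U))"
   by (rule sum.cong[OF refl]) (use H01_has_weak_gradient[OF y] d in \<open>simp add: has_weak_gradient_def\<close>)
  also have "... = (-1) * (\<Sum>b\<in>Basis. \<integral>x. y x * ?dd b x \<partial>lebesgue_on U)"
   by (rule sum_distrib_left[symmetric])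
  also have "(\<Sum>b\<in>Basis. \<integral>x. y x * ?dd b x \<partial>lebesgue_on U) = (\<integral>x. (\<Sum>b\<in>Basis. y x * ?dd b x) \<partial>lebesgue_on U)"
   by (rule Bochner_Integration.integral_sum[symmetric]) (rule i2)
  also have "(-1) * ... = l2inner U y \<psi>"
   unfolding l2inner_def \<psi>_def by (subst Bochner_Integration.integral_mult_right_zero[symmetric])
    (simp add: sum_distrib_left sum_negf[symmetric])
  finally show ?thesis .
 qed
 ultimately show ?thesis by blast
qed

lemma vinner_product_estimate:
 assumes "a \<in> H01 U" "a' \<in> H01 U" "c \<in> H01 U" "c' \<in> H01 U"
 shows "\<bar>vinner a c - vinner a' c'\<bar> <= vnorm U (\<lambda>x. a x - a' x) * vnorm U c + vnorm U a' * vnorm U (\<lambda>x. c x - c' x)"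
 using vinner_Cauchy_Schwarz[OF H01_diff[OF assms(1,2)] assms(3)] vinner_Cauchy_Schwarz[OF assms(2) H01_diff[OF assms(3,4)]]
 by (simp add: vinner_diff_left vinner_diff_right assms)

lemma l2inner_product_estimate:
 fixes a :: "'a \<Rightarrow> real"
 assumes "a \<in> L2 U" "a' \<in> L2 U" "c \<in> L2 U" "c' \<in> L2 U"
 shows "\<bar>l2inner U a c - l2inner U a' c'\<bar> <= l2norm U (\<lambda>x. a x - a' x) * l2norm U c + l2norm U a' * l2norm U (\<lambda>x. c x - c' x)"
 using l2inner_Cauchy_Schwarz[OF L2_diff[OF assms(1,2)] assms(3)] l2inner_Cauchy_Schwarz[OF assms(2) L2_diff[OF assms(3,4)]]
 by (simp add: l2inner_diff_left l2inner_diff_right assms)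

abbreviation V_curve where "V_curve T y \<equiv> curve (H01 U) (vnorm U) T y"
abbreviation L2_curve where "L2_curve T y \<equiv> curve (L2 U) (l2norm U) T y"

lemma V_curve_continuous: "V_curve T y ==> V_curve T z ==> continuous_on {0..T} (\<lambda>t. vinner (y t) (z t))"
 by (rule product_curve_continuous[OF _ _ vnorm_nonneg vnorm_reverse_triangle vinner_product_estimate])

lemma L2_curve_continuous: "L2_curve T y ==> L2_curve T z ==> continuous_on {0..T} (\<lambda>t. l2inner U (y t) (z t))"
 by (rule product_curve_continuous[OF _ _ l2norm_nonneg l2norm_reverse_triangle l2inner_product_estimate])

lemma V_curve_const: "z \<in> H01 U ==> V_curve T (\<lambda>_. z)"
 by (rule curve_const) (auto simp: vnorm_zero)

lemma l2norm_0: "l2norm U (\<lambda>x. 0 :: real) = 0"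
 using l2norm_mult[of U 0 "\<lambda>x. 0"] by simp

lemma L2_curve_const: "z \<in> L2 U ==> L2_curve T (\<lambda>_. z)"
 by (rule curve_const) (auto simp: l2norm_0)

lemma V_curve_imp_L2_curve:
 assumes y: "V_curve T y"
 shows "L2_curve T y"
proof -
 obtain D where D: "0 < D" "!!z. z \<in> H01 U ==> l2norm U z <= D * vnorm U z" by (metis Poincare)
 have "\<exists>\<delta>>0. \<forall>s\<in>{0..T}. \<forall>t\<in>{0..T}. \<bar>s - t\<bar> < \<delta> --> l2norm U (\<lambda>x. y s x - y t x) < e" if e: "0 < e" for e
 proof -
  from y have "0 < e / D ==> \<exists>\<delta>>0. \<forall>s\<in>{0..T}. \<forall>t\<in>{0..T}. \<bar>s - t\<bar> < \<delta> --> vnorm U (\<lambda>x. y s x - y t x) < e / D"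
   unfolding curve_def by blast
  then obtain \<delta> where \<delta>: "0 < \<delta>" "\<forall>s\<in>{0..T}. \<forall>t\<in>{0..T}. \<bar>s - t\<bar> < \<delta> --> vnorm U (\<lambda>x. y s x - y t x) < e / D"
   using e D(1) by auto
  have "l2norm U (\<lambda>x. y s x - y t x) < e" if st: "s \<in> {0..T}" "t \<in> {0..T}" "\<bar>s - t\<bar> < \<delta>" for s t
  proof -
   have "vnorm U (\<lambda>x. y s x - y t x) < e / D" using \<delta>(2) st by blast
   then have "D * vnorm U (\<lambda>x. y s x - y t x) < e" using D(1) by (simp add: field_simps)
   then show ?thesis using D(2)[OF H01_diff[OF curve_mem[OF y st(1)] curve_mem[OF y st(2)]]] by linarith
  qed
  with \<delta>(1) show ?thesis by blast
 qed
 then show ?thesis using y H01_L2 by (simp add: curve_def)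
qed

lemma V_curve_bounded:
 assumes y: "V_curve T y"
 obtains K where "0 <= K" "!!t. t \<in> {0..T} ==> vnorm U (y t) <= K"
proof -
 have "bounded ((\<lambda>t. vinner (y t) (y t)) ` {0..T})"
  by (rule compact_imp_bounded[OF compact_continuous_image[OF V_curve_continuous[OF y y] compact_Icc]])
 then obtain B where B: "\<forall>t\<in>{0..T}. \<bar>vinner (y t) (y t)\<bar> <= B" by (auto simp only: bounded_iff ball_simps real_norm_def)
 have "vnorm U (y t) <= 1 + \<bar>B\<bar>" if "t \<in> {0..T}" for t
 proof -
  have "(vnorm U (y t))\<^sup>2 <= \<bar>B\<bar>" using bspec[OF B that] by (simp add: vnorm_power2)
  moreover have "0 <= (vnorm U (y t) - 1)\<^sup>2" by simp
  ultimately show ?thesis using vnorm_nonneg[of "y t"] by (simp add: power2_diff)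
 qed
 then show ?thesis using that[of "1 + \<bar>B\<bar>"] by auto
qed

end

section \<open>Energy solutions\<close>

lemma tint_eq_integral: "integrable (lebesgue_on {a..b}) f ==> tint f a b = integral {a..b} f" for f :: "real \<Rightarrow> real"
 by (rule lebesgue_integral_eq_integral) auto

lemma continuous_tint: 
 assumes "integrable (lebesgue_on {0..T}) h"
 shows "continuous_on {0..T} (\<lambda>t. tint h 0 t)"
proof -
 have "h integrable_on {0..T}" using integrable_on_lebesgue_on[OF assms] by simp
 then have "continuous_on {0..T} (\<lambda>t. integral {0..t} h)" by (rule indefinite_integral_continuous_1)
 moreover have "integral {0..t} h = tint h 0 t" if "t \<in> {0..T}" for t
  using tint_eq_integral[OF tint_integrable[OF assms, of 0 t]] that by simp
 ultimately show ?thesis by (metis (no_types, lifting) continuous_on_cong)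
qed

lemma tint_reflect:
 assumes "continuous_on {0..t} f" "0 <= t"
 shows "tint (\<lambda>s. f (t - s)) 0 t = tint f 0 t"
proof -
 have c: "continuous_on {0..t} (\<lambda>s. f (t - s))"
  by (rule continuous_on_compose2[OF assms(1)]) (auto intro!: continuous_intros)
 have c': "continuous_on {0 + - t..t + - t} (\<lambda>x. f (- x))"
  by (rule continuous_on_compose2[OF assms(1)]) (auto intro!: continuous_intros)
 have "tint (\<lambda>s. f (t - s)) 0 t = integral {0..t} ((\<lambda>x. f (- x)) \<circ> (\<lambda>s. s + - t))"
  by (simp add: tint_eq_integral[OF continuous_imp_integrable_real[OF c]] o_def)
 also have "... = integral {0 + - t..t + - t} (\<lambda>x. f (- x))" by (rule integral_shift[OF c'])
 also have "... = integral {0..t} f" using Henstock_Kurzweil_Integration.integral_reflect_real[of t 0 f] by simp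
 finally show ?thesis by (simp add: tint_eq_integral[OF continuous_imp_integrable_real[OF assms(1)]])
qed

subsection \<open>The kernel\<close>

lemma
 assumes H2: "hyp_H2 g"
 shows kernel_continuous: "S \<subseteq> {0..} ==> continuous_on S g"
  and kernel_nonneg: "0 <= t ==> 0 <= g t"
  and kernel_decreasing: "0 <= t ==> gprime g t <= 0"
  and kernel_integral_le: "tint g 0 t <= 1 - ell g"
proof -
 have d: "!!t. 0 <= t ==> g differentiable (at t within {0..})" and nn: "!!t. 0 <= t ==> 0 <= g t"
  and i: "integrable (lebesgue_on {0..}) g" and dec: "!!t. 0 <= t ==> gprime g t <= 0"
  using H2 by (auto simp: hyp_H2_def)
 have "continuous_on {0..} g"
  unfolding continuous_on_eq_continuous_within using d by (auto intro: differentiable_imp_continuous_within)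
 then show "continuous_on S g" if "S \<subseteq> {0..}" using that by (rule continuous_on_subset)
 show "0 <= g t" if "0 <= t" using nn[OF that] .
 show "gprime g t <= 0" if "0 <= t" using dec[OF that] .
 have I: "integrable lebesgue (\<lambda>x. indicator {0..} x *\<^sub>R g x)"
  using i by (subst (asm) integrable_restrict_space) auto
 have J: "integrable lebesgue (\<lambda>x. indicator {0..t} x *\<^sub>R g x)"
 proof -
  have "integrable lebesgue (\<lambda>x. indicator {0..t} x *\<^sub>R (indicator {0..} x *\<^sub>R g x))"
   by (rule integrable_mult_indicator[OF _ I]) simp
  moreover have "(\<lambda>x. indicator {0..t} x *\<^sub>R (indicator {0..} x *\<^sub>R g x)) = (\<lambda>x. indicator {0..t} x *\<^sub>R g x)"
   by (auto simp: indicator_def)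
  ultimately show ?thesis by simp
 qed
 have "tint g 0 t = (\<integral>x. indicator {0..t} x *\<^sub>R g x \<partial>lebesgue)" by (rule integral_restrict_space) simp
 also have "... <= (\<integral>x. indicator {0..} x *\<^sub>R g x \<partial>lebesgue)"
  by (rule integral_mono[OF J I]) (auto simp: indicator_def nn)
 also have "... = (\<integral>x. g x \<partial>lebesgue_on {0..})" by (rule integral_restrict_space[symmetric]) simp
 finally show "tint g 0 t <= 1 - ell g" by (simp add: ell_def)
qed

subsection \<open>The solution as a pair of curves\<close>

locale evolution = variable_exponent U p for U :: "'a::euclidean_space set" and p +
 fixes g :: "real \<Rightarrow> real" and u0 u1 :: "'a \<Rightarrow> real" and T :: real and u v :: "real \<Rightarrow> 'a \<Rightarrow> real"
 assumes H2: "hyp_H2 g" and T_pos: "0 < T" and solution: "energy_solution U p g u0 u1 T u v"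
begin

definition acceleration :: "(real \<Rightarrow> ('a \<Rightarrow> real) \<Rightarrow> real) \<Rightarrow> bool" where
 "acceleration w \<longleftrightarrow> bochner_L2 (dual_V U) (dual_norm U) T w \<and> has_weak_time_derivative U T v w \<and>
   (\<forall>z\<in>H01 U. AE t in lebesgue_on {0<..<T}. w t z + vinner (u t) z + vinner (v t) z
    - tint (\<lambda>s. g (t - s) * vinner (u s) z) 0 t = (\<integral>x. source p x (u t x) * z x \<partial>lebesgue_on U))"

definition w where "w = (SOME w. acceleration w)"

lemma w: "acceleration w"
proof -
 have "\<exists>w. acceleration w"
  using solution unfolding energy_solution_def acceleration_def vinner_def by (elim conjE) assumption
 then show ?thesis unfolding w_def by (rule someI_ex[of acceleration])
qed

lemma w_bochner: "bochner_L2 (dual_V U) (dual_norm U) T w"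
 and w_weak: "has_weak_time_derivative U T v w"
 using w by (simp_all add: acceleration_def)

lemma v_bochner: "bochner_L2 (H01 U) (vnorm U) T v"
 and time_derivative: "has_time_derivative U T u v"
 and u_0: "AE x in lebesgue_on U. u 0 x = u0 x"
 and v_0: "AE x in lebesgue_on U. v 0 x = u1 x"
 using solution by (simp_all add: energy_solution_def)

lemma u_curve: "V_curve T u"
proof -
 have "continuous_into (H01 U) (vnorm U) {0..T} u" using solution by (simp add: energy_solution_def)
 then show ?thesis by (rule curve_of_continuous_into) (auto intro: vnorm_triangle_diff vnorm_zero)
qed

lemma v_curve: "L2_curve T v"
proof -
 have "continuous_into (L2 U) (l2norm U) {0..T} v" using solution by (simp add: energy_solution_def)
 then show ?thesis
 proof (rule curve_of_continuous_into)
  fix a b c :: "'a \<Rightarrow> real" assume "a \<in> L2 U" "b \<in> L2 U" "c \<in> L2 U"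
  then show "l2norm U (\<lambda>x. a x - b x) <= l2norm U (\<lambda>x. a x - c x) + l2norm U (\<lambda>x. b x - c x)"
   using l2norm_triangle_diff[of a U c b] l2norm_diff_commute[of U c b] by simp
 qed (rule l2norm_0)
qed

lemma u_H01: "t \<in> {0..T} ==> u t \<in> H01 U" by (rule curve_mem[OF u_curve])
lemma u_L2: "t \<in> {0..T} ==> u t \<in> L2 U" by (rule H01_L2[OF u_H01])
lemma v_L2: "t \<in> {0..T} ==> v t \<in> L2 U" by (rule curve_mem[OF v_curve])

lemma v_H01: "AE t in lebesgue_on {0..T}. v t \<in> H01 U"
 by (rule bochner_L2_AE_mem[OF v_bochner])

lemma w_dual: "AE t in lebesgue_on {0..T}. w t \<in> dual_V U"
 by (rule bochner_L2_AE_mem[OF w_bochner])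

lemma AE_interval: "AE t in lebesgue_on {a..b}. t \<in> {a..b}" for a b :: real
 by (rule AE_I2) simp

lemma vinner_v_integrable:
 assumes y: "V_curve T y"
 shows "integrable (lebesgue_on {0..T}) (\<lambda>t. vinner (v t) (y t))"
proof -
 obtain K where K: "0 <= K" "!!t. t \<in> {0..T} ==> vnorm U (y t) <= K" by (metis V_curve_bounded[OF y])
 show ?thesis
 proof (rule bochner_L2_functional_integrable[OF v_bochner, where K = K])
  show bound: "\<bar>vinner a (y t)\<bar> <= K * vnorm U a" if "t \<in> {0..T}" "a \<in> H01 U" for t a
   using vinner_Cauchy_Schwarz[OF that(2) curve_mem[OF y that(1)]] mult_left_mono[OF K(2)[OF that(1)] vnorm_nonneg[of a]]
   by (simp add: mult.commute)
  show "\<bar>vinner a (y t) - vinner b (y t)\<bar> <= K * vnorm U (a - b)"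
   if "t \<in> {0..T}" "a \<in> H01 U" "b \<in> H01 U" for t a b
   using bound[OF that(1) H01_diff[OF that(2,3)]]
   by (simp add: vinner_diff_left[OF that(2,3) curve_mem[OF y that(1)]] fun_diff_def)
  show "continuous_on {0..T} (\<lambda>t. vinner a (y t))" if "a \<in> H01 U" for a
   by (rule V_curve_continuous[OF V_curve_const[OF that] y])
 qed
qed

lemma w_integrable:
 assumes y: "V_curve T y"
 shows "integrable (lebesgue_on {0..T}) (\<lambda>t. w t (y t))"
proof -
 obtain K where K: "0 <= K" "!!t. t \<in> {0..T} ==> vnorm U (y t) <= K" by (metis V_curve_bounded[OF y])
 show ?thesis
 proof (rule bochner_L2_functional_integrable[OF w_bochner, where K = K])
  show bound: "\<bar>F (y t)\<bar> <= K * dual_norm U F" if "t \<in> {0..T}" "F \<in> dual_V U" for t F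
   using dual_norm_bound[OF that(2) curve_mem[OF y that(1)]] mult_left_mono[OF K(2)[OF that(1)] dual_norm_nonneg[OF that(2)]]
   by (simp add: mult.commute)
  show "\<bar>F (y t) - F' (y t)\<bar> <= K * dual_norm U (F - F')"
   if "t \<in> {0..T}" "F \<in> dual_V U" "F' \<in> dual_V U" for t F F'
   using bound[OF that(1) dual_V_diff[OF that(2,3)]] by simp
  show "continuous_on {0..T} (\<lambda>t. F (y t))" if F: "F \<in> dual_V U" for F
   unfolding continuous_on_def
  proof
   fix t assume t: "t \<in> {0..T}"
   let ?F = "at t within {0..T}"
   have lim: "((\<lambda>s. dual_norm U F * vnorm U (\<lambda>x. y s x - y t x)) \<longlongrightarrow> 0) ?F"
    using tendsto_mult_right_zero[OF curve_tendsto[OF y vnorm_nonneg t]] by simp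
   have "eventually (\<lambda>s. s \<in> {0..T}) ?F" by (simp add: eventually_at_filter)
   then have "eventually (\<lambda>s. norm (F (y s) - F (y t)) <= dual_norm U F * vnorm U (\<lambda>x. y s x - y t x)) ?F"
   proof eventually_elim
    case (elim s)
    show ?case
     using dual_norm_bound[OF F H01_diff[OF curve_mem[OF y elim] curve_mem[OF y t]]]
     by (simp add: dual_diff[OF F curve_mem[OF y elim] curve_mem[OF y t]])
   qed
   from Lim_null_comparison[OF this lim] show "((\<lambda>t. F (y t)) \<longlongrightarrow> F (y t)) ?F" by (rule LIM_zero_cancel)
  qed
 qed
qed

lemma l2inner_v_integrable: "L2_curve T y ==> integrable (lebesgue_on {0..T}) (\<lambda>t. l2inner U (v t) (y t))"
 by (intro continuous_tint_integrable L2_curve_continuous v_curve)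

lemma l2norm_v_integrable: "integrable (lebesgue_on {0..T}) (\<lambda>t. l2norm U (v t))"
 unfolding l2norm_def by (intro continuous_tint_integrable continuous_intros L2_curve_continuous v_curve)

text \<open>Replacing the test curve by a close one changes the time integrals little.\<close>

lemma tint_vinner_close:
 assumes y: "V_curve T y" and z: "V_curve T z" and st: "0 <= s" "t <= T"
  and c: "!!r. r \<in> {s..t} ==> vnorm U (\<lambda>x. y r x - z r x) <= c"
 shows "\<bar>tint (\<lambda>r. vinner (v r) (y r)) s t - tint (\<lambda>r. vinner (v r) (z r)) s t\<bar> <= c * tint (\<lambda>r. \<bar>vnorm U (v r)\<bar>) s t"
proof -
 note i = tint_integrable[OF vinner_v_integrable[OF y] st] tint_integrable[OF vinner_v_integrable[OF z] st]
  tint_integrable[OF bochner_L2_norm_integrable(2)[OF v_bochner] st]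
 have "\<bar>tint (\<lambda>r. vinner (v r) (y r) - vinner (v r) (z r)) s t\<bar> <= tint (\<lambda>r. c * \<bar>vnorm U (v r)\<bar>) s t"
 proof (rule tint_abs_le)
  have "AE r in lebesgue_on {s..t}. v r \<in> H01 U" by (rule AE_subinterval[OF v_H01]) (use st in auto)
  with AE_interval[of s t]
  show "AE r in lebesgue_on {s..t}. \<bar>vinner (v r) (y r) - vinner (v r) (z r)\<bar> <= c * \<bar>vnorm U (v r)\<bar>"
  proof eventually_elim
   case (elim r)
   then have r: "r \<in> {0..T}" using st by auto
   note yz = curve_mem[OF y r] curve_mem[OF z r]
   have "\<bar>vinner (v r) (\<lambda>x. y r x - z r x)\<bar> <= vnorm U (v r) * vnorm U (\<lambda>x. y r x - z r x)"
    by (rule vinner_Cauchy_Schwarz[OF elim(2) H01_diff[OF yz]])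
   also have "... <= vnorm U (v r) * c" by (rule mult_left_mono[OF c[OF elim(1)] vnorm_nonneg])
   finally show ?case using vnorm_nonneg[of "v r"] by (simp add: vinner_diff_right[OF yz elim(2)] mult.commute)
  qed
 qed (use i in auto)
 then show ?thesis using i by simp
qed

lemma tint_w_close:
 assumes y: "V_curve T y" and z: "V_curve T z" and st: "0 <= s" "t <= T"
  and c: "!!r. r \<in> {s..t} ==> vnorm U (\<lambda>x. y r x - z r x) <= c"
 shows "\<bar>tint (\<lambda>r. w r (y r)) s t - tint (\<lambda>r. w r (z r)) s t\<bar> <= c * tint (\<lambda>r. \<bar>dual_norm U (w r)\<bar>) s t"
proof -
 note i = tint_integrable[OF w_integrable[OF y] st] tint_integrable[OF w_integrable[OF z] st]
  tint_integrable[OF bochner_L2_norm_integrable(2)[OF w_bochner] st]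
 have "\<bar>tint (\<lambda>r. w r (y r) - w r (z r)) s t\<bar> <= tint (\<lambda>r. c * \<bar>dual_norm U (w r)\<bar>) s t"
 proof (rule tint_abs_le)
  have "AE r in lebesgue_on {s..t}. w r \<in> dual_V U" by (rule AE_subinterval[OF w_dual]) (use st in auto)
  with AE_interval[of s t]
  show "AE r in lebesgue_on {s..t}. \<bar>w r (y r) - w r (z r)\<bar> <= c * \<bar>dual_norm U (w r)\<bar>"
  proof eventually_elim
   case (elim r)
   then have r: "r \<in> {0..T}" using st by auto
   note yz = curve_mem[OF y r] curve_mem[OF z r]
   have "\<bar>w r (\<lambda>x. y r x - z r x)\<bar> <= dual_norm U (w r) * vnorm U (\<lambda>x. y r x - z r x)"
    by (rule dual_norm_bound[OF elim(2) H01_diff[OF yz]])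
   also have "... <= dual_norm U (w r) * c" by (rule mult_left_mono[OF c[OF elim(1)] dual_norm_nonneg[OF elim(2)]])
   finally show ?case using dual_norm_nonneg[OF elim(2)] by (simp add: dual_diff[OF elim(2) yz] mult.commute)
  qed
 qed (use i in auto)
 then show ?thesis using i by simp
qed

lemma tint_l2inner_close:
 assumes y: "L2_curve T y" and z: "L2_curve T z" and st: "0 <= s" "t <= T"
  and c: "!!r. r \<in> {s..t} ==> l2norm U (\<lambda>x. y r x - z r x) <= c"
 shows "\<bar>tint (\<lambda>r. l2inner U (v r) (y r)) s t - tint (\<lambda>r. l2inner U (v r) (z r)) s t\<bar> <= c * tint (\<lambda>r. l2norm U (v r)) s t"
proof -
 note i = tint_integrable[OF l2inner_v_integrable[OF y] st] tint_integrable[OF l2inner_v_integrable[OF z] st]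
  tint_integrable[OF l2norm_v_integrable st]
 have "\<bar>tint (\<lambda>r. l2inner U (v r) (y r) - l2inner U (v r) (z r)) s t\<bar> <= tint (\<lambda>r. c * l2norm U (v r)) s t"
 proof (rule tint_abs_le)
  show "AE r in lebesgue_on {s..t}. \<bar>l2inner U (v r) (y r) - l2inner U (v r) (z r)\<bar> <= c * l2norm U (v r)"
   using AE_interval[of s t]
  proof eventually_elim
   case (elim r)
   then have r: "r \<in> {0..T}" using st by auto
   note yz = curve_mem[OF y r] curve_mem[OF z r]
   have "\<bar>l2inner U (v r) (\<lambda>x. y r x - z r x)\<bar> <= l2norm U (v r) * l2norm U (\<lambda>x. y r x - z r x)"
    by (rule l2inner_Cauchy_Schwarz[OF v_L2[OF r] L2_diff[OF yz]])
   also have "... <= l2norm U (v r) * c" by (rule mult_left_mono[OF c[OF elim(1)] l2norm_nonneg])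
   finally show ?case by (simp add: l2inner_diff_right[OF yz v_L2[OF r]] mult.commute)
  qed
 qed (use i in auto)
 then show ?thesis using i by simp
qed

subsection \<open>Increments\<close>

lemma u_l2inner_increment:
 assumes \<psi>: "\<psi> \<in> L2 U" and st: "0 <= s" "s <= t" "t <= T"
 shows "l2inner U (u t) \<psi> - l2inner U (u s) \<psi> = tint (\<lambda>r. l2inner U (v r) \<psi>) s t"
proof -
 have deriv: "((\<lambda>t. l2inner U (u t) \<psi>) has_real_derivative l2inner U (v t) \<psi>) (at t within {0..T})"
  if t: "t \<in> {0..T}" for t
 proof -
  let ?F = "at t within {0..T}"
  let ?n = "\<lambda>s. l2norm U (\<lambda>x. (u s x - u t x) / (s - t) - v t x)"
  have "(?n \<longlongrightarrow> 0) ?F" using time_derivative t by (simp add: has_time_derivative_def)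
  then have lim: "((\<lambda>s. ?n s * l2norm U \<psi>) \<longlongrightarrow> 0) ?F" by (rule tendsto_mult_left_zero)
  have "eventually (\<lambda>s. s \<in> {0..T}) ?F" by (simp add: eventually_at_filter)
  then have "eventually (\<lambda>s. norm ((l2inner U (u s) \<psi> - l2inner U (u t) \<psi>) / (s - t) - l2inner U (v t) \<psi>)
    <= ?n s * l2norm U \<psi>) ?F"
  proof eventually_elim
   case (elim s)
   have q: "(\<lambda>x. (1 / (s - t)) *\<^sub>R (u s x - u t x)) \<in> L2 U"
    by (rule L2_scaleR[OF L2_diff[OF u_L2[OF elim] u_L2[OF t]]])
   have "l2inner U (\<lambda>x. (1 / (s - t)) *\<^sub>R (u s x - u t x) - v t x) \<psi>
     = (1 / (s - t)) * (l2inner U (u s) \<psi> - l2inner U (u t) \<psi>) - l2inner U (v t) \<psi>"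
    by (simp only: l2inner_diff_left[OF q v_L2[OF t] \<psi>] l2inner_scaleR_left l2inner_diff_left[OF u_L2[OF elim] u_L2[OF t] \<psi>])
   then show ?case using l2inner_Cauchy_Schwarz[OF L2_diff[OF q v_L2[OF t]] \<psi>] by simp
  qed
  from Lim_null_comparison[OF this lim] show ?thesis
   unfolding has_field_derivative_iff by (rule LIM_zero_cancel)
 qed
 have "tint (\<lambda>r. l2inner U (v r) \<psi>) s t = l2inner U (u t) \<psi> - l2inner U (u s) \<psi>"
 proof (rule tint_FTC[OF _ _ st(2)])
  show "((\<lambda>t. l2inner U (u t) \<psi>) has_real_derivative l2inner U (v r) \<psi>) (at r within {s..t})" if "r \<in> {s..t}" for r
   by (rule DERIV_subset[OF deriv]) (use that st in auto)
  show "continuous_on {s..t} (\<lambda>r. l2inner U (v r) \<psi>)"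
   by (rule continuous_on_subset[OF L2_curve_continuous[OF v_curve L2_curve_const[OF \<psi>]]]) (use st in auto)
 qed
 then show ?thesis by simp
qed

lemma u_vinner_increment_test:
 assumes \<phi>: "\<phi> \<in> test_functions U" and st: "0 <= s" "s <= t" "t <= T"
 shows "vinner (u t) \<phi> - vinner (u s) \<phi> = tint (\<lambda>r. vinner (v r) \<phi>) s t"
proof -
 from vinner_test[OF \<phi>] obtain \<psi> where \<psi>: "\<psi> \<in> L2 U" "\<forall>y\<in>H01 U. vinner y \<phi> = l2inner U y \<psi>" by blast
 have mem: "u t \<in> H01 U" "u s \<in> H01 U" using st by (auto intro: u_H01)
 have "vinner (u t) \<phi> - vinner (u s) \<phi> = l2inner U (u t) \<psi> - l2inner U (u s) \<psi>" using \<psi>(2) mem by simp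
 also have "... = tint (\<lambda>r. l2inner U (v r) \<psi>) s t" by (rule u_l2inner_increment[OF \<psi>(1) st])
 also have "... = tint (\<lambda>r. vinner (v r) \<phi>) s t"
 proof (rule integral_cong_AE)
  show "(\<lambda>r. l2inner U (v r) \<psi>) \<in> borel_measurable (lebesgue_on {s..t})"
   using tint_integrable[OF l2inner_v_integrable[OF L2_curve_const[OF \<psi>(1)]] st(1,3)] by (rule borel_measurable_integrable)
  show "(\<lambda>r. vinner (v r) \<phi>) \<in> borel_measurable (lebesgue_on {s..t})"
   using tint_integrable[OF vinner_v_integrable[OF V_curve_const[OF test_H01[OF \<phi>]]] st(1,3)] by (rule borel_measurable_integrable)
  have "AE r in lebesgue_on {s..t}. v r \<in> H01 U" by (rule AE_subinterval[OF v_H01]) (use st in auto)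
  then show "AE r in lebesgue_on {s..t}. l2inner U (v r) \<psi> = vinner (v r) \<phi>" by eventually_elim (use \<psi>(2) in simp)
 qed
 finally show ?thesis .
qed

text \<open>Test functions are dense, and both sides are continuous in \<open>z\<close>.\<close>

lemma u_vinner_increment:
 assumes z: "z \<in> H01 U" and st: "0 <= s" "s <= t" "t <= T"
 shows "vinner (u t) z - vinner (u s) z = tint (\<lambda>r. vinner (v r) z) s t"
proof -
 obtain \<phi> where \<phi>: "!!k. \<phi> k \<in> test_functions U" "(\<lambda>k. vnorm U (\<lambda>x. \<phi> k x - z x)) \<longlonglongrightarrow> 0"
  by (metis H01_approximation[OF z])
 define c where "c k = vnorm U (\<lambda>x. \<phi> k x - z x)" for k
 define A where "A = vnorm U (u t) + vnorm U (u s) + tint (\<lambda>r. \<bar>vnorm U (v r)\<bar>) s t"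
 have mem: "u t \<in> H01 U" "u s \<in> H01 U" using st by (auto intro: u_H01)
 have "\<bar>vinner (u t) z - vinner (u s) z - tint (\<lambda>r. vinner (v r) z) s t\<bar> <= c k * A" for k
 proof -
  have \<phi>k: "\<phi> k \<in> H01 U" by (rule test_H01[OF \<phi>(1)])
  have "\<bar>vinner y (\<phi> k) - vinner y z\<bar> <= c k * vnorm U y" if "y \<in> H01 U" for y
   using vinner_Cauchy_Schwarz[OF that H01_diff[OF \<phi>k z]] by (simp add: vinner_diff_right[OF \<phi>k z that] c_def mult.commute)
  from this[OF mem(1)] this[OF mem(2)]
  have "\<bar>vinner (u t) (\<phi> k) - vinner (u t) z\<bar> <= c k * vnorm U (u t)"
   "\<bar>vinner (u s) (\<phi> k) - vinner (u s) z\<bar> <= c k * vnorm U (u s)" .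
  moreover have "\<bar>tint (\<lambda>r. vinner (v r) (\<phi> k)) s t - tint (\<lambda>r. vinner (v r) z) s t\<bar> <= c k * tint (\<lambda>r. \<bar>vnorm U (v r)\<bar>) s t"
   by (rule tint_vinner_close[OF V_curve_const[OF \<phi>k] V_curve_const[OF z] st(1,3)]) (simp add: c_def)
  moreover note u_vinner_increment_test[OF \<phi>(1) st, of k]
  moreover have "c k * A = c k * vnorm U (u t) + c k * vnorm U (u s) + c k * tint (\<lambda>r. \<bar>vnorm U (v r)\<bar>) s t"
   by (simp add: A_def algebra_simps)
  ultimately show ?thesis by linarith
 qed
 moreover have "(\<lambda>k. c k * A) \<longlonglongrightarrow> 0" using \<phi>(2) unfolding c_def by (rule tendsto_mult_left_zero)
 ultimately have "\<bar>vinner (u t) z - vinner (u s) z - tint (\<lambda>r. vinner (v r) z) s t\<bar> <= 0"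
  by (intro LIMSEQ_le_const) auto
 then show ?thesis by simp
qed

lemma u_vnorm_increment:
 assumes st: "0 <= s" "s <= t" "t <= T"
 shows "vnorm U (\<lambda>x. u t x - u s x) <= tint (\<lambda>r. \<bar>vnorm U (v r)\<bar>) s t"
proof -
 let ?z = "\<lambda>x. u t x - u s x"
 have mem: "u t \<in> H01 U" "u s \<in> H01 U" using st by (auto intro: u_H01)
 have z: "?z \<in> H01 U" by (rule H01_diff[OF mem])
 have z0: "(\<lambda>x. 0) \<in> H01 U" by (rule test_H01[OF test_zero])
 have 0: "tint (\<lambda>r. vinner (v r) (\<lambda>x. 0)) s t = 0"
  using u_vinner_increment[OF z0 st] vinner_Cauchy_Schwarz[OF mem(1) z0] vinner_Cauchy_Schwarz[OF mem(2) z0] by (simp add: vnorm_zero)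
 have "(vnorm U ?z)\<^sup>2 = tint (\<lambda>r. vinner (v r) ?z) s t"
  using u_vinner_increment[OF z st] by (simp add: vnorm_power2 vinner_diff_left[OF mem z])
 also have "... <= vnorm U ?z * tint (\<lambda>r. \<bar>vnorm U (v r)\<bar>) s t"
  using tint_vinner_close[OF V_curve_const[OF z] V_curve_const[OF z0] st(1,3), of "vnorm U ?z"] 0 by simp
 finally have "vnorm U ?z * vnorm U ?z <= vnorm U ?z * tint (\<lambda>r. \<bar>vnorm U (v r)\<bar>) s t" by (simp add: power2_eq_square)
 moreover have "0 <= tint (\<lambda>r. \<bar>vnorm U (v r)\<bar>) s t" by (intro integral_nonneg_AE AE_I2) simp
 ultimately show ?thesis using vnorm_nonneg[of ?z] by (cases "vnorm U ?z = 0") (auto simp: mult_le_cancel_left)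
qed

text \<open>The weak derivative yields the increments inside the interval only, but both sides are continuous
 up to its end points.\<close>

lemma w_increment:
 assumes z: "z \<in> H01 U" and st: "0 <= s" "s <= t" "t <= T"
 shows "l2inner U (v t) z - l2inner U (v s) z = tint (\<lambda>r. w r z) s t"
proof -
 define f where "f t = l2inner U (v t) z" for t
 have f: "continuous_on {0..T} f" unfolding f_def[abs_def] by (rule L2_curve_continuous[OF v_curve L2_curve_const[OF H01_L2[OF z]]])
 have h: "integrable (lebesgue_on {0..T}) (\<lambda>r. w r z)" by (rule w_integrable[OF V_curve_const[OF z]])
 define R where "R t = f t - tint (\<lambda>r. w r z) 0 t" for t
 have R_cont: "continuous_on {0..T} R" unfolding R_def[abs_def] by (intro continuous_on_diff f continuous_tint[OF h])
 have inner: "f t - f s = tint (\<lambda>r. w r z) s t" if "0 < s" "s < t" "t < T" for s t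
 proof (rule weak_derivative_increment[OF f h _ that])
  fix \<phi> assume "\<phi> \<in> test_functions {0<..<T}"
  then show "(\<integral>x. deriv \<phi> x * f x \<partial>lebesgue_on {0<..<T}) = - (\<integral>x. \<phi> x * w x z \<partial>lebesgue_on {0<..<T})"
   using w_weak z unfolding has_weak_time_derivative_def f_def by blast
 qed
 have R_eq: "R t = R s" if "0 < s" "s < t" "t < T" for s t
  using inner[OF that] tint_increment[OF h, of s t] that by (simp add: R_def)
 have R_const: "R t = R (T / 2)" if "t \<in> {0<..<T}" for t
  using R_eq[of t "T / 2"] R_eq[of "T / 2" t] that by (cases t "T / 2" rule: linorder_cases) auto
 have "closure {0<..<T} = {0..T}" using T_pos by simp
 then have cl: "continuous_on (closure {0<..<T}) R" using R_cont by simp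
 have "R t = R (T / 2)" if "t \<in> {0..T}" for t
  by (rule continuous_constant_on_closure[OF cl R_const]) (use that \<open>closure {0<..<T} = {0..T}\<close> in auto)
 from this[of t] this[of s] have "R t = R s" using st by simp
 then show ?thesis using tint_increment[OF h st] by (simp add: R_def f_def)
qed

text \<open>By symmetry, the increment over \<open>[s, t]\<close> is a sum of two integrals with the fixed test functions \<open>u s\<close>
 and \<open>u t\<close>. On short intervals, exchanging them for \<open>u r\<close> costs a small multiple of \<open>\<integral> \<parallel>\<nabla>v\<parallel>\<close>. The same
 argument proves the other two product rules below.\<close>

lemma vnorm_increment:
 assumes st: "0 <= s" "s <= t" "t <= T"
 shows "(vnorm U (u t))\<^sup>2 - (vnorm U (u s))\<^sup>2 = 2 * tint (\<lambda>r. vinner (v r) (u r)) s t"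
proof -
 let ?P = "\<lambda>r. vinner (v r) (u r)" and ?n = "\<lambda>r. \<bar>vnorm U (v r)\<bar>"
 note P_int = vinner_v_integrable[OF u_curve] and n_int = bochner_L2_norm_integrable(2)[OF v_bochner]
 define R where "R t = vinner (u t) (u t) - 2 * tint ?P 0 t" for t
 define H where "H t = 2 * tint ?n 0 t" for t
 have "R t = R s"
 proof (rule constant_if_small_increments[OF _ st])
  fix e :: real assume "0 < e"
  from curve_modulus[OF u_curve this] obtain \<delta> where \<delta>: "0 < \<delta>"
   "\<forall>s\<in>{0..T}. \<forall>t\<in>{0..T}. \<bar>s - t\<bar> < \<delta> --> vnorm U (\<lambda>x. u s x - u t x) < e" by blast
  have "\<bar>R t - R s\<bar> <= e * (H t - H s)" if 1: "0 <= s" "s <= t" "t <= T" "t - s < \<delta>" for s t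
  proof -
   have mem: "u t \<in> H01 U" "u s \<in> H01 U" using 1 by (auto intro: u_H01)
   have close: "vnorm U (\<lambda>x. u q x - u r x) <= e" if "q \<in> {s..t}" "r \<in> {s..t}" for q r
    using \<delta>(2)[rule_format, of q r] that 1 by (auto intro: less_imp_le)
   have "\<bar>tint (\<lambda>r. vinner (v r) (u t)) s t - tint ?P s t\<bar> <= e * tint ?n s t"
    "\<bar>tint (\<lambda>r. vinner (v r) (u s)) s t - tint ?P s t\<bar> <= e * tint ?n s t"
    by (rule tint_vinner_close[OF V_curve_const u_curve 1(1,3)], use mem close 1 in auto)+
   moreover have "vinner (u t) (u t) - vinner (u s) (u s)
     = tint (\<lambda>r. vinner (v r) (u t)) s t + tint (\<lambda>r. vinner (v r) (u s)) s t"
    using u_vinner_increment[OF mem(1) 1(1-3)] u_vinner_increment[OF mem(2) 1(1-3)] vinner_commute[of "u t" "u s"] by simp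
   moreover have "R t - R s = (vinner (u t) (u t) - vinner (u s) (u s)) - 2 * tint ?P s t"
    using tint_increment[OF P_int 1(1-3)] by (simp add: R_def)
   moreover have "e * (H t - H s) = 2 * (e * tint ?n s t)"
    using tint_increment[OF n_int 1(1-3)] by (simp add: H_def right_diff_distrib[symmetric])
   ultimately show ?thesis by linarith
  qed
  with \<delta>(1) show "\<exists>d>0. \<forall>s t. 0 <= s \<and> s <= t \<and> t <= T \<and> t - s < d --> \<bar>R t - R s\<bar> <= e * (H t - H s)" by blast
 qed
 then show ?thesis using tint_increment[OF P_int st] by (simp add: R_def vnorm_power2)
qed

lemma u_L2_curve: "L2_curve T u"
 by (rule V_curve_imp_L2_curve[OF u_curve])

lemma l2norm_increment:
 assumes st: "0 <= s" "s <= t" "t <= T"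
 shows "(l2norm U (u t))\<^sup>2 - (l2norm U (u s))\<^sup>2 = tint (\<lambda>r. 2 * l2inner U (u r) (v r)) s t"
proof -
 let ?P = "\<lambda>r. l2inner U (v r) (u r)" and ?n = "\<lambda>r. l2norm U (v r)"
 note P_int = l2inner_v_integrable[OF u_L2_curve] and n_int = l2norm_v_integrable
 define R where "R t = l2inner U (u t) (u t) - 2 * tint ?P 0 t" for t
 define H where "H t = 2 * tint ?n 0 t" for t
 have "R t = R s"
 proof (rule constant_if_small_increments[OF _ st])
  fix e :: real assume "0 < e"
  from curve_modulus[OF u_L2_curve this] obtain \<delta> where \<delta>: "0 < \<delta>"
   "\<forall>s\<in>{0..T}. \<forall>t\<in>{0..T}. \<bar>s - t\<bar> < \<delta> --> l2norm U (\<lambda>x. u s x - u t x) < e" by blast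
  have "\<bar>R t - R s\<bar> <= e * (H t - H s)" if 1: "0 <= s" "s <= t" "t <= T" "t - s < \<delta>" for s t
  proof -
   have mem: "u t \<in> L2 U" "u s \<in> L2 U" using 1 by (auto intro: u_L2)
   have close: "l2norm U (\<lambda>x. u q x - u r x) <= e" if "q \<in> {s..t}" "r \<in> {s..t}" for q r
    using \<delta>(2)[rule_format, of q r] that 1 by (auto intro: less_imp_le)
   have "\<bar>tint (\<lambda>r. l2inner U (v r) (u t)) s t - tint ?P s t\<bar> <= e * tint ?n s t"
    "\<bar>tint (\<lambda>r. l2inner U (v r) (u s)) s t - tint ?P s t\<bar> <= e * tint ?n s t"
    by (rule tint_l2inner_close[OF L2_curve_const u_L2_curve 1(1,3)], use mem close 1 in auto)+
   moreover have "l2inner U (u t) (u t) - l2inner U (u s) (u s)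
     = tint (\<lambda>r. l2inner U (v r) (u t)) s t + tint (\<lambda>r. l2inner U (v r) (u s)) s t"
    using u_l2inner_increment[OF mem(1) 1(1-3)] u_l2inner_increment[OF mem(2) 1(1-3)] l2inner_commute[of U "u t" "u s"] by simp
   moreover have "R t - R s = (l2inner U (u t) (u t) - l2inner U (u s) (u s)) - 2 * tint ?P s t"
    using tint_increment[OF P_int 1(1-3)] by (simp add: R_def)
   moreover have "e * (H t - H s) = 2 * (e * tint ?n s t)"
    using tint_increment[OF n_int 1(1-3)] by (simp add: H_def right_diff_distrib[symmetric])
   ultimately show ?thesis by linarith
  qed
  with \<delta>(1) show "\<exists>d>0. \<forall>s t. 0 <= s \<and> s <= t \<and> t <= T \<and> t - s < d --> \<bar>R t - R s\<bar> <= e * (H t - H s)" by blast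
 qed
 then have "l2inner U (u t) (u t) - l2inner U (u s) (u s) = 2 * tint ?P s t"
  using tint_increment[OF P_int st] by (simp add: R_def)
 then show ?thesis by (simp add: l2norm_power2 l2inner_commute[of U "u _" "v _"])
qed

lemma cross_increment:
 assumes st: "0 <= s" "s <= t" "t <= T"
 shows "l2inner U (u t) (v t) - l2inner U (u s) (v s) = tint (\<lambda>r. w r (u r)) s t + tint (\<lambda>r. (l2norm U (v r))\<^sup>2) s t"
proof -
 let ?P = "\<lambda>r. w r (u r)" and ?V = "\<lambda>r. l2inner U (v r) (v r)"
  and ?n = "\<lambda>r. \<bar>dual_norm U (w r)\<bar>" and ?k = "\<lambda>r. l2norm U (v r)"
 note P_int = w_integrable[OF u_curve] and n_int = bochner_L2_norm_integrable(2)[OF w_bochner]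
  and V_int = l2inner_v_integrable[OF v_curve] and k_int = l2norm_v_integrable
 define R where "R t = l2inner U (u t) (v t) - tint ?P 0 t - tint ?V 0 t" for t
 define H where "H t = tint ?n 0 t + tint ?k 0 t" for t
 have "R t = R s"
 proof (rule constant_if_small_increments[OF _ st])
  fix e :: real assume e: "0 < e"
  from curve_modulus[OF u_curve e] obtain \<delta>1 where \<delta>1: "0 < \<delta>1"
   "\<forall>s\<in>{0..T}. \<forall>t\<in>{0..T}. \<bar>s - t\<bar> < \<delta>1 --> vnorm U (\<lambda>x. u s x - u t x) < e" by blast
  from curve_modulus[OF v_curve e] obtain \<delta>2 where \<delta>2: "0 < \<delta>2"
   "\<forall>s\<in>{0..T}. \<forall>t\<in>{0..T}. \<bar>s - t\<bar> < \<delta>2 --> l2norm U (\<lambda>x. v s x - v t x) < e" by blast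
  have "\<bar>R t - R s\<bar> <= e * (H t - H s)" if 1: "0 <= s" "s <= t" "t <= T" "t - s < min \<delta>1 \<delta>2" for s t
  proof -
   have mem: "u t \<in> H01 U" "v s \<in> L2 U" "v t \<in> L2 U" "u s \<in> L2 U" "u t \<in> L2 U"
    using 1 by (auto intro: u_H01 v_L2 u_L2)
   have close: "vnorm U (\<lambda>x. u t x - u r x) <= e" "l2norm U (\<lambda>x. v s x - v r x) <= e" if "r \<in> {s..t}" for r
    using \<delta>1(2)[rule_format, of t r] \<delta>2(2)[rule_format, of s r] that 1 by (auto intro: less_imp_le)
   have "\<bar>tint (\<lambda>r. w r (u t)) s t - tint ?P s t\<bar> <= e * tint ?n s t"
    by (rule tint_w_close[OF V_curve_const[OF mem(1)] u_curve 1(1,3)]) (rule close)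
   moreover have "\<bar>tint (\<lambda>r. l2inner U (v r) (v s)) s t - tint ?V s t\<bar> <= e * tint ?k s t"
    by (rule tint_l2inner_close[OF L2_curve_const[OF mem(2)] v_curve 1(1,3)]) (rule close)
   moreover have "l2inner U (u t) (v t) - l2inner U (u s) (v s)
     = tint (\<lambda>r. w r (u t)) s t + tint (\<lambda>r. l2inner U (v r) (v s)) s t"
    using w_increment[OF mem(1) 1(1-3)] u_l2inner_increment[OF mem(2) 1(1-3)]
     l2inner_commute[of U "v t" "u t"] l2inner_commute[of U "v s" "u t"] by simp
   moreover have "R t - R s = (l2inner U (u t) (v t) - l2inner U (u s) (v s)) - tint ?P s t - tint ?V s t"
    using tint_increment[OF P_int 1(1-3)] tint_increment[OF V_int 1(1-3)] by (simp add: R_def)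
   moreover have "e * (H t - H s) = e * tint ?n s t + e * tint ?k s t"
    using tint_increment[OF n_int 1(1-3)] tint_increment[OF k_int 1(1-3)]
    by (simp add: H_def distrib_left[symmetric])
   ultimately show ?thesis by linarith
  qed
  with \<delta>1(1) \<delta>2(1) show "\<exists>d>0. \<forall>s t. 0 <= s \<and> s <= t \<and> t <= T \<and> t - s < d --> \<bar>R t - R s\<bar> <= e * (H t - H s)"
   by (intro exI[of _ "min \<delta>1 \<delta>2"]) simp
 qed
 then show ?thesis using tint_increment[OF P_int st] tint_increment[OF V_int st] by (simp add: R_def l2norm_power2)
qed

subsection \<open>The energy inequality\<close>

definition memory :: "real \<Rightarrow> ('a \<Rightarrow> real) \<Rightarrow> real" where
 "memory t z = tint (\<lambda>s. g (t - s) * vinner (u s) z) 0 t"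

definition residual :: "real \<Rightarrow> ('a \<Rightarrow> real) \<Rightarrow> real" where
 "residual t z = w t z + vinner (u t) z + vinner (v t) z - memory t z - (\<integral>x. source p x (u t x) * z x \<partial>lebesgue_on U)"

lemma kernel_shift_continuous: "continuous_on {0..t} (\<lambda>s. g (t - s))"
proof -
 have "continuous_on ((\<lambda>s. t - s) ` {0..t}) g" by (rule kernel_continuous[OF H2]) auto
 moreover have "continuous_on {0..t} (\<lambda>s. t - s)" by (rule continuous_on_diff[OF continuous_on_const continuous_on_id])
 ultimately have "continuous_on {0..t} (g \<circ> (\<lambda>s. t - s))" by (rule continuous_on_compose[rotated])
 then show ?thesis by (simp only: o_def)
qed

lemma u_continuous:
 assumes t: "t \<in> {0..T}" and z: "z \<in> H01 U"
 shows "continuous_on {0..t} (\<lambda>s. vinner (u s) z)"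
 by (rule continuous_on_subset[OF V_curve_continuous[OF u_curve V_curve_const[OF z]]]) (use t in auto)

lemma memory_integrable:
 assumes t: "t \<in> {0..T}" and z: "z \<in> H01 U"
 shows "integrable (lebesgue_on {0..t}) (\<lambda>s. g (t - s) * vinner (u s) z)"
 by (rule continuous_imp_integrable_real[OF continuous_on_mult[OF kernel_shift_continuous u_continuous[OF t z]]])

lemma memory_diff:
 assumes t: "t \<in> {0..T}" and y: "y \<in> H01 U" and z: "z \<in> H01 U"
 shows "memory t (\<lambda>x. y x - z x) = memory t y - memory t z"
proof -
 have "memory t (\<lambda>x. y x - z x) = tint (\<lambda>s. g (t - s) * vinner (u s) y - g (t - s) * vinner (u s) z) 0 t"
  unfolding memory_def
 proof (rule Bochner_Integration.integral_cong[OF refl])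
  fix s assume "s \<in> space (lebesgue_on {0..t})"
  then have s: "s \<in> {0..T}" using t by auto
  show "g (t - s) * vinner (u s) (\<lambda>x. y x - z x) = g (t - s) * vinner (u s) y - g (t - s) * vinner (u s) z"
   by (simp only: vinner_diff_right[OF y z u_H01[OF s]] right_diff_distrib)
 qed
 then show ?thesis unfolding memory_def
  by (simp add: Bochner_Integration.integral_diff[OF memory_integrable[OF t y] memory_integrable[OF t z]])
qed

lemma memory_bounded:
 assumes t: "t \<in> {0..T}"
 shows "\<exists>K. \<forall>z\<in>H01 U. \<bar>memory t z\<bar> <= K * vnorm U z"
proof -
 obtain K where K: "0 <= K" "!!t. t \<in> {0..T} ==> vnorm U (u t) <= K" by (metis V_curve_bounded[OF u_curve])
 have "\<bar>memory t z\<bar> <= (tint (\<lambda>s. g (t - s)) 0 t * K) * vnorm U z" if z: "z \<in> H01 U" for z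
 proof -
  have "\<bar>memory t z\<bar> <= tint (\<lambda>s. g (t - s) * (K * vnorm U z)) 0 t"
   unfolding memory_def
  proof (rule tint_abs_le[OF memory_integrable[OF t z]])
   show "integrable (lebesgue_on {0..t}) (\<lambda>s. g (t - s) * (K * vnorm U z))"
    by (rule continuous_imp_integrable_real[OF continuous_on_mult[OF kernel_shift_continuous continuous_on_const]])
   show "AE s in lebesgue_on {0..t}. \<bar>g (t - s) * vinner (u s) z\<bar> <= g (t - s) * (K * vnorm U z)"
   proof (rule AE_I2)
    fix s assume "s \<in> space (lebesgue_on {0..t})"
    then have s: "s \<in> {0..T}" "0 <= t - s" using t by auto
    have "\<bar>vinner (u s) z\<bar> <= K * vnorm U z"
     using vinner_Cauchy_Schwarz[OF u_H01[OF s(1)] z] mult_right_mono[OF K(2)[OF s(1)] vnorm_nonneg[of z]] by linarith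
    then show "\<bar>g (t - s) * vinner (u s) z\<bar> <= g (t - s) * (K * vnorm U z)"
     using kernel_nonneg[OF H2 s(2)] by (simp add: abs_mult mult_left_mono)
   qed
  qed
  then show ?thesis by (simp add: mult.assoc)
 qed
 then show ?thesis by blast
qed

lemma residual_close:
 assumes t: "t \<in> {0..T}" and wt: "w t \<in> dual_V U" and vt: "v t \<in> H01 U"
 shows "\<exists>K. \<forall>y\<in>H01 U. \<forall>z\<in>H01 U. \<bar>residual t y - residual t z\<bar> <= K * vnorm U (\<lambda>x. y x - z x)"
proof -
 from memory_bounded[OF t] obtain K1 where K1: "\<forall>z\<in>H01 U. \<bar>memory t z\<bar> <= K1 * vnorm U z" by blast
 from source_bounded[OF u_H01[OF t]] obtain K2 where
  K2: "\<forall>z\<in>H01 U. \<bar>\<integral>x. source p x (u t x) * z x \<partial>lebesgue_on U\<bar> <= K2 * vnorm U z" by blast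
 let ?K = "dual_norm U (w t) + vnorm U (u t) + vnorm U (v t) + K1 + K2"
 have "\<bar>residual t y - residual t z\<bar> <= ?K * vnorm U (\<lambda>x. y x - z x)" if y: "y \<in> H01 U" and z: "z \<in> H01 U" for y z
 proof -
  let ?d = "\<lambda>x. y x - z x" let ?S = "\<lambda>z. \<integral>x. source p x (u t x) * z x \<partial>lebesgue_on U"
  have d: "?d \<in> H01 U" by (rule H01_diff[OF y z])
  have S: "?S ?d = ?S y - ?S z"
   using source_integrable[OF u_H01[OF t] y] source_integrable[OF u_H01[OF t] z] by (simp add: right_diff_distrib)
  have "\<bar>w t y - w t z\<bar> <= dual_norm U (w t) * vnorm U ?d"
   using dual_norm_bound[OF wt d] by (simp add: dual_diff[OF wt y z])
  moreover have "\<bar>vinner (u t) y - vinner (u t) z\<bar> <= vnorm U (u t) * vnorm U ?d"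
   using vinner_Cauchy_Schwarz[OF u_H01[OF t] d] by (simp add: vinner_diff_right[OF y z u_H01[OF t]])
  moreover have "\<bar>vinner (v t) y - vinner (v t) z\<bar> <= vnorm U (v t) * vnorm U ?d"
   using vinner_Cauchy_Schwarz[OF vt d] by (simp add: vinner_diff_right[OF y z vt])
  moreover have "\<bar>memory t y - memory t z\<bar> <= K1 * vnorm U ?d"
   using bspec[OF K1 d] by (simp add: memory_diff[OF t y z])
  moreover have "\<bar>?S y - ?S z\<bar> <= K2 * vnorm U ?d" using bspec[OF K2 d] by (simp only: S)
  ultimately show ?thesis unfolding residual_def distrib_right by linarith
 qed
 then show ?thesis by blast
qed

text \<open>The exceptional null set in the weak formulation depends on the test function. It can be chosen
 uniformly for the countably many test functions \<open>u q\<close> with rational \<open>q\<close>, and these approximate \<open>u t\<close>.\<close>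

lemma residual_u: "AE t in lebesgue_on {0..T}. residual t (u t) = 0"
proof -
 let ?Q = "\<rat> \<inter> {0..T}"
 have "AE t in lebesgue_on {0<..<T}. \<forall>q\<in>?Q. residual t (u q) = 0"
 proof (rule AE_ball_countable')
  fix q assume "q \<in> ?Q"
  then have "u q \<in> H01 U" by (auto intro: u_H01)
  then have "AE t in lebesgue_on {0<..<T}. w t (u q) + vinner (u t) (u q) + vinner (v t) (u q)
    - tint (\<lambda>s. g (t - s) * vinner (u s) (u q)) 0 t = (\<integral>x. source p x (u t x) * u q x \<partial>lebesgue_on U)"
   using w unfolding acceleration_def by blast
  then show "AE t in lebesgue_on {0<..<T}. residual t (u q) = 0"
   by eventually_elim (simp add: residual_def memory_def)
 qed (auto intro: countable_subset[OF _ countable_rat])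
 then have "AE t in lebesgue_on {0..T}. \<forall>q\<in>?Q. residual t (u q) = 0" by (rule AE_closed_interval)
 with AE_interval[of 0 T] v_H01 w_dual show ?thesis
 proof eventually_elim
  case (elim t)
  from residual_close[OF elim(1,3,2)] obtain K where
   K: "\<forall>y\<in>H01 U. \<forall>z\<in>H01 U. \<bar>residual t y - residual t z\<bar> <= K * vnorm U (\<lambda>x. y x - z x)" by blast
  have "\<bar>residual t (u t)\<bar> <= \<bar>K\<bar> * e" if "0 < e" for e
  proof -
   from curve_modulus[OF u_curve that] obtain \<delta> where \<delta>: "0 < \<delta>"
    "\<forall>s\<in>{0..T}. \<forall>t\<in>{0..T}. \<bar>s - t\<bar> < \<delta> --> vnorm U (\<lambda>x. u s x - u t x) < e" by blast
   have "max 0 (t - \<delta>) < min T (t + \<delta>)" using \<delta>(1) elim(1) T_pos by auto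
   from Rats_dense_in_real[OF this] obtain q where q: "q \<in> \<rat>" "max 0 (t - \<delta>) < q" "q < min T (t + \<delta>)" by blast
   then have qQ: "q \<in> ?Q" "q \<in> {0..T}" by auto
   have "vnorm U (\<lambda>x. u t x - u q x) < e" using \<delta>(2)[rule_format, OF elim(1) qQ(2)] q by auto
   then have "\<bar>K\<bar> * vnorm U (\<lambda>x. u t x - u q x) <= \<bar>K\<bar> * e" by (intro mult_left_mono) auto
   moreover have "K * vnorm U (\<lambda>x. u t x - u q x) <= \<bar>K\<bar> * vnorm U (\<lambda>x. u t x - u q x)"
    by (intro mult_right_mono vnorm_nonneg) simp
   moreover have "\<bar>residual t (u t) - residual t (u q)\<bar> <= K * vnorm U (\<lambda>x. u t x - u q x)"
    using K u_H01[OF elim(1)] u_H01[OF qQ(2)] by blast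
   ultimately show ?thesis using elim(4) qQ(1) by simp
  qed
  note small = this
  show "residual t (u t) = 0"
  proof (rule ccontr)
   assume "residual t (u t) \<noteq> 0"
   then have "0 < \<bar>residual t (u t)\<bar> / (2 * (\<bar>K\<bar> + 1))" by simp
   from small[OF this] have "\<bar>residual t (u t)\<bar> * (2 * (\<bar>K\<bar> + 1)) <= \<bar>K\<bar> * \<bar>residual t (u t)\<bar>" by (simp add: field_simps)
   then have "\<bar>residual t (u t)\<bar> * (\<bar>K\<bar> + 2) <= 0" by (simp add: algebra_simps)
   then show False using \<open>residual t (u t) \<noteq> 0\<close> by (simp add: mult_le_0_iff)
  qed
 qed
qed

definition \<kappa> where "\<kappa> = ((m - 1)\<^sup>2 * ell g - 1) / (2 * m)"

text \<open>Replacing \<open>u s\<close> by \<open>u t\<close> in the memory term leaves a mixed term. Young's inequality splits it with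
 the weight \<open>m\<close>, for which the history part is exactly the one contained in \<open>m\<close> times the energy.\<close>

lemma memory_u_ge:
 assumes t: "t \<in> {0..T}"
 shows "(1 - 1 / (2 * m)) * tint g 0 t * (vnorm U (u t))\<^sup>2
  - m / 2 * tint (\<lambda>s. g (t - s) * (vnorm U (\<lambda>x. u t x - u s x))\<^sup>2) 0 t <= memory t (u t)"
proof -
 have m: "0 < m" using m_gt_2 by simp
 let ?G = "(vnorm U (u t))\<^sup>2" and ?d = "\<lambda>s. (vnorm U (\<lambda>x. u t x - u s x))\<^sup>2"
 have d_eq: "?d s = ?G - 2 * vinner (u s) (u t) + vinner (u s) (u s)" if "s \<in> {0..t}" for s
 proof -
  have s: "s \<in> {0..T}" using that t by auto
  show ?thesis using vnorm_diff_power2[OF u_H01[OF t] u_H01[OF s]] vinner_commute[of "u t" "u s"] by (simp add: vnorm_power2)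
 qed
 have sub: "{0..t} \<subseteq> {0..T}" using t by auto
 have "continuous_on {0..t} (\<lambda>s. ?G - 2 * vinner (u s) (u t) + vinner (u s) (u s))"
  by (intro continuous_intros u_continuous[OF t u_H01[OF t]] continuous_on_subset[OF V_curve_continuous[OF u_curve u_curve] sub])
 then have d_cont: "continuous_on {0..t} ?d" by (rule continuous_on_eq) (simp add: d_eq)
 have i1: "integrable (lebesgue_on {0..t}) (\<lambda>s. g (t - s))"
  by (rule continuous_imp_integrable_real[OF kernel_shift_continuous])
 have i2: "integrable (lebesgue_on {0..t}) (\<lambda>s. g (t - s) * ?d s)"
  by (rule continuous_imp_integrable_real[OF continuous_on_mult[OF kernel_shift_continuous d_cont]])
 have refl: "tint (\<lambda>s. g (t - s)) 0 t = tint g 0 t"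
  by (rule tint_reflect[OF kernel_continuous[OF H2]]) (use t in auto)
 have "(1 - 1 / (2 * m)) * tint g 0 t * ?G - m / 2 * tint (\<lambda>s. g (t - s) * ?d s) 0 t
   = tint (\<lambda>s. ((1 - 1 / (2 * m)) * ?G) * g (t - s)) 0 t - tint (\<lambda>s. m / 2 * (g (t - s) * ?d s)) 0 t"
  unfolding refl[symmetric] by simp
 also have "... = tint (\<lambda>s. ((1 - 1 / (2 * m)) * ?G) * g (t - s) - m / 2 * (g (t - s) * ?d s)) 0 t"
  by (rule Bochner_Integration.integral_diff[symmetric]) (rule Bochner_Integration.integrable_mult_right i1 i2)+
 also have "... <= memory t (u t)"
  unfolding memory_def
 proof (rule tint_mono_AE[OF _ memory_integrable[OF t u_H01[OF t]]])
  show "integrable (lebesgue_on {0..t}) (\<lambda>s. ((1 - 1 / (2 * m)) * ?G) * g (t - s) - m / 2 * (g (t - s) * ?d s))"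
   by (intro Bochner_Integration.integrable_diff Bochner_Integration.integrable_mult_right i1 i2)
  show "AE s in lebesgue_on {0..t}. ((1 - 1 / (2 * m)) * ?G) * g (t - s) - m / 2 * (g (t - s) * ?d s) <= g (t - s) * vinner (u s) (u t)"
  proof (rule AE_I2)
   fix s assume "s \<in> space (lebesgue_on {0..t})"
   then have s: "s \<in> {0..T}" "0 <= t - s" using t by auto
   let ?n = "vnorm U (\<lambda>x. u t x - u s x)" and ?k = "vnorm U (u t)"
   have "?G - vinner (u s) (u t) = vinner (\<lambda>x. u t x - u s x) (u t)"
    by (simp add: vinner_diff_left[OF u_H01[OF t] u_H01[OF s(1)] u_H01[OF t]] vnorm_power2)
   also have "... <= ?n * ?k" using vinner_Cauchy_Schwarz[OF H01_diff[OF u_H01[OF t] u_H01[OF s(1)]] u_H01[OF t]] by linarith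
   also have "... <= m / 2 * ?n\<^sup>2 + 1 / (2 * m) * ?k\<^sup>2"
   proof -
    have "0 <= 1 / (2 * m) * (m * ?n - ?k)\<^sup>2" using m by simp
    also have "... = m / 2 * ?n\<^sup>2 + 1 / (2 * m) * ?k\<^sup>2 - ?n * ?k" using m by (simp add: power2_eq_square field_simps)
    finally show ?thesis by simp
   qed
   finally have "(1 - 1 / (2 * m)) * ?G - m / 2 * ?d s <= vinner (u s) (u t)" by (simp add: left_diff_distrib)
   then have "g (t - s) * ((1 - 1 / (2 * m)) * ?G - m / 2 * ?d s) <= g (t - s) * vinner (u s) (u t)"
    using kernel_nonneg[OF H2 s(2)] by (rule mult_left_mono)
   then show "((1 - 1 / (2 * m)) * ?G) * g (t - s) - m / 2 * (g (t - s) * ?d s) <= g (t - s) * vinner (u s) (u t)"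
    by (simp add: algebra_simps)
  qed
 qed
 finally show ?thesis .
qed

lemma energy_pointwise:
 assumes t: "t \<in> {0..T}" and res: "residual t (u t) = 0"
 shows "m / 2 * (l2norm U (v t))\<^sup>2 + \<kappa> * (vnorm U (u t))\<^sup>2 - m * shifted_energy U p g u v t <= w t (u t) + vinner (v t) (u t)"
proof -
 have m: "0 < m" using m_gt_2 by simp
 define \<gamma> where "\<gamma> = tint g 0 t"
 define X where "X = (vnorm U (u t))\<^sup>2"
 define M where "M = tint (\<lambda>s. g (t - s) * (vnorm U (\<lambda>x. u t x - u s x))\<^sup>2) 0 t"
 define F where "F = (\<integral>x. source_primitive p x (u t x) \<partial>lebesgue_on U)"
 define S where "S = (\<integral>x. source p x (u t x) * u t x \<partial>lebesgue_on U)"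
 have M_eq: "(\<integral>s. g (t - s) * (l2norm U (wgrad U (u t) - wgrad U (u s)))\<^sup>2 \<partial>lebesgue_on {0..t}) = M"
  unfolding M_def by (rule Bochner_Integration.integral_cong[OF refl]) (use t in \<open>auto simp: vnorm_diff[OF u_H01 u_H01] fun_diff_def\<close>)
 have E: "m * shifted_energy U p g u v t = m / 2 * (l2norm U (v t))\<^sup>2 + m / 2 * ((1 - \<gamma>) * X) + m / 2 * M - m * F + C_star U p"
  using m unfolding shifted_energy_def energy_def M_eq m_def[symmetric]
  by (simp add: \<gamma>_def X_def F_def vnorm_def algebra_simps)
 have S: "m * F - C_star U p <= S" unfolding F_def S_def by (rule source_energy[OF u_H01[OF t]])
 have mem: "(1 - 1 / (2 * m)) * \<gamma> * X - m / 2 * M <= memory t (u t)"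
  unfolding \<gamma>_def X_def M_def by (rule memory_u_ge[OF t])
 have eq: "w t (u t) + vinner (v t) (u t) = memory t (u t) + S - X"
  using res by (simp add: residual_def S_def X_def vnorm_power2)
 have "\<gamma> <= 1 - ell g" unfolding \<gamma>_def by (rule kernel_integral_le[OF H2])
 then have "(m - 1)\<^sup>2 * ell g <= (m - 1)\<^sup>2 * (1 - \<gamma>)" by (intro mult_left_mono) auto
 then have "\<kappa> <= ((m - 1)\<^sup>2 * (1 - \<gamma>) - 1) / (2 * m)" unfolding \<kappa>_def using m by (intro divide_right_mono) auto
 also have "... = (1 - 1 / (2 * m)) * \<gamma> - 1 + m / 2 * (1 - \<gamma>)" using m by (simp add: power2_eq_square field_simps)
 finally have "\<kappa> * X <= ((1 - 1 / (2 * m)) * \<gamma> - 1 + m / 2 * (1 - \<gamma>)) * X" by (rule mult_right_mono) (simp add: X_def)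
 also have "... = (1 - 1 / (2 * m)) * \<gamma> * X - X + m / 2 * ((1 - \<gamma>) * X)" by (simp add: algebra_simps)
 finally show ?thesis using E S mem eq unfolding X_def[symmetric] by linarith
qed

lemma energy_inequality:
 assumes st: "0 <= s" "s <= t" "t <= T" and E: "continuous_on {0..T} (shifted_energy U p g u v)"
 shows "tint (\<lambda>r. (m + 2) / 2 * (l2norm U (v r))\<^sup>2 + \<kappa> * (vnorm U (u r))\<^sup>2 - m * shifted_energy U p g u v r - vinner (v r) (u r)) s t
  <= l2inner U (u t) (v t) - l2inner U (u s) (v s)"
proof -
 have Vi: "integrable (lebesgue_on {s..t}) (\<lambda>r. (l2norm U (v r))\<^sup>2)"
  unfolding l2norm_power2 by (rule tint_integrable[OF l2inner_v_integrable[OF v_curve] st(1,3)])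
 have Gi: "integrable (lebesgue_on {s..t}) (\<lambda>r. (vnorm U (u r))\<^sup>2)"
  unfolding vnorm_power2 by (rule tint_integrable[OF continuous_tint_integrable[OF V_curve_continuous[OF u_curve u_curve]] st(1,3)])
 note Ei = tint_integrable[OF continuous_tint_integrable[OF E] st(1,3)]
 note Pi = tint_integrable[OF vinner_v_integrable[OF u_curve] st(1,3)]
 note wi = tint_integrable[OF w_integrable[OF u_curve] st(1,3)]
 have "tint (\<lambda>r. (m + 2) / 2 * (l2norm U (v r))\<^sup>2 + \<kappa> * (vnorm U (u r))\<^sup>2 - m * shifted_energy U p g u v r - vinner (v r) (u r)) s t
   <= tint (\<lambda>r. w r (u r) + (l2norm U (v r))\<^sup>2) s t"
 proof (rule tint_mono_AE)
  have "AE r in lebesgue_on {s..t}. residual r (u r) = 0" by (rule AE_subinterval[OF residual_u]) (use st in auto)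
  with AE_interval[of s t]
  show "AE r in lebesgue_on {s..t}. (m + 2) / 2 * (l2norm U (v r))\<^sup>2 + \<kappa> * (vnorm U (u r))\<^sup>2
    - m * shifted_energy U p g u v r - vinner (v r) (u r) <= w r (u r) + (l2norm U (v r))\<^sup>2"
  proof eventually_elim
   case (elim r)
   have "r \<in> {0..T}" using elim(1) st by auto
   from energy_pointwise[OF this elim(2)]
   show ?case by (simp add: add_divide_distrib distrib_right)
  qed
 qed (intro Bochner_Integration.integrable_add Bochner_Integration.integrable_diff Bochner_Integration.integrable_mult_right Vi Gi Ei Pi wi)+
 also have "... = tint (\<lambda>r. w r (u r)) s t + tint (\<lambda>r. (l2norm U (v r))\<^sup>2) s t"
  by (rule Bochner_Integration.integral_add[OF wi Vi])
 finally show ?thesis using cross_increment[OF st] by simp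
qed

end

section \<open>The blow-up argument for real functions\<close>

lemma tint_const: "a <= b ==> tint (\<lambda>_. c) a b = c * (b - a)"
 by (simp add: measure_restrict_space)

lemma tint_same: "tint f a a = 0"
proof -
 have "tint f a a = tint (\<lambda>_. f a) a a" by (rule Bochner_Integration.integral_cong) auto
 then show ?thesis by (simp only: tint_const order_refl diff_self mult_zero_right)
qed

lemma nondecreasing_within:
 fixes f :: "real \<Rightarrow> real"
 assumes f: "!!r. r \<in> {a..b} ==> (f has_real_derivative f' r) (at r within {a..b})"
  and nonneg: "!!r. r \<in> {a..b} ==> 0 <= f' r" and st: "a <= s" "s <= t" "t <= b"
 shows "f s <= f t"
proof (rule DERIV_nonneg_imp_increasing_open[OF st(2)])
 have "continuous_on {a..b} f" using f by (rule DERIV_continuous_on)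
 then show "continuous_on {s..t} f" by (rule continuous_on_subset) (use st in auto)
 fix x assume x: "s < x" "x < t"
 then have "at x within {a..b} = at x" using st by (intro at_within_interior) auto
 then show "\<exists>y. (f has_real_derivative y) (at x) \<and> 0 <= y" using f[of x] nonneg[of x] x st by auto
qed

lemma powr_has_derivative_within:
 fixes f :: "real \<Rightarrow> real"
 assumes "(f has_real_derivative D) (at x within S)" "0 < f x"
 shows "((\<lambda>x. f x powr r) has_real_derivative r * f x powr (r - 1) * D) (at x within S)"
 using DERIV_chain2[OF has_real_derivative_powr[OF assms(2)] assms(1)] .

text \<open>The power \<open>\<Psi> powr -\<alpha>\<close> of a function with \<open>\<Psi>'' \<Psi> \<ge> (1 + \<alpha>) \<Psi>'\<^sup>2\<close> is concave, so it reaches zero no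
 later than its tangent does. The second derivative enters through an integral inequality only.\<close>

lemma concavity_lifespan:
 fixes \<Psi> \<phi> :: "real \<Rightarrow> real"
 assumes ab: "a <= b" and \<alpha>: "0 < \<alpha>"
  and pos: "!!t. t \<in> {a..b} ==> 0 < \<Psi> t"
  and deriv: "!!t. t \<in> {a..b} ==> (\<Psi> has_real_derivative \<phi> t) (at t within {a..b})"
  and \<phi>: "continuous_on {a..b} \<phi>" "0 < \<phi> a"
  and growth: "!!t. t \<in> {a..b} ==> \<phi> a + (1 + \<alpha>) * tint (\<lambda>r. (\<phi> r)\<^sup>2 / \<Psi> r) a t <= \<phi> t"
 shows "(b - a) * (\<alpha> * \<phi> a) <= \<Psi> a"
proof -
 have a_mem: "a \<in> {a..b}" using ab by simp
 have \<Psi>_cont: "continuous_on {a..b} \<Psi>"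
  using deriv by (rule DERIV_continuous_on)
 have q_cont: "continuous_on {a..b} (\<lambda>r. (\<phi> r)\<^sup>2 / \<Psi> r)"
  by (intro continuous_intros \<phi> \<Psi>_cont) (use pos in fastforce)
 define J where "J t = \<phi> a + (1 + \<alpha>) * tint (\<lambda>r. (\<phi> r)\<^sup>2 / \<Psi> r) a t" for t
 have J': "(J has_real_derivative (1 + \<alpha>) * ((\<phi> t)\<^sup>2 / \<Psi> t)) (at t within {a..b})" if "t \<in> {a..b}" for t
  unfolding J_def[abs_def] using tint_has_derivative[OF q_cont that] by (auto intro!: derivative_eq_intros)
 have J\<phi>: "J t <= \<phi> t" if "t \<in> {a..b}" for t using growth[OF that] by (simp add: J_def)
 have Ja: "J a = \<phi> a"
 proof -
  have "J a = \<phi> a + (1 + \<alpha>) * (tint (\<lambda>r. (\<phi> r)\<^sup>2 / \<Psi> r) a a)" by (simp add: J_def)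
  then show ?thesis by (simp only: tint_same mult_zero_right add_0_right)
 qed
 have J_ge: "\<phi> a <= J t" if "t \<in> {a..b}" for t
 proof -
  have "J a <= J t"
  proof (rule nondecreasing_within[OF J'])
   show "0 <= (1 + \<alpha>) * ((\<phi> r)\<^sup>2 / \<Psi> r)" if "r \<in> {a..b}" for r using pos[OF that] \<alpha> by simp
  qed (use that in auto)
  then show ?thesis by (simp add: Ja)
 qed
 define Q where "Q t = \<Psi> t powr (- (1 + \<alpha>)) * J t" for t
 define Q' where "Q' t = \<Psi> t powr (- (1 + \<alpha>)) * ((1 + \<alpha>) * \<phi> t * (\<phi> t - J t) / \<Psi> t)" for t
 have Q_deriv: "(Q has_real_derivative Q' t) (at t within {a..b})" if t: "t \<in> {a..b}" for t
 proof -
  have e: "\<Psi> t powr (- (1 + \<alpha>) - 1) = \<Psi> t powr (- (1 + \<alpha>)) / \<Psi> t"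
   using pos[OF t] by (simp only: powr_diff powr_one)
  have "(Q has_real_derivative (- (1 + \<alpha>)) * \<Psi> t powr (- (1 + \<alpha>) - 1) * \<phi> t * J t
    + (1 + \<alpha>) * ((\<phi> t)\<^sup>2 / \<Psi> t) * \<Psi> t powr (- (1 + \<alpha>))) (at t within {a..b})"
   unfolding Q_def[abs_def]
   by (rule DERIV_mult[OF powr_has_derivative_within[OF deriv[OF t] pos[OF t]] J'[OF t]])
  moreover have "(- (1 + \<alpha>)) * \<Psi> t powr (- (1 + \<alpha>) - 1) * \<phi> t * J t
    + (1 + \<alpha>) * ((\<phi> t)\<^sup>2 / \<Psi> t) * \<Psi> t powr (- (1 + \<alpha>)) = Q' t"
   unfolding e Q'_def by (simp add: algebra_simps power2_eq_square add_divide_distrib diff_divide_distrib)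
  ultimately show ?thesis by simp
 qed
 have Q_ge: "Q a <= Q t" if t: "t \<in> {a..b}" for t
 proof (rule nondecreasing_within[OF Q_deriv])
  show "0 <= Q' r" if r: "r \<in> {a..b}" for r
   using pos[OF r] J\<phi>[OF r] J_ge[OF r] \<phi>(2) \<alpha> unfolding Q'_def by (intro mult_nonneg_nonneg divide_nonneg_pos) auto
 qed (use t in auto)
 define c where "c = \<alpha> * (\<Psi> a powr (- (1 + \<alpha>)) * \<phi> a)"
 define K where "K t = - (\<Psi> t powr (- \<alpha>)) - c * (t - a)" for t
 define K' where "K' t = \<alpha> * \<Psi> t powr (- (1 + \<alpha>)) * \<phi> t - c" for t
 have K_deriv: "(K has_real_derivative K' t) (at t within {a..b})" if t: "t \<in> {a..b}" for t
 proof -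
  have e: "- \<alpha> - 1 = - (1 + \<alpha>)" by simp
  have "((\<lambda>t. \<Psi> t powr (- \<alpha>)) has_real_derivative (- \<alpha>) * \<Psi> t powr (- (1 + \<alpha>)) * \<phi> t) (at t within {a..b})"
   using powr_has_derivative_within[OF deriv[OF t] pos[OF t], of "- \<alpha>"] unfolding e .
  from DERIV_diff[OF DERIV_minus[OF this] DERIV_cmult[OF DERIV_diff[OF DERIV_ident DERIV_const[of a]], of c]]
  show ?thesis unfolding K_def[abs_def] K'_def by (rule DERIV_cong) simp
 qed
 have "K a <= K b"
 proof (rule nondecreasing_within[OF K_deriv])
  show "0 <= K' r" if r: "r \<in> {a..b}" for r
  proof -
   have "\<Psi> a powr (- (1 + \<alpha>)) * \<phi> a <= \<Psi> r powr (- (1 + \<alpha>)) * J r" using Q_ge[OF r] by (simp add: Q_def Ja)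
   also have "... <= \<Psi> r powr (- (1 + \<alpha>)) * \<phi> r" using J\<phi>[OF r] by (intro mult_left_mono) auto
   finally have "\<alpha> * (\<Psi> a powr (- (1 + \<alpha>)) * \<phi> a) <= \<alpha> * (\<Psi> r powr (- (1 + \<alpha>)) * \<phi> r)" using \<alpha> by (intro mult_left_mono) auto
   then show ?thesis by (simp add: K'_def c_def mult.assoc)
  qed
 qed (use ab in auto)
 then have "c * (b - a) <= \<Psi> a powr (- \<alpha>) - \<Psi> b powr (- \<alpha>)" by (simp add: K_def)
 also have "... <= \<Psi> a powr (- \<alpha>)" by simp
 also have "\<Psi> a powr (- \<alpha>) = \<Psi> a powr (- (1 + \<alpha>) + 1)" by simp
 also have "... = \<Psi> a powr (- (1 + \<alpha>)) * \<Psi> a" using pos[OF a_mem] by (simp only: powr_add powr_one)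
 finally have "\<Psi> a powr (- (1 + \<alpha>)) * ((b - a) * (\<alpha> * \<phi> a)) <= \<Psi> a powr (- (1 + \<alpha>)) * \<Psi> a"
  by (simp add: c_def mult.assoc mult.left_commute mult.commute)
 then show ?thesis using pos[OF a_mem] by (simp add: mult_le_cancel_left)
qed

subsection \<open>Quadratic forms\<close>

lemma quadratic_nonneg:
 fixes a b c s :: real
 assumes "b\<^sup>2 <= a * c" "0 <= a" "0 <= c"
 shows "0 <= a + 2 * s * b + s\<^sup>2 * c"
proof -
 have "\<bar>b\<bar> <= sqrt (a * c)" using real_sqrt_le_mono[OF assms(1)] by simp
 then have "\<bar>s\<bar> * \<bar>b\<bar> <= \<bar>s\<bar> * (sqrt a * sqrt c)" by (intro mult_left_mono) (auto simp: real_sqrt_mult)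
 moreover have "- (\<bar>s\<bar> * \<bar>b\<bar>) <= s * b" by (metis abs_ge_minus_self abs_mult minus_le_iff)
 moreover have "0 <= (sqrt a - \<bar>s\<bar> * sqrt c)\<^sup>2" by simp
 then have "0 <= a - 2 * (\<bar>s\<bar> * (sqrt a * sqrt c)) + s\<^sup>2 * c"
  using assms(2,3) by (simp add: power2_diff power_mult_distrib algebra_simps)
 ultimately show ?thesis by (simp add: mult.assoc)
qed

lemma discriminant_power2:
 fixes a b c :: real
 assumes "!!s. 0 <= a + 2 * s * b + s\<^sup>2 * c" "0 <= a" "0 <= c"
 shows "b\<^sup>2 <= a * c"
proof -
 have "\<bar>b\<bar> <= sqrt (a * c)" using nonneg_quadratic_discriminant[OF assms] by (simp add: real_sqrt_mult)
 then have "\<bar>b\<bar>\<^sup>2 <= (sqrt (a * c))\<^sup>2" by (intro power_mono) auto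
 then show ?thesis using assms(2,3) by simp
qed

lemma sqrt_add_power2_le: "(sqrt a + sqrt b)\<^sup>2 <= 2 * a + 2 * b" if "0 <= a" "0 <= b" for a b :: real
proof -
 have "0 <= (sqrt a - sqrt b)\<^sup>2" by simp
 then show ?thesis using that by (simp add: power2_sum power2_diff)
qed

lemma positive_quadratic_root:
 fixes a b c :: real
 assumes "0 < a" "0 < c"
 shows "\<exists>\<tau>>0. a * \<tau>\<^sup>2 + b * \<tau> - c = 0 \<and> (\<forall>t\<ge>0. a * t\<^sup>2 + b * t - c <= 0 --> t <= \<tau>) \<and>
  (\<forall>t>0. a * t\<^sup>2 + b * t - c = 0 --> t = \<tau>)"
proof -
 define S where "S = sqrt (b\<^sup>2 + 4 * a * c)"
 define \<tau> where "\<tau> = (S - b) / (2 * a)"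
 have ac: "0 < 4 * a * c" using assms by simp
 have S2: "S\<^sup>2 = b\<^sup>2 + 4 * a * c" unfolding S_def using ac by (intro real_sqrt_pow2) (simp add: add_nonneg_nonneg less_imp_le)
 have "sqrt (b\<^sup>2) < S" unfolding S_def using ac by (intro real_sqrt_less_mono) simp
 then have \<tau>: "0 < \<tau>" using assms(1) by (simp add: \<tau>_def)
 have "2 * a * \<tau> = S - b" using assms(1) by (simp add: \<tau>_def)
 then have "(2 * a * \<tau> + b)\<^sup>2 = b\<^sup>2 + 4 * a * c" using S2 by simp
 then have "4 * a * (a * \<tau>\<^sup>2 + b * \<tau> - c) = 0" by (simp add: power2_eq_square algebra_simps)
 then have root: "a * \<tau>\<^sup>2 + b * \<tau> - c = 0" using assms(1) by simp
 have factor: "\<tau> * (a * t\<^sup>2 + b * t - c) = (t - \<tau>) * (a * t * \<tau> + c)" for t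
 proof -
  have "b * \<tau> = c - a * \<tau>\<^sup>2" using root by simp
  then have "t * (b * \<tau>) = t * (c - a * \<tau>\<^sup>2)" by simp
  then have "\<tau> * (a * t\<^sup>2 + b * t - c) = \<tau> * a * t\<^sup>2 + t * (c - a * \<tau>\<^sup>2) - \<tau> * c"
   by (simp add: algebra_simps)
  also have "... = (t - \<tau>) * (a * t * \<tau> + c)" by (simp add: power2_eq_square algebra_simps)
  finally show ?thesis .
 qed
 have pos: "0 < a * t * \<tau> + c" if "0 <= t" for t using assms \<tau> that by (simp add: add_nonneg_pos)
 have "t <= \<tau>" if "0 <= t" "a * t\<^sup>2 + b * t - c <= 0" for t
 proof (rule ccontr)
  assume "\<not> t <= \<tau>"
  then have "0 < (t - \<tau>) * (a * t * \<tau> + c)" using pos[OF that(1)] by simp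
  moreover have "\<tau> * (a * t\<^sup>2 + b * t - c) <= 0" using \<tau> that(2) by (simp add: mult_le_0_iff)
  ultimately show False using factor[of t] by linarith
 qed
 moreover have "t = \<tau>" if "0 < t" "a * t\<^sup>2 + b * t - c = 0" for t
 proof -
  have "(t - \<tau>) * (a * t * \<tau> + c) = 0" using factor[of t] that(2) by simp
  then show ?thesis using pos[of t] that(1) by simp
 qed
 ultimately show ?thesis using \<tau> root by blast
qed

subsection \<open>The lifespan bound\<close>

text \<open>The bound of \<open>lifespan_from\<close> below at the optimal \<open>\<sigma>\<close>, where \<open>d = (m - 2) B - 2 G\<close> and \<open>A = N\<close> at the
 starting time.\<close>

definition lifespan :: "real \<Rightarrow> real \<Rightarrow> real \<Rightarrow> real \<Rightarrow> real" where
 "lifespan m \<beta> d A = 4 * (sqrt (d\<^sup>2 + (m - 2)\<^sup>2 * \<beta> * A) - d) / ((m - 2)\<^sup>2 * \<beta>)"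

lemma lifespan_mono:
 assumes \<beta>: "0 < \<beta>" and m: "2 < m" and d: "d <= d'" and A: "0 <= A'" "A' <= A"
 shows "lifespan m \<beta> d' A' <= lifespan m \<beta> d A"
proof -
 define c c' where "c = (m - 2)\<^sup>2 * \<beta> * A" and "c' = (m - 2)\<^sup>2 * \<beta> * A'"
 have cc: "0 <= c'" "c' <= c" using A \<beta> m by (auto simp: c_def c'_def intro!: mult_left_mono)
 define S where "S = sqrt (d\<^sup>2 + c)"
 have S: "\<bar>d\<bar> <= S" "S\<^sup>2 = d\<^sup>2 + c" using cc by (auto simp: S_def intro!: real_le_rsqrt)
 have "sqrt (d'\<^sup>2 + c') <= S + (d' - d)"
 proof (rule real_le_lsqrt)
  show "0 <= S + (d' - d)" using S d by linarith
  have "0 <= 2 * (d' - d) * (S - d)" using d S(1) by (intro mult_nonneg_nonneg) auto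
  then show "d'\<^sup>2 + c' <= (S + (d' - d))\<^sup>2" using S(2) cc by (simp add: power2_eq_square algebra_simps)
 qed
 then have "4 * (sqrt (d'\<^sup>2 + c') - d') <= 4 * (sqrt (d\<^sup>2 + c) - d)" by (simp add: S_def)
 then show ?thesis unfolding lifespan_def c_def c'_def using \<beta> m by (intro divide_right_mono) auto
qed

lemma lifespan_nonneg:
 assumes "0 < \<beta>" "0 <= A"
 shows "0 <= lifespan m \<beta> d A"
proof -
 have "d\<^sup>2 <= d\<^sup>2 + (m - 2)\<^sup>2 * \<beta> * A" using assms by simp
 then have "\<bar>d\<bar> <= sqrt (d\<^sup>2 + (m - 2)\<^sup>2 * \<beta> * A)" by (intro real_le_rsqrt) simp
 then show ?thesis unfolding lifespan_def using assms by (intro divide_nonneg_nonneg) auto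
qed

subsection \<open>Energy growth\<close>

text \<open>The quantities \<open>N\<close>, \<open>G\<close>, \<open>V\<close>, \<open>B\<close>, \<open>E\<close>, \<open>D\<close>, \<open>P\<close> stand for the squared norms of \<open>u\<close>, \<open>\<nabla>u\<close>, \<open>u\<^sub>t\<close>, the
 inner product of \<open>u\<close> and \<open>u\<^sub>t\<close>, the shifted energy, the dissipation \<open>\<parallel>\<nabla>u\<^sub>t\<parallel>\<^sup>2\<close> and the inner product
 of \<open>\<nabla>u\<close> and \<open>\<nabla>u\<^sub>t\<close>; \<open>l\<close> is the Poincare constant.\<close>

locale energy_growth =
 fixes T m \<kappa> l :: real and N G V B E D P :: "real \<Rightarrow> real"
 assumes T_pos: "0 < T" and m_gt: "2 < m" and \<kappa>_pos: "0 < \<kappa>" and l_pos: "0 < l"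
  and nonneg: "!!t. 0 <= N t" "!!t. 0 <= G t" "!!t. 0 <= V t" "!!t. 0 <= D t"
  and cont: "continuous_on {0..T} G" "continuous_on {0..T} V" "continuous_on {0..T} B" "continuous_on {0..T} E"
  and D_int: "integrable (lebesgue_on {0..T}) D" and P_int: "integrable (lebesgue_on {0..T}) P"
  and N_increment: "!!s t. 0 <= s ==> s <= t ==> t <= T ==> N t - N s = tint (\<lambda>r. 2 * B r) s t"
  and G_increment: "!!s t. 0 <= s ==> s <= t ==> t <= T ==> G t - G s = 2 * tint P s t"
  and B_increment: "!!s t. 0 <= s ==> s <= t ==> t <= T ==>
   tint (\<lambda>r. (m + 2) / 2 * V r + \<kappa> * G r - m * E r - P r) s t <= B t - B s"
  and E_increment: "!!s t. 0 <= s ==> s <= t ==> t <= T ==> E t <= E s - tint D s t"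
  and B_power2: "!!t. t \<in> {0..T} ==> (B t)\<^sup>2 <= N t * V t"
  and P_power2: "AE t in lebesgue_on {0..T}. (P t)\<^sup>2 <= G t * D t"
  and N_le_G: "!!t. t \<in> {0..T} ==> l * N t <= G t"
  and G_growth: "!!t. t \<in> {0..T} ==> sqrt (G t) <= sqrt (G 0) + sqrt (t * tint D 0 t)"
  and N_growth: "!!t. t \<in> {0..T} ==> sqrt (N t) <= sqrt (N 0) + sqrt (t * tint D 0 t / l)"
begin

lemma P_integral_power2:
 assumes st: "0 <= s" "t <= T"
 shows "(tint P s t)\<^sup>2 <= tint G s t * tint D s t"
proof (rule discriminant_power2)
 have i: "integrable (lebesgue_on {s..t}) G" "integrable (lebesgue_on {s..t}) P" "integrable (lebesgue_on {s..t}) D"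
  by (fact tint_integrable[OF continuous_tint_integrable[OF cont(1)] st] tint_integrable[OF P_int st] tint_integrable[OF D_int st])+
 fix c
 have "AE r in lebesgue_on {s..t}. (P r)\<^sup>2 <= G r * D r" by (rule AE_subinterval[OF P_power2]) (use st in auto)
 then have "AE r in lebesgue_on {s..t}. 0 <= G r + 2 * c * P r + c\<^sup>2 * D r"
  by eventually_elim (intro quadratic_nonneg nonneg)
 then have "0 <= tint (\<lambda>r. G r + 2 * c * P r + c\<^sup>2 * D r) s t" by (rule integral_nonneg_AE)
 also have "... = tint G s t + 2 * c * tint P s t + c\<^sup>2 * tint D s t" using i by simp
 finally show "0 <= tint G s t + 2 * c * tint P s t + c\<^sup>2 * tint D s t" .
qed (intro integral_nonneg_AE AE_I2 nonneg)+

lemma B_increment_integrable: "integrable (lebesgue_on {0..T}) (\<lambda>r. (m + 2) / 2 * V r + \<kappa> * G r - m * E r - P r)"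
proof (rule Bochner_Integration.integrable_diff[OF _ P_int])
 have "continuous_on {0..T} (\<lambda>r. (m + 2) / 2 * V r + \<kappa> * G r - m * E r)" by (intro continuous_intros cont) auto
 then show "integrable (lebesgue_on {0..T}) (\<lambda>r. (m + 2) / 2 * V r + \<kappa> * G r - m * E r)"
  by (rule continuous_tint_integrable)
qed

text \<open>Once the energy is below \<open>-\<beta>\<close>, the functional \<open>\<Psi>\<close> below is convex enough for
 \<open>\<alpha> = (m - 2) / 4\<close>: the energy inequality yields \<open>\<Psi>'' \<ge> (m + 2) (V + \<integral> D + \<beta>)\<close>, and
 Cauchy-Schwarz bounds \<open>(\<Psi>' / 2)\<^sup>2\<close> by the product of that bracket with \<open>\<Psi>\<close>.\<close>

lemma lifespan_from:
 assumes a: "0 <= a" "a <= T" and \<beta>: "0 < \<beta>" and \<sigma>: "0 < \<sigma>" and Ea: "E a <= - \<beta>"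
  and pos: "0 < B a + \<beta> * \<sigma>"
 shows "(T - a) * ((m - 2) * (B a + \<beta> * \<sigma>) - 2 * G a) <= 2 * (N a + \<beta> * \<sigma>\<^sup>2)"
proof -
 define \<Psi> where "\<Psi> t = N t + tint G a t + (T - t) * G a + \<beta> * (t - a + \<sigma>)\<^sup>2" for t
 define \<phi> where "\<phi> t = 2 * B t + G t - G a + 2 * \<beta> * (t - a + \<sigma>)" for t
 have sub: "{a..T} \<subseteq> {0..T}" using a by auto
 note c = cont[THEN continuous_on_subset, OF sub]
 have i: "integrable (lebesgue_on {a..t}) f" if "integrable (lebesgue_on {0..T}) f" "t <= T" for f :: "real \<Rightarrow> real" and t
  using tint_integrable[OF that(1) a(1) that(2)] .
 have N': "(N has_real_derivative 2 * B t) (at t within {a..T})" if t: "t \<in> {a..T}" for t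
 proof (rule has_field_derivative_transform_within[where d = 1])
  have "((\<lambda>t. tint (\<lambda>r. 2 * B r) a t) has_real_derivative 2 * B t) (at t within {a..T})"
   by (rule tint_has_derivative[OF _ t]) (intro continuous_intros c)
  from DERIV_add[OF DERIV_const[of "N a"] this]
  show "((\<lambda>t. N a + tint (\<lambda>r. 2 * B r) a t) has_real_derivative 2 * B t) (at t within {a..T})"
   by (simp only: add_0)
  show "N a + tint (\<lambda>r. 2 * B r) a x = N x" if "x \<in> {a..T}" for x using N_increment[of a x] a that by simp
 qed (use t in simp_all)
 have \<Psi>': "(\<Psi> has_real_derivative \<phi> t) (at t within {a..T})" if t: "t \<in> {a..T}" for t
  unfolding \<Psi>_def[abs_def] \<phi>_def
  by (auto intro!: derivative_eq_intros N'[OF t] tint_has_derivative[OF c(1) t] simp: algebra_simps)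
 have intG: "0 <= tint G a t" for t by (intro integral_nonneg_AE AE_I2 nonneg)
 have intD: "0 <= tint D a t" for t by (intro integral_nonneg_AE AE_I2 nonneg)
 have \<Psi>_pos: "0 < \<Psi> t" if "t \<in> {a..T}" for t
 proof -
  have "0 < \<beta> * (t - a + \<sigma>)\<^sup>2" using \<beta> \<sigma> that by (intro mult_pos_pos zero_less_power) auto
  moreover have "0 <= (T - t) * G a" using that nonneg(2) by (intro mult_nonneg_nonneg) auto
  ultimately show ?thesis unfolding \<Psi>_def using nonneg(1)[of t] intG[of t] by linarith
 qed
 have \<phi>_cont: "continuous_on {a..T} \<phi>" unfolding \<phi>_def[abs_def] by (intro continuous_intros c)
 have \<phi>_eq: "\<phi> t = 2 * (B t + tint P a t + \<beta> * (t - a + \<sigma>))" if "t \<in> {a..T}" for t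
  using G_increment[of a t] a that by (simp add: \<phi>_def algebra_simps)
 have q: "(\<phi> r)\<^sup>2 / \<Psi> r <= 4 * (V r + tint D a r + \<beta>)" if r: "r \<in> {a..T}" for r
 proof -
  define X where "X = N r + tint G a r + \<beta> * (r - a + \<sigma>)\<^sup>2"
  define Y where "Y = V r + tint D a r + \<beta>"
  define b where "b = B r + tint P a r + \<beta> * (r - a + \<sigma>)"
  have r0: "r \<in> {0..T}" using r a by auto
  have XY: "0 <= X" "0 <= Y" unfolding X_def Y_def using nonneg intG intD \<beta> by (auto intro!: add_nonneg_nonneg)
  have "b\<^sup>2 <= X * Y"
  proof (rule discriminant_power2[OF _ XY])
   fix s
   have "0 <= N r + 2 * s * B r + s\<^sup>2 * V r" by (rule quadratic_nonneg[OF B_power2[OF r0] nonneg(1,3)])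
   moreover have "0 <= tint G a r + 2 * s * tint P a r + s\<^sup>2 * tint D a r"
    by (rule quadratic_nonneg[OF P_integral_power2 intG intD]) (use a r in auto)
   moreover have "0 <= \<beta> * ((r - a + \<sigma>) + s)\<^sup>2" using \<beta> by simp
   moreover have "\<beta> * ((r - a + \<sigma>) + s)\<^sup>2 = \<beta> * (r - a + \<sigma>)\<^sup>2 + 2 * s * (\<beta> * (r - a + \<sigma>)) + s\<^sup>2 * \<beta>"
    unfolding power2_sum by (simp only: algebra_simps)
   ultimately show "0 <= X + 2 * s * b + s\<^sup>2 * Y" unfolding X_def Y_def b_def distrib_left by linarith
  qed
  moreover have "X <= \<Psi> r" unfolding X_def \<Psi>_def using r nonneg(2)[of a] by simp
  then have "X * Y <= \<Psi> r * Y" using XY(2) by (rule mult_right_mono)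
  moreover have "\<phi> r = 2 * b" using \<phi>_eq[OF r] by (simp add: b_def)
  ultimately have "(\<phi> r)\<^sup>2 <= 4 * Y * \<Psi> r" by (simp add: power_mult_distrib mult.commute)
  then show ?thesis using \<Psi>_pos[OF r] by (simp add: pos_divide_le_eq Y_def)
 qed
 have growth: "\<phi> a + (1 + (m - 2) / 4) * tint (\<lambda>r. (\<phi> r)\<^sup>2 / \<Psi> r) a t <= \<phi> t" if t: "t \<in> {a..T}" for t
 proof -
  let ?f = "\<lambda>r. (m + 2) / 2 * V r + \<kappa> * G r - m * E r - P r"
  have ifP: "integrable (lebesgue_on {a..t}) ?f" "integrable (lebesgue_on {a..t}) P"
   using t by (intro i[OF B_increment_integrable] i[OF P_int]; simp)+
  have i\<beta>: "integrable (lebesgue_on {a..t}) (\<lambda>r. 2 * \<beta>)" by (rule continuous_imp_integrable_real[OF continuous_on_const])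
  have "continuous_on {a..T} \<Psi>" using \<Psi>' by (rule DERIV_continuous_on)
  then have "continuous_on {a..T} (\<lambda>r. (\<phi> r)\<^sup>2 / \<Psi> r)"
   by (rule continuous_on_divide[OF continuous_on_power[OF \<phi>_cont]]) (use \<Psi>_pos in fastforce)
  then have "continuous_on {a..t} (\<lambda>r. (\<phi> r)\<^sup>2 / \<Psi> r)" by (rule continuous_on_subset) (use t in auto)
  then have iq: "integrable (lebesgue_on {a..t}) (\<lambda>r. (\<phi> r)\<^sup>2 / \<Psi> r)"
   by (rule continuous_imp_integrable_real)
  have "(1 + (m - 2) / 4) * tint (\<lambda>r. (\<phi> r)\<^sup>2 / \<Psi> r) a t = tint (\<lambda>r. (m + 2) / 4 * ((\<phi> r)\<^sup>2 / \<Psi> r)) a t"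
   by (subst Bochner_Integration.integral_mult_right_zero) (simp add: field_simps)
  also have "... <= tint (\<lambda>r. 2 * ?f r + 2 * P r + 2 * \<beta>) a t"
  proof (rule tint_mono_AE)
   show "integrable (lebesgue_on {a..t}) (\<lambda>r. (m + 2) / 4 * ((\<phi> r)\<^sup>2 / \<Psi> r))"
    by (rule Bochner_Integration.integrable_mult_right[OF iq])
   show "integrable (lebesgue_on {a..t}) (\<lambda>r. 2 * ?f r + 2 * P r + 2 * \<beta>)"
    by (rule Bochner_Integration.integrable_add[OF Bochner_Integration.integrable_add[OF
       Bochner_Integration.integrable_mult_right[OF ifP(1)] Bochner_Integration.integrable_mult_right[OF ifP(2)]] i\<beta>])
   show "AE r in lebesgue_on {a..t}. (m + 2) / 4 * ((\<phi> r)\<^sup>2 / \<Psi> r) <= 2 * ?f r + 2 * P r + 2 * \<beta>"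
   proof (rule AE_I2)
    fix r assume "r \<in> space (lebesgue_on {a..t})"
    then have r: "r \<in> {a..T}" "a <= r" using t by auto
    have "(m + 2) / 4 * ((\<phi> r)\<^sup>2 / \<Psi> r) <= (m + 2) / 4 * (4 * (V r + tint D a r + \<beta>))"
     using q[OF r(1)] m_gt by (intro mult_left_mono) auto
    also have "... = (m + 2) * (V r + tint D a r + \<beta>)" by simp
    finally have 1: "(m + 2) / 4 * ((\<phi> r)\<^sup>2 / \<Psi> r) <= (m + 2) * (V r + tint D a r + \<beta>)" .
    have "E r <= - \<beta> - tint D a r" using E_increment[of a r] a r Ea by simp
    then have "m * E r <= m * (- \<beta> - tint D a r)" using m_gt by (intro mult_left_mono) auto
    then have 2: "m * \<beta> + m * tint D a r <= - (m * E r)" by (simp add: algebra_simps)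
    have 3: "2 * tint D a r <= m * tint D a r" using m_gt intD by (intro mult_right_mono) auto
    have 4: "2 * \<beta> <= m * \<beta>" using m_gt \<beta> by (intro mult_right_mono) auto
    have 5: "0 <= \<kappa> * G r" using \<kappa>_pos nonneg(2) by simp
    have "(m + 2) * (V r + tint D a r + \<beta>) = (m + 2) * V r + m * tint D a r + 2 * tint D a r + m * \<beta> + 2 * \<beta>"
     by (simp add: algebra_simps)
    moreover have "2 * ?f r + 2 * P r + 2 * \<beta> = (m + 2) * V r + 2 * (\<kappa> * G r) - 2 * (m * E r) + 2 * \<beta>"
     by (simp add: algebra_simps)
    ultimately show "(m + 2) / 4 * ((\<phi> r)\<^sup>2 / \<Psi> r) <= 2 * ?f r + 2 * P r + 2 * \<beta>"
     using 1 2 3 4 5 \<beta> by linarith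
   qed
  qed
  also have "... = 2 * tint ?f a t + 2 * tint P a t + 2 * \<beta> * (t - a)"
  proof -
   have "tint (\<lambda>r. 2 * ?f r + 2 * P r + 2 * \<beta>) a t = tint (\<lambda>r. 2 * ?f r + 2 * P r) a t + tint (\<lambda>r. 2 * \<beta>) a t"
    by (rule Bochner_Integration.integral_add[OF Bochner_Integration.integrable_add[OF
       Bochner_Integration.integrable_mult_right[OF ifP(1)] Bochner_Integration.integrable_mult_right[OF ifP(2)]] i\<beta>])
   also have "tint (\<lambda>r. 2 * ?f r + 2 * P r) a t = tint (\<lambda>r. 2 * ?f r) a t + tint (\<lambda>r. 2 * P r) a t"
    by (rule Bochner_Integration.integral_add[OF
       Bochner_Integration.integrable_mult_right[OF ifP(1)] Bochner_Integration.integrable_mult_right[OF ifP(2)]])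
   also have "tint (\<lambda>r. 2 * ?f r) a t = 2 * tint ?f a t" by (rule Bochner_Integration.integral_mult_right_zero)
   also have "tint (\<lambda>r. 2 * P r) a t = 2 * tint P a t" by (rule Bochner_Integration.integral_mult_right_zero)
   also have "tint (\<lambda>r. 2 * \<beta>) a t = 2 * \<beta> * (t - a)" using t by (intro tint_const) simp
   finally show ?thesis .
  qed
  also have "... <= 2 * (B t - B a) + (G t - G a) + 2 * \<beta> * (t - a)"
   using B_increment[of a t] G_increment[of a t] a t by simp
  also have "... = \<phi> t - \<phi> a" by (simp add: \<phi>_def algebra_simps)
  finally show ?thesis by simp
 qed
 have \<phi>a: "\<phi> a = 2 * (B a + \<beta> * \<sigma>)" by (simp add: \<phi>_def)
 have bound: "(T - a) * ((m - 2) / 4 * \<phi> a) <= \<Psi> a"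
  by (rule concavity_lifespan[OF a(2) _ \<Psi>_pos \<Psi>' \<phi>_cont _ growth]) (use m_gt pos \<phi>a in auto)
 have \<Psi>a: "\<Psi> a = N a + (T - a) * G a + \<beta> * \<sigma>\<^sup>2" unfolding \<Psi>_def tint_same by simp
 define Y Z where "Y = (T - a) * ((m - 2) * (B a + \<beta> * \<sigma>))" and "Z = (T - a) * G a"
 have "(T - a) * ((m - 2) / 4 * \<phi> a) = Y / 2" unfolding \<phi>a Y_def by simp
 then have "Y / 2 <= N a + Z + \<beta> * \<sigma>\<^sup>2" using bound unfolding \<Psi>a Z_def by (simp only:)
 moreover have "(T - a) * ((m - 2) * (B a + \<beta> * \<sigma>) - 2 * G a) = Y - 2 * Z"
  unfolding Y_def Z_def by (simp only: right_diff_distrib mult.left_commute)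
 ultimately show ?thesis by simp
qed

text \<open>At the \<open>\<sigma>\<close> that minimizes the bound, the denominator equals the square root.\<close>

lemma lifespan_optimal:
 assumes a: "0 <= a" "a <= T" and \<beta>: "0 < \<beta>" and Ea: "E a <= - \<beta>" and Na: "0 < N a"
 shows "T - a <= lifespan m \<beta> ((m - 2) * B a - 2 * G a) (N a)"
proof -
 define d where "d = (m - 2) * B a - 2 * G a"
 define k where "k = (m - 2)\<^sup>2 * \<beta>"
 define S where "S = sqrt (d\<^sup>2 + k * N a)"
 have k: "0 < k" using m_gt \<beta> by (simp add: k_def)
 have "sqrt (d\<^sup>2) < S" unfolding S_def using k Na by (intro real_sqrt_less_mono) simp
 then have S: "\<bar>d\<bar> < S" "S\<^sup>2 = d\<^sup>2 + k * N a" using k Na by (auto simp: S_def)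
 define \<sigma> where "\<sigma> = (S - d) / ((m - 2) * \<beta>)"
 have \<sigma>: "0 < \<sigma>" using S(1) m_gt \<beta> by (simp add: \<sigma>_def)
 have den: "(m - 2) * (B a + \<beta> * \<sigma>) - 2 * G a = S"
  using m_gt \<beta> by (simp add: \<sigma>_def d_def field_simps)
 then have "0 < (m - 2) * (B a + \<beta> * \<sigma>)" using S(1) nonneg(2)[of a] by linarith
 then have "0 < B a + \<beta> * \<sigma>" using m_gt by (simp add: zero_less_mult_iff)
 from lifespan_from[OF a \<beta> \<sigma> Ea this]
 have 1: "(T - a) * S <= 2 * (N a + \<beta> * \<sigma>\<^sup>2)" unfolding den .
 have "k * (N a + \<beta> * \<sigma>\<^sup>2) = k * N a + ((m - 2) * \<beta> * \<sigma>)\<^sup>2" by (simp add: k_def power_mult_distrib power2_eq_square algebra_simps)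
 also have "(m - 2) * \<beta> * \<sigma> = S - d" using m_gt \<beta> by (simp add: \<sigma>_def)
 also have "k * N a + (S - d)\<^sup>2 = 2 * S * (S - d)" using S(2) by (simp add: power2_eq_square algebra_simps)
 finally have 2: "k * (N a + \<beta> * \<sigma>\<^sup>2) = 2 * S * (S - d)" .
 have "k * ((T - a) * S) <= k * (2 * (N a + \<beta> * \<sigma>\<^sup>2))" using 1 k by (intro mult_left_mono) auto
 then have "S * (k * (T - a)) <= S * (4 * (S - d))" using 2 by (simp add: algebra_simps)
 then have "k * (T - a) <= 4 * (S - d)" using S(1) by (simp add: mult_le_cancel_left)
 then have "T - a <= 4 * (S - d) / k" using k by (simp add: pos_le_divide_eq mult.commute)
 then show ?thesis by (simp add: lifespan_def S_def k_def d_def)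
qed

text \<open>While the energy is at least \<open>-\<beta>\<close>, the functional \<open>L\<close> makes \<open>N\<close> grow quadratically, while the
 dissipated energy, and with it the growth of \<open>sqrt N\<close>, is bounded. So the energy has reached \<open>-\<beta>\<close> by
 time \<open>\<tau>\<close>.\<close>

lemma delayed_lifespan:
 assumes C: "0 < C" "C <= m + 2" "C * (l + 2 * m) <= 4 * m * l * \<kappa>"
  and e: "e = E 0" "0 <= e" and L0: "L0 = B 0 - m / C * e" "0 < L0" and \<beta>: "\<beta> = C * L0 / (2 * m)"
  and \<tau>: "0 < \<tau>" "!!t. 0 <= t ==> C * L0 * t\<^sup>2 + (L0 - 2 * (e + \<beta>) / l) * t - N 0 <= 0 ==> t <= \<tau>"
 shows "T <= \<tau> + lifespan m \<beta> ((m - 2) / 2 * L0 - 2 * (sqrt (G 0) + sqrt (\<tau> * (e + \<beta>)))\<^sup>2)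
  ((sqrt (N 0) + sqrt (\<tau> * (e + \<beta>) / l))\<^sup>2)"
proof -
 have m: "0 < m" using m_gt by simp
 have \<beta>_pos: "0 < \<beta>" using C(1) L0(2) m by (simp add: \<beta>)
 define L where "L t = B t - m / C * E t" for t
 have L_cont: "continuous_on {0..T} L" unfolding L_def[abs_def] by (intro continuous_intros cont)
 have pw: "C * L r <= (m + 2) / 2 * V r + \<kappa> * G r - m * E r - P r + m / C * D r"
  if r: "r \<in> {0..T}" and P: "(P r)\<^sup>2 <= G r * D r" for r
 proof -
  have "2 * P r <= C / (2 * m) * G r + 2 * m / C * D r"
  proof -
   have "0 <= G r + 2 * (- 2 * m / C) * P r + (- 2 * m / C)\<^sup>2 * D r" by (rule quadratic_nonneg[OF P nonneg(2,4)])
   then have "0 <= C / (2 * m) * (G r + 2 * (- 2 * m / C) * P r + (- 2 * m / C)\<^sup>2 * D r)" using C(1) m by simp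
   also have "... = C / (2 * m) * G r - 2 * P r + 2 * m / C * D r"
    using C(1) m by (simp add: field_simps power2_eq_square)
   finally show ?thesis by simp
  qed
  then have 1: "P r <= C / (4 * m) * G r + m / C * D r" by simp
  have "0 <= N r + 2 * (- 1) * B r + (- 1)\<^sup>2 * V r" by (rule quadratic_nonneg[OF B_power2[OF r] nonneg(1,3)])
  then have 2: "2 * B r <= N r + V r" by simp
  have 3: "N r <= G r / l" using N_le_G[OF r] l_pos by (simp add: pos_le_divide_eq mult.commute)
  have "2 * B r <= G r / l + V r" using 2 3 by linarith
  then have "C / 2 * (2 * B r) <= C / 2 * (G r / l + V r)" using C(1) by (intro mult_left_mono) auto
  then have 4: "C * B r <= C / (2 * l) * G r + C / 2 * V r" by (simp add: algebra_simps)
  have 5: "C / 2 * V r <= (m + 2) / 2 * V r" using C(2) nonneg(3) by (intro mult_right_mono) auto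
  have "C / (4 * m) + C / (2 * l) = C * (l + 2 * m) / (4 * m * l)" using m l_pos by (simp add: field_simps)
  also have "... <= \<kappa>" using C(3) m l_pos by (simp add: pos_divide_le_eq mult.commute)
  finally have "(C / (4 * m) + C / (2 * l)) * G r <= \<kappa> * G r" using nonneg(2) by (rule mult_right_mono)
  then have 6: "C / (4 * m) * G r + C / (2 * l) * G r <= \<kappa> * G r" by (simp add: algebra_simps)
  have "C * L r = C * B r - m * E r" using C(1) by (simp add: L_def field_simps)
  with 1 4 5 6 show ?thesis by linarith
 qed
 have L_inc: "C * tint L s t <= L t - L s" if st: "0 <= s" "s <= t" "t <= T" for s t
 proof -
  let ?f = "\<lambda>r. (m + 2) / 2 * V r + \<kappa> * G r - m * E r - P r"
  have i: "integrable (lebesgue_on {s..t}) L" "integrable (lebesgue_on {s..t}) ?f" "integrable (lebesgue_on {s..t}) D"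
   by (fact tint_integrable[OF continuous_tint_integrable[OF L_cont] st(1,3)]
     tint_integrable[OF B_increment_integrable st(1,3)] tint_integrable[OF D_int st(1,3)])+
  have "AE r in lebesgue_on {s..t}. (P r)\<^sup>2 <= G r * D r" by (rule AE_subinterval[OF P_power2]) (use st in auto)
  moreover have "AE r in lebesgue_on {s..t}. r \<in> {0..T}" by (rule AE_I2) (use st in auto)
  ultimately have ae: "AE r in lebesgue_on {s..t}. C * L r <= ?f r + m / C * D r"
   by eventually_elim (rule pw)
  have "C * tint L s t = tint (\<lambda>r. C * L r) s t" by simp
  also have "... <= tint (\<lambda>r. ?f r + m / C * D r) s t"
   by (rule tint_mono_AE[OF Bochner_Integration.integrable_mult_right[OF i(1)]
      Bochner_Integration.integrable_add[OF i(2) Bochner_Integration.integrable_mult_right[OF i(3)]] ae])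
  also have "... = tint ?f s t + tint (\<lambda>r. m / C * D r) s t"
   by (rule Bochner_Integration.integral_add[OF i(2) Bochner_Integration.integrable_mult_right[OF i(3)]])
  also have "... = tint ?f s t + m / C * tint D s t" by simp
  also have "... <= (B t - B s) + m / C * (E s - E t)"
  proof (rule add_mono[OF B_increment[OF st]])
   have "tint D s t <= E s - E t" using E_increment[OF st] by simp
   then show "m / C * tint D s t <= m / C * (E s - E t)" using C(1) m by (intro mult_left_mono) auto
  qed
  also have "... = L t - L s" by (simp add: L_def algebra_simps)
  finally show ?thesis .
 qed
 have L_0: "L 0 = L0" using L0(1) e(1) by (simp add: L_def)
 have tint_L: "c * (t - s) <= tint L s t" if "0 <= s" "s <= t" "t <= T" "!!r. r \<in> {s..t} ==> c <= L r" for c s t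
 proof -
  have "tint (\<lambda>_. c) s t <= tint L s t"
  proof (rule tint_mono_AE)
   show "integrable (lebesgue_on {s..t}) (\<lambda>_. c)" by (rule continuous_imp_integrable_real[OF continuous_on_const])
   show "integrable (lebesgue_on {s..t}) L" by (rule tint_integrable[OF continuous_tint_integrable[OF L_cont] that(1,3)])
   show "AE x in lebesgue_on {s..t}. c <= L x" by (rule AE_I2) (rule that(4), simp)
  qed
  then show ?thesis by (simp only: tint_const[OF that(2)])
 qed
 have L_pos: "0 < L t" if t: "t \<in> {0..T}" for t
 proof (rule ccontr)
  assume "\<not> 0 < L t"
  let ?Z = "{0..T} \<inter> L -` {..0}"
  have "compact ?Z" using continuous_closed_preimage[OF L_cont closed_atLeastAtMost, of "{..0}"]
   by (auto simp: compact_eq_bounded_closed intro: bounded_subset[OF bounded_closed_interval[of 0 T]])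
  moreover have "?Z \<noteq> {}" using t \<open>\<not> 0 < L t\<close> by auto
  ultimately obtain z where z: "z \<in> ?Z" "!!y. y \<in> ?Z ==> z <= y" using compact_attains_inf[of ?Z] by blast
  have "0 <= L r" if "r \<in> {0..z}" for r
  proof (cases "r = z")
   case True
   show ?thesis
   proof (rule ccontr)
    assume "\<not> 0 <= L r"
    then have "\<exists>x\<ge>0. x <= z \<and> L x = 0"
     using IVT2'[of L z 0 0] L_0 L0(2) z(1) True continuous_on_subset[OF L_cont, of "{0..z}"] by auto
    then obtain x where "0 <= x" "x <= z" "L x = 0" by blast
    then have "z = x" using z(2)[of x] z(1) by auto
    with \<open>L x = 0\<close> \<open>\<not> 0 <= L r\<close> True show False by simp
   qed
  next
   case False
   then have "r \<notin> ?Z" using z(2)[of r] that by auto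
   then show ?thesis using that z(1) by auto
  qed
  then have "0 * (z - 0) <= tint L 0 z" using z(1) by (intro tint_L) auto
  then have "0 <= C * tint L 0 z" using C(1) by simp
  then have "L0 <= L z" using L_inc[of 0 z] z(1) L_0 by auto
  then show False using z(1) L0(2) by auto
 qed
 have L_ge0: "L0 <= L t" if t: "t \<in> {0..T}" for t
 proof -
  have "0 * (t - 0) <= tint L 0 t" using t L_pos by (intro tint_L) (auto simp: less_imp_le)
  then have "0 <= C * tint L 0 t" using C(1) by simp
  then show ?thesis using L_inc[of 0 t] t L_0 by auto
 qed
 have L_ge: "L0 + C * L0 * t <= L t" if t: "t \<in> {0..T}" for t
 proof -
  have "L0 * (t - 0) <= tint L 0 t" using t L_ge0 by (intro tint_L) auto
  then have "C * (L0 * t) <= C * tint L 0 t" using C(1) by simp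
  then show ?thesis using L_inc[of 0 t] t L_0 by (auto simp: mult.assoc)
 qed
 have until: "t <= \<tau>" "L0 / 2 <= B t" "tint D 0 t <= e + \<beta>"
  if t: "t \<in> {0..T}" and E: "!!r. r \<in> {0..t} ==> - \<beta> <= E r" for t
 proof -
  have B_ge: "L0 / 2 + C * L0 * r <= B r" if r: "r \<in> {0..t}" for r
  proof -
   have "m / C * (- \<beta>) <= m / C * E r" using E[OF r] C(1) m by (intro mult_left_mono) auto
   moreover have "m / C * (- \<beta>) = - L0 / 2" using C(1) m by (simp add: \<beta> field_simps)
   ultimately have "- L0 / 2 <= m / C * E r" by (simp only:)
   moreover have "L0 + C * L0 * r <= L r" by (rule L_ge) (use r t in auto)
   ultimately have "(L0 + C * L0 * r) + - L0 / 2 <= L r + m / C * E r" by (intro add_mono)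
   also have "L r + m / C * E r = B r" by (simp add: L_def)
   finally show ?thesis by simp
  qed
  have "0 <= C * L0 * t" using C(1) L0(2) t by auto
  then show "L0 / 2 <= B t" using B_ge[of t] t by auto
  show D: "tint D 0 t <= e + \<beta>" using E_increment[of 0 t] E[of t] t e(1) by auto
  have "L0 * t + C * L0 * t\<^sup>2 = tint (\<lambda>r. 2 * (L0 / 2 + C * L0 * r)) 0 t"
  proof -
   have "tint (\<lambda>r. 2 * (L0 / 2 + C * L0 * r)) 0 t = (L0 * t + C * L0 * t\<^sup>2) - (L0 * 0 + C * L0 * 0\<^sup>2)"
   proof (rule tint_FTC)
    show "((\<lambda>r. L0 * r + C * L0 * r\<^sup>2) has_real_derivative 2 * (L0 / 2 + C * L0 * r)) (at r within {0..t})" for r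
     by (auto intro!: derivative_eq_intros simp: algebra_simps)
    show "continuous_on {0..t} (\<lambda>r. 2 * (L0 / 2 + C * L0 * r))" by (intro continuous_intros)
   qed (use t in simp)
   then show ?thesis by simp
  qed
  also have "... <= tint (\<lambda>r. 2 * B r) 0 t"
  proof (rule tint_mono_AE)
   show "integrable (lebesgue_on {0..t}) (\<lambda>r. 2 * B r)"
    using t by (intro Bochner_Integration.integrable_mult_right tint_integrable[OF continuous_tint_integrable[OF cont(3)]]) auto
   show "integrable (lebesgue_on {0..t}) (\<lambda>r. 2 * (L0 / 2 + C * L0 * r))"
    by (intro continuous_imp_integrable_real continuous_intros)
   show "AE r in lebesgue_on {0..t}. 2 * (L0 / 2 + C * L0 * r) <= 2 * B r"
    by (rule AE_I2) (use B_ge in \<open>force intro: mult_left_mono\<close>)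
  qed
  also have "... = N t - N 0" using N_increment[of 0 t] t by auto
  finally have 1: "N 0 + L0 * t + C * L0 * t\<^sup>2 <= N t" by simp
  let ?x = "t * tint D 0 t / l"
  have x: "0 <= ?x" using t l_pos by (auto intro!: divide_nonneg_pos mult_nonneg_nonneg integral_nonneg_AE AE_I2 nonneg)
  have "N t = (sqrt (N t))\<^sup>2" using nonneg(1) by simp
  also have "... <= (sqrt (N 0) + sqrt ?x)\<^sup>2" using N_growth[OF t] nonneg(1) by (intro power_mono) auto
  also have "... <= 2 * N 0 + 2 * ?x" by (rule sqrt_add_power2_le[OF nonneg(1) x])
  finally have 2: "N t <= 2 * N 0 + 2 * ?x" .
  have 3: "?x <= t * (e + \<beta>) / l" using D t l_pos by (intro divide_right_mono mult_left_mono) auto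
  have 4: "(L0 - 2 * (e + \<beta>) / l) * t = L0 * t - 2 * (t * (e + \<beta>) / l)" using l_pos by (simp add: field_simps)
  from 1 2 3 4 have "C * L0 * t\<^sup>2 + (L0 - 2 * (e + \<beta>) / l) * t - N 0 <= 0" by linarith
  then show "t <= \<tau>" using \<tau>(2) t by auto
 qed
 show ?thesis
 proof (cases "T <= \<tau>")
  case True
  then show ?thesis using lifespan_nonneg[OF \<beta>_pos zero_le_power2, of m] by (simp add: add_increasing2)
 next
  case False
  have "\<exists>t\<in>{0..T}. E t <= - \<beta>"
  proof (rule ccontr)
   assume "\<not> ?thesis"
   then have "- \<beta> <= E r" if "r \<in> {0..T}" for r using that by (simp add: not_le less_imp_le)
   from until(1)[OF _ this] T_pos False show False by auto
  qed
  then obtain t1 where t1: "t1 \<in> {0..T}" "E t1 <= - \<beta>" by blast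
  let ?Z = "{0..T} \<inter> E -` {..- \<beta>}"
  have "compact ?Z" using continuous_closed_preimage[OF cont(4) closed_atLeastAtMost, of "{..- \<beta>}"]
   by (auto simp: compact_eq_bounded_closed intro: bounded_subset[OF bounded_closed_interval[of 0 T]])
  moreover have "?Z \<noteq> {}" using t1 by auto
  ultimately obtain z where z: "z \<in> ?Z" "!!y. y \<in> ?Z ==> z <= y" using compact_attains_inf[of ?Z] by blast
  have "\<exists>x\<ge>0. x <= z \<and> E x = - \<beta>"
   using IVT2'[of E z "- \<beta>" 0] e \<beta>_pos z(1) continuous_on_subset[OF cont(4), of "{0..z}"] by auto
  then obtain x where "0 <= x" "x <= z" "E x = - \<beta>" by blast
  then have Ez: "E z = - \<beta>" using z(2)[of x] z(1) by auto
  have before: "- \<beta> <= E r" if "r \<in> {0..z}" for r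
   using z(2)[of r] z(1) Ez that by (cases "r = z") force+
  have zT: "z \<in> {0..T}" using z(1) by auto
  note u = until[OF zT before]
  have "0 < (B z)\<^sup>2" using u(2) L0(2) by simp
  then have "0 < N z * V z" using B_power2[OF zT] by linarith
  then have Nz: "0 < N z" using nonneg(1)[of z] nonneg(3)[of z] by (auto simp: zero_less_mult_iff)
  have zD: "z * tint D 0 z <= \<tau> * (e + \<beta>)"
   using zT u(1,3) \<tau>(1) by (intro mult_mono) (auto intro!: integral_nonneg_AE AE_I2 nonneg)
  have "sqrt (G z) <= sqrt (G 0) + sqrt (\<tau> * (e + \<beta>))"
   using G_growth[OF zT] real_sqrt_le_mono[OF zD] by linarith
  then have "(sqrt (G z))\<^sup>2 <= (sqrt (G 0) + sqrt (\<tau> * (e + \<beta>)))\<^sup>2" using nonneg(2) by (intro power_mono) auto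
  then have Gz: "G z <= (sqrt (G 0) + sqrt (\<tau> * (e + \<beta>)))\<^sup>2" using nonneg(2) by simp
  have "sqrt (N z) <= sqrt (N 0) + sqrt (\<tau> * (e + \<beta>) / l)"
   using N_growth[OF zT] real_sqrt_le_mono[OF divide_right_mono[OF zD less_imp_le[OF l_pos]]] by linarith
  then have "(sqrt (N z))\<^sup>2 <= (sqrt (N 0) + sqrt (\<tau> * (e + \<beta>) / l))\<^sup>2" using nonneg(1) by (intro power_mono) auto
  then have Nz': "N z <= (sqrt (N 0) + sqrt (\<tau> * (e + \<beta>) / l))\<^sup>2" using nonneg(1) by simp
  have "(m - 2) * (L0 / 2) <= (m - 2) * B z" using u(2) m_gt by (intro mult_left_mono) auto
  then have d: "(m - 2) / 2 * L0 - 2 * (sqrt (G 0) + sqrt (\<tau> * (e + \<beta>)))\<^sup>2 <= (m - 2) * B z - 2 * G z"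
   using Gz by simp
  have "T - z <= lifespan m \<beta> ((m - 2) * B z - 2 * G z) (N z)"
   by (rule lifespan_optimal) (use zT \<beta>_pos Ez Nz in auto)
  also have "... <= lifespan m \<beta> ((m - 2) / 2 * L0 - 2 * (sqrt (G 0) + sqrt (\<tau> * (e + \<beta>)))\<^sup>2)
    ((sqrt (N 0) + sqrt (\<tau> * (e + \<beta>) / l))\<^sup>2)"
   by (rule lifespan_mono[OF \<beta>_pos m_gt d _ Nz']) (rule nonneg)
  finally show ?thesis using u(1) by linarith
 qed
qed

end

section \<open>Blow-up of energy solutions\<close>

lemma absolutely_continuous_on_subinterval:
 assumes "absolutely_continuous_on_interval a b f" "a <= s" "t <= b"
 shows "absolutely_continuous_on_interval s t f"
 unfolding absolutely_continuous_iff_modulus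
proof (intro allI impI)
 fix e :: real assume "0 < e"
 with assms(1) obtain d where d: "0 < d" "variation_modulus a b f e d"
  unfolding absolutely_continuous_iff_modulus by blast
 have "variation_modulus s t f e d"
  unfolding variation_modulus_def
 proof (intro allI impI, elim conjE)
  fix D :: "(real \<times> real) set"
  assume D: "finite D" "\<forall>(c, d)\<in>D. s <= c \<and> c <= d \<and> d <= t"
   "pairwise (\<lambda>I J. {fst I<..<snd I} \<inter> {fst J<..<snd J} = {}) D" "(\<Sum>(c, d)\<in>D. d - c) < d"
  have "\<forall>(c, d)\<in>D. a <= c \<and> c <= d \<and> d <= b" using D(2) assms(2,3) by fastforce
  from variation_modulusD[OF d(2) D(1) this D(3,4)] show "(\<Sum>(c, d)\<in>D. \<bar>f d - f c\<bar>) < e" .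
 qed
 with d(1) show "\<exists>\<delta>>0. variation_modulus s t f e \<delta>" by blast
qed

context evolution
begin

lemma cross_power2: "t \<in> {0..T} ==> (l2inner U (u t) (v t))\<^sup>2 <= (l2norm U (u t))\<^sup>2 * (l2norm U (v t))\<^sup>2"
 using power_mono[OF l2inner_Cauchy_Schwarz[OF u_L2 v_L2] abs_ge_zero, of t t 2] by (simp add: power_mult_distrib)

lemma dissipation_power2: "AE t in lebesgue_on {0..T}. (vinner (v t) (u t))\<^sup>2 <= (vnorm U (u t))\<^sup>2 * (vnorm U (v t))\<^sup>2"
 using AE_interval[of 0 T] v_H01
proof eventually_elim
 case (elim t)
 show ?case
  using power_mono[OF vinner_Cauchy_Schwarz[OF elim(2) u_H01[OF elim(1)]] abs_ge_zero, of 2]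
  by (simp add: power_mult_distrib mult.commute)
qed

lemma u_vnorm_displacement:
 assumes t: "t \<in> {0..T}"
 shows "vnorm U (\<lambda>x. u t x - u 0 x) <= sqrt (t * tint (\<lambda>r. (vnorm U (v r))\<^sup>2) 0 t)"
proof -
 let ?n = "\<lambda>r. \<bar>vnorm U (v r)\<bar>"
 have t0: "0 <= t" "t <= T" using t by auto
 note i = tint_integrable[OF bochner_L2_norm_integrable(2)[OF v_bochner] order_refl t0(2)]
  tint_integrable[OF bochner_L2_norm_integrable(1)[OF v_bochner] order_refl t0(2)]
 have ic: "integrable (lebesgue_on {0..t}) (\<lambda>_. 1::real)" by (rule continuous_imp_integrable_real[OF continuous_on_const])
 have "(tint ?n 0 t)\<^sup>2 <= t * tint (\<lambda>r. (vnorm U (v r))\<^sup>2) 0 t"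
 proof (rule discriminant_power2)
  fix s
  have "0 <= tint (\<lambda>r. (1 + 2 * s * ?n r) + s\<^sup>2 * (vnorm U (v r))\<^sup>2) 0 t"
  proof (intro integral_nonneg_AE AE_I2)
   fix r
   have "(1 + 2 * s * ?n r) + s\<^sup>2 * (vnorm U (v r))\<^sup>2 = (1 + s * ?n r)\<^sup>2"
    by (simp add: power2_sum power_mult_distrib)
   then show "0 <= (1 + 2 * s * ?n r) + s\<^sup>2 * (vnorm U (v r))\<^sup>2" by simp
  qed
  also have "... = tint (\<lambda>r. 1 + 2 * s * ?n r) 0 t + tint (\<lambda>r. s\<^sup>2 * (vnorm U (v r))\<^sup>2) 0 t"
   by (rule Bochner_Integration.integral_add[OF Bochner_Integration.integrable_add[OF ic
      Bochner_Integration.integrable_mult_right[OF i(1)]] Bochner_Integration.integrable_mult_right[OF i(2)]])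
  also have "tint (\<lambda>r. 1 + 2 * s * ?n r) 0 t = tint (\<lambda>_. 1) 0 t + tint (\<lambda>r. 2 * s * ?n r) 0 t"
   by (rule Bochner_Integration.integral_add[OF ic Bochner_Integration.integrable_mult_right[OF i(1)]])
  also have "tint (\<lambda>_. 1) 0 t = t" using tint_const[OF t0(1), of 1] by simp
  also have "tint (\<lambda>r. 2 * s * ?n r) 0 t = 2 * s * tint ?n 0 t" by (rule Bochner_Integration.integral_mult_right_zero)
  also have "tint (\<lambda>r. s\<^sup>2 * (vnorm U (v r))\<^sup>2) 0 t = s\<^sup>2 * tint (\<lambda>r. (vnorm U (v r))\<^sup>2) 0 t"
   by (rule Bochner_Integration.integral_mult_right_zero)
  finally show "0 <= t + 2 * s * tint ?n 0 t + s\<^sup>2 * tint (\<lambda>r. (vnorm U (v r))\<^sup>2) 0 t" .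
 qed (use t0 in \<open>auto intro!: integral_nonneg_AE AE_I2\<close>)
 then have "tint ?n 0 t <= sqrt (t * tint (\<lambda>r. (vnorm U (v r))\<^sup>2) 0 t)" by (rule real_le_rsqrt)
 with u_vnorm_increment[OF order_refl t0] show ?thesis by linarith
qed

theorem energy_growth:
 assumes ac: "absolutely_continuous_on_interval 0 T (energy U p g u v)"
  and deriv: "AE t in lebesgue_on {0..T}. \<exists>D. (energy U p g u v has_real_derivative D) (at t) \<and> D <= - (vnorm U (v t))\<^sup>2"
  and \<kappa>: "0 < \<kappa>"
 shows "energy_growth T m \<kappa> (lambda1 U) (\<lambda>t. (l2norm U (u t))\<^sup>2) (\<lambda>t. (vnorm U (u t))\<^sup>2) (\<lambda>t. (l2norm U (v t))\<^sup>2)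
  (\<lambda>t. l2inner U (u t) (v t)) (shifted_energy U p g u v) (\<lambda>t. (vnorm U (v t))\<^sup>2) (\<lambda>t. vinner (v t) (u t))"
proof
 have E: "continuous_on {0..T} (shifted_energy U p g u v)"
  unfolding shifted_energy_def[abs_def]
  by (rule continuous_on_add[OF absolutely_continuous_on_interval_continuous[OF ac] continuous_on_const])
 show "continuous_on {0..T} (shifted_energy U p g u v)" by (rule E)
 show "0 < T" by (rule T_pos)
 show "2 < m" by (rule m_gt_2)
 show "0 < \<kappa>" by (rule \<kappa>)
 show "0 < lambda1 U" by (rule lambda1_pos)
 show "continuous_on {0..T} (\<lambda>t. (vnorm U (u t))\<^sup>2)"
  unfolding vnorm_power2 by (rule V_curve_continuous[OF u_curve u_curve])
 show "continuous_on {0..T} (\<lambda>t. (l2norm U (v t))\<^sup>2)"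
  unfolding l2norm_power2 by (rule L2_curve_continuous[OF v_curve v_curve])
 show "continuous_on {0..T} (\<lambda>t. l2inner U (u t) (v t))" by (rule L2_curve_continuous[OF u_L2_curve v_curve])
 show "integrable (lebesgue_on {0..T}) (\<lambda>t. (vnorm U (v t))\<^sup>2)" by (rule bochner_L2_norm_integrable(1)[OF v_bochner])
 show "integrable (lebesgue_on {0..T}) (\<lambda>t. vinner (v t) (u t))" by (rule vinner_v_integrable[OF u_curve])
 show "AE t in lebesgue_on {0..T}. (vinner (v t) (u t))\<^sup>2 <= (vnorm U (u t))\<^sup>2 * (vnorm U (v t))\<^sup>2"
  by (rule dissipation_power2)
 show "0 <= (l2norm U (u t))\<^sup>2" "0 <= (vnorm U (u t))\<^sup>2" "0 <= (l2norm U (v t))\<^sup>2" "0 <= (vnorm U (v t))\<^sup>2" for t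
  by simp_all
 fix s t :: real
 show "(l2inner U (u t) (v t))\<^sup>2 <= (l2norm U (u t))\<^sup>2 * (l2norm U (v t))\<^sup>2" if "t \<in> {0..T}"
  by (rule cross_power2[OF that])
 show "lambda1 U * (l2norm U (u t))\<^sup>2 <= (vnorm U (u t))\<^sup>2" if "t \<in> {0..T}" by (rule lambda1_le[OF u_H01[OF that]])
 show "sqrt ((vnorm U (u t))\<^sup>2) <= sqrt ((vnorm U (u 0))\<^sup>2) + sqrt (t * tint (\<lambda>t. (vnorm U (v t))\<^sup>2) 0 t)" if t: "t \<in> {0..T}"
  using u_vnorm_displacement[OF t] vnorm_reverse_triangle[OF u_H01[OF t] u_H01[of 0]] T_pos vnorm_nonneg by simp
 show "sqrt ((l2norm U (u t))\<^sup>2) <= sqrt ((l2norm U (u 0))\<^sup>2) + sqrt (t * tint (\<lambda>t. (vnorm U (v t))\<^sup>2) 0 t / lambda1 U)"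
  if t: "t \<in> {0..T}"
 proof -
  let ?d = "\<lambda>x. u t x - u 0 x" and ?I = "t * tint (\<lambda>t. (vnorm U (v t))\<^sup>2) 0 t"
  have 0: "0 \<in> {0..T}" using T_pos by simp
  have "0 <= ?I" using t by (intro mult_nonneg_nonneg integral_nonneg_AE AE_I2) auto
  then have "(vnorm U ?d)\<^sup>2 <= ?I"
   using power_mono[OF u_vnorm_displacement[OF t] vnorm_nonneg, of 2] by simp
  then have "lambda1 U * (l2norm U ?d)\<^sup>2 <= ?I" using lambda1_le[OF H01_diff[OF u_H01[OF t] u_H01[OF 0]]] by linarith
  then have "(l2norm U ?d)\<^sup>2 <= ?I / lambda1 U" using lambda1_pos by (simp add: pos_le_divide_eq mult.commute)
  then have "l2norm U ?d <= sqrt (?I / lambda1 U)" by (rule real_le_rsqrt)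
  then show ?thesis using l2norm_reverse_triangle[OF u_L2[OF t] u_L2[OF 0]] by (simp add: l2norm_nonneg)
 qed
 assume st: "0 <= s" "s <= t" "t <= T"
 show "(l2norm U (u t))\<^sup>2 - (l2norm U (u s))\<^sup>2 = tint (\<lambda>r. 2 * l2inner U (u r) (v r)) s t" by (rule l2norm_increment[OF st])
 show "(vnorm U (u t))\<^sup>2 - (vnorm U (u s))\<^sup>2 = 2 * tint (\<lambda>t. vinner (v t) (u t)) s t" by (rule vnorm_increment[OF st])
 show "tint (\<lambda>r. (m + 2) / 2 * (l2norm U (v r))\<^sup>2 + \<kappa> * (vnorm U (u r))\<^sup>2 - m * shifted_energy U p g u v r - vinner (v r) (u r)) s t
  <= l2inner U (u t) (v t) - l2inner U (u s) (v s)" by (rule energy_inequality[OF st E])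
 have "energy U p g u v t - energy U p g u v s <= tint (\<lambda>r. - (vnorm U (v r))\<^sup>2) s t"
 proof (rule absolutely_continuous_increment_le[OF absolutely_continuous_on_subinterval[OF ac st(1,3)] _ _ st(2)])
  show "integrable (lebesgue_on {s..t}) (\<lambda>r. - (vnorm U (v r))\<^sup>2)"
   using tint_integrable[OF bochner_L2_norm_integrable(1)[OF v_bochner] st(1,3)] by simp
  show "AE x in lebesgue_on {s..t}. \<exists>D. (energy U p g u v has_real_derivative D) (at x) \<and> D <= - (vnorm U (v x))\<^sup>2"
   by (rule AE_subinterval[OF deriv]) (use st in auto)
 qed
 then show "shifted_energy U p g u v t <= shifted_energy U p g u v s - tint (\<lambda>t. (vnorm U (v t))\<^sup>2) s t"
  by (simp add: shifted_energy_def)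
qed

end

subsection \<open>Initial values\<close>

context variable_exponent
begin

lemma vnorm_AE_cong:
 assumes y: "y \<in> H01 U" and z: "z \<in> H01 U" and ae: "AE x in lebesgue_on U. y x = z x"
 shows "vnorm U y = vnorm U z"
proof -
 have wg: "has_weak_gradient U y (wgrad U y)" by (rule H01_has_weak_gradient[OF y])
 have "has_weak_gradient U z (wgrad U y)"
  unfolding has_weak_gradient_def
 proof (intro conjI ballI)
  show "wgrad U y \<in> L2 U" by (rule wgrad_L2[OF y])
  fix \<phi> :: "'a \<Rightarrow> real" and b :: 'a assume \<phi>: "\<phi> \<in> test_functions U" and b: "b \<in> Basis"
  let ?d = "\<lambda>x. frechet_derivative \<phi> (at x) b"
  have d: "?d \<in> L2 U" by (rule test_L2[OF test_partial[OF \<phi> b] sets_U])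
  have "(\<integral>x. z x * ?d x \<partial>lebesgue_on U) = (\<integral>x. y x * ?d x \<partial>lebesgue_on U)"
  proof (rule integral_cong_AE)
   show "(\<lambda>x. z x * ?d x) \<in> borel_measurable (lebesgue_on U)" "(\<lambda>x. y x * ?d x) \<in> borel_measurable (lebesgue_on U)"
    using L2_mult_integrable[OF H01_L2[OF z] d] L2_mult_integrable[OF H01_L2[OF y] d] by (auto intro: borel_measurable_integrable)
   show "AE x in lebesgue_on U. z x * ?d x = y x * ?d x" using ae by eventually_elim simp
  qed
  also have "... = - (\<integral>x. (wgrad U y x \<bullet> b) * \<phi> x \<partial>lebesgue_on U)" using wg \<phi> b unfolding has_weak_gradient_def by blast
  finally show "(\<integral>x. z x * ?d x \<partial>lebesgue_on U) = - (\<integral>x. (wgrad U y x \<bullet> b) * \<phi> x \<partial>lebesgue_on U)" .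
 qed
 from wgrad_AE[OF this] show ?thesis
  unfolding vnorm_def by (rule l2norm_AE_cong[OF sets_U wgrad_L2[OF z], symmetric])
qed

definition initial_energy :: "('a \<Rightarrow> real) \<Rightarrow> ('a \<Rightarrow> real) \<Rightarrow> real" where
 "initial_energy u0 u1 = 1 / 2 * (l2norm U u1)\<^sup>2 + 1 / 2 * (vnorm U u0)\<^sup>2 - (\<integral>x. source_primitive p x (u0 x) \<partial>lebesgue_on U)"

end

context evolution
begin

lemma initial_values:
 assumes u0: "u0 \<in> H01 U" and u1: "u1 \<in> L2 U"
 shows "l2norm U (u 0) = l2norm U u0" "vnorm U (u 0) = vnorm U u0" "l2inner U (u 0) (v 0) = l2inner U u0 u1"
  "energy U p g u v 0 = initial_energy u0 u1"
proof -
 have 0: "0 \<in> {0..T}" using T_pos by simp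
 show "l2norm U (u 0) = l2norm U u0" by (rule l2norm_AE_cong[OF sets_U u_L2[OF 0] u_0])
 show G: "vnorm U (u 0) = vnorm U u0" by (rule vnorm_AE_cong[OF u_H01[OF 0] u0 u_0])
 show "l2inner U (u 0) (v 0) = l2inner U u0 u1" by (rule l2inner_AE_cong[OF sets_U u_L2[OF 0] v_L2[OF 0] u_0 v_0])
 have V: "l2norm U (v 0) = l2norm U u1" by (rule l2norm_AE_cong[OF sets_U v_L2[OF 0] v_0])
 have F: "(\<integral>x. source_primitive p x (u 0 x) \<partial>lebesgue_on U) = (\<integral>x. source_primitive p x (u0 x) \<partial>lebesgue_on U)"
  by (rule integral_cong_AE[OF source_measurable(2)[OF L2_measurable[OF u_L2[OF 0]]] source_measurable(2)[OF L2_measurable[OF H01_L2[OF u0]]]])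
   (use u_0 in \<open>eventually_elim, simp\<close>)
 show "energy U p g u v 0 = initial_energy u0 u1"
  unfolding energy_def tint_same initial_energy_def V F G[symmetric] vnorm_def[symmetric] by simp
qed

end

subsection \<open>Data of prescribed energy\<close>

text \<open>With \<open>y = \<bar>r\<bar>\<^sup>p\<close> the primitive is \<open>(y ln y - y) / p\<^sup>2\<close>, which exceeds each of its tangents.\<close>

lemma source_primitive_ge:
 assumes p: "2 <= p x" "p x <= P" and A: "0 <= A"
 shows "A * r\<^sup>2 - (A + exp (A * P\<^sup>2)) <= source_primitive p x r"
proof (cases "r = 0")
 case True
 have "0 <= A + exp (A * P\<^sup>2)" using A by (intro add_nonneg_nonneg) auto
 then show ?thesis using True by (simp add: source_primitive_def)
next
 case False
 define y where "y = \<bar>r\<bar> powr p x"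
 \<comment> \<open>The slope of the tangent at \<open>y = exp a\<close>; the factor \<open>P\<^sup>2\<close> compensates the division by \<open>p\<^sup>2\<close>.\<close>
 define a where "a = A * P\<^sup>2"
 have y: "0 < y" using False by (simp add: y_def)
 have ln_y: "ln y = p x * ln \<bar>r\<bar>" using False by (simp add: y_def ln_powr)
 have a: "0 <= a" using A by (simp add: a_def)
 have "ln (exp a / y) <= exp a / y - 1" by (rule ln_le_minus_one) (use y in simp)
 then have "a - ln y <= exp a / y - 1" using y by (simp add: ln_div)
 then have "y * (a - ln y) <= y * (exp a / y - 1)" using y by (intro mult_left_mono) auto
 then have tangent: "a * y - exp a <= y * ln y - y" using y by (simp add: algebra_simps)
 have F: "source_primitive p x r = (y * ln y - y) / (p x)\<^sup>2"
  using False p by (simp add: source_primitive_def ln_y y_def[symmetric] power2_eq_square field_simps)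
 have y_ge: "r\<^sup>2 - 1 <= y"
 proof (cases "1 <= \<bar>r\<bar>")
  case True
  have "r\<^sup>2 = \<bar>r\<bar> powr 2" using False by (simp add: powr_numeral)
  also have "... <= y" unfolding y_def by (rule powr_mono[OF p(1) True])
  finally show ?thesis by simp
 next
  case False
  then have "r\<^sup>2 <= 1" by (simp add: abs_square_le_1)
  then show ?thesis using y by linarith
 qed
 have p2: "1 <= (p x)\<^sup>2" "(p x)\<^sup>2 <= P\<^sup>2" using p by (auto intro: power_mono one_le_power)
 then have P2: "0 < P\<^sup>2" by linarith
 have "A * r\<^sup>2 - A = A * (r\<^sup>2 - 1)" by (simp add: algebra_simps)
 also have "... <= A * y" using y_ge A by (rule mult_left_mono)
 also have "... = a * y / P\<^sup>2" using P2 by (simp add: a_def)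
 also have "... <= a * y / (p x)\<^sup>2" using p2 P2 a y by (intro divide_left_mono mult_pos_pos) auto
 finally have 1: "A * r\<^sup>2 - A <= a * y / (p x)\<^sup>2" .
 have "exp a / (p x)\<^sup>2 <= exp a / 1" using p2 by (intro divide_left_mono) auto
 then have "A * r\<^sup>2 - A - exp a <= (a * y - exp a) / (p x)\<^sup>2" using 1 by (simp add: diff_divide_distrib)
 also have "... <= source_primitive p x r" unfolding F by (rule divide_right_mono[OF tangent]) simp
 finally show ?thesis by (simp add: a_def)
qed

context variable_exponent
begin

text \<open>The source part of the energy grows faster than quadratically along the multiples of a bump
 function, so a large initial velocity is needed to restore the energy level \<open>R\<close>.\<close>

lemma data_with_energy:
 assumes K: "0 < K"
 shows "\<exists>u0\<in>test_functions U. \<exists>u1\<in>test_functions U.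
  initial_energy u0 u1 = R \<and> 0 < l2norm U u0 \<and> 0 < l2inner U u0 u1 \<and> S < K * l2inner U u0 u1"
proof -
 obtain \<phi> where \<phi>: "\<phi> \<in> test_functions U" and norm_pos: "0 < l2norm U \<phi>" by (metis nonzero_test_function)
 note \<phi>V = test_H01[OF \<phi>]
 define a where "a = (l2norm U \<phi>)\<^sup>2"
 define b where "b = (vnorm U \<phi>)\<^sup>2"
 have a: "0 < a" and b: "0 <= b" using norm_pos by (simp_all add: a_def b_def)
 from subcritical_growth obtain P where P: "AE x in lebesgue_on U. p x <= P" by blast
 \<comment> \<open>With this slope, the source energy of \<open>k \<phi>\<close> exceeds its gradient energy by \<open>k\<^sup>2\<close>, up to the constant \<open>M\<close>.\<close>
 define A where "A = (b / 2 + 1) / a"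
 have A: "0 <= A" "A * a = b / 2 + 1" using a b by (simp_all add: A_def)
 define M where "M = (A + exp (A * P\<^sup>2)) * measure (lebesgue_on U) U"
 define c where "c = \<bar>S\<bar> / (K * sqrt a)"
 define h where "h = \<bar>M - R\<bar>"
 have h: "0 <= h" "M - R <= h" by (simp_all add: h_def)
 define k where "k = 1 + 2 * h + c"
 have c: "0 <= c" using K a by (simp add: c_def)
 have k: "1 <= k" and k_ge: "2 * (M - R) <= k" and k_gt: "c < k" unfolding k_def using h c by simp_all
 have k2: "k <= k\<^sup>2" using k by (simp add: power2_eq_square)
 define \<Phi> where "\<Phi> = (\<integral>x. source_primitive p x (k * \<phi> x) \<partial>lebesgue_on U)"
 have \<Phi>_ge: "A * (k\<^sup>2 * a) - M <= \<Phi>"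
 proof -
  interpret finite_measure "lebesgue_on U" by (rule finite_measure_U)
  have i: "integrable (lebesgue_on U) (\<lambda>x. (k * \<phi> x)\<^sup>2)"
   using L2_integrable[OF L2_mult[OF test_L2[OF \<phi> sets_U], of k]] by simp
  have "A * (k\<^sup>2 * a) - M = A * (l2norm U (\<lambda>x. k * \<phi> x))\<^sup>2 - M" by (simp add: l2norm_mult power_mult_distrib a_def)
  also have "... = A * (\<integral>x. (k * \<phi> x)\<^sup>2 \<partial>lebesgue_on U) - M" by (simp add: l2norm_power2_integral)
  also have "... = (\<integral>x. A * (k * \<phi> x)\<^sup>2 - (A + exp (A * P\<^sup>2)) \<partial>lebesgue_on U)"
   using i by (simp add: M_def)
  also have "... <= \<Phi>"
   unfolding \<Phi>_def
  proof (rule integral_mono_AE)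
   show "integrable (lebesgue_on U) (\<lambda>x. A * (k * \<phi> x)\<^sup>2 - (A + exp (A * P\<^sup>2)))" using i by simp
   show "integrable (lebesgue_on U) (\<lambda>x. source_primitive p x (k * \<phi> x))"
    by (rule source_primitive_integrable[OF H01_scale[OF \<phi>V]])
   show "AE x in lebesgue_on U. A * (k * \<phi> x)\<^sup>2 - (A + exp (A * P\<^sup>2)) <= source_primitive p x (k * \<phi> x)"
    using P m_le_p
   proof eventually_elim
    case (elim x)
    have "2 <= p x" using elim(2) m_gt_2 by linarith
    then show ?case using elim(1) A(1) by (rule source_primitive_ge)
   qed
  qed
  finally show ?thesis .
 qed
 define q where "q = R - k\<^sup>2 * b / 2 + \<Phi>"
 have "A * (k\<^sup>2 * a) = k\<^sup>2 * b / 2 + k\<^sup>2" using A(2) by (metis (no_types, opaque_lifting) distrib_left mult.left_commute mult.right_neutral times_divide_eq_right)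
 moreover have "Y / 2 <= R - X + \<Phi>" if "Z = X + Y" "Z - M <= \<Phi>" "k <= Y" for X Y Z :: real
 proof -
  have "M - R <= Y / 2" using k_ge that(3) by simp
  then show ?thesis using that(1,2) by simp
 qed
 ultimately have q: "k\<^sup>2 / 2 <= q" using \<Phi>_ge k2 unfolding q_def by blast
 define s where "s = sqrt (2 * q / a)"
 have q_nonneg: "0 <= q" using q zero_le_power2[of k] by linarith
 have s2: "s\<^sup>2 * a = 2 * q" using q_nonneg a by (simp add: s_def)
 have "(k / sqrt a)\<^sup>2 <= 2 * q / a" using q a by (simp add: power_divide divide_right_mono)
 then have s: "k / sqrt a <= s" unfolding s_def by (rule real_le_rsqrt)
 define u0 where "u0 x = k * \<phi> x" for x
 define u1 where "u1 x = s * \<phi> x" for x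
 have inner: "l2inner U u0 u1 = k * (s * a)"
 proof -
  have "l2inner U u0 u1 = l2inner U (\<lambda>x. k *\<^sub>R \<phi> x) (\<lambda>x. s *\<^sub>R \<phi> x)" by (simp add: u0_def[abs_def] u1_def[abs_def])
  also have "... = k * (s * a)" unfolding l2inner_scaleR_left l2inner_scaleR_right a_def l2norm_power2 ..
  finally show ?thesis .
 qed
 have "k * sqrt a = k / sqrt a * a" using a by (simp add: real_div_sqrt field_simps)
 also have "... <= s * a" using s a by (intro mult_right_mono) auto
 finally have "k * (k * sqrt a) <= k * (s * a)" using k by (intro mult_left_mono) auto
 moreover have "1 * (k * sqrt a) <= k * (k * sqrt a)" using k a by (intro mult_right_mono) auto
 ultimately have inner_ge: "k * sqrt a <= l2inner U u0 u1" unfolding inner by linarith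
 have pos: "0 < k * sqrt a" using k a by simp
 have "\<bar>S\<bar> < K * (k * sqrt a)" using k_gt K a unfolding c_def by (simp add: pos_divide_less_eq mult.left_commute mult.commute)
 also have "... <= K * l2inner U u0 u1" using inner_ge K by (intro mult_left_mono) auto
 finally have S: "S < K * l2inner U u0 u1" by linarith
 have "initial_energy u0 u1 = 1 / 2 * (s\<^sup>2 * a) + 1 / 2 * (k\<^sup>2 * b) - \<Phi>"
  unfolding initial_energy_def u0_def[abs_def] u1_def[abs_def] \<Phi>_def a_def b_def vnorm_scale[OF \<phi>V] l2norm_mult power_mult_distrib power2_abs ..
 also have "... = R" unfolding s2 q_def by (simp add: field_simps)
 finally have "initial_energy u0 u1 = R" .
 moreover have "u0 \<in> test_functions U" "u1 \<in> test_functions U"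
  unfolding u0_def[abs_def] u1_def[abs_def] by (rule test_scale[OF \<phi>])+
 moreover have "0 < l2norm U u0" unfolding u0_def[abs_def] l2norm_mult using k norm_pos by simp
 ultimately show ?thesis using S inner_ge pos by (intro bexI[of _ u0] bexI[of _ u1]) auto
qed

end

subsection \<open>The blow-up theorem\<close>

lemma ereal_le_if_all_below:
 assumes "0 < X" "!!t. 0 < t ==> ereal t < X ==> t <= b"
 shows "X <= ereal b"
proof (rule ccontr)
 assume "\<not> X <= ereal b"
 then have "ereal b < X" by simp
 then have "ereal (max b 0) < X" using assms(1) by (simp add: max_def zero_ereal_def)
 then obtain t where t: "ereal (max b 0) < ereal t" "ereal t < X" using ereal_dense2 by blast
 then have "0 < t" "b < t" by auto
 with assms(2)[OF _ t(2)] show False by simp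
qed

lemma energy_derivative_le:
 fixes a b :: "real \<Rightarrow> real" and c :: "real \<Rightarrow> real \<Rightarrow> real"
 assumes H2: "hyp_H2 g" and T: "ereal T < Tm" and b: "!!t. 0 <= b t"
  and deriv: "AE t in lebesgue_on {t. 0 < t \<and> ereal t < Tm}.
   (E has_real_derivative - a t - 1/2 * g t * b t + 1/2 * (\<integral>s. gprime g (t - s) * (c t s)\<^sup>2 \<partial>lebesgue_on {0..t})) (at t)"
 shows "AE t in lebesgue_on {0..T}. \<exists>D. (E has_real_derivative D) (at t) \<and> D <= - a t"
proof (rule AE_closed_interval)
 let ?S = "{t. 0 < t \<and> ereal t < Tm}"
 have "open ?S" by (intro open_Collect_conj open_Collect_less continuous_intros continuous_on_ereal)
 then have S: "?S \<in> sets lebesgue" by (simp add: lborelD)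
 have "AE t in lebesgue. t \<in> ?S --> (E has_real_derivative - a t - 1/2 * g t * b t
   + 1/2 * (\<integral>s. gprime g (t - s) * (c t s)\<^sup>2 \<partial>lebesgue_on {0..t})) (at t)"
  using deriv S by (subst (asm) AE_restrict_space_iff) simp_all
 then have "AE t in lebesgue. t \<in> {0<..<T} --> (\<exists>D. (E has_real_derivative D) (at t) \<and> D <= - a t)"
 proof eventually_elim
  case (elim t)
  show ?case
  proof
   assume t: "t \<in> {0<..<T}"
   have "ereal t < ereal T" using t by simp
   then have tS: "t \<in> ?S" using t less_trans[OF _ T] by auto
   have "0 <= (\<integral>s. - (gprime g (t - s) * (c t s)\<^sup>2) \<partial>lebesgue_on {0..t})"
   proof (intro integral_nonneg_AE AE_I2)
    fix s assume "s \<in> space (lebesgue_on {0..t})"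
    then have "gprime g (t - s) <= 0" by (intro kernel_decreasing[OF H2]) auto
    then show "0 <= - (gprime g (t - s) * (c t s)\<^sup>2)" by (simp add: mult_nonpos_nonneg)
   qed
   then have "(\<integral>s. gprime g (t - s) * (c t s)\<^sup>2 \<partial>lebesgue_on {0..t}) <= 0" by simp
   moreover have "0 <= g t * b t" using kernel_nonneg[OF H2, of t] b[of t] t by (intro mult_nonneg_nonneg) auto
   ultimately have "- a t - 1/2 * g t * b t + 1/2 * (\<integral>s. gprime g (t - s) * (c t s)\<^sup>2 \<partial>lebesgue_on {0..t}) <= - a t"
    by simp
   with mp[OF elim tS] show "\<exists>D. (E has_real_derivative D) (at t) \<and> D <= - a t" by blast
  qed
 qed
 then show "AE t in lebesgue_on {0<..<T}. \<exists>D. (E has_real_derivative D) (at t) \<and> D <= - a t"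
  by (simp add: AE_restrict_space_iff)
qed

lemma (in variable_exponent) growth_const:
 assumes ell: "1 / (m - 1)\<^sup>2 < ell g"
 defines "k \<equiv> ((m - 1)\<^sup>2 * ell g - 1) / (2 * m)"
 shows "0 < k" "0 < growth_const U p g" "growth_const U p g <= m + 2"
  "growth_const U p g * (lambda1 U + 2 * m) <= 4 * m * lambda1 U * k"
proof -
 have m: "2 < m" by (rule m_gt_2)
 have l: "0 < lambda1 U" by (rule lambda1_pos)
 have pos: "0 < (m - 1)\<^sup>2 * ell g - 1" using ell m by (simp add: pos_divide_less_eq mult.commute)
 then show "0 < k" using m by (simp add: k_def)
 let ?b = "2 * lambda1 U * ((m - 1)\<^sup>2 * ell g - 1) / (2 * m + lambda1 U)"
 have C: "growth_const U p g = min (m + 2) ?b" by (simp add: growth_const_def m_def Let_def)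
 have d: "0 < 2 * m + lambda1 U" using m l by simp
 have "0 < ?b" using pos l d by simp
 then show "0 < growth_const U p g" using m by (simp add: C)
 show "growth_const U p g <= m + 2" by (simp add: C)
 have "growth_const U p g * (2 * m + lambda1 U) <= ?b * (2 * m + lambda1 U)"
  using d by (intro mult_right_mono) (auto simp: C)
 also have "... = 2 * lambda1 U * ((m - 1)\<^sup>2 * ell g - 1)" using d by simp
 also have "... = 4 * m * lambda1 U * k" using m by (simp add: k_def)
 finally show "growth_const U p g * (lambda1 U + 2 * m) <= 4 * m * lambda1 U * k" by (simp add: add.commute)
qed

theorem theorem2p4:
  fixes \<Omega> :: "'a::euclidean_space set" and p :: "'a \<Rightarrow> real" and g :: "real \<Rightarrow> real" and R :: real
  assumes "smooth_bounded_domain \<Omega>"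
    and "hyp_H1 \<Omega> p"
    and "hyp_H2 g"
    and "local_theory \<Omega> p g"
    and "ell g > 1 / (p_minus \<Omega> p - 1)\<^sup>2"
  shows "\<exists>u0\<in>test_functions \<Omega>. \<exists>u1\<in>test_functions \<Omega>. \<exists>Tm u v.
     unique_maximal_solution \<Omega> p g u0 u1 Tm u v \<and>
     energy \<Omega> p g u v 0 = R \<and>
     Tm < \<infinity> \<and> blows_up_at \<Omega> (real_of_ereal Tm) u v \<and>
     (R + C_star \<Omega> p / p_minus \<Omega> p < 0 \<longrightarrow>
        (let m = p_minus \<Omega> p;
             \<beta> = - shifted_energy \<Omega> p g u v 0;
             d0 = (m - 2) * l2inner \<Omega> u0 u1 - 2 * (l2norm \<Omega> (wgrad \<Omega> u0))\<^sup>2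
         in (\<forall>\<sigma>>0. (m - 2) * (l2inner \<Omega> u0 u1 + \<beta> * \<sigma>) - 2 * (l2norm \<Omega> (wgrad \<Omega> u0))\<^sup>2 > 0 \<longrightarrow>
               Tm \<le> ereal (2 * ((l2norm \<Omega> u0)\<^sup>2 + \<beta> * \<sigma>\<^sup>2) /
                 ((m - 2) * (l2inner \<Omega> u0 u1 + \<beta> * \<sigma>) - 2 * (l2norm \<Omega> (wgrad \<Omega> u0))\<^sup>2))) \<and>
            Tm \<le> ereal (4 * (sqrt (d0\<^sup>2 + (m - 2)\<^sup>2 * \<beta> * (l2norm \<Omega> u0)\<^sup>2) - d0) /
                 ((m - 2)\<^sup>2 * \<beta>)))) \<and>
     (R + C_star \<Omega> p / p_minus \<Omega> p = 0 \<longrightarrow>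
        l2inner \<Omega> u0 u1 > 0 \<and>
        lifespan_bound \<Omega> p g u0 u1 (shifted_energy \<Omega> p g u v 0) Tm) \<and>
     (R + C_star \<Omega> p / p_minus \<Omega> p > 0 \<longrightarrow>
        0 < shifted_energy \<Omega> p g u v 0 \<and>
        shifted_energy \<Omega> p g u v 0 < growth_const \<Omega> p g / p_minus \<Omega> p * l2inner \<Omega> u0 u1 \<and>
        lifespan_bound \<Omega> p g u0 u1 (shifted_energy \<Omega> p g u v 0) Tm)"
proof -
 interpret variable_exponent \<Omega> p
  using assms(1,2) by unfold_locales (simp_all add: smooth_bounded_domain_def)
 define C where "C = growth_const \<Omega> p g"
 define k where "k = ((m - 1)\<^sup>2 * ell g - 1) / (2 * m)"
 have ell: "1 / (m - 1)\<^sup>2 < ell g" using assms(5) by (simp add: m_def)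
 note const = growth_const[OF ell, folded C_def k_def]
 have m: "2 < m" by (rule m_gt_2)
 define e where "e = R + C_star \<Omega> p / m"
 have "0 < C / m" using const(2) m by simp
 from data_with_energy[OF this, of R e] obtain u0 u1 where
  u0: "u0 \<in> test_functions \<Omega>" and u1: "u1 \<in> test_functions \<Omega>" and R: "initial_energy u0 u1 = R"
  and u0_pos: "0 < l2norm \<Omega> u0" and inner_pos: "0 < l2inner \<Omega> u0 u1" and small: "e < C / m * l2inner \<Omega> u0 u1"
  by blast
 have u0V: "u0 \<in> H01 \<Omega>" and u1H: "u1 \<in> L2 \<Omega>" by (rule test_H01[OF u0], rule test_L2[OF u1 sets_U])
 from assms(4)[unfolded local_theory_def, rule_format, OF u0V u1H] obtain Tm u v where
  sol: "unique_maximal_solution \<Omega> p g u0 u1 Tm u v"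
  and blow_up: "Tm < \<infinity> --> blows_up_at \<Omega> (real_of_ereal Tm) u v"
  and ac: "\<forall>T. 0 < T \<and> ereal T < Tm --> absolutely_continuous_on_interval 0 T (energy \<Omega> p g u v)"
  and deriv: "AE t in lebesgue_on {t. 0 < t \<and> ereal t < Tm}.
    (energy \<Omega> p g u v has_real_derivative
     - (l2norm \<Omega> (wgrad \<Omega> (v t)))\<^sup>2
     - 1/2 * g t * (l2norm \<Omega> (wgrad \<Omega> (u t)))\<^sup>2
     + 1/2 * (\<integral>s. gprime g (t - s) * (l2norm \<Omega> (wgrad \<Omega> (u t) - wgrad \<Omega> (u s)))\<^sup>2
           \<partial>lebesgue_on {0..t})) (at t)"
  by (elim exE conjE)
 have upto: "solution_upto \<Omega> p g u0 u1 Tm u v"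
  using sol by (simp add: unique_maximal_solution_def maximal_solution_def)
 then have Tm_pos: "0 < Tm" by (simp add: solution_upto_def)
 have evolution: "evolution \<Omega> p g u0 u1 T u v" if "0 < T" "ereal T < Tm" for T
  using assms(3) upto that by unfold_locales (simp_all add: solution_upto_def)
 let ?N = "\<lambda>t. (l2norm \<Omega> (u t))\<^sup>2" and ?G = "\<lambda>t. (vnorm \<Omega> (u t))\<^sup>2" and ?V = "\<lambda>t. (l2norm \<Omega> (v t))\<^sup>2"
  and ?B = "\<lambda>t. l2inner \<Omega> (u t) (v t)" and ?E = "shifted_energy \<Omega> p g u v"
  and ?D = "\<lambda>t. (vnorm \<Omega> (v t))\<^sup>2" and ?P = "\<lambda>t. vinner (v t) (u t)"
 have growth: "energy_growth T m k (lambda1 \<Omega>) ?N ?G ?V ?B ?E ?D ?P" if T: "0 < T" "ereal T < Tm" for T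
 proof -
  interpret ev: evolution \<Omega> p g u0 u1 T u v by (rule evolution[OF T])
  have k: "ev.\<kappa> = k" by (simp add: ev.\<kappa>_def k_def)
  have "AE t in lebesgue_on {0..T}. \<exists>D. (energy \<Omega> p g u v has_real_derivative D) (at t) \<and> D <= - (vnorm \<Omega> (v t))\<^sup>2"
   unfolding vnorm_def by (rule energy_derivative_le[OF assms(3) T(2) _ deriv]) simp
  from ev.energy_growth[OF _ this] show ?thesis using ac T const(1) unfolding k by blast
 qed
 obtain T0 where T0: "0 < T0" "ereal T0 < Tm" using ereal_dense2[OF Tm_pos] by (auto simp: zero_ereal_def)
 interpret ev0: evolution \<Omega> p g u0 u1 T0 u v by (rule evolution[OF T0])
 note init = ev0.initial_values[OF u0V u1H]
 have energy_R: "energy \<Omega> p g u v 0 = R" using init(4) R by simp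
 have E0: "?E 0 = e" by (simp add: shifted_energy_def energy_R e_def m_def)
 have N0: "0 < (l2norm \<Omega> u0)\<^sup>2" using u0_pos by simp
 have sqrt_norm: "sqrt ((vnorm \<Omega> u0)\<^sup>2) = vnorm \<Omega> u0" "sqrt ((l2norm \<Omega> u0)\<^sup>2) = l2norm \<Omega> u0"
  using vnorm_nonneg[of u0] l2norm_nonneg[of \<Omega> u0] by simp_all
 have negative_sigma: "Tm <= ereal (2 * ((l2norm \<Omega> u0)\<^sup>2 + (- e) * \<sigma>\<^sup>2) /
   ((m - 2) * (l2inner \<Omega> u0 u1 + (- e) * \<sigma>) - 2 * (vnorm \<Omega> u0)\<^sup>2))"
  if e: "e < 0" and \<sigma>: "0 < \<sigma>" and den: "0 < (m - 2) * (l2inner \<Omega> u0 u1 + (- e) * \<sigma>) - 2 * (vnorm \<Omega> u0)\<^sup>2" for \<sigma>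
 proof (rule ereal_le_if_all_below[OF Tm_pos])
  fix T assume T: "0 < T" "ereal T < Tm"
  have "0 <= (vnorm \<Omega> u0)\<^sup>2" by simp
  then have "0 < (m - 2) * (l2inner \<Omega> u0 u1 + (- e) * \<sigma>)" using den by linarith
  then have "0 < l2inner \<Omega> u0 u1 + (- e) * \<sigma>" using m by (simp add: zero_less_mult_iff)
  then have "(T - 0) * ((m - 2) * (l2inner \<Omega> u0 u1 + (- e) * \<sigma>) - 2 * (vnorm \<Omega> u0)\<^sup>2)
    <= 2 * ((l2norm \<Omega> u0)\<^sup>2 + (- e) * \<sigma>\<^sup>2)"
   using energy_growth.lifespan_from[OF growth[OF T] order_refl less_imp_le[OF T(1)], of "- e" \<sigma>] e \<sigma>
   unfolding init(1-3) E0 by simp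
  then show "T <= 2 * ((l2norm \<Omega> u0)\<^sup>2 + (- e) * \<sigma>\<^sup>2) /
    ((m - 2) * (l2inner \<Omega> u0 u1 + (- e) * \<sigma>) - 2 * (vnorm \<Omega> u0)\<^sup>2)"
   by (simp only: diff_zero pos_le_divide_eq[OF den])
 qed
 have negative: "Tm <= ereal (lifespan m (- e) ((m - 2) * l2inner \<Omega> u0 u1 - 2 * (vnorm \<Omega> u0)\<^sup>2) ((l2norm \<Omega> u0)\<^sup>2))"
  if e: "e < 0"
 proof (rule ereal_le_if_all_below[OF Tm_pos])
  fix T assume T: "0 < T" "ereal T < Tm"
  show "T <= lifespan m (- e) ((m - 2) * l2inner \<Omega> u0 u1 - 2 * (vnorm \<Omega> u0)\<^sup>2) ((l2norm \<Omega> u0)\<^sup>2)"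
   using energy_growth.lifespan_optimal[OF growth[OF T] order_refl less_imp_le[OF T(1)], of "- e"] e N0
   unfolding init(1-3) E0 by simp
 qed
 have nonnegative: "lifespan_bound \<Omega> p g u0 u1 e Tm" if e: "0 <= e"
 proof -
  define L0 where "L0 = l2inner \<Omega> u0 u1 - m / C * e"
  define \<beta> where "\<beta> = C * L0 / (2 * m)"
  have "m / C * e < m / C * (C / m * l2inner \<Omega> u0 u1)" using small const(2) m by (intro mult_strict_left_mono) auto
  then have L0: "0 < L0" using const(2) m by (simp add: L0_def)
  let ?b = "L0 - 2 * (e + \<beta>) / lambda1 \<Omega>"
  have "0 < C * L0" using const(2) L0 by simp
  from positive_quadratic_root[OF this N0, of ?b] obtain \<tau> where \<tau>: "0 < \<tau>"
   and root: "C * L0 * \<tau>\<^sup>2 + ?b * \<tau> - (l2norm \<Omega> u0)\<^sup>2 = 0"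
   and below: "\<forall>t\<ge>0. C * L0 * t\<^sup>2 + ?b * t - (l2norm \<Omega> u0)\<^sup>2 <= 0 --> t <= \<tau>"
   and unique: "\<forall>t>0. C * L0 * t\<^sup>2 + ?b * t - (l2norm \<Omega> u0)\<^sup>2 = 0 --> t = \<tau>"
   by (elim exE conjE)
  have "Tm <= ereal (\<tau> + lifespan m \<beta> ((m - 2) / 2 * L0 - 2 * (vnorm \<Omega> u0 + sqrt (\<tau> * (e + \<beta>)))\<^sup>2)
    ((l2norm \<Omega> u0 + sqrt (\<tau> * (e + \<beta>) / lambda1 \<Omega>))\<^sup>2))"
  proof (rule ereal_le_if_all_below[OF Tm_pos])
   fix T assume T: "0 < T" "ereal T < Tm"
   show "T <= \<tau> + lifespan m \<beta> ((m - 2) / 2 * L0 - 2 * (vnorm \<Omega> u0 + sqrt (\<tau> * (e + \<beta>)))\<^sup>2)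
    ((l2norm \<Omega> u0 + sqrt (\<tau> * (e + \<beta>) / lambda1 \<Omega>))\<^sup>2)"
    by (rule energy_growth.delayed_lifespan[OF growth[OF T] const(2-4), of e L0 \<beta> \<tau>, unfolded init(1-3) E0 sqrt_norm])
     (use e L0 \<tau> below in \<open>auto simp: L0_def \<beta>_def\<close>)
  qed
  then show ?thesis
   unfolding lifespan_bound_def Let_def m_def[symmetric] C_def[symmetric] L0_def[symmetric] \<beta>_def[symmetric]
    vnorm_def[symmetric] lifespan_def
   using L0 \<tau> root unique by blast
 qed
 have "Tm < \<infinity>"
 proof (cases "e < 0")
  case True
  from negative[OF this] show ?thesis by (cases Tm) auto
 next
  case False
  then have "lifespan_bound \<Omega> p g u0 u1 e Tm" by (intro nonnegative) simp
  then obtain b where "Tm <= ereal b" unfolding lifespan_bound_def Let_def by blast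
  then show ?thesis by (cases Tm) auto
 qed
 moreover from this have "blows_up_at \<Omega> (real_of_ereal Tm) u v" using blow_up by simp
 moreover have "0 < l2inner \<Omega> u0 u1 \<and> lifespan_bound \<Omega> p g u0 u1 e Tm" if "e = 0"
  using inner_pos nonnegative that by simp
 moreover have "0 < e \<and> e < C / m * l2inner \<Omega> u0 u1 \<and> lifespan_bound \<Omega> p g u0 u1 e Tm" if "0 < e"
  using small nonnegative that by simp
 ultimately show ?thesis
  using sol energy_R negative_sigma negative
  unfolding Let_def m_def[symmetric] e_def[symmetric] E0 C_def[symmetric] vnorm_def[symmetric]
  by (intro bexI[OF _ u0] bexI[OF _ u1] exI[of _ Tm] exI[of _ u] exI[of _ v] conjI impI allI)
   (simp_all add: E0 lifespan_def)
qed

end
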